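(* Let $f\in L^\infty(\Omega)\setminus\{0\}$ and $f\ge0$ a.e. in $\Omega$. Then for any $\alpha>\alpha_*$ there exists $\varepsilon(\alpha)>0$ such that for any $\beta\ge\lambda_1(q)-\varepsilon(\alpha)$ the problem $$-\Delta_p u-\Delta_q u=\alpha|u|^{p-2}u+\beta|u|^{q-2}u+f(x)\ \text{ in }\Omega,\qquad u=0\ \text{ on }\partial\Omega,$$ has no nonnegative (weak) solutions.
   Context: Standing assumptions: $N\ge 1$, $\Omega\subset\mathbb{R}^N$ is a bounded domain with $C^2$-boundary, $1<q<p<\infty$; $\Delta_r u=\mathrm{div}(|\nabla u|^{r-2}\nabla u)$; $W_0^{1,r}=W_0^{1,r}(\Omega)$; $\|\cdot\|_r$ is the $L^r(\Omega)$-norm. A (weak) solution of the problem is a function $u\in W_0^{1,p}$ such that $\int_\Omega(|\nabla u|^{p-2}+|\nabla u|^{q-2})\nabla u\cdot\nabla\varphi\,dx=\int_\Omega(\alpha|u|^{p-2}u+\beta|u|^{q-2}u+f)\varphi\,dx$ for all $\varphi\in W_0^{1,p}$. $\lambda_1(q):=\inf\{\|\nabla u\|_q^q/\|u\|_q^q:\ u\in W_0^{1,q}\setminus\{0\}\}$ is the first eigenvalue of the $q$-Laplacian; it is simple, and $\varphi_q$ denotes an associated eigenfunction (a minimizer), chosen strictly positive in $\Omega$. It belongs to $C^1(\overline\Omega)$. $\alpha_*:=\|\nabla\varphi_q\|_p^p/\|\varphi_q\|_p^p$. *)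

theory Defs
  imports "HOL-Analysis.Analysis"
begin

text \<open>The space \<open>\<real>\<^sup>N\<close>, \<open>N \<ge> 1\<close>, is an arbitrary type of class \<open>euclidean_space\<close>.
  Functions on \<open>\<Omega>\<close> are total functions whose values outside \<open>\<Omega>\<close> never matter; elements of
  Lebesgue and Sobolev spaces are represented by functions rather than by classes modulo
  equality almost everywhere.\<close>

definition grad :: "('a::euclidean_space \<Rightarrow> real) \<Rightarrow> 'a \<Rightarrow> 'a" where
  "grad f x = (THE D. GDERIV f x :> D)"

primrec Ck :: "nat \<Rightarrow> ('a::euclidean_space \<Rightarrow> real) \<Rightarrow> bool" where
  "Ck 0 f \<longleftrightarrow> continuous_on UNIV f"
| "Ck (Suc k) f \<longleftrightarrow>
     (\<exists>g. (\<forall>x. GDERIV f x :> g x) \<and> (\<forall>b\<in>Basis. Ck k (\<lambda>x. g x \<bullet> b)))"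

definition C1_closure :: "'a::euclidean_space set \<Rightarrow> ('a \<Rightarrow> real) \<Rightarrow> bool" where
  "C1_closure \<Omega> u \<longleftrightarrow> continuous_on (closure \<Omega>) u \<and>
     (\<exists>g. continuous_on (closure \<Omega>) g \<and> (\<forall>x\<in>\<Omega>. GDERIV u x :> g x))"

text \<open>Near each boundary point, \<open>\<Omega>\<close> is the region on one side of the graph of a \<open>C\<^sup>2\<close> function
  over a hyperplane orthogonal to a unit vector \<open>\<nu>\<close> (a choice of rotated coordinates);
  \<open>x - (x \<bullet> \<nu>) *\<^sub>R \<nu>\<close> is the projection of \<open>x\<close> to that hyperplane.\<close>

definition C2_boundary :: "'a::euclidean_space set \<Rightarrow> bool" where
  "C2_boundary \<Omega> \<longleftrightarrow> (\<forall>x0\<in>frontier \<Omega>. \<exists>r>0. \<exists>\<nu> \<gamma>. norm \<nu> = 1 \<and> Ck 2 \<gamma> \<and>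
     \<Omega> \<inter> ball x0 r = {x \<in> ball x0 r. \<gamma> (x - (x \<bullet> \<nu>) *\<^sub>R \<nu>) < x \<bullet> \<nu>})"

definition bounded_C2_domain :: "'a::euclidean_space set \<Rightarrow> bool" where
  "bounded_C2_domain \<Omega> \<longleftrightarrow>
     open \<Omega> \<and> connected \<Omega> \<and> \<Omega> \<noteq> {} \<and> bounded \<Omega> \<and> C2_boundary \<Omega>"

definition Lspace :: "'a::euclidean_space set \<Rightarrow> real \<Rightarrow> ('a \<Rightarrow> 'b::euclidean_space) set" where
  "Lspace \<Omega> r = {u. u \<in> borel_measurable (lebesgue_on \<Omega>) \<and>
     integrable (lebesgue_on \<Omega>) (\<lambda>x. norm (u x) powr r)}"

definition Lnorm :: "'a::euclidean_space set \<Rightarrow> real \<Rightarrow> ('a \<Rightarrow> 'b::euclidean_space) \<Rightarrow> real" where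
  "Lnorm \<Omega> r u = (\<integral>x. norm (u x) powr r \<partial>lebesgue_on \<Omega>) powr (1 / r)"

definition Linfty :: "'a::euclidean_space set \<Rightarrow> ('a \<Rightarrow> real) set" where
  "Linfty \<Omega> = {u. u \<in> borel_measurable (lebesgue_on \<Omega>) \<and>
     (\<exists>C. AE x in lebesgue_on \<Omega>. \<bar>u x\<bar> \<le> C)}"

definition test_functions :: "'a::euclidean_space set \<Rightarrow> ('a \<Rightarrow> real) set" where
  "test_functions \<Omega> = {\<phi>. (\<forall>k. Ck k \<phi>) \<and>
     compact (closure {x. \<phi> x \<noteq> 0}) \<and> closure {x. \<phi> x \<noteq> 0} \<subseteq> \<Omega>}"

definition is_weak_gradient ::
    "'a::euclidean_space set \<Rightarrow> ('a \<Rightarrow> real) \<Rightarrow> ('a \<Rightarrow> 'a) \<Rightarrow> bool" where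
  "is_weak_gradient \<Omega> u g \<longleftrightarrow>
     (\<forall>K. compact K \<and> K \<subseteq> \<Omega> \<longrightarrow> u absolutely_integrable_on K \<and> g absolutely_integrable_on K) \<and>
     (\<forall>\<phi>\<in>test_functions \<Omega>.
        (\<integral>x. u x *\<^sub>R grad \<phi> x \<partial>lebesgue_on \<Omega>) = - (\<integral>x. \<phi> x *\<^sub>R g x \<partial>lebesgue_on \<Omega>))"

text \<open>The weak gradient is unique only up to null sets; \<open>wgrad\<close> picks one representative, and is
  used only under integrals over \<open>\<Omega>\<close>, which do not depend on the choice.\<close>

definition wgrad :: "'a::euclidean_space set \<Rightarrow> ('a \<Rightarrow> real) \<Rightarrow> 'a \<Rightarrow> 'a" where
  "wgrad \<Omega> u = (SOME g. is_weak_gradient \<Omega> u g)"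

definition W1 :: "'a::euclidean_space set \<Rightarrow> real \<Rightarrow> ('a \<Rightarrow> real) set" where
  "W1 \<Omega> r = {u \<in> Lspace \<Omega> r. \<exists>g\<in>Lspace \<Omega> r. is_weak_gradient \<Omega> u g}"

text \<open>The closure of the test functions in \<open>W1 \<Omega> r\<close>.\<close>

definition W01 :: "'a::euclidean_space set \<Rightarrow> real \<Rightarrow> ('a \<Rightarrow> real) set" where
  "W01 \<Omega> r = {u \<in> W1 \<Omega> r. \<exists>\<phi>. (\<forall>n::nat. \<phi> n \<in> test_functions \<Omega>) \<and>
     (\<lambda>n. Lnorm \<Omega> r (\<lambda>x. \<phi> n x - u x)) \<longlonglongrightarrow> 0 \<and>
     (\<lambda>n. Lnorm \<Omega> r (\<lambda>x. grad (\<phi> n) x - wgrad \<Omega> u x)) \<longlonglongrightarrow> 0}"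

definition rayleigh :: "'a::euclidean_space set \<Rightarrow> real \<Rightarrow> ('a \<Rightarrow> real) \<Rightarrow> real" where
  "rayleigh \<Omega> r u = Lnorm \<Omega> r (wgrad \<Omega> u) powr r / Lnorm \<Omega> r u powr r"

definition lambda1 :: "'a::euclidean_space set \<Rightarrow> real \<Rightarrow> real" where
  "lambda1 \<Omega> q = Inf {rayleigh \<Omega> q u | u. u \<in> W01 \<Omega> q \<and> \<not> (AE x in lebesgue_on \<Omega>. u x = 0)}"

text \<open>Positivity at every point of \<open>\<Omega>\<close> refers to the \<open>C\<^sup>1\<close> representative of the minimizer.\<close>

definition positive_first_eigenfunction ::
    "'a::euclidean_space set \<Rightarrow> real \<Rightarrow> ('a \<Rightarrow> real) \<Rightarrow> bool" where
  "positive_first_eigenfunction \<Omega> q \<phi> \<longleftrightarrow>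
     \<phi> \<in> W01 \<Omega> q \<and> \<not> (AE x in lebesgue_on \<Omega>. \<phi> x = 0) \<and> rayleigh \<Omega> q \<phi> = lambda1 \<Omega> q \<and>
     C1_closure \<Omega> \<phi> \<and> (\<forall>x\<in>\<Omega>. \<phi> x > 0)"

definition alpha_star :: "'a::euclidean_space set \<Rightarrow> real \<Rightarrow> ('a \<Rightarrow> real) \<Rightarrow> real" where
  "alpha_star \<Omega> p \<phi>q = Lnorm \<Omega> p (wgrad \<Omega> \<phi>q) powr p / Lnorm \<Omega> p \<phi>q powr p"

text \<open>A negative exponent at a zero of \<open>u\<close> or of its gradient is harmless: as usual, the products
  \<open>\<bar>t\<bar> powr (r - 2) * t\<close> then vanish.\<close>

definition weak_solution ::
    "'a::euclidean_space set \<Rightarrow> real \<Rightarrow> real \<Rightarrow> real \<Rightarrow> real \<Rightarrow> ('a \<Rightarrow> real) \<Rightarrow> ('a \<Rightarrow> real) \<Rightarrow> bool"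
where
  "weak_solution \<Omega> p q \<alpha> \<beta> f u \<longleftrightarrow> u \<in> W01 \<Omega> p \<and>
     (\<forall>\<phi>\<in>W01 \<Omega> p.
        (\<integral>x. (norm (wgrad \<Omega> u x) powr (p - 2) + norm (wgrad \<Omega> u x) powr (q - 2))
              * (wgrad \<Omega> u x \<bullet> wgrad \<Omega> \<phi> x) \<partial>lebesgue_on \<Omega>)
        = (\<integral>x. (\<alpha> * \<bar>u x\<bar> powr (p - 2) * u x + \<beta> * \<bar>u x\<bar> powr (q - 2) * u x + f x)
              * \<phi> x \<partial>lebesgue_on \<Omega>))"

end

theory Submission
 imports Defs
begin

text \<open>
  Write \<open>\<phi>\<close> for the eigenfunction, \<open>\<mu>\<close> for the eigenvalue, and \<open>v = u + \<delta>\<close> with \<open>\<delta> > 0\<close> for a nonnegative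
  solution \<open>u\<close>. The equation is tested with \<open>\<phi>^p / v^(p-1)\<close>. Picone's inequality bounds the contribution of the
  \<open>p\<close>-Laplacian by the integral of \<open>|\<nabla>\<phi>|^p\<close>. The contribution of the \<open>q\<close>-Laplacian is compared with the
  equation of \<open>\<phi>\<close> tested with \<open>\<phi>^(p-q+1) / v^(p-q)\<close>: pointwise the two differ by a nonnegative remainder made of
  convexity defects of \<open>a \<mapsto> |a|^q\<close> at \<open>\<nabla>\<phi>/\<phi>\<close> and \<open>\<nabla>u/v\<close>. Letting \<open>\<delta>\<close> tend to 0 and using
  \<open>\<alpha> > \<alpha>\<^sub>*\<close>, which makes \<open>gap\<close> positive, one gets for \<open>\<beta> \<ge> \<mu> - \<epsilon>\<close> and a suitable \<open>\<delta>\<close>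
  the inequality \<open>gap + F + R \<le> 2 \<epsilon> m\<close> (\<open>solution_good_shift\<close>),
  where \<open>m\<close> is the integral of the weight \<open>\<phi>^p / v^(p-q)\<close>, \<open>R \<ge> 0\<close> the integral of the remainder, and \<open>F \<ge> 0\<close> the
  integral of \<open>f \<phi>^p / v^(p-1)\<close>.

  If no \<open>\<epsilon>\<close> worked, there would be solutions for a sequence \<open>\<epsilon>\<close> tending to 0. Along it \<open>m\<close> tends to infinity and
  \<open>R/m\<close>, \<open>F/m\<close> tend to 0. Consider \<open>z = m^(-1/q) (\<phi>/v)^((p-q)/q)\<close>, normalised so that \<open>\<phi> z\<close> has norm 1 in \<open>L\<^sup>q\<close>.
  Smallness of \<open>R/m\<close> makes the gradient of \<open>z\<close> tend to 0 locally, so \<open>z\<close> becomes locally constant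
  (\<open>ratio_local_oscillation\<close>). Smallness of \<open>F/m\<close> makes \<open>z\<close> tend to 0 on a set of positive measure where \<open>f\<close> is
  bounded below (\<open>ratio_small_where_forced\<close>). Since \<open>\<Omega>\<close> is connected, \<open>z\<close> tends to 0 locally in \<open>L\<^sup>1\<close>
  (\<open>connected_spread\<close>). But \<open>\<phi> z\<close> is bounded in \<open>W01 \<Omega> q\<close>, so its \<open>q\<close>-th powers are uniformly integrable
  (\<open>uniform_integrability\<close>) and its norm would tend to 0, a contradiction (\<open>ratio_not_locally_null\<close>).

  For one solution, the passage \<open>\<delta> \<rightarrow> 0\<close> requires that \<open>u > 0\<close> almost everywhere and that \<open>m\<close> stays bounded. The
  first is a strong maximum principle, proved by the same spreading argument for the logarithm of \<open>u\<close>
  (\<open>solution_positive\<close>); the second combines positivity with uniform integrability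
  (\<open>solution_weight_bounded\<close>). Near the boundary these integral estimates take the
  place of a comparison of normal derivatives by Hopf's lemma. That \<open>\<phi>\<close> tends to 0 at the boundary
  (\<open>trace_zero\<close>) makes functions like \<open>\<phi>^p / v^(p-1)\<close> admissible in the weak formulation.
\<close>

section \<open>Pointwise inequalities for the fluxes\<close>

lemma powr_add_le:
 fixes x y r :: real
 assumes "0 \<le> x" "0 \<le> y" "0 \<le> r"
 shows "(x + y) powr r \<le> 2 powr r * (x powr r + y powr r)"
proof -
 have "(x + y) powr r \<le> (2 * max x y) powr r"
  using assms by (intro powr_mono2) auto
 also have "\<dots> = 2 powr r * max x y powr r"
  using assms by (simp add: powr_mult)
 also have "\<dots> \<le> 2 powr r * (x powr r + y powr r)"
  by (intro mult_left_mono) (auto simp: max_def)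
 finally show ?thesis .
qed

lemma young_with_constant:
 fixes x y \<kappa> q :: real
 assumes "0 \<le> x" "0 \<le> y" "0 < \<kappa>" "1 < q"
 shows "x powr (q - 1) * y \<le> \<kappa> * x powr q + \<kappa> powr (1 - q) * y powr q"
proof (cases "y \<le> \<kappa> * x")
 case True
 have "x powr (q - 1) * y \<le> x powr (q - 1) * (\<kappa> * x)"
  using True by (intro mult_left_mono) auto
 also have "\<dots> = \<kappa> * x powr q"
  using assms by (cases "x = 0") (auto simp: powr_diff)
 finally show ?thesis by (smt (verit) mult_nonneg_nonneg powr_ge_zero)
next
 case False
 have "x powr (q - 1) * y \<le> (y / \<kappa>) powr (q - 1) * y"
  using False assms by (intro mult_right_mono powr_mono2) (auto simp: field_simps)
 also have "\<dots> = \<kappa> powr (1 - q) * y powr q"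
  using assms False
  by (cases "y = 0") (auto simp: powr_divide powr_diff field_simps)
 finally show ?thesis
  using assms by (smt (verit) mult_nonneg_nonneg powr_ge_zero)
qed

lemma bernoulli_powr_strict:
 fixes t q :: real
 assumes "1 < q" "0 \<le> t" "t \<noteq> 1"
 shows "1 + q * (t - 1) < t powr q"
proof (cases "t = 0")
 case False
 with assms have t: "0 < t" by auto
 define h where "h t = t powr q - q * t" for t
 have D: "(h has_real_derivative q * x powr (q - 1) - q) (at x)" if "0 < x" for x
  unfolding h_def using that by (auto intro!: derivative_eq_intros)
 have "h 1 < h t"
 proof (cases "t < 1")
  case True
  show ?thesis
  proof (rule DERIV_neg_imp_decreasing_open[OF True])
   fix x assume x: "t < x" "x < 1"
   have "x powr (q - 1) < 1" using x t assms
    by (metis diff_gt_0_iff_gt dual_order.strict_trans nless_le powr_less_mono2 powr_one_eq_one)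
   then show "\<exists>y. (h has_real_derivative y) (at x) \<and> y < 0"
    using D[of x] x t assms by (intro exI[of _ "q * x powr (q - 1) - q"]) auto
  next
   show "continuous_on {t..1} h" unfolding h_def using t by (intro continuous_intros) auto
  qed
 next
  case False
  with assms have t1: "1 < t" by auto
  show ?thesis
  proof (rule DERIV_pos_imp_increasing_open[OF t1])
   fix x assume x: "1 < x" "x < t"
   have "1 < x powr (q - 1)" using x assms by simp
   then show "\<exists>y. (h has_real_derivative y) (at x) \<and> y > 0"
    using D[of x] x t assms by (intro exI[of _ "q * x powr (q - 1) - q"]) auto
  next
   show "continuous_on {1..t} h" unfolding h_def using t by (intro continuous_intros) auto
  qed
 qed
 then show ?thesis by (simp add: h_def algebra_simps)
qed (use assms in auto)

lemma young_strict:
 fixes x y q :: real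
 assumes "1 < q" "0 \<le> x" "0 \<le> y" "x \<noteq> y"
 shows "q * x * y powr (q - 1) < x powr q + (q - 1) * y powr q"
proof (cases "y = 0")
 case False
 with assms have y: "0 < y" by auto
 have "1 + q * (x / y - 1) < (x / y) powr q"
  using assms y by (intro bernoulli_powr_strict) auto
 then have "(1 + q * (x / y - 1)) * y powr q < (x / y) powr q * y powr q"
  using y by (intro mult_strict_right_mono) auto
 also have "(x / y) powr q * y powr q = x powr q"
  using assms y by (simp add: powr_divide)
 finally show ?thesis
  using y by (simp add: powr_diff field_simps)
qed (use assms in auto)

text \<open>The vector field of the \<open>r\<close>-Laplacian.\<close>

definition flux :: "real \<Rightarrow> 'a::euclidean_space \<Rightarrow> 'a" where
 "flux r a = norm a powr (r - 2) *\<^sub>R a"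

lemma norm_flux: "norm (flux r a) = norm a powr (r - 1)"
proof (cases "a = 0")
 case False
 then have "norm a powr (r - 2) * norm a = norm a powr (r - 2 + 1)"
  by (subst powr_add) simp
 then show ?thesis by (simp add: flux_def)
qed (simp add: flux_def)

lemma flux_inner_self: "flux r a \<bullet> a = norm a powr r"
proof (cases "a = 0")
 case False
 have "norm a powr (r - 2) * (a \<bullet> a) = norm a powr (r - 2) * norm a powr 2"
  using False by (simp add: dot_square_norm)
 also have "\<dots> = norm a powr r" by (simp only: powr_add[symmetric]) simp
 finally show ?thesis by (simp add: flux_def)
qed (simp add: flux_def)

lemma flux_zero [simp]: "flux r 0 = 0"
 by (simp add: flux_def)

lemma flux_inner_le: "\<bar>flux r a \<bullet> b\<bar> \<le> norm a powr (r - 1) * norm b"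
 using Cauchy_Schwarz_ineq2[of "flux r a" b] by (simp add: norm_flux)

lemma flux_scaleR:
 assumes "0 < t"
 shows "flux r (t *\<^sub>R a) = t powr (r - 1) *\<^sub>R flux r a"
proof -
 have "(t * norm a) powr (r - 2) * t = t powr (r - 1) * norm a powr (r - 2)"
  using assms powr_add[of t "r - 2" 1] by (simp add: powr_mult)
 then show ?thesis using assms by (simp add: flux_def)
qed

lemma continuous_flux:
 assumes "1 < r"
 shows "continuous_on UNIV (flux r :: 'a::euclidean_space \<Rightarrow> 'a)"
proof -
 have "isCont (flux r) a" for a :: 'a
 proof (cases "a = 0")
  case True
  have "((\<lambda>x::'a. norm x powr (r - 1)) \<longlongrightarrow> norm (0::'a) powr (r - 1)) (at 0)"
   using assms by (intro tendsto_powr' tendsto_intros) auto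
  then have "((\<lambda>x::'a. norm (flux r x)) \<longlongrightarrow> 0) (at 0)"
   using assms by (simp add: norm_flux)
  then show ?thesis
   unfolding True isCont_def flux_zero by (rule tendsto_norm_zero_cancel)
 next
  case False
  then show ?thesis unfolding flux_def by (intro continuous_intros) auto
 qed
 then show ?thesis by (simp add: continuous_at_imp_continuous_on)
qed

text \<open>The gap in the tangent line inequality for \<open>a \<mapsto> |a|^q\<close> at \<open>b\<close> (a Bregman distance).\<close>

definition convexity_defect :: "real \<Rightarrow> 'a::euclidean_space \<Rightarrow> 'a \<Rightarrow> real" where
 "convexity_defect q a b = norm a powr q - norm b powr q - q * (flux q b \<bullet> (a - b))"

lemma convexity_defect_alt:
 "convexity_defect q a b = norm a powr q + (q - 1) * norm b powr q - q * (flux q b \<bullet> a)"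
 by (simp add: convexity_defect_def inner_diff_right flux_inner_self algebra_simps)

lemma convexity_defect_pos:
 assumes "1 < q" "a \<noteq> b"
 shows "0 < convexity_defect q a b"
proof (cases "norm a = norm b")
 case False
 have "q * (flux q b \<bullet> a) \<le> q * (norm b powr (q - 1) * norm a)"
  using flux_inner_le[of q b a] assms by (intro mult_left_mono) auto
 also have "\<dots> < norm a powr q + (q - 1) * norm b powr q"
  using young_strict[of q "norm a" "norm b"] assms False by (simp add: mult_ac)
 finally show ?thesis by (simp add: convexity_defect_alt)
next
 case True
 have nb: "b \<noteq> 0" using True assms by auto
 have "0 < (norm (a - b))\<^sup>2" using assms by simp
 also have "(norm (a - b))\<^sup>2 = (norm a)\<^sup>2 + (norm b)\<^sup>2 - 2 * (a \<bullet> b)"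
  by (simp add: power2_norm_eq_inner inner_diff inner_commute)
 finally have "a \<bullet> b < (norm b)\<^sup>2" using True by simp
 then have "norm b powr (q - 2) * (b \<bullet> a) < norm b powr (q - 2) * (norm b)\<^sup>2"
  using nb by (intro mult_strict_left_mono) (auto simp: inner_commute)
 also have "\<dots> = norm b powr q"
  using flux_inner_self[of q b] by (simp add: flux_def dot_square_norm)
 finally have "flux q b \<bullet> a < norm b powr q" by (simp add: flux_def)
 then have "q * (flux q b \<bullet> a) < q * norm b powr q" using assms by simp
 then show ?thesis using True by (simp add: convexity_defect_alt algebra_simps)
qed

lemma convexity_defect_nonneg:
 assumes "1 < q"
 shows "0 \<le> convexity_defect q a b"
proof (cases "a = b")
 case True
 then show ?thesis by (simp add: convexity_defect_def)
next
 case False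
 then show ?thesis using convexity_defect_pos[OF assms False] by linarith
qed

lemma convexity_defect_scaleR:
 assumes "0 < t" "1 < q"
 shows "convexity_defect q (t *\<^sub>R a) (t *\<^sub>R b) = t powr q * convexity_defect q a b"
proof -
 have "t powr (q - 1) * t = t powr q"
  using assms by (simp add: powr_diff)
 then show ?thesis
  using assms by (simp add: convexity_defect_alt flux_scaleR powr_mult algebra_simps)
qed

text \<open>For \<open>q \<ge> 2\<close> the defect itself dominates \<open>|a - b|^q\<close> up to a constant; for \<open>q < 2\<close> it does not, and a small multiple of the energy
  has to be added. Both cases are covered at once by compactness: by homogeneity only the unit sphere
  \<open>|a|^q + |b|^q = 1\<close> matters, and there the defect is bounded below away from the diagonal by strict convexity.\<close>

lemma diff_le_convexity_defect:
 assumes q: "1 < q" and \<eta>: "0 < \<eta>"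
 obtains C where "0 \<le> C"
  "\<And>a b::'a::euclidean_space. norm (a - b) powr q
   \<le> \<eta> * (norm a powr q + norm b powr q) + C * convexity_defect q a b"
proof -
 define S where "S = {z::'a \<times> 'a. norm (fst z) powr q + norm (snd z) powr q = 1 \<and>
   \<eta> \<le> norm (fst z - snd z) powr q}"
 have cont: "continuous_on UNIV (\<lambda>z::'a\<times>'a. norm (fst z) powr q + norm (snd z) powr q)"
   "continuous_on UNIV (\<lambda>z::'a\<times>'a. norm (fst z - snd z) powr q)"
  using q by (intro continuous_intros continuous_on_powr' ballI; auto)+
 have "closed S"
 proof -
  have "S = {z. norm (fst z) powr q + norm (snd z) powr q = 1} \<inter> {z. \<eta> \<le> norm (fst z - snd z) powr q}"
   by (auto simp: S_def)
  then show ?thesis using cont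
   by (auto intro!: closed_Int closed_Collect_eq closed_Collect_le continuous_on_const)
 qed
 moreover have "bounded S"
 proof (rule boundedI)
  fix z assume "z \<in> S"
  then have "norm (fst z) powr q \<le> 1 powr q" "norm (snd z) powr q \<le> 1 powr q"
   by (auto simp: S_def) (smt (verit) powr_ge_zero)+
  then have "norm (fst z) \<le> 1" "norm (snd z) \<le> 1"
   using q by (metis (no_types) norm_ge_zero powr_less_mono2 not_le zero_le_one less_trans zero_less_one)+
  then show "norm z \<le> 2"
   using norm_Pair_le[of "fst z" "snd z"] by simp
 qed
 ultimately have cS: "compact S" using compact_eq_bounded_closed by blast
 have cfl: "continuous_on UNIV (\<lambda>z::'a\<times>'a. flux q (snd z))"
  using continuous_on_compose2[OF continuous_flux[OF q] continuous_on_snd[OF continuous_on_id]] by auto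
 have cD: "continuous_on S (\<lambda>z. convexity_defect q (fst z) (snd z))"
  unfolding convexity_defect_alt using q
  by (intro continuous_intros continuous_on_powr' ballI continuous_on_subset[OF cfl]) auto
 have "\<exists>m>0. \<forall>z\<in>S. m \<le> convexity_defect q (fst z) (snd z)"
 proof (cases "S = {}")
  case False
  obtain z0 where z0: "z0 \<in> S"
   "\<And>z. z \<in> S \<Longrightarrow> convexity_defect q (fst z0) (snd z0) \<le> convexity_defect q (fst z) (snd z)"
   using continuous_attains_inf[OF cS False cD] by blast
  have "fst z0 \<noteq> snd z0" using z0(1) \<eta> by (auto simp: S_def)
  then show ?thesis using z0 convexity_defect_pos[OF q] by blast
 qed (auto intro: exI[of _ 1])
 then obtain m where m: "0 < m" "\<And>a b. (a, b) \<in> S \<Longrightarrow> m \<le> convexity_defect q a b" by force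
 have "norm (a - b) powr q \<le> \<eta> * (norm a powr q + norm b powr q) + 2 powr q / m * convexity_defect q a b"
  for a b :: 'a
 proof (cases "norm (a - b) powr q \<le> \<eta> * (norm a powr q + norm b powr q)")
  case True
  then show ?thesis using m convexity_defect_nonneg[OF q, of a b]
   by (smt (verit) divide_nonneg_pos mult_nonneg_nonneg powr_ge_zero)
 next
  case False
  define \<sigma> where "\<sigma> = norm a powr q + norm b powr q"
  have \<sigma>0: "\<sigma> \<noteq> 0"
  proof
   assume "\<sigma> = 0"
   then have "a = 0" "b = 0" by (auto simp: \<sigma>_def add_nonneg_eq_0_iff)
   with False show False by simp
  qed
  then have \<sigma>: "0 < \<sigma>" by (simp add: \<sigma>_def less_le add_nonneg_nonneg)
  define t where "t = \<sigma> powr (- 1 / q)"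
  have t: "0 < t" using \<sigma> by (simp add: t_def)
  have tq: "t powr q = 1 / \<sigma>"
   unfolding t_def powr_powr using \<sigma> q by (simp add: powr_minus_divide)
  have "(t *\<^sub>R a, t *\<^sub>R b) \<in> S"
  proof -
   have "norm (t *\<^sub>R a) powr q + norm (t *\<^sub>R b) powr q = t powr q * \<sigma>"
    using t by (simp add: powr_mult \<sigma>_def algebra_simps)
   then have "norm (t *\<^sub>R a) powr q + norm (t *\<^sub>R b) powr q = 1" using \<sigma> tq by simp
   moreover have "norm (t *\<^sub>R a - t *\<^sub>R b) powr q = t powr q * norm (a - b) powr q"
    using t by (simp add: powr_mult flip: scaleR_diff_right)
   moreover have "\<eta> < norm (a - b) powr q / \<sigma>"
    using False \<sigma> by (simp add: \<sigma>_def field_simps)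
   ultimately show ?thesis using tq by (simp add: S_def)
  qed
  from m(2)[OF this] have "m \<le> convexity_defect q a b / \<sigma>"
   using t q tq by (simp add: convexity_defect_scaleR)
  then have "\<sigma> \<le> convexity_defect q a b / m" using \<sigma> m by (simp add: field_simps)
  moreover have "norm (a - b) powr q \<le> 2 powr q * \<sigma>"
  proof -
   have "norm (a - b) powr q \<le> (norm a + norm b) powr q"
    using q by (intro powr_mono2) (auto simp: norm_triangle_ineq4)
   also have "\<dots> \<le> 2 powr q * \<sigma>"
    unfolding \<sigma>_def using q by (intro powr_add_le) auto
   finally show ?thesis .
  qed
  ultimately have "norm (a - b) powr q \<le> 2 powr q * (convexity_defect q a b / m)"
   by (smt (verit) mult_left_mono powr_ge_zero)
  moreover have "0 \<le> \<eta> * \<sigma>" using \<sigma> \<eta> by simp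
  ultimately show ?thesis by (simp add: \<sigma>_def)
 qed
 then show ?thesis using that[of "2 powr q / m"] m by simp
qed

text \<open>With \<open>a = \<nabla>\<phi>/\<phi>\<close> and \<open>b = \<nabla>u/v\<close> this is the exact error, up to the weight \<open>\<phi>^p / v^(p-q)\<close>, in the comparison of
  the two tested \<open>q\<close>-Laplacians. It is a positive combination of the defects in both directions.\<close>

definition picone_remainder :: "real \<Rightarrow> real \<Rightarrow> 'a::euclidean_space \<Rightarrow> 'a \<Rightarrow> real" where
 "picone_remainder p q a b =
   p / q * convexity_defect q a b + (p - q) / q * convexity_defect q b a"

lemma picone_remainder_eq:
 assumes "1 < q"
 shows "picone_remainder p q a b =
  flux q a \<bullet> ((p - q + 1) *\<^sub>R a - (p - q) *\<^sub>R b) - flux q b \<bullet> (p *\<^sub>R a - (p - 1) *\<^sub>R b)"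
proof -
 have "picone_remainder p q a b = (p / q + (p - q) / q * (q - 1)) * norm a powr q
   + (p / q * (q - 1) + (p - q) / q) * norm b powr q
   - p / q * q * (flux q b \<bullet> a) - (p - q) / q * q * (flux q a \<bullet> b)"
  unfolding picone_remainder_def convexity_defect_alt by algebra
 also have "p / q + (p - q) / q * (q - 1) = p - q + 1" using assms by (simp add: field_simps)
 also have "p / q * (q - 1) + (p - q) / q = p - 1" using assms by (simp add: field_simps)
 also have "p / q * q = p" using assms by simp
 also have "(p - q) / q * q = p - q" using assms by simp
 finally show ?thesis
  by (simp only: inner_diff_right inner_scaleR_right flux_inner_self)
qed

lemma convexity_defect_le_picone_remainder:
 assumes "1 < q" "q < p"
 shows "convexity_defect q a b \<le> picone_remainder p q a b"
proof -
 have "1 * convexity_defect q a b \<le> p / q * convexity_defect q a b"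
  using assms convexity_defect_nonneg[OF assms(1), of a b] by (intro mult_right_mono) auto
 moreover have "0 \<le> (p - q) / q * convexity_defect q b a"
  using assms convexity_defect_nonneg[OF assms(1), of b a] by auto
 ultimately show ?thesis by (simp add: picone_remainder_def)
qed

text \<open>The inner product is \<open>|a|^q\<close> plus \<open>d\<close> times that of \<open>flux q a\<close> and \<open>a - b\<close>. Young's inequality leaves half of \<open>|a|^q\<close> and a
  multiple of \<open>|a - b|^q\<close>, which \<open>diff_le_convexity_defect\<close> absorbs.\<close>

lemma coercive_up_to_defect:
 assumes q: "1 < q" and d: "0 \<le> d"
 obtains c K where "0 < c" "0 \<le> K"
  "\<And>a b::'a::euclidean_space. c * (norm a powr q + norm b powr q)
    \<le> flux q a \<bullet> ((d + 1) *\<^sub>R a - d *\<^sub>R b) + K * convexity_defect q a b"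
proof -
 define c where "c = 1 / (4 * (1 + 2 powr q))"
 define C1 where "C1 = (d + 1) * (1 / (2 * (d + 1))) powr (1 - q)"
 define C2 where "C2 = C1 + 1"
 have pos: "0 < c" "0 \<le> C1" "0 < C2"
  using d by (auto simp: c_def C1_def C2_def intro!: divide_pos_pos add_pos_nonneg)
 obtain C where C: "0 \<le> C" "\<And>a b::'a. norm (a - b) powr q
   \<le> c / C2 * (norm a powr q + norm b powr q) + C * convexity_defect q a b"
  using diff_le_convexity_defect[OF q, of "c / C2"] pos by auto
 show ?thesis
 proof (rule that[of c "C2 * C"])
  fix a b :: 'a
  define A B e where "A = norm a powr q" and "B = norm b powr q" and "e = norm (a - b) powr q"
  have "d * \<bar>flux q a \<bullet> (a - b)\<bar> \<le> (d + 1) * (norm a powr (q - 1) * norm (a - b))"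
   using d flux_inner_le[of q a "a - b"] by (intro mult_mono) auto
  also have "\<dots> \<le> (d + 1) * (1 / (2 * (d + 1)) * A + (1 / (2 * (d + 1))) powr (1 - q) * e)"
   using d q unfolding A_def e_def by (intro mult_left_mono young_with_constant) auto
  also have "\<dots> = A / 2 + C1 * e"
   using d by (simp add: C1_def field_simps)
  finally have 1: "d * \<bar>flux q a \<bullet> (a - b)\<bar> \<le> A / 2 + C1 * e" .
  have "norm b powr q \<le> (norm a + norm (a - b)) powr q"
   using q norm_triangle_ineq4[of a "a - b"] by (intro powr_mono2) auto
  also have "\<dots> \<le> 2 powr q * (A + e)"
   unfolding A_def e_def using q by (intro powr_add_le) auto
  finally have 2: "B \<le> 2 powr q * (A + e)" by (simp add: B_def)
  have "flux q a \<bullet> ((d + 1) *\<^sub>R a - d *\<^sub>R b) = A + d * (flux q a \<bullet> (a - b))"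
   by (simp add: A_def inner_diff_right flux_inner_self algebra_simps)
  moreover have "d * (flux q a \<bullet> (a - b)) \<ge> - (d * \<bar>flux q a \<bullet> (a - b)\<bar>)"
   using d by (metis abs_le_D2 abs_mult abs_of_nonneg order_refl minus_le_iff)
  ultimately have 3: "flux q a \<bullet> ((d + 1) *\<^sub>R a - d *\<^sub>R b) \<ge> A / 2 - C1 * e"
   using 1 by linarith
  have "A + B \<le> (1 + 2 powr q) * A + (1 + 2 powr q) * e"
   using 2 by (simp add: algebra_simps e_def) (smt (verit) powr_ge_zero)
  then have "2 * c * (A + B) \<le> 2 * c * ((1 + 2 powr q) * A + (1 + 2 powr q) * e)"
   using pos by (intro mult_left_mono) auto
  also have "\<dots> = A / 2 + e / 2"
  proof -
   have "c * (1 + 2 powr q) = 1 / 4"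
    unfolding c_def using powr_ge_zero[of 2 q] by (simp add: add_nonneg_eq_0_iff)
   then have "2 * (c * (1 + 2 powr q)) * (A + e) = A / 2 + e / 2" by (simp only:) (simp add: algebra_simps)
   then show ?thesis by (simp add: algebra_simps)
  qed
  finally have 4: "2 * c * (A + B) \<le> A / 2 + e / 2" .
  have "C2 * e \<le> C2 * (c / C2 * (A + B) + C * convexity_defect q a b)"
   using C(2)[of a b] pos unfolding A_def B_def e_def by (intro mult_left_mono) auto
  also have "\<dots> = c * (A + B) + C2 * C * convexity_defect q a b"
   using pos by (simp add: field_simps)
  finally have 5: "C2 * e \<le> c * (A + B) + C2 * C * convexity_defect q a b" .
  have "0 \<le> e" by (simp add: e_def)
  then have "C2 * e \<ge> C1 * e + e / 2" by (simp add: C2_def algebra_simps)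
  with 3 4 5 have "c * (A + B) \<le> flux q a \<bullet> ((d + 1) *\<^sub>R a - d *\<^sub>R b) + C2 * C * convexity_defect q a b"
   by linarith
  then show "c * (norm a powr q + norm b powr q)
    \<le> flux q a \<bullet> ((d + 1) *\<^sub>R a - d *\<^sub>R b) + C2 * C * convexity_defect q a b"
   by (simp add: A_def B_def)
 qed (use pos C in auto)
qed

section \<open>Continuously differentiable functions of compact support\<close>

lemma nn_integral_lborel_translate:
 fixes k :: "'a::euclidean_space \<Rightarrow> ennreal"
 assumes [measurable]: "k \<in> borel_measurable borel"
 shows "(\<integral>\<^sup>+x. k (x + c) \<partial>lborel) = (\<integral>\<^sup>+x. k x \<partial>lborel)"
proof -
 have "(\<integral>\<^sup>+x. k x \<partial>lborel) = (\<integral>\<^sup>+x. k x \<partial>distr lborel borel ((+) c))"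
  by (simp add: lborel_distr_plus)
 also have "\<dots> = (\<integral>\<^sup>+x. k (c + x) \<partial>lborel)"
  by (subst nn_integral_distr) auto
 finally show ?thesis by (simp add: add.commute)
qed

lemma has_integral_indicator_scaleR:
 fixes f :: "'a::euclidean_space \<Rightarrow> 'b::banach"
 shows "((\<lambda>x. indicator S x *\<^sub>R f x) has_integral i) UNIV \<longleftrightarrow> (f has_integral i) S"
 by (simp add: indicator_scaleR_eq_if has_integral_restrict_UNIV)

text \<open>The fundamental theorem of calculus along the segment from \<open>x\<close> to \<open>x + y\<close>, integrated over \<open>x\<close>. All Poincare and
  trace estimates below come from this one inequality. Only the segments have to stay inside \<open>W\<close>, which is what
  makes it usable at the boundary.\<close>

lemma translation_estimate:
 fixes z :: "'a::euclidean_space \<Rightarrow> real" and dz :: "'a \<Rightarrow> 'a"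
 assumes D [measurable]: "D \<in> sets borel" and W: "open W"
  and der: "\<And>x. x \<in> W \<Longrightarrow> GDERIV z x :> dz x"
  and cont: "continuous_on W dz"
  and seg: "\<And>x t. x \<in> D \<Longrightarrow> 0 \<le> t \<Longrightarrow> t \<le> 1 \<Longrightarrow> x + t *\<^sub>R y \<in> W"
 shows "(\<integral>\<^sup>+x. ennreal \<bar>z (x + y) - z x\<bar> * indicator D x \<partial>lborel)
  \<le> ennreal (norm y) * (\<integral>\<^sup>+x. ennreal (norm (dz x)) * indicator W x \<partial>lborel)"
proof -
 define k where "k x = ennreal (norm (dz x)) * indicator W x" for x
 have k_eq: "k = (\<lambda>x. ennreal (norm (indicator W x *\<^sub>R dz x)))"
  by (auto simp: k_def indicator_def fun_eq_iff)
 have km [measurable]: "k \<in> borel_measurable borel"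
  unfolding k_eq
  using borel_measurable_continuous_on_indicator[OF _ cont] W by measurable
 have pt: "ennreal \<bar>z (x + y) - z x\<bar>
   \<le> (\<integral>\<^sup>+t. ennreal (norm y) * k (x + t *\<^sub>R y) * indicator {0..1} t \<partial>lborel)" if x: "x \<in> D" for x
 proof -
  have ftc: "((\<lambda>t. dz (x + t *\<^sub>R y) \<bullet> y) has_integral z (x + 1 *\<^sub>R y) - z (x + 0 *\<^sub>R y)) {0..1}"
  proof (rule fundamental_theorem_of_calculus)
   fix t :: real assume t: "t \<in> {0..1}"
   have "(z has_derivative (\<lambda>h. h \<bullet> dz (x + t *\<^sub>R y))) (at (x + t *\<^sub>R y))"
    using der seg x t unfolding gderiv_def by auto
   moreover have "((\<lambda>t. x + t *\<^sub>R y) has_derivative (\<lambda>s. s *\<^sub>R y)) (at t within {0..1})"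
    by (auto intro!: derivative_eq_intros)
   ultimately have "((\<lambda>t. z (x + t *\<^sub>R y)) has_derivative (\<lambda>s. (s *\<^sub>R y) \<bullet> dz (x + t *\<^sub>R y))) (at t within {0..1})"
    by (rule has_derivative_compose[rotated])
   then show "((\<lambda>t. z (x + t *\<^sub>R y)) has_vector_derivative dz (x + t *\<^sub>R y) \<bullet> y) (at t within {0..1})"
    by (simp add: has_vector_derivative_def inner_commute)
  qed simp
  have cont': "continuous_on {0..1} (\<lambda>t. dz (x + t *\<^sub>R y))"
   by (rule continuous_on_compose2[OF cont]) (use seg x in \<open>auto intro!: continuous_intros\<close>)
  define J where "J = integral {0..1} (\<lambda>t. norm (dz (x + t *\<^sub>R y)) * norm y)"
  have int: "(\<lambda>t. norm (dz (x + t *\<^sub>R y)) * norm y) integrable_on {0..1}"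
   by (intro integrable_continuous_interval continuous_intros cont')
  have "norm (z (x + y) - z x) \<le> J"
   unfolding J_def using ftc int
   by (subst integral_unique[OF ftc, simplified, symmetric], intro integral_norm_bound_integral)
    (auto intro: Cauchy_Schwarz_ineq2 has_integral_integrable)
  moreover have "(\<integral>\<^sup>+t. ennreal (norm (dz (x + t *\<^sub>R y)) * norm y) * indicator {0..1} t \<partial>lborel) = ennreal J"
  proof -
   have "((\<lambda>t. norm (dz (x + t *\<^sub>R y)) * norm y) has_integral J) {0..1}"
    unfolding J_def using int by (rule integrable_integral)
   moreover have "(\<lambda>t. indicator {0..1} t *\<^sub>R (norm (dz (x + t *\<^sub>R y)) * norm y)) \<in> borel_measurable borel"
    by (intro borel_measurable_continuous_on_indicator) (auto intro!: continuous_intros cont')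
   ultimately have "(\<integral>\<^sup>+t. ennreal (indicator {0..1} t *\<^sub>R (norm (dz (x + t *\<^sub>R y)) * norm y)) \<partial>lborel) = ennreal J"
    by (intro nn_integral_has_integral_lborel)
     (simp_all only: has_integral_indicator_scaleR, auto simp: indicator_def)
   moreover have "ennreal (indicator {0..1} t *\<^sub>R (norm (dz (x + t *\<^sub>R y)) * norm y))
     = ennreal (norm (dz (x + t *\<^sub>R y)) * norm y) * indicator {0..1} t" for t
    by (auto simp: indicator_def)
   ultimately show ?thesis by simp
  qed
  moreover have "(\<integral>\<^sup>+t. ennreal (norm (dz (x + t *\<^sub>R y)) * norm y) * indicator {0..1} t \<partial>lborel)
    = (\<integral>\<^sup>+t. ennreal (norm y) * k (x + t *\<^sub>R y) * indicator {0..1} t \<partial>lborel)"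
   by (intro nn_integral_cong) (use seg x in \<open>auto simp: k_def indicator_def ennreal_mult mult.commute\<close>)
  ultimately show ?thesis by (metis ennreal_leI real_norm_def)
 qed
 have "(\<integral>\<^sup>+x. ennreal \<bar>z (x + y) - z x\<bar> * indicator D x \<partial>lborel)
   \<le> (\<integral>\<^sup>+x. (\<integral>\<^sup>+t. ennreal (norm y) * k (x + t *\<^sub>R y) * indicator {0..1} t \<partial>lborel) * indicator D x \<partial>lborel)"
  by (intro nn_integral_mono) (use pt in \<open>auto simp: indicator_def\<close>)
 also have "\<dots> \<le> (\<integral>\<^sup>+x. (\<integral>\<^sup>+t. ennreal (norm y) * k (x + t *\<^sub>R y) * indicator {0..1::real} t \<partial>lborel) \<partial>lborel)"
  by (intro nn_integral_mono) (auto simp: indicator_def)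
 also have "\<dots> = (\<integral>\<^sup>+t. (\<integral>\<^sup>+x. ennreal (norm y) * k (x + t *\<^sub>R y) * indicator {0..1::real} t \<partial>lborel) \<partial>lborel)"
  by (rule lborel_pair.Fubini') measurable
 also have "\<dots> = (\<integral>\<^sup>+t. ennreal (norm y) * (\<integral>\<^sup>+x. k x \<partial>lborel) * indicator {0..1::real} t \<partial>lborel)"
  by (intro nn_integral_cong)
   (auto simp: nn_integral_multc nn_integral_cmult nn_integral_lborel_translate)
 also have "\<dots> = ennreal (norm y) * (\<integral>\<^sup>+x. k x \<partial>lborel)"
  by (subst nn_integral_cmult_indicator) auto
 finally show ?thesis by (simp add: k_def)
qed

text \<open>A function together with its gradient. Such pairs are closed under multiplication by, and composition with,
  functions that are merely \<open>C\<^sup>1\<close>, which the smooth test functions are not.\<close>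

definition C1_compact_support :: "'a::euclidean_space set \<Rightarrow> ('a \<Rightarrow> real) \<Rightarrow> ('a \<Rightarrow> 'a) \<Rightarrow> bool" where
 "C1_compact_support \<Omega> h g \<longleftrightarrow> (\<forall>x. GDERIV h x :> g x) \<and> continuous_on UNIV g \<and>
   (\<exists>K. compact K \<and> K \<subseteq> \<Omega> \<and> (\<forall>x. x \<notin> K \<longrightarrow> h x = 0 \<and> g x = 0))"

lemma GDERIV_unique:
 assumes "GDERIV f x :> a" "GDERIV f x :> b"
 shows "a = b"
proof -
 have "(\<lambda>h. h \<bullet> a) = (\<lambda>h. h \<bullet> b)"
  using assms has_derivative_unique unfolding gderiv_def by blast
 then have "(a - b) \<bullet> a = (a - b) \<bullet> b" by metis
 then have "(a - b) \<bullet> (a - b) = 0" by (simp add: inner_diff_right)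
 then show ?thesis by simp
qed

lemma grad_eq: "GDERIV f x :> a \<Longrightarrow> grad f x = a"
 unfolding grad_def using GDERIV_unique by blast

lemma GDERIV_isCont: "GDERIV f x :> a \<Longrightarrow> isCont f x"
 unfolding gderiv_def using has_derivative_continuous by blast

lemma GDERIV_zero_outside:
 assumes "closed K" "x \<notin> K" "\<And>y. y \<notin> K \<Longrightarrow> f y = 0"
 shows "GDERIV f x :> 0"
proof -
 have "((\<lambda>_. 0) has_derivative (\<lambda>h. h \<bullet> 0)) (at x)" by simp
 then show ?thesis unfolding gderiv_def
  by (rule has_derivative_transform_within_open[of _ _ _ _ "- K"]) (use assms in auto)
qed

lemma GDERIV_transform_open:
 assumes "GDERIV f x :> a" "open S" "x \<in> S" "\<And>y. y \<in> S \<Longrightarrow> f y = g y"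
 shows "GDERIV g x :> a"
 using has_derivative_transform_within_open[of f _ x UNIV S g] assms unfolding gderiv_def by blast

lemma C1_compact_supportI:
 assumes "\<And>x. GDERIV h x :> g x" "continuous_on UNIV g" "compact K" "K \<subseteq> \<Omega>" "\<And>x. x \<notin> K \<Longrightarrow> h x = 0"
 shows "C1_compact_support \<Omega> h g"
proof -
 have "g x = 0" if "x \<notin> K" for x
  using GDERIV_unique[OF assms(1) GDERIV_zero_outside[OF compact_imp_closed[OF assms(3)] that assms(5)]] .
 then show ?thesis unfolding C1_compact_support_def using assms by blast
qed

lemma C1_compact_support_continuous: "C1_compact_support \<Omega> h g \<Longrightarrow> continuous_on UNIV h"
 unfolding C1_compact_support_def by (intro continuous_at_imp_continuous_on ballI GDERIV_isCont) blast

lemma compact_support_bounded: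
 fixes f :: "'a::euclidean_space \<Rightarrow> 'b::real_normed_vector"
 assumes "continuous_on UNIV f" "compact K" "\<And>x. x \<notin> K \<Longrightarrow> f x = 0"
 obtains B where "0 \<le> B" "\<And>x. norm (f x) \<le> B"
proof -
 have "compact (f ` K)"
  using assms(2) by (intro compact_continuous_image continuous_on_subset[OF assms(1)]) auto
 from compact_imp_bounded[OF this] obtain B where "\<forall>y\<in>f ` K. norm y \<le> B"
  unfolding bounded_iff by auto
 then have "norm (f x) \<le> max B 0" for x using assms(3)[of x] by (cases "x \<in> K") (auto simp: le_max_iff_disj)
 then show ?thesis using that[of "max B 0"] by simp
qed

lemma compact_support_integrable:
 fixes f :: "'a::euclidean_space \<Rightarrow> 'b::euclidean_space"
 assumes "continuous_on UNIV f" "compact K" "\<And>x. x \<notin> K \<Longrightarrow> f x = 0"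
 shows "integrable lborel f"
proof -
 have "integrable lborel (\<lambda>x. indicator K x *\<^sub>R f x)"
  using assms(2) by (intro borel_integrable_compact continuous_on_subset[OF assms(1)]) auto
 also have "(\<lambda>x. indicator K x *\<^sub>R f x) = f" using assms(3) by (auto simp: indicator_def fun_eq_iff)
 finally show ?thesis .
qed

text \<open>The integral of \<open>h\<close> is invariant under translation, so its derivative in any direction is 0; this is
  integration by parts without iterated integrals.\<close>

lemma integral_gradient_eq_0:
 assumes "C1_compact_support \<Omega> h g"
 shows "(\<integral>x. g x \<partial>lborel) = 0"
proof -
 obtain K where K: "compact K" "\<And>x. x \<notin> K \<Longrightarrow> h x = 0" "\<And>x. x \<notin> K \<Longrightarrow> g x = 0"
  and der: "\<And>x. GDERIV h x :> g x" and cg: "continuous_on UNIV g"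
  using assms unfolding C1_compact_support_def by blast
 have ch: "continuous_on UNIV h" using assms C1_compact_support_continuous by blast
 have gint: "integrable lborel g" using compact_support_integrable[OF cg K(1,3)] .
 have hint: "integrable lborel h" using compact_support_integrable[OF ch K(1,2)] .
 obtain B where B: "0 \<le> B" "\<And>x. norm (g x) \<le> B" using compact_support_bounded[OF cg K(1,3)] by blast
 have [measurable]: "h \<in> borel_measurable borel" "g \<in> borel_measurable borel"
  using ch cg by (auto intro: borel_measurable_continuous_onI)
 have lip: "\<bar>h (x + v) - h x\<bar> \<le> B * norm v" for x v
 proof -
  have "norm (h (x + v) - h x) \<le> B * norm (x + v - x)"
  proof (rule differentiable_bound[of UNIV h "\<lambda>x h. h \<bullet> g x"])
   show "onorm (\<lambda>h. h \<bullet> g x) \<le> B" for x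
   proof (rule onorm_bound)
    show "norm (h \<bullet> g x) \<le> B * norm h" for h
     using Cauchy_Schwarz_ineq2[of h "g x"] mult_left_mono[OF B(2)[of x], of "norm h"]
     by (simp add: mult.commute)
   qed (use B in auto)
  qed (use der in \<open>auto simp: gderiv_def\<close>)
  then show ?thesis by simp
 qed
 define K' where "K' = {x + y | x y. x \<in> K \<and> y \<in> cball 0 1}"
 have cK': "compact K'" unfolding K'_def using K(1) by (intro compact_sums) auto
 have *: "(\<integral>x. g x \<bullet> b \<partial>lborel) = 0" if b: "b \<in> Basis" for b
 proof -
  define t where "t n = inverse (real (Suc n))" for n
  have t0: "t \<longlonglongrightarrow> 0" unfolding t_def by (rule LIMSEQ_inverse_real_of_nat)
  have tpos: "0 < t n" "t n \<le> 1" for n by (auto simp: t_def divide_simps)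
  have "(\<lambda>n. \<integral>x. (h (x + t n *\<^sub>R b) - h x) / t n \<partial>lborel) \<longlonglongrightarrow> (\<integral>x. g x \<bullet> b \<partial>lborel)"
  proof (rule integral_dominated_convergence[where w="\<lambda>x. B * indicator K' x"])
   show "integrable lborel (\<lambda>x. B * indicator K' x)"
    using cK' by (intro integrable_mult_right integrable_real_indicator)
     (use emeasure_bounded_finite[OF compact_imp_bounded[OF cK']] in \<open>auto intro: borel_compact\<close>)
   show "AE x in lborel. (\<lambda>n. (h (x + t n *\<^sub>R b) - h x) / t n) \<longlonglongrightarrow> g x \<bullet> b"
   proof (rule AE_I2)
    fix x
    have "((\<lambda>s. h (x + s *\<^sub>R b)) has_derivative (\<lambda>s. (s *\<^sub>R b) \<bullet> g x)) (at 0)"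
     by (rule has_derivative_compose[where g=h and f="\<lambda>s. x + s *\<^sub>R b"])
       (use der in \<open>auto simp: gderiv_def intro!: derivative_eq_intros\<close>)
    then have "((\<lambda>s. h (x + s *\<^sub>R b)) has_real_derivative g x \<bullet> b) (at 0)"
     by (simp add: has_field_derivative_def inner_commute mult.commute[of "b \<bullet> g x"] mult_commute_abs)
    then have "((\<lambda>s. (h (x + s *\<^sub>R b) - h x) / s) \<longlongrightarrow> g x \<bullet> b) (at 0)"
     by (simp add: has_field_derivative_iff)
    then show "(\<lambda>n. (h (x + t n *\<^sub>R b) - h x) / t n) \<longlonglongrightarrow> g x \<bullet> b"
     by (rule filterlim_compose) (use t0 tpos in \<open>auto simp: filterlim_at intro!: always_eventually\<close>, metis less_irrefl)
   qed
   show "AE x in lborel. norm ((h (x + t n *\<^sub>R b) - h x) / t n) \<le> B * indicator K' x" for n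
   proof (rule AE_I2)
    fix x
    show "norm ((h (x + t n *\<^sub>R b) - h x) / t n) \<le> B * indicator K' x"
    proof (cases "x \<in> K'")
     case True
     have "\<bar>h (x + t n *\<^sub>R b) - h x\<bar> \<le> B * t n"
      using lip[of x "t n *\<^sub>R b"] tpos[of n] b by simp
     then show ?thesis using True tpos[of n] by (simp add: field_simps)
    next
     case False
     have "x \<notin> K" using False unfolding K'_def by force
     moreover have "x + t n *\<^sub>R b \<notin> K"
     proof
      assume "x + t n *\<^sub>R b \<in> K"
      moreover have "x = (x + t n *\<^sub>R b) + (- t n *\<^sub>R b)" by simp
      moreover have "- t n *\<^sub>R b \<in> cball 0 1" using tpos[of n] b by simp
      ultimately have "x \<in> K'" unfolding K'_def by blast
      with False show False by simp
     qed
     ultimately show ?thesis using False K(2) by simp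
    qed
   qed
  qed measurable
  moreover have "(\<integral>x. (h (x + t n *\<^sub>R b) - h x) / t n \<partial>lborel) = 0" for n
  proof -
   have "has_bochner_integral (distr lborel borel ((+) (t n *\<^sub>R b))) h (\<integral>x. h x \<partial>lborel)"
    using hint by (simp add: lborel_distr_plus has_bochner_integral_integrable)
   then have "integrable lborel (\<lambda>x. h (t n *\<^sub>R b + x))" "(\<integral>x. h (t n *\<^sub>R b + x) \<partial>lborel) = (\<integral>x. h x \<partial>lborel)"
    by (auto simp: has_bochner_integral_iff integrable_distr_eq integral_distr)
   then show ?thesis using hint by (simp add: add.commute)
  qed
  ultimately show ?thesis by (simp only: LIMSEQ_const_iff)
 qed
 have "(\<integral>x. g x \<partial>lborel) \<bullet> b = 0" if "b \<in> Basis" for b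
  by (rule trans[OF sym[OF integral_inner_left] *[OF that]]) (rule gint)
 then show ?thesis by (rule euclidean_eqI[where y=0, simplified])
qed

section \<open>Mollification\<close>

lemma power_le_fact_exp:
 fixes s :: real
 assumes "0 \<le> s"
 shows "s ^ n \<le> fact n * exp s"
proof -
 have "(\<Sum>k\<in>{n}. s ^ k /\<^sub>R fact k) \<le> exp s"
  unfolding exp_def using assms
  by (intro sum_le_suminf summable_exp_generic) auto
 then show ?thesis by (simp add: field_simps)
qed

text \<open>The derivatives of \<open>t \<mapsto> exp (-1/t)\<close> are combinations of these functions, so the family is closed under
  differentiation, and every member vanishes to second order at 0.\<close>

definition flat_exp :: "nat \<Rightarrow> real \<Rightarrow> real" where
 "flat_exp m t = (if t \<le> 0 then 0 else exp (- 1 / t) / t ^ m)"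

lemma flat_exp_quadratic: "\<bar>flat_exp m t\<bar> \<le> fact (m + 2) * t\<^sup>2"
proof (cases "t \<le> 0")
 case False
 then have t: "0 < t" by simp
 have "(1 / t) ^ (m + 2) \<le> fact (m + 2) * exp (1 / t)"
  using t by (intro power_le_fact_exp) auto
 then have "(1 / t) ^ (m + 2) * exp (- 1 / t) \<le> fact (m + 2) * exp (1 / t) * exp (- 1 / t)"
  by (intro mult_right_mono) auto
 also have "\<dots> = fact (m + 2)"
  by (simp add: mult.assoc flip: exp_add)
 finally have "(1 / t) ^ (m + 2) * exp (- 1 / t) * t\<^sup>2 \<le> fact (m + 2) * t\<^sup>2"
  by (intro mult_right_mono) auto
 moreover have "(1 / t) ^ (m + 2) * exp (- 1 / t) * t\<^sup>2 = flat_exp m t"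
  using t by (simp add: flat_exp_def power_add power_divide power2_eq_square field_simps)
 ultimately show ?thesis using t by (simp add: flat_exp_def)
qed (simp add: flat_exp_def)

lemma flat_exp_deriv:
 "(flat_exp m has_real_derivative flat_exp (m + 2) t - real m * flat_exp (m + 1) t) (at t)"
proof -
 consider "t < 0" | "t = 0" | "0 < t" by linarith
 then show ?thesis
 proof cases
  case 1
  have "((\<lambda>_. 0) has_real_derivative 0) (at t)" by simp
  then have "(flat_exp m has_real_derivative 0) (at t)"
   by (rule has_field_derivative_transform_within_open[where S="{..<0}"]) (use 1 in \<open>auto simp: flat_exp_def\<close>)
  then show ?thesis using 1 by (simp add: flat_exp_def)
 next
  case 2
  have "((\<lambda>h. flat_exp m h / h) \<longlongrightarrow> 0) (at 0)"
  proof (rule Lim_null_comparison)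
   have "norm (flat_exp m h / h) \<le> fact (m + 2) * \<bar>h\<bar>" if "h \<noteq> 0" for h
   proof -
    have "\<bar>flat_exp m h\<bar> / \<bar>h\<bar> \<le> fact (m + 2) * h\<^sup>2 / \<bar>h\<bar>"
     by (intro divide_right_mono flat_exp_quadratic) auto
    also have "\<dots> = fact (m + 2) * \<bar>h\<bar>" using that by (simp add: power2_eq_square abs_if)
    finally show ?thesis by (simp add: abs_divide)
   qed
   then show "\<forall>\<^sub>F h in at 0. norm (flat_exp m h / h) \<le> fact (m + 2) * \<bar>h\<bar>"
    by (auto simp: eventually_at intro!: exI[of _ 1])
   show "((\<lambda>h. fact (m + 2) * \<bar>h\<bar>) \<longlongrightarrow> (0::real)) (at 0)"
    by (auto intro!: tendsto_eq_intros)
  qed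
  then show ?thesis using 2 by (simp add: has_field_derivative_iff flat_exp_def)
 next
  case 3
  have "((\<lambda>t. exp (- 1 / t) / t ^ m) has_real_derivative
    (exp (- 1 / t) * (1 / t\<^sup>2) * t ^ m - exp (- 1 / t) * (real m * t ^ (m - 1))) / (t ^ m * t ^ m)) (at t)"
   using 3 by (auto intro!: derivative_eq_intros simp: power2_eq_square)
  also have "(exp (- 1 / t) * (1 / t\<^sup>2) * t ^ m - exp (- 1 / t) * (real m * t ^ (m - 1))) / (t ^ m * t ^ m)
    = flat_exp (m + 2) t - real m * flat_exp (m + 1) t"
   using 3 by (cases m) (auto simp: flat_exp_def field_simps power2_eq_square)
  finally show ?thesis
   by (rule has_field_derivative_transform_within_open[where S="{0<..}"]) (use 3 in \<open>auto simp: flat_exp_def\<close>)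
 qed
qed

lemma Ck_SucI:
 assumes "\<And>x. GDERIV f x :> g x" "\<And>b. b \<in> Basis \<Longrightarrow> Ck k (\<lambda>x. g x \<bullet> b)"
 shows "Ck (Suc k) f"
 using assms by auto

lemma Ck_const: "Ck k (\<lambda>_. c)"
proof (induction k arbitrary: c)
 case (Suc k)
 show ?case by (rule Ck_SucI[where g="\<lambda>_. 0"]) (use Suc[of 0] GDERIV_const in auto)
qed simp

lemma Ck_continuous: "Ck k f \<Longrightarrow> continuous_on UNIV f"
proof (cases k)
 case (Suc n)
 assume "Ck k f"
 then obtain g where "\<And>x. GDERIV f x :> g x" unfolding Suc Ck.simps by blast
 then show ?thesis by (intro continuous_at_imp_continuous_on ballI GDERIV_isCont)
qed simp

lemma Ck_Suc_imp: "Ck (Suc k) f \<Longrightarrow> Ck k f"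
proof (induction k arbitrary: f)
 case 0
 then show ?case using Ck_continuous[of "Suc 0"] by simp
next
 case (Suc k)
 then obtain g where g: "\<And>x. GDERIV f x :> g x" "\<And>b. b \<in> Basis \<Longrightarrow> Ck (Suc k) (\<lambda>x. g x \<bullet> b)"
  unfolding Ck.simps(2)[of "Suc k"] by blast
 show ?case by (rule Ck_SucI[OF g(1)]) (use g(2) Suc.IH in blast)
qed

lemma Ck_add:
 assumes "Ck k f" "Ck k g" shows "Ck k (\<lambda>x. f x + g x)"
 using assms
proof (induction k arbitrary: f g)
 case (Suc k)
 then obtain F G where FG: "\<And>x. GDERIV f x :> F x" "\<And>x. GDERIV g x :> G x"
  "\<And>b. b \<in> Basis \<Longrightarrow> Ck k (\<lambda>x. F x \<bullet> b)" "\<And>b. b \<in> Basis \<Longrightarrow> Ck k (\<lambda>x. G x \<bullet> b)"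
  unfolding Ck.simps by blast
 show ?case
  by (rule Ck_SucI[OF GDERIV_add[OF FG(1,2)]]) (use FG Suc.IH in \<open>auto simp: inner_add_left\<close>)
qed (auto intro: continuous_intros)

lemma Ck_mult:
 assumes "Ck k f" "Ck k g" shows "Ck k (\<lambda>x. f x * g x)"
 using assms
proof (induction k arbitrary: f g)
 case (Suc k)
 then obtain F G where FG: "\<And>x. GDERIV f x :> F x" "\<And>x. GDERIV g x :> G x"
  "\<And>b. b \<in> Basis \<Longrightarrow> Ck k (\<lambda>x. F x \<bullet> b)" "\<And>b. b \<in> Basis \<Longrightarrow> Ck k (\<lambda>x. G x \<bullet> b)"
  unfolding Ck.simps by blast
 have "Ck k f" "Ck k g" using Suc.prems Ck_Suc_imp by auto
 then show ?case
  by (intro Ck_SucI[OF GDERIV_mult[OF FG(1,2)]])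
   (use FG Suc.IH in \<open>auto simp: inner_add_left intro!: Ck_add\<close>)
qed (auto intro: continuous_intros)

lemma Ck_inner_const: "Ck k (\<lambda>x. x \<bullet> b)"
proof (cases k)
 case (Suc k')
 show ?thesis unfolding Suc
  by (rule Ck_SucI[where g="\<lambda>_. b"])
   (auto simp: gderiv_def Ck_const intro!: derivative_eq_intros)
qed (auto intro: continuous_intros)

lemma GDERIV_norm_square: "GDERIV (\<lambda>x. c - x \<bullet> x) x :> - 2 *\<^sub>R x"
 unfolding gderiv_def by (auto intro!: derivative_eq_intros simp: inner_commute)

text \<open>The chain rule stays within the family \<open>flat_exp\<close>, so induction on \<open>k\<close> with \<open>m\<close> arbitrary applies.\<close>

lemma Ck_bump: "Ck k (\<lambda>x. flat_exp m (c - x \<bullet> x))"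
proof (induction k arbitrary: m)
 case 0
 have "continuous_on UNIV (flat_exp m)"
  using flat_exp_deriv DERIV_isCont continuous_at_imp_continuous_on by blast
 then show ?case
  using continuous_on_compose2[of UNIV "flat_exp m" UNIV "\<lambda>x. c - x \<bullet> x"]
  by (simp add: continuous_intros)
next
 case (Suc k)
 show ?case
 proof (rule Ck_SucI)
  show "GDERIV (\<lambda>x. flat_exp m (c - x \<bullet> x)) x :>
    (flat_exp (m + 2) (c - x \<bullet> x) - real m * flat_exp (m + 1) (c - x \<bullet> x)) *\<^sub>R (- 2 *\<^sub>R x)" for x
   by (rule GDERIV_DERIV_compose[OF GDERIV_norm_square flat_exp_deriv])
  fix b :: 'a
  have "Ck k (\<lambda>x. (flat_exp (m + 2) (c - x \<bullet> x) + (- real m) * flat_exp (m + 1) (c - x \<bullet> x)) * ((- 2) * (x \<bullet> b)))"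
   by (intro Ck_mult Ck_add Ck_const Ck_inner_const Suc.IH)
  moreover have "(flat_exp (m + 2) (c - x \<bullet> x) - real m * flat_exp (m + 1) (c - x \<bullet> x)) *\<^sub>R (- 2 *\<^sub>R x) \<bullet> b
    = (flat_exp (m + 2) (c - x \<bullet> x) + (- real m) * flat_exp (m + 1) (c - x \<bullet> x)) * ((- 2) * (x \<bullet> b))" for x
   by (simp only: inner_scaleR_left) simp
  ultimately show "Ck k (\<lambda>x. (flat_exp (m + 2) (c - x \<bullet> x) - real m * flat_exp (m + 1) (c - x \<bullet> x)) *\<^sub>R (- 2 *\<^sub>R x) \<bullet> b)"
   by (simp only:)
 qed
qed

lemma leibniz_rule_GDERIV:
 fixes f :: "'a::euclidean_space \<Rightarrow> 'b::euclidean_space \<Rightarrow> real"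
 assumes der: "\<And>x y. GDERIV (\<lambda>x. f x y) x :> fx x y"
  and cont: "continuous_on UNIV (\<lambda>(x, y). fx x y)"
  and contf: "\<And>x. continuous_on UNIV (f x)"
 shows "GDERIV (\<lambda>x. integral (cbox a b) (f x)) x0 :> integral (cbox a b) (fx x0)"
proof -
 have c: "continuous_on (cbox a b) (fx x0)"
  using continuous_on_compose2[OF cont, of "cbox a b" "\<lambda>y. (x0, y)"] by (simp add: continuous_intros)
 have "((\<lambda>x. integral (cbox a b) (f x)) has_derivative
   blinfun_apply (integral (cbox a b) (\<lambda>y. blinfun_inner_left (fx x0 y)))) (at x0 within UNIV)"
 proof (rule leibniz_rule)
  show "((\<lambda>x. f x t) has_derivative blinfun_apply (blinfun_inner_left (fx x t))) (at x within UNIV)" for x t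
   using der[of t x] by (simp add: gderiv_def)
  show "f x integrable_on cbox a b" for x
   using contf integrable_continuous continuous_on_subset by blast
  show "continuous_on (UNIV \<times> cbox a b) (\<lambda>(x, t). blinfun_inner_left (fx x t))"
   using continuous_on_subset[OF cont] by (auto simp: split_beta intro!: bounded_linear.continuous_on[OF bounded_linear_blinfun_inner_left])
 qed auto
 also have "integral (cbox a b) (\<lambda>y. blinfun_inner_left (fx x0 y)) = blinfun_inner_left (integral (cbox a b) (fx x0))"
  using integral_linear[OF integrable_continuous[OF c] bounded_linear_blinfun_inner_left] by (simp add: o_def)
 finally show ?thesis by (simp add: gderiv_def)
qed

lemma GDERIV_shift:
 assumes "GDERIV f (x - y) :> a"
 shows "GDERIV (\<lambda>x. f (x - y)) x :> a"
proof -
 have "((\<lambda>x. x - y) has_derivative (\<lambda>h. h)) (at x)" by (auto intro!: derivative_eq_intros)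
 from has_derivative_compose[OF this] assms show ?thesis unfolding gderiv_def by blast
qed

lemma Ck_convolution:
 fixes h \<rho> :: "'a::euclidean_space \<Rightarrow> real"
 assumes h: "continuous_on UNIV h" and \<rho>: "Ck k \<rho>"
 shows "Ck k (\<lambda>x. integral (cbox a b) (\<lambda>y. h y * \<rho> (x - y)))"
 using \<rho>
proof (induction k arbitrary: \<rho>)
 case 0
 then have c: "continuous_on UNIV \<rho>" by simp
 have "continuous_on (UNIV \<times> cbox a b) (\<lambda>(x, y). h y * \<rho> (x - y))"
  unfolding split_beta
  by (intro continuous_intros continuous_on_compose2[OF c] continuous_on_compose2[OF h]) auto
 then show ?case using integral_continuous_on_param by auto
next
 case (Suc k)
 then obtain g where g: "\<And>x. GDERIV \<rho> x :> g x" "\<And>b. b \<in> Basis \<Longrightarrow> Ck k (\<lambda>x. g x \<bullet> b)"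
  by auto
 have c: "continuous_on UNIV \<rho>" using Ck_continuous[OF Suc.prems] .
 have "continuous_on UNIV (\<lambda>x. \<Sum>b\<in>Basis. (g x \<bullet> b) *\<^sub>R b)"
  using Ck_continuous[OF g(2)]
  by (intro continuous_on_sum continuous_on_scaleR continuous_on_const)
 then have cg: "continuous_on UNIV g" by (simp add: euclidean_representation)
 have cF: "continuous_on (cbox a b) (\<lambda>y. h y *\<^sub>R g (x - y))" for x
  by (intro continuous_intros continuous_on_compose2[OF cg] continuous_on_subset[OF h]) auto
 show ?case
 proof (rule Ck_SucI)
  show "GDERIV (\<lambda>x. integral (cbox a b) (\<lambda>y. h y * \<rho> (x - y))) x :>
    integral (cbox a b) (\<lambda>y. h y *\<^sub>R g (x - y))" for x
  proof (rule leibniz_rule_GDERIV)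
   fix x y
   have "GDERIV (\<lambda>x. \<rho> (x - y)) x :> g (x - y)"
    using g(1) by (rule GDERIV_shift)
   from GDERIV_mult[OF GDERIV_const[of "h y" x] this]
   show "GDERIV (\<lambda>x. h y * \<rho> (x - y)) x :> h y *\<^sub>R g (x - y)" by simp
  next
   show "continuous_on UNIV (\<lambda>(x, y). h y *\<^sub>R g (x - y))"
    unfolding split_beta
    by (intro continuous_intros continuous_on_compose2[OF cg] continuous_on_compose2[OF h]) auto
   show "continuous_on UNIV (\<lambda>y. h y * \<rho> (x - y))" for x
    by (intro continuous_intros continuous_on_compose2[OF c] h) auto
  qed
  fix i :: 'a assume i: "i \<in> Basis"
  have "integral (cbox a b) (\<lambda>y. h y *\<^sub>R g (x - y)) \<bullet> i = integral (cbox a b) (\<lambda>y. h y * (g (x - y) \<bullet> i))" for x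
   using integral_linear[OF integrable_continuous[OF cF[of x]] bounded_linear_inner_left[of i]]
   by (simp add: o_def)
  then show "Ck k (\<lambda>x. integral (cbox a b) (\<lambda>y. h y *\<^sub>R g (x - y)) \<bullet> i)"
   using Suc.IH[OF g(2)[OF i]] by simp
 qed
qed

lemma lborel_reflect: "lborel = distr lborel borel (\<lambda>y. x - y :: 'a::euclidean_space)"
 using lborel_affine[of "-1" x] by (simp add: density_1)

lemma averaging_error:
 fixes F :: "'a::euclidean_space \<Rightarrow> 'b::euclidean_space" and \<rho> :: "'a \<Rightarrow> real"
 assumes F: "continuous_on UNIV F" and \<rho>: "continuous_on UNIV \<rho>" and nn: "\<And>y. 0 \<le> \<rho> y"
  and I: "integral (cbox a b) \<rho> = 1"
  and close: "\<And>y. \<rho> y \<noteq> 0 \<Longrightarrow> norm (F (x - y) - F x) \<le> \<eta>"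
 shows "norm (integral (cbox a b) (\<lambda>y. \<rho> y *\<^sub>R F (x - y)) - F x) \<le> \<eta>"
proof -
 have c: "continuous_on (cbox a b) (\<lambda>y. \<rho> y *\<^sub>R F (x - y))"
   "continuous_on (cbox a b) \<rho>"
  by (intro continuous_intros continuous_on_compose2[OF F] continuous_on_subset[OF \<rho>]; auto)+
 have 1: "integral (cbox a b) (\<lambda>y. \<rho> y *\<^sub>R F x) = F x"
  using integral_linear[OF integrable_continuous[OF c(2)] bounded_linear_scaleR_left[of "F x"]] I
  by (simp add: o_def)
 have int1: "(\<lambda>y. \<rho> y *\<^sub>R F (x - y)) integrable_on cbox a b" "(\<lambda>y. \<rho> y *\<^sub>R F x) integrable_on cbox a b"
  by (intro integrable_continuous continuous_intros c)+
 have "integral (cbox a b) (\<lambda>y. \<rho> y *\<^sub>R F (x - y)) - F x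
   = integral (cbox a b) (\<lambda>y. \<rho> y *\<^sub>R F (x - y) - \<rho> y *\<^sub>R F x)"
  using integral_diff[OF int1] 1 by simp
 also have "norm \<dots> \<le> integral (cbox a b) (\<lambda>y. \<rho> y * \<eta>)"
 proof (rule integral_norm_bound_integral)
  show "(\<lambda>y. \<rho> y *\<^sub>R F (x - y) - \<rho> y *\<^sub>R F x) integrable_on cbox a b"
   using integrable_diff[OF int1] .
  show "(\<lambda>y. \<rho> y * \<eta>) integrable_on cbox a b"
   by (intro integrable_continuous continuous_intros c)
  show "norm (\<rho> y *\<^sub>R F (x - y) - \<rho> y *\<^sub>R F x) \<le> \<rho> y * \<eta>" for y
   using close[of y] nn[of y] by (cases "\<rho> y = 0") (auto simp flip: scaleR_diff_right intro!: mult_left_mono)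
 qed
 also have "\<dots> = \<eta>" using I by simp
 finally show ?thesis .
qed

lemma uniformly_close_shift:
 fixes F :: "'a::euclidean_space \<Rightarrow> 'b::euclidean_space"
 assumes F: "continuous_on UNIV F" and K: "compact K" "\<And>x. x \<notin> K \<Longrightarrow> F x = 0" and \<eta>: "0 < \<eta>"
 obtains e where "0 < e" "\<And>x y. norm y < e \<Longrightarrow> norm (F (x - y) - F x) \<le> \<eta>"
proof -
 define K' where "K' = {x + y | x y. x \<in> K \<and> y \<in> cball 0 2}"
 have cK': "compact K'" unfolding K'_def using K(1) by (intro compact_sums) auto
 have "uniformly_continuous_on K' F"
  using compact_uniformly_continuous[OF continuous_on_subset[OF F] cK'] by auto
 then obtain d where d: "0 < d" "\<And>x x'. x \<in> K' \<Longrightarrow> x' \<in> K' \<Longrightarrow> dist x' x < d \<Longrightarrow> dist (F x') (F x) < \<eta>"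
  using \<eta> unfolding uniformly_continuous_on_def by metis
 have "norm (F (x - y) - F x) \<le> \<eta>" if y: "norm y < min d 1" for x y
 proof (cases "x \<in> K \<or> x - y \<in> K")
  case True
  have "x \<in> K' \<and> x - y \<in> K'"
   using True
  proof
   assume x: "x \<in> K"
   have "x + 0 \<in> K'" unfolding K'_def mem_Collect_eq using x
    by - (rule exI[where x=x], rule exI[where x=0], simp)
   moreover have "x + (- y) \<in> K'" unfolding K'_def mem_Collect_eq using x y
    by - (rule exI[where x=x], rule exI[where x="- y"], simp)
   ultimately show ?thesis by simp
  next
   assume x: "x - y \<in> K"
   have "(x - y) + 0 \<in> K'" unfolding K'_def mem_Collect_eq using x
    by - (rule exI[where x="x - y"], rule exI[where x=0], simp)
   moreover have "(x - y) + y \<in> K'" unfolding K'_def mem_Collect_eq using x y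
    by - (rule exI[where x="x - y"], rule exI[where x=y], simp)
   ultimately show ?thesis by simp
  qed
  then show ?thesis using d(2)[of x "x - y"] y by (simp add: dist_norm less_imp_le)
 next
  case False
  then show ?thesis using K(2) \<eta> by simp
 qed
 then show ?thesis using that[of "min d 1"] d by auto
qed

text \<open>The set \<open>K'\<close> is a closed neighbourhood of \<open>K\<close> that does not depend on \<open>h\<close>; this uniformity is what lets a sequence of
  approximations be handled on one compact set. The mollified gradient is the gradient of the mollified
  function, so both are uniformly close.\<close>

lemma mollification:
 fixes \<Omega> :: "'a::euclidean_space set"
 assumes \<Omega>: "open \<Omega>" and K: "compact K" "K \<subseteq> \<Omega>"
 obtains K' where "compact K'" "K' \<subseteq> \<Omega>"
  "\<And>h \<eta>. continuous_on UNIV h \<Longrightarrow> (\<And>x. x \<notin> K \<Longrightarrow> h x = 0) \<Longrightarrow> 0 < \<eta> \<Longrightarrow>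
   \<exists>\<psi>\<in>test_functions \<Omega>. (\<forall>x. x \<notin> K' \<longrightarrow> \<psi> x = 0) \<and> (\<forall>x. \<bar>\<psi> x - h x\<bar> \<le> \<eta>) \<and>
   (\<forall>g. C1_compact_support K h g \<longrightarrow> (\<forall>x. norm (grad \<psi> x - g x) \<le> \<eta>))"
proof -
 obtain r where r: "0 < r" "(\<Union>x\<in>K. cball x r) \<subseteq> \<Omega>"
  using compact_subset_open_imp_cball_epsilon_subset[OF K(1) \<Omega> K(2)] by blast
 define K' where "K' = {x + y | x y. x \<in> K \<and> y \<in> cball 0 r}"
 have cK': "compact K'" unfolding K'_def using K(1) by (intro compact_sums) auto
 have K'\<Omega>: "K' \<subseteq> \<Omega>"
 proof
  fix z assume "z \<in> K'"
  then obtain x y where "z = x + y" "x \<in> K" "norm y \<le> r" unfolding K'_def by auto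
  then have "z \<in> cball x r" by (simp add: dist_norm)
  then show "z \<in> \<Omega>" using r \<open>x \<in> K\<close> by blast
 qed
 obtain a b where ab: "K \<subseteq> cbox a b"
  using K(1) bounded_subset_cbox_symmetric compact_imp_bounded by metis
 obtain c d where cd: "cball (0::'a) r \<subseteq> cbox c d"
  using bounded_subset_cbox_symmetric bounded_cball by metis
 show ?thesis
 proof (rule that[OF cK' K'\<Omega>])
  fix h :: "'a \<Rightarrow> real" and \<eta> :: real
  assume h: "continuous_on UNIV h" and h0: "\<And>x. x \<notin> K \<Longrightarrow> h x = 0" and \<eta>: "0 < \<eta>"
  obtain e1 where e1: "0 < e1" "\<And>x y. norm y < e1 \<Longrightarrow> norm (h (x - y) - h x) \<le> \<eta>"
   using uniformly_close_shift[OF h K(1) h0 \<eta>] by blast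
  have "\<exists>e>0. \<forall>g. C1_compact_support K h g \<longrightarrow> (\<forall>x y. norm y < e \<longrightarrow> norm (g (x - y) - g x) \<le> \<eta>)"
  proof (cases "\<exists>g. C1_compact_support K h g")
   case True
   then obtain g where g: "C1_compact_support K h g" by blast
   then obtain L where L: "compact L" "L \<subseteq> K" "\<And>x. x \<notin> L \<Longrightarrow> g x = 0" and cg: "continuous_on UNIV g"
    unfolding C1_compact_support_def by blast
   have "g' = g" if "C1_compact_support K h g'" for g'
    using that g GDERIV_unique unfolding C1_compact_support_def by (intro ext) blast
   moreover obtain e where "0 < e" "\<And>x y. norm y < e \<Longrightarrow> norm (g (x - y) - g x) \<le> \<eta>"
    using uniformly_close_shift[OF cg L(1,3) \<eta>] by blast
   ultimately show ?thesis by metis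
  qed (auto intro: exI[of _ 1])
  then obtain e2 where e2: "0 < e2"
   "\<And>g x y. C1_compact_support K h g \<Longrightarrow> norm y < e2 \<Longrightarrow> norm (g (x - y) - g x) \<le> \<eta>" by blast
  define e where "e = min r (min e1 e2)"
  have e: "0 < e" "e \<le> r" "e \<le> e1" "e \<le> e2" using r e1 e2 by (auto simp: e_def)
  define bump where "bump y = flat_exp 0 (e\<^sup>2 - y \<bullet> y)" for y :: 'a
  have bump_nn: "0 \<le> bump y" for y by (simp add: bump_def flat_exp_def)
  have bump_supp: "norm y < e" if "bump y \<noteq> 0" for y
  proof -
   have "y \<bullet> y < e\<^sup>2" using that by (auto simp: bump_def flat_exp_def split: if_splits)
   then show ?thesis using e by (simp add: norm_lt_square dot_square_norm power2_less_imp_less)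
  qed
  have bump_c: "continuous_on UNIV bump" unfolding bump_def using Ck_continuous[OF Ck_bump[of 0 0 "e\<^sup>2"]] .
  define I where "I = integral (cbox c d) bump"
  have "0 < I"
  proof -
   have "0 \<le> I" unfolding I_def
    using bump_nn by (intro integral_nonneg integrable_continuous continuous_on_subset[OF bump_c]) auto
   moreover have "I \<noteq> 0"
   proof
    assume "I = 0"
    moreover have int: "bump integrable_on cbox c d"
     using continuous_on_subset[OF bump_c] integrable_continuous by blast
    moreover have "box c d \<noteq> {}"
    proof -
     have "ball (0::'a) r \<subseteq> interior (cbox c d)"
      using cd by (intro interior_maximal) (auto simp: subset_iff)
     then show ?thesis using r(1) by (auto simp: interior_cbox)
    qed
    ultimately have "bump 0 = 0"
     using has_integral_0_cbox_imp_0[of c d bump 0] continuous_on_subset[OF bump_c] bump_nn cd r(1)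
     by (metis I_def centre_in_cball integrable_integral less_imp_le subset_UNIV subsetD)
    then show False using e by (simp add: bump_def flat_exp_def)
   qed
   ultimately show ?thesis by simp
  qed
  define \<rho> where "\<rho> y = (1 / I) * bump y" for y
  have \<rho>: "Ck k \<rho>" for k
   unfolding \<rho>_def bump_def by (intro Ck_mult Ck_const Ck_bump)
  have \<rho>c: "continuous_on UNIV \<rho>" using \<rho> Ck_continuous by blast
  have \<rho>nn: "0 \<le> \<rho> y" for y using bump_nn \<open>0 < I\<close> by (simp add: \<rho>_def)
  have \<rho>supp: "norm y < e" if "\<rho> y \<noteq> 0" for y using that bump_supp by (auto simp: \<rho>_def)
  have \<rho>0: "\<rho> y = 0" if "y \<notin> cball 0 r" for y using \<rho>supp[of y] that e by auto
  have \<rho>I: "integral (cbox c d) \<rho> = 1"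
   unfolding \<rho>_def using \<open>0 < I\<close> by (simp add: I_def)
  define \<psi> where "\<psi> x = integral (cbox a b) (\<lambda>y. h y * \<rho> (x - y))" for x
  have \<psi>_alt: "\<psi> x = integral (cbox c d) (\<lambda>y. \<rho> y *\<^sub>R h (x - y))" for x
  proof -
   have c1: "continuous_on UNIV (\<lambda>y. h y * \<rho> (x - y))"
    by (intro continuous_intros continuous_on_compose2[OF \<rho>c] h) auto
   have c2: "continuous_on UNIV (\<lambda>y. \<rho> y *\<^sub>R h (x - y))"
    by (intro continuous_intros continuous_on_compose2[OF h] \<rho>c) auto
   have i1: "integrable lborel (\<lambda>y. h y * \<rho> (x - y))"
    by (rule compact_support_integrable[OF c1 K(1)]) (use h0 in auto)
   have i2: "integrable lborel (\<lambda>y. \<rho> y *\<^sub>R h (x - y))"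
    by (rule compact_support_integrable[OF c2 compact_cball[of 0 r]]) (use \<rho>0 in auto)
   have "\<psi> x = integral UNIV (\<lambda>y. h y * \<rho> (x - y))"
   proof -
    have "(\<lambda>y. h y * \<rho> (x - y)) = (\<lambda>y. if y \<in> cbox a b then h y * \<rho> (x - y) else 0)"
     using ab h0 by (auto simp: fun_eq_iff)
    then show ?thesis unfolding \<psi>_def by (metis integral_restrict_UNIV)
   qed
   also have "\<dots> = (\<integral>y. h y * \<rho> (x - y) \<partial>lborel)" using integral_lborel[OF i1] .
   also have "\<dots> = (\<integral>y. h y * \<rho> (x - y) \<partial>distr lborel borel (\<lambda>y. x - y))" using lborel_reflect by metis
   also have "\<dots> = (\<integral>y. \<rho> y *\<^sub>R h (x - y) \<partial>lborel)"
    by (subst integral_distr) (auto intro: borel_measurable_continuous_onI c1 simp: mult.commute)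
   also have "\<dots> = integral UNIV (\<lambda>y. \<rho> y *\<^sub>R h (x - y))" using integral_lborel[OF i2] by simp
   also have "\<dots> = integral (cbox c d) (\<lambda>y. \<rho> y *\<^sub>R h (x - y))"
   proof -
    have "(\<lambda>y. \<rho> y *\<^sub>R h (x - y)) = (\<lambda>y. if y \<in> cbox c d then \<rho> y *\<^sub>R h (x - y) else 0)"
    proof
     fix y
     show "\<rho> y *\<^sub>R h (x - y) = (if y \<in> cbox c d then \<rho> y *\<^sub>R h (x - y) else 0)"
     proof (cases "y \<in> cbox c d")
      case False
      then have "y \<notin> cball 0 r" using cd by blast
      then show ?thesis using \<rho>0 by simp
     qed simp
    qed
    then show ?thesis by (metis integral_restrict_UNIV)
   qed
   finally show ?thesis .
  qed
  have supp: "\<psi> x = 0" if x: "x \<notin> K'" for x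
  proof -
   have "h y * \<rho> (x - y) = 0" for y
   proof (rule ccontr)
    assume "h y * \<rho> (x - y) \<noteq> 0"
    then have "y \<in> K" "norm (x - y) \<le> r" using h0 \<rho>supp[of "x - y"] e by auto
    then have "y + (x - y) \<in> K'" unfolding K'_def by (intro CollectI exI conjI refl) auto
    with x show False by simp
   qed
   then have "(\<lambda>y. h y * \<rho> (x - y)) = (\<lambda>y. 0)" by (rule ext)
   then show ?thesis by (simp add: \<psi>_def)
  qed
  have close: "\<bar>\<psi> x - h x\<bar> \<le> \<eta>" for x
   unfolding \<psi>_alt real_norm_def[symmetric]
   by (rule averaging_error[OF h \<rho>c \<rho>nn \<rho>I]) (use e1 e \<rho>supp in fastforce)
  have closeg: "norm (grad \<psi> x - g x) \<le> \<eta>" if g: "C1_compact_support K h g" for g x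
  proof -
   have cg: "continuous_on UNIV g" and dg: "\<And>x. GDERIV h x :> g x"
    using g unfolding C1_compact_support_def by auto
   have "GDERIV (\<lambda>x. integral (cbox c d) (\<lambda>y. \<rho> y *\<^sub>R h (x - y))) x :>
     integral (cbox c d) (\<lambda>y. \<rho> y *\<^sub>R g (x - y))"
   proof (rule leibniz_rule_GDERIV)
    fix x y
    have "GDERIV (\<lambda>x. h (x - y)) x :> g (x - y)"
     using dg by (rule GDERIV_shift)
    from GDERIV_mult[OF GDERIV_const[of "\<rho> y" x] this]
    show "GDERIV (\<lambda>x. \<rho> y *\<^sub>R h (x - y)) x :> \<rho> y *\<^sub>R g (x - y)" by simp
   next
    show "continuous_on UNIV (\<lambda>(x, y). \<rho> y *\<^sub>R g (x - y))"
     unfolding split_beta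
     by (intro continuous_intros continuous_on_compose2[OF cg] continuous_on_compose2[OF \<rho>c]) auto
    show "continuous_on UNIV (\<lambda>y. \<rho> y *\<^sub>R h (x - y))" for x
     by (intro continuous_intros continuous_on_compose2[OF h] \<rho>c) auto
   qed
   then have "grad \<psi> x = integral (cbox c d) (\<lambda>y. \<rho> y *\<^sub>R g (x - y))"
    unfolding \<psi>_alt by (rule grad_eq)
   then show ?thesis
    using averaging_error[OF cg \<rho>c \<rho>nn \<rho>I, of x \<eta>] e2(2)[OF g] e \<rho>supp by fastforce
  qed
  have "closure {x. \<psi> x \<noteq> 0} \<subseteq> K'"
   using supp cK' by (intro closure_minimal compact_imp_closed) auto
  moreover have "compact (closure {x. \<psi> x \<noteq> 0})"
   unfolding compact_eq_bounded_closed
   using bounded_subset[OF compact_imp_bounded[OF cK'] calculation] by simp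
  moreover have "Ck k \<psi>" for k
   unfolding \<psi>_def using Ck_convolution[OF h \<rho>] .
  ultimately have "\<psi> \<in> test_functions \<Omega>"
   unfolding test_functions_def using K'\<Omega> by blast
  then show "\<exists>\<psi>\<in>test_functions \<Omega>. (\<forall>x. x \<notin> K' \<longrightarrow> \<psi> x = 0) \<and> (\<forall>x. \<bar>\<psi> x - h x\<bar> \<le> \<eta>) \<and>
   (\<forall>g. C1_compact_support K h g \<longrightarrow> (\<forall>x. norm (grad \<psi> x - g x) \<le> \<eta>))"
   using supp close closeg by blast
 qed
qed

section \<open>Lebesgue spaces on a bounded open set\<close>

lemma borel_measurable_lebesgue_on_AE:
 fixes f g :: "'a::euclidean_space \<Rightarrow> 'b::euclidean_space"
 assumes S: "S \<in> sets lebesgue" and f: "f \<in> borel_measurable (lebesgue_on S)"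
  and ae: "AE x in lebesgue_on S. f x = g x"
 shows "g \<in> borel_measurable (lebesgue_on S)"
proof -
 have "(\<lambda>x. indicator S x *\<^sub>R f x) \<in> borel_measurable lebesgue"
  using f S by (simp add: borel_measurable_restrict_space_iff)
 moreover have "AE x in lebesgue. indicator S x *\<^sub>R f x = indicator S x *\<^sub>R g x"
  using ae S by (simp add: AE_restrict_space_iff indicator_def) (auto elim: eventually_mono)
 ultimately have "(\<lambda>x. indicator S x *\<^sub>R g x) \<in> borel_measurable lebesgue"
  by (rule borel_measurable_AE)
 then show ?thesis using S by (simp add: borel_measurable_restrict_space_iff)
qed

lemma continuous_on_measurable_lebesgue_on:
 fixes f :: "'a::euclidean_space \<Rightarrow> 'b::euclidean_space"
 shows "open \<Omega> \<Longrightarrow> continuous_on \<Omega> f \<Longrightarrow> f \<in> borel_measurable (lebesgue_on \<Omega>)"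
 by (rule continuous_imp_measurable_on_sets_lebesgue) auto

lemma open_sets_lebesgue: "open S \<Longrightarrow> S \<in> sets lebesgue"
 by (simp add: borel_open)

lemma integral_lebesgue_on_eq_lborel:
 fixes f :: "'a::euclidean_space \<Rightarrow> 'b::euclidean_space"
 assumes "open \<Omega>" "f \<in> borel_measurable borel" "\<And>x. x \<notin> \<Omega> \<Longrightarrow> f x = 0"
 shows "integral\<^sup>L (lebesgue_on \<Omega>) f = integral\<^sup>L lborel f"
proof -
 have "integral\<^sup>L (lebesgue_on \<Omega>) f = integral\<^sup>L lebesgue (\<lambda>x. indicator \<Omega> x *\<^sub>R f x)"
  using assms(1) by (subst integral_restrict_space) (auto simp: open_sets_lebesgue)
 also have "(\<lambda>x. indicator \<Omega> x *\<^sub>R f x) = f"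
  using assms(3) by (auto simp: indicator_def fun_eq_iff)
 also have "integral\<^sup>L lebesgue f = integral\<^sup>L lborel f"
  using assms(2) by (simp add: integral_completion)
 finally show ?thesis .
qed

lemma tendsto_zero_le:
 fixes a b :: "nat \<Rightarrow> real"
 assumes "b \<longlonglongrightarrow> 0" "\<And>n. a n \<le> b n" "\<And>n. 0 \<le> a n"
 shows "a \<longlonglongrightarrow> 0"
 using tendsto_sandwich[of "\<lambda>_. 0" a sequentially b 0] assms by (simp add: always_eventually)

lemma set_integrable_lebesgue_on:
 fixes f :: "'a::euclidean_space \<Rightarrow> 'b::euclidean_space"
 assumes "open \<Omega>" "integrable (lebesgue_on \<Omega>) f" "K \<in> sets lebesgue" "K \<subseteq> \<Omega>"
 shows "f absolutely_integrable_on K"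
proof -
 have "set_integrable lebesgue \<Omega> f"
  using assms(1,2) by (simp add: set_integrable_def integrable_restrict_space open_sets_lebesgue)
 then show ?thesis using assms(3,4) set_integrable_subset by blast
qed

locale bounded_open =
 fixes \<Omega> :: "'a::euclidean_space set"
 assumes \<Omega>_open: "open \<Omega>" and \<Omega>_bounded: "bounded \<Omega>"
begin

abbreviation M :: "'a measure" where "M \<equiv> lebesgue_on \<Omega>"

sublocale finite_measure M
 using \<Omega>_open \<Omega>_bounded by (intro finite_measure_lebesgue_on lmeasurable_open)

lemma \<Omega>_sets [simp]: "\<Omega> \<in> sets lebesgue"
 using \<Omega>_open by (rule open_sets_lebesgue)

lemma continuous_measurable:
 fixes f :: "'a \<Rightarrow> 'b::euclidean_space"
 shows "continuous_on \<Omega> f \<Longrightarrow> f \<in> borel_measurable M"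
 using \<Omega>_open by (rule continuous_on_measurable_lebesgue_on)

lemma bounded_integrable:
 fixes f :: "'a \<Rightarrow> 'b::euclidean_space"
 assumes "f \<in> borel_measurable M" "\<And>x. x \<in> \<Omega> \<Longrightarrow> norm (f x) \<le> B"
 shows "integrable M f"
 by (rule integrable_const_bound[where B=B]) (use assms in \<open>auto intro!: AE_I2\<close>)

lemma LspaceD:
 assumes "f \<in> Lspace \<Omega> r"
 shows "f \<in> borel_measurable M" "integrable M (\<lambda>x. norm (f x) powr r)"
 using assms by (auto simp: Lspace_def)

lemma Lspace_dominated:
 fixes f :: "'a \<Rightarrow> 'b::euclidean_space" and g :: "'a \<Rightarrow> 'c::euclidean_space"
 assumes "0 < r" "g \<in> Lspace \<Omega> r" "f \<in> borel_measurable M" "0 \<le> C"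
  and le: "AE x in M. norm (f x) \<le> C * norm (g x)"
 shows "f \<in> Lspace \<Omega> r"
proof -
 have "integrable M (\<lambda>x. norm (f x) powr r)"
 proof (rule Bochner_Integration.integrable_bound)
  show "integrable M (\<lambda>x. C powr r * norm (g x) powr r)"
   using LspaceD(2)[OF assms(2)] by simp
  show "(\<lambda>x. norm (f x) powr r) \<in> borel_measurable M" using assms(3) by measurable
  show "AE x in M. norm (norm (f x) powr r) \<le> norm (C powr r * norm (g x) powr r)"
   using le
  proof eventually_elim
   case (elim x)
   have "norm (f x) powr r \<le> (C * norm (g x)) powr r"
    using elim assms(1) by (intro powr_mono2) auto
   then show ?case using assms(4) by (simp add: powr_mult)
  qed
 qed
 then show ?thesis using assms(3) by (simp add: Lspace_def)
qed

lemma Lspace_add: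
 fixes f g :: "'a \<Rightarrow> 'b::euclidean_space"
 assumes "0 < r" "f \<in> Lspace \<Omega> r" "g \<in> Lspace \<Omega> r"
 shows "(\<lambda>x. f x + g x) \<in> Lspace \<Omega> r"
proof -
 have "integrable M (\<lambda>x. norm (f x + g x) powr r)"
 proof (rule Bochner_Integration.integrable_bound)
  show "integrable M (\<lambda>x. 2 powr r * (norm (f x) powr r + norm (g x) powr r))"
   using LspaceD(2)[OF assms(2)] LspaceD(2)[OF assms(3)] by auto
  show "(\<lambda>x. norm (f x + g x) powr r) \<in> borel_measurable M"
   using LspaceD(1)[OF assms(2)] LspaceD(1)[OF assms(3)] by measurable
  have "norm (f x + g x) powr r \<le> 2 powr r * (norm (f x) powr r + norm (g x) powr r)" for x
   using powr_add_le[of "norm (f x)" "norm (g x)" r] assms(1)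
    powr_mono2[of r "norm (f x + g x)" "norm (f x) + norm (g x)"] norm_triangle_ineq[of "f x" "g x"]
   by auto
  then show "AE x in M. norm (norm (f x + g x) powr r) \<le> norm (2 powr r * (norm (f x) powr r + norm (g x) powr r))"
   by (intro AE_I2) (simp add: order_trans[OF _ abs_ge_self])
 qed
 then show ?thesis using assms by (auto simp: Lspace_def)
qed

lemma Lspace_diff:
 fixes f g :: "'a \<Rightarrow> 'b::euclidean_space"
 assumes "0 < r" "f \<in> Lspace \<Omega> r" "g \<in> Lspace \<Omega> r"
 shows "(\<lambda>x. f x - g x) \<in> Lspace \<Omega> r"
 using Lspace_add[OF assms(1,2), of "\<lambda>x. - g x"] assms(3) by (simp add: Lspace_def)

lemma Lspace_bounded:
 fixes f :: "'a \<Rightarrow> 'b::euclidean_space"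
 assumes "f \<in> borel_measurable M" "\<And>x. x \<in> \<Omega> \<Longrightarrow> norm (f x) \<le> B" "0 < r"
 shows "f \<in> Lspace \<Omega> r"
proof -
 have "integrable M (\<lambda>x. norm (f x) powr r)"
 proof (rule bounded_integrable)
  show "norm (norm (f x) powr r) \<le> B powr r" if "x \<in> \<Omega>" for x
   using assms(2)[OF that] assms(3) by (simp add: powr_mono2)
 qed (use assms(1) in measurable)
 then show ?thesis using assms by (simp add: Lspace_def)
qed

lemma powr_le_scaled:
 fixes x \<eta> s r :: real
 assumes "0 < s" "s \<le> r" "0 < \<eta>" "0 \<le> x"
 shows "x powr s \<le> \<eta> powr s + \<eta> powr (s - r) * x powr r"
proof (cases "x \<le> \<eta>")
 case True
 then have "x powr s \<le> \<eta> powr s" using assms by (intro powr_mono2) auto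
 then show ?thesis by (smt (verit) mult_nonneg_nonneg powr_ge_zero)
next
 case False
 then have "x powr s = x powr (s - r) * x powr r" by (simp flip: powr_add)
 also have "\<dots> \<le> \<eta> powr (s - r) * x powr r"
  using False assms by (intro mult_right_mono powr_mono2') auto
 finally show ?thesis by (smt (verit) powr_ge_zero)
qed

lemma Lspace_mono:
 fixes f :: "'a \<Rightarrow> 'b::euclidean_space"
 assumes "0 < s" "s \<le> r" "f \<in> Lspace \<Omega> r"
 shows "f \<in> Lspace \<Omega> s"
proof -
 have "integrable M (\<lambda>x. norm (f x) powr s)"
 proof (rule Bochner_Integration.integrable_bound)
  show "integrable M (\<lambda>x. 1 + norm (f x) powr r)"
   using LspaceD(2)[OF assms(3)] by auto
  show "(\<lambda>x. norm (f x) powr s) \<in> borel_measurable M" using LspaceD(1)[OF assms(3)] by measurable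
  show "AE x in M. norm (norm (f x) powr s) \<le> norm (1 + norm (f x) powr r)"
   using powr_le_scaled[OF assms(1,2), of 1] by (intro AE_I2) auto
 qed
 then show ?thesis using assms(3) by (simp add: Lspace_def)
qed

lemma Lspace_integrable:
 fixes f :: "'a \<Rightarrow> 'b::euclidean_space"
 assumes "1 \<le> r" "f \<in> Lspace \<Omega> r"
 shows "integrable M f"
 using Lspace_mono[of 1 r f] assms LspaceD[of f 1] by (auto intro: integrable_norm_cancel)

text \<open>Convergence to 0 in \<open>L\<^sup>r\<close>; stated with the power of the norm to avoid roots.\<close>

definition Lnull :: "real \<Rightarrow> (nat \<Rightarrow> 'a \<Rightarrow> 'b::euclidean_space) \<Rightarrow> bool" where
 "Lnull r e \<longleftrightarrow> (\<forall>n. e n \<in> Lspace \<Omega> r) \<and> (\<lambda>n. \<integral>x. norm (e n x) powr r \<partial>M) \<longlonglongrightarrow> 0"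

lemma LnullD:
 assumes "Lnull r e"
 shows "e n \<in> Lspace \<Omega> r" "(\<lambda>n. \<integral>x. norm (e n x) powr r \<partial>M) \<longlonglongrightarrow> 0"
 using assms by (auto simp: Lnull_def)

lemma Lnull_dominated_by:
 fixes e :: "nat \<Rightarrow> 'a \<Rightarrow> 'b::euclidean_space" and e' :: "nat \<Rightarrow> 'a \<Rightarrow> 'c::euclidean_space"
 assumes "0 < r" "Lnull r e" "\<And>n. e' n \<in> borel_measurable M" "0 \<le> C"
  and le: "\<And>n. AE x in M. norm (e' n x) \<le> C * norm (e n x)"
 shows "Lnull r e'"
proof -
 have mem: "e' n \<in> Lspace \<Omega> r" for n
  using Lspace_dominated[OF assms(1) LnullD(1)[OF assms(2)] assms(3,4) le] .
 have "(\<integral>x. norm (e' n x) powr r \<partial>M) \<le> C powr r * (\<integral>x. norm (e n x) powr r \<partial>M)" for n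
 proof -
  have "(\<integral>x. norm (e' n x) powr r \<partial>M) \<le> (\<integral>x. C powr r * norm (e n x) powr r \<partial>M)"
  proof (rule integral_mono_AE)
   show "AE x in M. norm (e' n x) powr r \<le> C powr r * norm (e n x) powr r"
    using le[of n]
   proof eventually_elim
    case (elim x)
    have "norm (e' n x) powr r \<le> (C * norm (e n x)) powr r"
     using elim assms(1) by (intro powr_mono2) auto
    then show ?case using assms(4) by (simp add: powr_mult)
   qed
  qed (use mem LspaceD(2) LnullD(1)[OF assms(2)] in auto)
  then show ?thesis by simp
 qed
 moreover have "(\<lambda>n. C powr r * (\<integral>x. norm (e n x) powr r \<partial>M)) \<longlonglongrightarrow> 0"
  using tendsto_mult_right_zero[OF LnullD(2)[OF assms(2)]] .
 ultimately have "(\<lambda>n. \<integral>x. norm (e' n x) powr r \<partial>M) \<longlonglongrightarrow> 0"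
  by (intro Lim_null_comparison[of "\<lambda>n. \<integral>x. norm (e' n x) powr r \<partial>M"] always_eventually) auto
 then show ?thesis using mem by (simp add: Lnull_def)
qed

lemma Lnull_add:
 fixes e e' :: "nat \<Rightarrow> 'a \<Rightarrow> 'b::euclidean_space"
 assumes "0 < r" "Lnull r e" "Lnull r e'"
 shows "Lnull r (\<lambda>n x. e n x + e' n x)"
proof -
 have mem: "(\<lambda>x. e n x + e' n x) \<in> Lspace \<Omega> r" for n
  using assms by (intro Lspace_add LnullD(1)) auto
 have le: "(\<integral>x. norm (e n x + e' n x) powr r \<partial>M)
   \<le> 2 powr r * ((\<integral>x. norm (e n x) powr r \<partial>M) + (\<integral>x. norm (e' n x) powr r \<partial>M))" for n
 proof -
  have int: "integrable M (\<lambda>x. norm (e n x) powr r)" "integrable M (\<lambda>x. norm (e' n x) powr r)"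
   using assms LnullD(1) LspaceD(2) by blast+
  have "(\<integral>x. norm (e n x + e' n x) powr r \<partial>M) \<le> (\<integral>x. 2 powr r * (norm (e n x) powr r + norm (e' n x) powr r) \<partial>M)"
  proof (rule integral_mono)
   show "norm (e n x + e' n x) powr r \<le> 2 powr r * (norm (e n x) powr r + norm (e' n x) powr r)" for x
    using powr_add_le[of "norm (e n x)" "norm (e' n x)" r] assms(1)
     powr_mono2[of r "norm (e n x + e' n x)" "norm (e n x) + norm (e' n x)"] norm_triangle_ineq[of "e n x" "e' n x"]
    by auto
  qed (use mem[THEN LspaceD(2)] int in auto)
  then show ?thesis using int by simp
 qed
 have lim: "(\<lambda>n. 2 powr r * ((\<integral>x. norm (e n x) powr r \<partial>M) + (\<integral>x. norm (e' n x) powr r \<partial>M))) \<longlonglongrightarrow> 0"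
  using tendsto_mult_right_zero[OF tendsto_add_zero[OF LnullD(2)[OF assms(2)] LnullD(2)[OF assms(3)]]] .
 have "(\<lambda>n. \<integral>x. norm (e n x + e' n x) powr r \<partial>M) \<longlonglongrightarrow> 0"
  by (rule tendsto_zero_le[OF lim le]) simp
 then show ?thesis using mem by (simp add: Lnull_def)
qed

lemma Lnull_uniform:
 fixes e :: "nat \<Rightarrow> 'a \<Rightarrow> 'b::euclidean_space"
 assumes "0 < r" "\<And>n. e n \<in> borel_measurable M" "\<And>n x. x \<in> \<Omega> \<Longrightarrow> norm (e n x) \<le> c n" "c \<longlonglongrightarrow> 0"
 shows "Lnull r e"
proof -
 have mem: "e n \<in> Lspace \<Omega> r" for n
  using assms(1-3) by (intro Lspace_bounded) auto
 have "(\<integral>x. norm (e n x) powr r \<partial>M) \<le> \<bar>c n\<bar> powr r * measure M \<Omega>" for n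
 proof -
  have "(\<integral>x. norm (e n x) powr r \<partial>M) \<le> (\<integral>x. \<bar>c n\<bar> powr r \<partial>M)"
  proof (rule integral_mono)
   show "norm (e n x) powr r \<le> \<bar>c n\<bar> powr r" if "x \<in> space M" for x
    using assms(3)[of x n] that assms(1) by (intro powr_mono2) auto
  qed (use mem[THEN LspaceD(2)] in auto)
  then show ?thesis by (simp add: mult.commute)
 qed
 moreover have "(\<lambda>n. \<bar>c n\<bar> powr r * measure M \<Omega>) \<longlonglongrightarrow> 0"
 proof -
  have "(\<lambda>n. \<bar>c n\<bar> powr r) \<longlonglongrightarrow> \<bar>0\<bar> powr r"
   using assms(1,4) by (intro tendsto_powr' tendsto_rabs tendsto_const) auto
  then show ?thesis using assms(1) by (intro tendsto_mult_left_zero) simp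
 qed
 ultimately have "(\<lambda>n. \<integral>x. norm (e n x) powr r \<partial>M) \<longlonglongrightarrow> 0"
  by (intro Lim_null_comparison[of "\<lambda>n. \<integral>x. norm (e n x) powr r \<partial>M"] always_eventually) auto
 then show ?thesis using mem by (simp add: Lnull_def)
qed

lemma Lnull_pointwise:
 fixes e :: "nat \<Rightarrow> 'a \<Rightarrow> 'b::euclidean_space" and w :: "'a \<Rightarrow> 'c::euclidean_space"
 assumes r: "0 < r" and w: "w \<in> Lspace \<Omega> r" and m: "\<And>n. e n \<in> borel_measurable M"
  and le: "\<And>n. AE x in M. norm (e n x) \<le> norm (w x)" and lim: "AE x in M. (\<lambda>n. e n x) \<longlonglongrightarrow> 0"
 shows "Lnull r e"
proof -
 have mem: "e n \<in> Lspace \<Omega> r" for n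
  using Lspace_dominated[OF r w m, of 1 n] le by simp
 have "(\<lambda>n. \<integral>x. norm (e n x) powr r \<partial>M) \<longlonglongrightarrow> (\<integral>x. 0 \<partial>M)"
 proof (rule integral_dominated_convergence[where w="\<lambda>x. norm (w x) powr r"])
  show "AE x in M. (\<lambda>n. norm (e n x) powr r) \<longlonglongrightarrow> 0"
   using lim
  proof eventually_elim
   case (elim x)
   have "(\<lambda>n. norm (e n x) powr r) \<longlonglongrightarrow> norm (0::'b) powr r"
    using r elim by (intro tendsto_powr' tendsto_norm tendsto_const) auto
   then show ?case using r by simp
  qed
  show "AE x in M. norm (norm (e n x) powr r) \<le> norm (w x) powr r" for n
   using le[of n] by eventually_elim (use r in \<open>auto intro: powr_mono2\<close>)
 qed (use w LspaceD(2) m in auto)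
 then show ?thesis using mem by (simp add: Lnull_def)
qed

lemma Lnull_mono:
 fixes e :: "nat \<Rightarrow> 'a \<Rightarrow> 'b::euclidean_space"
 assumes sr: "0 < s" "s \<le> r" and e: "Lnull r e"
 shows "Lnull s e"
proof -
 have mem: "e n \<in> Lspace \<Omega> s" for n
  using Lspace_mono[OF sr LnullD(1)[OF e]] .
 have bound: "(\<integral>x. norm (e n x) powr s \<partial>M)
   \<le> \<eta> powr s * measure M \<Omega> + \<eta> powr (s - r) * (\<integral>x. norm (e n x) powr r \<partial>M)" if "0 < \<eta>" for \<eta> n
 proof -
  have int: "integrable M (\<lambda>x. norm (e n x) powr r)" using LspaceD(2)[OF LnullD(1)[OF e]] .
  have "(\<integral>x. norm (e n x) powr s \<partial>M) \<le> (\<integral>x. \<eta> powr s + \<eta> powr (s - r) * norm (e n x) powr r \<partial>M)"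
   by (rule integral_mono) (use mem[THEN LspaceD(2)] int sr that powr_le_scaled in auto)
  then show ?thesis using int by (simp add: mult.commute)
 qed
 have "(\<lambda>n. \<integral>x. norm (e n x) powr s \<partial>M) \<longlonglongrightarrow> 0"
 proof (rule tendstoI)
  fix \<epsilon> :: real assume \<epsilon>: "0 < \<epsilon>"
  define \<eta> where "\<eta> = (\<epsilon> / (2 * (measure M \<Omega> + 1))) powr (1 / s)"
  have mpos: "0 < measure M \<Omega> + 1" using measure_nonneg[of M \<Omega>] by linarith
  have \<eta>: "0 < \<eta>" using \<epsilon> mpos by (simp add: \<eta>_def)
  have "\<eta> powr s = \<epsilon> / (2 * (measure M \<Omega> + 1))"
   using sr \<epsilon> mpos by (simp add: \<eta>_def powr_powr)
  then have "2 * \<eta> powr s + 2 * (\<eta> powr s * measure M \<Omega>) = \<epsilon>"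
   using \<epsilon> mpos by (simp add: field_simps)
  then have 1: "\<eta> powr s * measure M \<Omega> \<le> \<epsilon> / 2"
   using powr_ge_zero[of \<eta> s] by linarith
  have "(\<lambda>n. \<eta> powr (s - r) * (\<integral>x. norm (e n x) powr r \<partial>M)) \<longlonglongrightarrow> 0"
   using tendsto_mult_right_zero[OF LnullD(2)[OF e]] .
  then have "\<forall>\<^sub>F n in sequentially. \<eta> powr (s - r) * (\<integral>x. norm (e n x) powr r \<partial>M) < \<epsilon> / 2"
   using \<epsilon> by (intro order_tendstoD(2)) auto
  then show "\<forall>\<^sub>F n in sequentially. dist (\<integral>x. norm (e n x) powr s \<partial>M) 0 < \<epsilon>"
  proof eventually_elim
   case (elim n)
   then show ?case using bound[OF \<eta>, of n] 1 by (simp add: abs_of_nonneg)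
  qed
 qed
 then show ?thesis using mem by (simp add: Lnull_def)
qed

lemma Lnull_AE_subseq:
 fixes e :: "nat \<Rightarrow> 'a \<Rightarrow> 'b::euclidean_space"
 assumes "0 < r" "Lnull r e"
 obtains k where "strict_mono k" "AE x in M. (\<lambda>n. e (k n) x) \<longlonglongrightarrow> 0"
proof -
 have int: "integrable M (\<lambda>x. norm (e n x) powr r)" for n using LspaceD(2)[OF LnullD(1)[OF assms(2)]] .
 obtain k where k: "strict_mono k" "AE x in M. (\<lambda>n. norm (e (k n) x) powr r) \<longlonglongrightarrow> 0"
  using tendsto_L1_AE_subseq[of M "\<lambda>n x. norm (e n x) powr r"] int LnullD(2)[OF assms(2)] by auto
 from k(2) have "AE x in M. (\<lambda>n. e (k n) x) \<longlonglongrightarrow> 0"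
 proof eventually_elim
  case (elim x)
  have "(\<lambda>n. (norm (e (k n) x) powr r) powr (1 / r)) \<longlonglongrightarrow> 0 powr (1 / r)"
   using elim assms(1) by (intro tendsto_powr' tendsto_const) auto
  then have "(\<lambda>n. norm (e (k n) x)) \<longlonglongrightarrow> 0"
   using assms(1) by (simp add: powr_powr)
  then show ?case by (rule tendsto_norm_zero_cancel)
 qed
 with k(1) show ?thesis using that by blast
qed

lemma Lnull_subseq: "strict_mono k \<Longrightarrow> Lnull r e \<Longrightarrow> Lnull r (\<lambda>n. e (k n))"
 using LIMSEQ_subseq_LIMSEQ[of "\<lambda>n. \<integral>x. norm (e n x) powr r \<partial>M" 0 k] by (simp add: Lnull_def o_def)

lemma Lnull_tendsto_integral:
 fixes e :: "nat \<Rightarrow> 'a \<Rightarrow> 'b::euclidean_space" and w :: "'a \<Rightarrow> 'c::euclidean_space"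
 assumes "1 \<le> r" "Lnull r e"
 shows "(\<lambda>n. \<integral>x. norm (e n x) \<partial>M) \<longlonglongrightarrow> 0"
proof -
 have "Lnull 1 e" using assms Lnull_mono[of 1 r e] by auto
 then show ?thesis using LnullD(2) by fastforce
qed

end

section \<open>Test functions and the fundamental lemma\<close>

lemma test_functions_C1:
 assumes "\<psi> \<in> test_functions \<Omega>"
 shows "C1_compact_support \<Omega> \<psi> (grad \<psi>)"
proof -
 have "Ck (Suc 0) \<psi>" using assms unfolding test_functions_def by blast
 then obtain g where g: "\<And>x. GDERIV \<psi> x :> g x" "\<And>b. b \<in> Basis \<Longrightarrow> Ck 0 (\<lambda>x. g x \<bullet> b)"
  unfolding Ck.simps(2) by blast
 have "grad \<psi> = g" using g(1) grad_eq by blast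
 moreover have "continuous_on UNIV (\<lambda>x. \<Sum>b\<in>Basis. (g x \<bullet> b) *\<^sub>R b)"
  using Ck_continuous[OF g(2)]
  by (intro continuous_on_sum continuous_on_scaleR continuous_on_const)
 then have "continuous_on UNIV g" by (simp add: euclidean_representation)
 moreover have "\<psi> x = 0" if "x \<notin> closure {x. \<psi> x \<noteq> 0}" for x
  using closure_subset[THEN subsetD, of x "{x. \<psi> x \<noteq> 0}"] that by auto
 ultimately show ?thesis
  using assms g(1) unfolding test_functions_def mem_Collect_eq
  by (metis (no_types, lifting) C1_compact_supportI)
qed

lemma C1_compact_support_extend:
 assumes w: "\<And>x. x \<in> \<Omega> \<Longrightarrow> GDERIV w x :> dw x" "continuous_on \<Omega> dw" and \<Omega>: "open \<Omega>"
  and K: "compact K" "K \<subseteq> \<Omega>" "\<And>x. x \<in> \<Omega> - K \<Longrightarrow> w x = 0"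
 shows "C1_compact_support \<Omega> (\<lambda>x. if x \<in> \<Omega> then w x else 0) (\<lambda>x. if x \<in> \<Omega> then dw x else 0)"
proof -
 let ?h = "\<lambda>x. if x \<in> \<Omega> then w x else 0"
 let ?g = "\<lambda>x. if x \<in> \<Omega> then dw x else 0"
 have in\<Omega>: "GDERIV ?h x :> dw x" if "x \<in> \<Omega>" for x
  by (rule GDERIV_transform_open[OF w(1)[OF that] \<Omega> that]) auto
 have out: "GDERIV ?h x :> 0" if "x \<notin> K" for x
  by (rule GDERIV_zero_outside[OF compact_imp_closed[OF K(1)] that]) (use K(3) in auto)
 have der: "GDERIV ?h x :> ?g x" for x
 proof (cases "x \<in> \<Omega>")
  case False
  then have "x \<notin> K" using K by blast
  then show ?thesis using False out by simp
 qed (use in\<Omega> in simp)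
 have g0: "?g x = 0" if "x \<notin> K" for x
  using GDERIV_unique[OF der out[OF that]] .
 show ?thesis
 proof (rule C1_compact_supportI[OF der _ K(1,2)])
  have "continuous_on (\<Omega> \<union> - K) ?g"
  proof (rule continuous_on_open_Un)
   show "continuous_on \<Omega> ?g"
    by (rule continuous_on_eq[OF w(2)]) auto
   show "continuous_on (- K) ?g"
    by (rule continuous_on_eq[where f="\<lambda>x. 0"]) (use g0 in auto)
  qed (use \<Omega> K(1) compact_imp_closed in auto)
  moreover have "\<Omega> \<union> - K = UNIV" using K(2) by blast
  ultimately show "continuous_on UNIV ?g" by simp
 qed (use K(3) in auto)
qed

lemma C1_compact_support_mult:
 assumes h: "C1_compact_support \<Omega> h g"
  and w: "\<And>x. x \<in> \<Omega> \<Longrightarrow> GDERIV w x :> dw x" "continuous_on \<Omega> dw" and \<Omega>: "open \<Omega>"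
 shows "C1_compact_support \<Omega> (\<lambda>x. if x \<in> \<Omega> then w x * h x else 0)
  (\<lambda>x. if x \<in> \<Omega> then w x *\<^sub>R g x + h x *\<^sub>R dw x else 0)"
proof -
 obtain K where K: "compact K" "K \<subseteq> \<Omega>" "\<And>x. x \<notin> K \<Longrightarrow> h x = 0 \<and> g x = 0"
  and der: "\<And>x. GDERIV h x :> g x" and cg: "continuous_on UNIV g"
  using h unfolding C1_compact_support_def by blast
 have ch: "continuous_on UNIV h" using C1_compact_support_continuous[OF h] .
 have cw: "continuous_on \<Omega> w"
  using w(1) by (intro continuous_at_imp_continuous_on ballI GDERIV_isCont)
 show ?thesis
 proof (rule C1_compact_support_extend[OF _ _ \<Omega> K(1,2)])
  show "GDERIV (\<lambda>x. w x * h x) x :> w x *\<^sub>R g x + h x *\<^sub>R dw x" if "x \<in> \<Omega>" for x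
   by (rule GDERIV_mult[OF w(1)[OF that] der])
  show "continuous_on \<Omega> (\<lambda>x. w x *\<^sub>R g x + h x *\<^sub>R dw x)"
   by (intro continuous_intros cw w(2) continuous_on_subset[OF cg] continuous_on_subset[OF ch]) auto
 qed (use K(3) in auto)
qed

lemma continuous_cutoff:
 fixes K :: "'a::euclidean_space set"
 assumes "compact K" "open \<Omega>" "K \<subseteq> \<Omega>"
 obtains \<theta> K1 where "continuous_on UNIV \<theta>" "\<And>x. 0 \<le> \<theta> x" "\<And>x. \<theta> x \<le> (1::real)"
  "\<And>x. x \<in> K \<Longrightarrow> \<theta> x = 1" "compact K1" "K1 \<subseteq> \<Omega>" "\<And>x. x \<notin> K1 \<Longrightarrow> \<theta> x = 0"
proof (cases "K = {}")
 case True
 show ?thesis by (rule that[of "\<lambda>_. 0" "{}"]) (use True in auto)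
next
 case False
 obtain r where r: "0 < r" "(\<Union>x\<in>K. cball x r) \<subseteq> \<Omega>"
  using compact_subset_open_imp_cball_epsilon_subset[OF assms] by blast
 have cK1: "compact {x + y | x y. x \<in> K \<and> y \<in> cball 0 r}" using assms(1) by (intro compact_sums) auto
 show ?thesis
 proof (rule that[OF _ _ _ _ cK1])
  let ?\<theta> = "\<lambda>x. max 0 (1 - infdist x K / r)"
  show "continuous_on UNIV ?\<theta>" using r by (intro continuous_intros) auto
  show "0 \<le> ?\<theta> x" "?\<theta> x \<le> 1" "x \<in> K \<Longrightarrow> ?\<theta> x = 1" for x
   using r infdist_nonneg[of x K] by auto
  show "{x + y | x y. x \<in> K \<and> y \<in> cball 0 r} \<subseteq> \<Omega>"
  proof
   fix z assume "z \<in> {x + y | x y. x \<in> K \<and> y \<in> cball 0 r}"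
   then obtain x y where "z = x + y" "x \<in> K" "norm y \<le> r" by auto
   then have "z \<in> cball x r" by (simp add: dist_norm)
   then show "z \<in> \<Omega>" using r \<open>x \<in> K\<close> by blast
  qed
  show "?\<theta> x = 0" if x: "x \<notin> {x + y | x y. x \<in> K \<and> y \<in> cball 0 r}" for x
  proof -
   obtain k where k: "k \<in> K" "infdist x K = dist x k"
    using infdist_attains_inf[OF compact_imp_closed[OF assms(1)] False] by blast
   have "r < dist x k"
   proof (rule ccontr)
    assume "\<not> r < dist x k"
    then have "x - k \<in> cball 0 r" by (simp add: dist_norm norm_minus_commute)
    moreover have "x = k + (x - k)" by simp
    ultimately show False using x k(1) by blast
   qed
   then show ?thesis using k r by simp
  qed
 qed
qed

context bounded_open
begin

lemma C1_compact_support_Lspace: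
 assumes "C1_compact_support \<Omega> h g" "0 < r"
 shows "h \<in> Lspace \<Omega> r" "g \<in> Lspace \<Omega> r"
proof -
 obtain K where K: "compact K" "\<And>x. x \<notin> K \<Longrightarrow> h x = 0" "\<And>x. x \<notin> K \<Longrightarrow> g x = 0"
  and cg: "continuous_on UNIV g"
  using assms unfolding C1_compact_support_def by blast
 have ch: "continuous_on UNIV h" using C1_compact_support_continuous[OF assms(1)] .
 obtain A B where "\<And>x. norm (h x) \<le> A" "\<And>x. norm (g x) \<le> B"
  using compact_support_bounded[OF ch K(1,2)] compact_support_bounded[OF cg K(1,3)] by metis
 then show "h \<in> Lspace \<Omega> r" "g \<in> Lspace \<Omega> r"
  using assms(2) ch cg by (auto intro!: Lspace_bounded continuous_measurable intro: continuous_on_subset)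
qed

lemma integration_by_parts:
 assumes h: "C1_compact_support \<Omega> h g" and \<psi>: "\<psi> \<in> test_functions \<Omega>"
 shows "(\<integral>x. h x *\<^sub>R grad \<psi> x \<partial>M) = - (\<integral>x. \<psi> x *\<^sub>R g x \<partial>M)"
proof -
 note \<psi>1 = test_functions_C1[OF \<psi>]
 have prod: "C1_compact_support \<Omega> (\<lambda>x. \<psi> x * h x) (\<lambda>x. \<psi> x *\<^sub>R g x + h x *\<^sub>R grad \<psi> x)"
 proof -
  obtain K where K: "compact K" "K \<subseteq> \<Omega>" "\<And>x. x \<notin> K \<Longrightarrow> h x = 0"
   using h unfolding C1_compact_support_def by blast
  show ?thesis
  proof (rule C1_compact_supportI[OF _ _ K(1,2)])
   show "GDERIV (\<lambda>x. \<psi> x * h x) x :> \<psi> x *\<^sub>R g x + h x *\<^sub>R grad \<psi> x" for x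
    using h \<psi>1 by (intro GDERIV_mult) (auto simp: C1_compact_support_def)
   show "continuous_on UNIV (\<lambda>x. \<psi> x *\<^sub>R g x + h x *\<^sub>R grad \<psi> x)"
    using h \<psi>1 C1_compact_support_continuous[OF h] C1_compact_support_continuous[OF \<psi>1]
    by (intro continuous_intros) (auto simp: C1_compact_support_def)
  qed (use K(3) in auto)
 qed
 obtain K where K: "K \<subseteq> \<Omega>" "\<And>x. x \<notin> K \<Longrightarrow> \<psi> x *\<^sub>R g x + h x *\<^sub>R grad \<psi> x = 0"
  and c: "continuous_on UNIV (\<lambda>x. \<psi> x *\<^sub>R g x + h x *\<^sub>R grad \<psi> x)"
  using prod unfolding C1_compact_support_def by blast
 have "(\<integral>x. \<psi> x *\<^sub>R g x + h x *\<^sub>R grad \<psi> x \<partial>M) = 0"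
  using integral_gradient_eq_0[OF prod] K
   integral_lebesgue_on_eq_lborel[OF \<Omega>_open borel_measurable_continuous_onI[OF c]] by (metis subsetD)
 moreover obtain A B where AB: "\<And>x. norm (\<psi> x) \<le> A" "\<And>x. norm (h x) \<le> B"
  using compact_support_bounded[OF C1_compact_support_continuous[OF \<psi>1]]
   compact_support_bounded[OF C1_compact_support_continuous[OF h]] h \<psi>1
  unfolding C1_compact_support_def by metis
 have m: "\<psi> \<in> borel_measurable M" "h \<in> borel_measurable M"
  using continuous_on_subset[OF C1_compact_support_continuous[OF \<psi>1]]
   continuous_on_subset[OF C1_compact_support_continuous[OF h]] by (auto intro!: continuous_measurable)
 have "integrable M (\<lambda>x. \<psi> x *\<^sub>R g x)"
  by (rule Lspace_integrable[of 1, OF _ Lspace_dominated[OF _ C1_compact_support_Lspace(2)[OF h, of 1]]])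
   (use m AB(1) LspaceD(1)[OF C1_compact_support_Lspace(2)[OF h, of 1]] order_trans[OF norm_ge_zero AB(1)]
    in \<open>auto intro!: mult_right_mono AE_I2\<close>)
 moreover have "integrable M (\<lambda>x. h x *\<^sub>R grad \<psi> x)"
  by (rule Lspace_integrable[of 1, OF _ Lspace_dominated[OF _ C1_compact_support_Lspace(2)[OF \<psi>1, of 1]]])
   (use m AB(2) LspaceD(1)[OF C1_compact_support_Lspace(2)[OF \<psi>1, of 1]] order_trans[OF norm_ge_zero AB(2)]
    in \<open>auto intro!: mult_right_mono AE_I2\<close>)
 ultimately show ?thesis by (simp add: add_eq_0_iff)
qed

lemma compact_exhaustion_AE:
 assumes "\<And>K. compact K \<Longrightarrow> K \<subseteq> \<Omega> \<Longrightarrow> AE x in lebesgue. x \<in> K \<longrightarrow> P x"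
 shows "AE x in M. P x"
proof -
 obtain f :: "nat \<Rightarrow> 'a set" where f: "\<And>n. compact (f n)" "\<And>n. f n \<subseteq> \<Omega>" "(\<Union>n. f n) = \<Omega>"
 proof (rule open_Union_compact_subsets[OF \<Omega>_open])
  fix C :: "nat \<Rightarrow> 'a set" assume "\<And>n. compact (C n)" "\<And>n. C n \<subseteq> \<Omega>" "\<Union> (range C) = \<Omega>"
  then show thesis using that[of C] by simp
 qed
 have "AE x in lebesgue. \<forall>n. x \<in> f n \<longrightarrow> P x"
  using assms f by (intro AE_all_countable[THEN iffD2]) auto
 then have "AE x in lebesgue. x \<in> \<Omega> \<longrightarrow> P x"
  by eventually_elim (use f(3) in blast)
 then show ?thesis by (simp add: AE_restrict_space_iff)
qed

text \<open>On a compact set \<open>K\<close> the sign of \<open>d\<close> is almost everywhere the limit of test functions with common bound and support,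
  so the integral of \<open>|d|\<close> over \<open>K\<close> is a limit of zeros.\<close>

lemma fundamental_lemma:
 fixes d :: "'a \<Rightarrow> real"
 assumes loc: "\<And>K. compact K \<Longrightarrow> K \<subseteq> \<Omega> \<Longrightarrow> d absolutely_integrable_on K"
  and zero: "\<And>\<psi>. \<psi> \<in> test_functions \<Omega> \<Longrightarrow> (\<integral>x. \<psi> x * d x \<partial>M) = 0"
 shows "AE x in M. d x = 0"
proof (rule compact_exhaustion_AE)
 fix K assume K: "compact K" "K \<subseteq> \<Omega>"
 obtain \<theta> K1 where \<theta>: "continuous_on UNIV \<theta>" "\<And>x. 0 \<le> \<theta> x" "\<And>x. \<theta> x \<le> (1::real)"
  "\<And>x. x \<in> K \<Longrightarrow> \<theta> x = 1" and K1: "compact K1" "K1 \<subseteq> \<Omega>" "\<And>x. x \<notin> K1 \<Longrightarrow> \<theta> x = 0"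
  using continuous_cutoff[OF K(1) \<Omega>_open K(2)] by blast
 obtain K' where K': "compact K'" "K' \<subseteq> \<Omega>"
  and moll: "\<And>h \<eta>. continuous_on UNIV h \<Longrightarrow> (\<And>x. x \<notin> K1 \<Longrightarrow> h x = 0) \<Longrightarrow> 0 < \<eta> \<Longrightarrow>
   \<exists>\<psi>\<in>test_functions \<Omega>. (\<forall>x. x \<notin> K' \<longrightarrow> \<psi> x = 0) \<and> (\<forall>x. \<bar>\<psi> x - h x\<bar> \<le> \<eta>) \<and>
   (\<forall>g. C1_compact_support K1 h g \<longrightarrow> (\<forall>x. norm (grad \<psi> x - g x) \<le> \<eta>))"
  using mollification[OF \<Omega>_open K1(1,2)] by metis
 have Ks: "K \<in> sets lebesgue" "K' \<in> sets lebesgue"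
  using K(1) K'(1) by (auto simp: borel_compact)
 define f where "f x = indicator K x * sgn (d x)" for x
 have dK: "(\<lambda>x. indicator K x *\<^sub>R d x) \<in> borel_measurable lebesgue"
  using loc[OF K] unfolding set_integrable_def by auto
 have "f = (\<lambda>x. sgn (indicator K x *\<^sub>R d x))"
  by (auto simp: f_def indicator_def fun_eq_iff)
 then have "f \<in> borel_measurable lebesgue"
  using dK by (simp add: borel_measurable_sgn)
 then have "f measurable_on UNIV"
  by (simp add: measurable_on_iff_borel_measurable)
 then obtain N g where N: "negligible N" and g: "\<And>n. continuous_on UNIV (g n)"
  and glim: "\<And>x. x \<notin> N \<Longrightarrow> (\<lambda>n. g n x) \<longlonglongrightarrow> f x"
  unfolding measurable_on_def by auto
 define h where "h n x = \<theta> x * max (-1) (min 1 (g n x))" for n x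
 have hc: "continuous_on UNIV (h n)" for n
  unfolding h_def by (intro continuous_intros \<theta>(1) g)
 have h0: "x \<notin> K1 \<Longrightarrow> h n x = 0" for n x using K1(3) by (simp add: h_def)
 have hb: "\<bar>h n x\<bar> \<le> 1" for n x
 proof -
  have "\<bar>\<theta> x\<bar> * \<bar>max (-1) (min 1 (g n x))\<bar> \<le> 1 * 1"
   using \<theta>(2,3)[of x] by (intro mult_mono) auto
  then show ?thesis by (simp add: h_def abs_mult)
 qed
 have "\<exists>\<psi>. \<forall>n. \<psi> n \<in> test_functions \<Omega> \<and> (\<forall>x. x \<notin> K' \<longrightarrow> \<psi> n x = 0) \<and> (\<forall>x. \<bar>\<psi> n x - h n x\<bar> \<le> inverse (real (Suc n)))"
 proof (rule choice, rule allI)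
  fix n
  show "\<exists>\<psi>. \<psi> \<in> test_functions \<Omega> \<and> (\<forall>x. x \<notin> K' \<longrightarrow> \<psi> x = 0) \<and> (\<forall>x. \<bar>\<psi> x - h n x\<bar> \<le> inverse (real (Suc n)))"
   using moll[of "h n" "inverse (real (Suc n))"] hc h0 by (metis inverse_positive_iff_positive of_nat_0_less_iff zero_less_Suc)
 qed
 then obtain \<psi> where \<psi>: "\<And>n. \<psi> n \<in> test_functions \<Omega>" "\<And>n x. x \<notin> K' \<Longrightarrow> \<psi> n x = 0"
  "\<And>n x. \<bar>\<psi> n x - h n x\<bar> \<le> inverse (real (Suc n))" by blast
 have \<psi>lim: "(\<lambda>n. \<psi> n x) \<longlonglongrightarrow> f x" if x: "x \<notin> N" for x
 proof -
  have "(\<lambda>n. h n x) \<longlonglongrightarrow> \<theta> x * max (-1) (min 1 (f x))"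
   unfolding h_def by (intro tendsto_intros tendsto_max tendsto_min glim x)
  moreover have "\<theta> x * max (-1) (min 1 (f x)) = f x"
   using \<theta>(4)[of x] by (auto simp: f_def indicator_def sgn_if)
  moreover have "(\<lambda>n. \<psi> n x - h n x) \<longlonglongrightarrow> 0"
   by (rule Lim_null_comparison[OF always_eventually LIMSEQ_inverse_real_of_nat]) (use \<psi>(3) in auto)
  ultimately show ?thesis using Lim_transform by fastforce
 qed
 have dK': "set_integrable lebesgue K' d" using loc[OF K'] .
 have \<psi>m: "\<psi> n \<in> borel_measurable lebesgue" for n
  using borel_measurable_continuous_onI[OF C1_compact_support_continuous[OF test_functions_C1[OF \<psi>(1)]]]
  by (intro measurable_completion) simp
 have eq: "(\<integral>x. \<psi> n x * (indicator K' x * d x) \<partial>lebesgue) = 0" for n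
 proof -
  have "(\<integral>x. \<psi> n x * d x \<partial>M) = (\<integral>x. indicator \<Omega> x *\<^sub>R (\<psi> n x * d x) \<partial>lebesgue)"
   by (subst integral_restrict_space) auto
  also have "(\<lambda>x. indicator \<Omega> x *\<^sub>R (\<psi> n x * d x)) = (\<lambda>x. \<psi> n x * (indicator K' x * d x))"
  proof
   fix x show "indicator \<Omega> x *\<^sub>R (\<psi> n x * d x) = \<psi> n x * (indicator K' x * d x)"
    using \<psi>(2)[of x n] K'(2) by (cases "x \<in> K'") auto
  qed
  finally show ?thesis using zero[OF \<psi>(1)] by simp
 qed
 have "(\<lambda>n. \<integral>x. \<psi> n x * (indicator K' x * d x) \<partial>lebesgue) \<longlonglongrightarrow> (\<integral>x. f x * (indicator K' x * d x) \<partial>lebesgue)"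
 proof (rule integral_dominated_convergence[where w="\<lambda>x. 2 * \<bar>indicator K' x * d x\<bar>"])
  show int: "integrable lebesgue (\<lambda>x. 2 * \<bar>indicator K' x * d x\<bar>)"
   using dK' unfolding set_integrable_def by auto
  have m: "(\<lambda>x. indicator K' x * d x) \<in> borel_measurable lebesgue"
   using dK' unfolding set_integrable_def by auto
  show "(\<lambda>x. f x * (indicator K' x * d x)) \<in> borel_measurable lebesgue"
   using \<open>f \<in> borel_measurable lebesgue\<close> m by (rule borel_measurable_times)
  show "(\<lambda>x. \<psi> n x * (indicator K' x * d x)) \<in> borel_measurable lebesgue" for n
   using \<psi>m m by (rule borel_measurable_times)
  have "AE x in lebesgue. x \<notin> N" using N by (simp add: AE_iff_null_sets negligible_iff_null_sets AE_not_in)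
  then show "AE x in lebesgue. (\<lambda>n. \<psi> n x * (indicator K' x * d x)) \<longlonglongrightarrow> f x * (indicator K' x * d x)"
   by eventually_elim (intro tendsto_intros \<psi>lim)
  show "AE x in lebesgue. norm (\<psi> n x * (indicator K' x * d x)) \<le> 2 * \<bar>indicator K' x * d x\<bar>" for n
  proof (rule AE_I2)
   fix x
   have "inverse (real (Suc n)) \<le> 1" by (simp add: inverse_le_1_iff)
   then have "\<bar>\<psi> n x\<bar> \<le> 2" using \<psi>(3)[of n x] hb[of n x] by linarith
   then show "norm (\<psi> n x * (indicator K' x * d x)) \<le> 2 * \<bar>indicator K' x * d x\<bar>"
    by (simp add: abs_mult mult_right_mono)
  qed
 qed
 then have "(\<integral>x. f x * (indicator K' x * d x) \<partial>lebesgue) = 0"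
  by (simp add: eq LIMSEQ_const_iff)
 moreover have "AE x in lebesgue. f x * (indicator K' x * d x) = indicator K x * \<bar>d x\<bar>"
 proof -
  have "AE x in lebesgue. x \<notin> N" using N by (simp add: AE_iff_null_sets negligible_iff_null_sets AE_not_in)
  then show ?thesis
  proof eventually_elim
   case (elim x)
   have "x \<notin> K' \<Longrightarrow> f x = 0" using \<psi>lim[OF elim] \<psi>(2) by (simp add: LIMSEQ_const_iff)
   then show ?case by (cases "x \<in> K'"; cases "x \<in> K") (auto simp: f_def abs_sgn sgn_if)
  qed
 qed
 moreover have iK: "integrable lebesgue (\<lambda>x. indicator K x * \<bar>d x\<bar>)"
  using set_integrable_abs[OF loc[OF K]] unfolding set_integrable_def by simp
 moreover have "(\<lambda>x. f x * (indicator K' x * d x)) \<in> borel_measurable lebesgue"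
  using dK' \<open>f \<in> borel_measurable lebesgue\<close> unfolding set_integrable_def
  by (intro borel_measurable_times[OF _ borel_measurable_integrable]) auto
 ultimately have "(\<integral>x. indicator K x * \<bar>d x\<bar> \<partial>lebesgue) = 0"
  using integral_cong_AE[of "\<lambda>x. f x * (indicator K' x * d x)" lebesgue "\<lambda>x. indicator K x * \<bar>d x\<bar>"]
   borel_measurable_integrable[OF iK] by simp
 then have "AE x in lebesgue. indicator K x * \<bar>d x\<bar> = 0"
  using integral_nonneg_eq_0_iff_AE[OF iK] by auto
 then show "AE x in lebesgue. x \<in> K \<longrightarrow> d x = 0"
  by eventually_elim auto
qed

end

section \<open>Sobolev functions with zero boundary values\<close>

context bounded_open
begin

lemma Lnull_integral_tendsto:
 fixes f :: "nat \<Rightarrow> 'a \<Rightarrow> 'b::euclidean_space"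
 assumes "1 \<le> r" "Lnull r (\<lambda>n x. f n x - f0 x)" "\<And>n. integrable M (f n)" "integrable M f0"
 shows "(\<lambda>n. \<integral>x. f n x \<partial>M) \<longlonglongrightarrow> (\<integral>x. f0 x \<partial>M)"
proof -
 have "(\<lambda>n. (\<integral>x. f n x \<partial>M) - (\<integral>x. f0 x \<partial>M)) \<longlonglongrightarrow> 0"
 proof (rule Lim_null_comparison[OF always_eventually Lnull_tendsto_integral[OF assms(1,2)]], rule allI)
  fix n
  have "(\<integral>x. f n x \<partial>M) - (\<integral>x. f0 x \<partial>M) = (\<integral>x. f n x - f0 x \<partial>M)"
   using assms(3,4) by simp
  then show "norm ((\<integral>x. f n x \<partial>M) - (\<integral>x. f0 x \<partial>M)) \<le> (\<integral>x. norm (f n x - f0 x) \<partial>M)"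
   by simp
 qed
 then show ?thesis by (rule LIM_zero_cancel)
qed

text \<open>Membership of \<open>u\<close> in \<open>W01 \<Omega> r\<close> with weak gradient \<open>D\<close>, but with \<open>C\<^sup>1\<close> approximations in place of smooth ones and
  the gradient as an explicit argument. In this form the chain and product rules can be proved by
  applying them to the approximations.\<close>

definition sobolev0 :: "real \<Rightarrow> ('a \<Rightarrow> real) \<Rightarrow> ('a \<Rightarrow> 'a) \<Rightarrow> bool" where
 "sobolev0 r u D \<longleftrightarrow> u \<in> Lspace \<Omega> r \<and> D \<in> Lspace \<Omega> r \<and>
   (\<exists>h g. (\<forall>n. C1_compact_support \<Omega> (h n) (g n)) \<and>
    Lnull r (\<lambda>n x. h n x - u x) \<and> Lnull r (\<lambda>n x. g n x - D x))"

lemma sobolev0D: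
 assumes "sobolev0 r u D"
 shows "u \<in> Lspace \<Omega> r" "D \<in> Lspace \<Omega> r" "u \<in> borel_measurable M" "D \<in> borel_measurable M"
 using assms LspaceD(1) by (auto simp: sobolev0_def)

lemma sobolev0I:
 assumes "u \<in> Lspace \<Omega> r" "D \<in> Lspace \<Omega> r" "\<And>n. C1_compact_support \<Omega> (h n) (g n)"
  "Lnull r (\<lambda>n x. h n x - u x)" "Lnull r (\<lambda>n x. g n x - D x)"
 shows "sobolev0 r u D"
 unfolding sobolev0_def by (intro conjI exI[of _ h] exI[of _ g] allI assms)

lemma sobolev0E:
 assumes "sobolev0 r u D"
 obtains h g where "\<And>n. C1_compact_support \<Omega> (h n) (g n)"
  "Lnull r (\<lambda>n x. h n x - u x)" "Lnull r (\<lambda>n x. g n x - D x)"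
 using assms unfolding sobolev0_def by blast

lemma bounded_mult_integrable:
 fixes f :: "'a \<Rightarrow> 'b::euclidean_space" and w :: "'a \<Rightarrow> real"
 assumes "integrable M f" "w \<in> borel_measurable M" "\<And>x. x \<in> \<Omega> \<Longrightarrow> \<bar>w x\<bar> \<le> B"
 shows "integrable M (\<lambda>x. w x *\<^sub>R f x)"
proof (rule Bochner_Integration.integrable_bound)
 show "integrable M (\<lambda>x. B * norm (f x))" using assms(1) by simp
 show "(\<lambda>x. w x *\<^sub>R f x) \<in> borel_measurable M" using assms(1,2) by measurable
 show "AE x in M. norm (w x *\<^sub>R f x) \<le> norm (B * norm (f x))"
  using assms(3) by (intro AE_I2) (fastforce simp: abs_mult intro!: mult_right_mono order_trans[OF _ abs_ge_self])
qed

lemma bounded_scaleR_integrable: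
 fixes f :: "'a \<Rightarrow> real" and w :: "'a \<Rightarrow> 'b::euclidean_space"
 assumes "integrable M f" "w \<in> borel_measurable M" "\<And>x. x \<in> \<Omega> \<Longrightarrow> norm (w x) \<le> B"
 shows "integrable M (\<lambda>x. f x *\<^sub>R w x)"
proof (rule Bochner_Integration.integrable_bound)
 show "integrable M (\<lambda>x. B * norm (f x))" using assms(1) by simp
 show "(\<lambda>x. f x *\<^sub>R w x) \<in> borel_measurable M" using assms(1,2) by measurable
 show "AE x in M. norm (f x *\<^sub>R w x) \<le> norm (B * norm (f x))"
 proof (rule AE_I2)
  fix x assume "x \<in> space M"
  then have "norm (w x) \<le> B" using assms(3) by simp
  then have "\<bar>f x\<bar> * norm (w x) \<le> \<bar>f x\<bar> * B" by (intro mult_left_mono) auto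
  then have "\<bar>f x\<bar> * norm (w x) \<le> B * \<bar>f x\<bar>" by (simp only: mult.commute)
  then show "norm (f x *\<^sub>R w x) \<le> norm (B * norm (f x))"
   by (simp add: order_trans[OF _ abs_ge_self])
 qed
qed

lemma sobolev0_weak_gradient:
 assumes r: "1 \<le> r" and s: "sobolev0 r u D"
 shows "is_weak_gradient \<Omega> u D"
 unfolding is_weak_gradient_def
proof (intro conjI allI impI ballI)
 have iu: "integrable M u" "integrable M D"
  using Lspace_integrable[OF r] sobolev0D[OF s] by auto
 fix K assume "compact K \<and> K \<subseteq> \<Omega>"
 then show "u absolutely_integrable_on K" "D absolutely_integrable_on K"
  using iu by (auto intro!: set_integrable_lebesgue_on[OF \<Omega>_open] simp: borel_compact)
next
 fix \<psi> assume \<psi>: "\<psi> \<in> test_functions \<Omega>"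
 note \<psi>1 = test_functions_C1[OF \<psi>]
 obtain h g where hg: "\<And>n. C1_compact_support \<Omega> (h n) (g n)"
  "Lnull r (\<lambda>n x. h n x - u x)" "Lnull r (\<lambda>n x. g n x - D x)"
  using s unfolding sobolev0_def by blast
 have iu: "integrable M u" "integrable M D"
  using Lspace_integrable[OF r] sobolev0D[OF s] by auto
 have r0: "0 < r" using r by simp
 have ih: "integrable M (h n)" "integrable M (g n)" for n
  using Lspace_integrable[OF r] C1_compact_support_Lspace[OF hg(1) r0] by auto
 obtain A where A: "0 \<le> A" "\<And>x. norm (\<psi> x) \<le> A"
  using compact_support_bounded[OF C1_compact_support_continuous[OF \<psi>1]] \<psi>1 unfolding C1_compact_support_def by metis
 obtain B where B: "0 \<le> B" "\<And>x. norm (grad \<psi> x) \<le> B"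
  using compact_support_bounded[of "grad \<psi>"] \<psi>1 unfolding C1_compact_support_def by metis
 have m: "\<psi> \<in> borel_measurable M" "grad \<psi> \<in> borel_measurable M"
  using LspaceD(1)[OF C1_compact_support_Lspace(1)[OF \<psi>1 r0]] LspaceD(1)[OF C1_compact_support_Lspace(2)[OF \<psi>1 r0]] by auto
 have L1: "(\<lambda>n. \<integral>x. h n x *\<^sub>R grad \<psi> x \<partial>M) \<longlonglongrightarrow> (\<integral>x. u x *\<^sub>R grad \<psi> x \<partial>M)"
 proof (rule Lnull_integral_tendsto[OF r])
  show "Lnull r (\<lambda>n x. h n x *\<^sub>R grad \<psi> x - u x *\<^sub>R grad \<psi> x)"
  proof (rule Lnull_dominated_by[OF r0 hg(2) _ B(1)])
   show "(\<lambda>x. h n x *\<^sub>R grad \<psi> x - u x *\<^sub>R grad \<psi> x) \<in> borel_measurable M" for n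
    using m ih iu by measurable
   show "AE x in M. norm (h n x *\<^sub>R grad \<psi> x - u x *\<^sub>R grad \<psi> x) \<le> B * norm (h n x - u x)" for n
    using B(2) by (intro AE_I2) (simp add: mult.commute mult_right_mono flip: scaleR_diff_left)
  qed
 qed (use ih iu m(2) B(2) bounded_scaleR_integrable in blast)+
 have L2: "(\<lambda>n. \<integral>x. \<psi> x *\<^sub>R g n x \<partial>M) \<longlonglongrightarrow> (\<integral>x. \<psi> x *\<^sub>R D x \<partial>M)"
 proof (rule Lnull_integral_tendsto[OF r])
  show "Lnull r (\<lambda>n x. \<psi> x *\<^sub>R g n x - \<psi> x *\<^sub>R D x)"
  proof (rule Lnull_dominated_by[OF r0 hg(3) _ A(1)])
   show "(\<lambda>x. \<psi> x *\<^sub>R g n x - \<psi> x *\<^sub>R D x) \<in> borel_measurable M" for n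
    using m ih iu by measurable
   show "AE x in M. norm (\<psi> x *\<^sub>R g n x - \<psi> x *\<^sub>R D x) \<le> A * norm (g n x - D x)" for n
    using A(2) by (intro AE_I2) (simp add: mult_right_mono flip: scaleR_diff_right)
  qed
  show "integrable M (\<lambda>x. \<psi> x *\<^sub>R g n x)" for n
   by (rule bounded_mult_integrable[OF ih(2) m(1)]) (use A(2) in auto)
  show "integrable M (\<lambda>x. \<psi> x *\<^sub>R D x)"
   by (rule bounded_mult_integrable[OF iu(2) m(1)]) (use A(2) in auto)
 qed
 have "(\<integral>x. h n x *\<^sub>R grad \<psi> x \<partial>M) = - (\<integral>x. \<psi> x *\<^sub>R g n x \<partial>M)" for n
  using integration_by_parts[OF hg(1) \<psi>] .
 then show "(\<integral>x. u x *\<^sub>R grad \<psi> x \<partial>M) = - (\<integral>x. \<psi> x *\<^sub>R D x \<partial>M)"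
  using LIMSEQ_unique[OF L1] tendsto_minus[OF L2] by simp
qed

lemma test_mult_integrable:
 fixes g :: "'a \<Rightarrow> 'b::euclidean_space"
 assumes loc: "\<And>K. compact K \<Longrightarrow> K \<subseteq> \<Omega> \<Longrightarrow> g absolutely_integrable_on K"
  and \<psi>: "\<psi> \<in> test_functions \<Omega>"
 shows "integrable M (\<lambda>x. \<psi> x *\<^sub>R g x)"
proof -
 note \<psi>1 = test_functions_C1[OF \<psi>]
 obtain K where K: "compact K" "K \<subseteq> \<Omega>" "\<And>x. x \<notin> K \<Longrightarrow> \<psi> x = 0"
  using \<psi>1 unfolding C1_compact_support_def by blast
 obtain A where A: "0 \<le> A" "\<And>x. norm (\<psi> x) \<le> A"
  using compact_support_bounded[OF C1_compact_support_continuous[OF \<psi>1] K(1,3)] by blast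
 have i: "integrable lebesgue (\<lambda>x. indicator K x *\<^sub>R g x)"
  using loc[OF K(1,2)] unfolding set_integrable_def .
 have "integrable lebesgue (\<lambda>x. \<psi> x *\<^sub>R (indicator K x *\<^sub>R g x))"
 proof (rule Bochner_Integration.integrable_bound)
  show "integrable lebesgue (\<lambda>x. A * norm (indicator K x *\<^sub>R g x))"
   using i by (intro integrable_mult_right integrable_norm)
  have "\<psi> \<in> borel_measurable lebesgue"
   using borel_measurable_continuous_onI[OF C1_compact_support_continuous[OF \<psi>1]]
   by (intro measurable_completion) simp
  then show "(\<lambda>x. \<psi> x *\<^sub>R (indicator K x *\<^sub>R g x)) \<in> borel_measurable lebesgue"
   using borel_measurable_integrable[OF i] by (rule borel_measurable_scaleR)
  show "AE x in lebesgue. norm (\<psi> x *\<^sub>R (indicator K x *\<^sub>R g x)) \<le> norm (A * norm (indicator K x *\<^sub>R g x))"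
  proof (rule AE_I2)
   fix x
   have "\<bar>\<psi> x\<bar> * norm (indicator K x *\<^sub>R g x) \<le> A * norm (indicator K x *\<^sub>R g x)"
    using A(2)[of x] by (intro mult_right_mono) auto
   then show "norm (\<psi> x *\<^sub>R (indicator K x *\<^sub>R g x)) \<le> norm (A * norm (indicator K x *\<^sub>R g x))"
    using A(1) by (simp only: norm_scaleR real_norm_def abs_mult abs_norm_cancel abs_of_nonneg)
  qed
 qed
 also have "(\<lambda>x. \<psi> x *\<^sub>R (indicator K x *\<^sub>R g x)) = (\<lambda>x. indicator \<Omega> x *\<^sub>R (\<psi> x *\<^sub>R g x))"
  using K(2,3) by (fastforce simp: indicator_def)
 finally show ?thesis
  by (subst integrable_restrict_space) auto
qed

lemma weak_gradient_unique:
 assumes "is_weak_gradient \<Omega> u g1" "is_weak_gradient \<Omega> u g2"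
 shows "AE x in M. g1 x = g2 x"
proof -
 have "AE x in M. (g1 x - g2 x) \<bullet> b = 0" for b
 proof (rule fundamental_lemma)
  fix K assume "compact K" "K \<subseteq> \<Omega>"
  then have "g1 absolutely_integrable_on K" "g2 absolutely_integrable_on K"
   using assms unfolding is_weak_gradient_def by blast+
  then have "(\<lambda>x. g1 x - g2 x) absolutely_integrable_on K"
   by (rule set_integral_diff)
  then show "(\<lambda>x. (g1 x - g2 x) \<bullet> b) absolutely_integrable_on K"
   unfolding set_integrable_def by (auto simp flip: inner_scaleR_left)
 next
  fix \<psi> assume \<psi>: "\<psi> \<in> test_functions \<Omega>"
  have int: "integrable M (\<lambda>x. \<psi> x *\<^sub>R g1 x)" "integrable M (\<lambda>x. \<psi> x *\<^sub>R g2 x)"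
   using assms \<psi> unfolding is_weak_gradient_def by (auto intro!: test_mult_integrable)
  have "(\<integral>x. \<psi> x *\<^sub>R g1 x \<partial>M) = (\<integral>x. \<psi> x *\<^sub>R g2 x \<partial>M)"
   using assms \<psi> unfolding is_weak_gradient_def by (metis neg_equal_iff_equal)
  then have "(\<integral>x. \<psi> x *\<^sub>R g1 x - \<psi> x *\<^sub>R g2 x \<partial>M) \<bullet> b = 0"
   using int by simp
  then have "(\<integral>x. (\<psi> x *\<^sub>R g1 x - \<psi> x *\<^sub>R g2 x) \<bullet> b \<partial>M) = 0"
   using int by (subst integral_inner_left) auto
  then show "(\<integral>x. \<psi> x * ((g1 x - g2 x) \<bullet> b) \<partial>M) = 0"
   by (simp add: inner_diff_left right_diff_distrib)
 qed
 then have "AE x in M. \<forall>b\<in>Basis. (g1 x - g2 x) \<bullet> b = 0"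
  by (intro AE_finite_allI) auto
 then show ?thesis
 proof eventually_elim
  case (elim x)
  then have "g1 x - g2 x = 0" by (intro euclidean_eqI[where y="0::'a"]) auto
  then show ?case by simp
 qed
qed

lemma sobolev0_wgrad:
 assumes "1 \<le> r" "sobolev0 r u D"
 shows "AE x in M. wgrad \<Omega> u x = D x"
proof -
 have D: "is_weak_gradient \<Omega> u D" using sobolev0_weak_gradient[OF assms] .
 then have "is_weak_gradient \<Omega> u (wgrad \<Omega> u)" unfolding wgrad_def by (rule someI[of "is_weak_gradient \<Omega> u"])
 then show ?thesis using D by (rule weak_gradient_unique)
qed

lemma AE_eq_measurable:
 fixes f g :: "'a \<Rightarrow> 'b::euclidean_space"
 shows "f \<in> borel_measurable M \<Longrightarrow> AE x in M. f x = g x \<Longrightarrow> g \<in> borel_measurable M"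
 using borel_measurable_lebesgue_on_AE[OF \<Omega>_sets] .

lemma sobolev0_cong_AE:
 assumes s: "sobolev0 r u D" and r: "0 < r" and ae: "AE x in M. u x = u' x" "AE x in M. D x = D' x"
 shows "sobolev0 r u' D'"
proof -
 obtain h g where hg: "\<And>n. C1_compact_support \<Omega> (h n) (g n)"
  "Lnull r (\<lambda>n x. h n x - u x)" "Lnull r (\<lambda>n x. g n x - D x)"
  using s unfolding sobolev0_def by blast
 note m = AE_eq_measurable[OF sobolev0D(3)[OF s] ae(1)] AE_eq_measurable[OF sobolev0D(4)[OF s] ae(2)]
 have hm: "h n \<in> borel_measurable M" "g n \<in> borel_measurable M" for n
  using LspaceD(1) C1_compact_support_Lspace[OF hg(1) r] by auto
 have "u' \<in> Lspace \<Omega> r"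
  by (rule Lspace_dominated[OF r sobolev0D(1)[OF s] m(1), of 1]) (use ae(1) in auto)
 moreover have "D' \<in> Lspace \<Omega> r"
  by (rule Lspace_dominated[OF r sobolev0D(2)[OF s] m(2), of 1]) (use ae(2) in auto)
 moreover have "Lnull r (\<lambda>n x. h n x - u' x)"
  by (rule Lnull_dominated_by[OF r hg(2), of _ 1]) (use ae(1) hm m in auto)
 moreover have "Lnull r (\<lambda>n x. g n x - D' x)"
  by (rule Lnull_dominated_by[OF r hg(3), of _ 1]) (use ae(2) hm m in auto)
 ultimately show ?thesis using hg(1) unfolding sobolev0_def by blast
qed

lemma Lnorm_null_iff:
 fixes f :: "nat \<Rightarrow> 'a \<Rightarrow> 'b::euclidean_space"
 assumes "0 < r"
 shows "(\<lambda>n. Lnorm \<Omega> r (f n)) \<longlonglongrightarrow> 0 \<longleftrightarrow> (\<lambda>n. \<integral>x. norm (f n x) powr r \<partial>M) \<longlonglongrightarrow> 0"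
proof
 assume L: "(\<lambda>n. Lnorm \<Omega> r (f n)) \<longlonglongrightarrow> 0"
 have "(\<lambda>n. Lnorm \<Omega> r (f n) powr r) \<longlonglongrightarrow> 0 powr r"
  by (rule tendsto_powr'[OF L tendsto_const]) (use assms in \<open>auto simp: Lnorm_def\<close>)
 then show "(\<lambda>n. \<integral>x. norm (f n x) powr r \<partial>M) \<longlonglongrightarrow> 0"
  using assms by (simp add: Lnorm_def powr_powr)
next
 assume L: "(\<lambda>n. \<integral>x. norm (f n x) powr r \<partial>M) \<longlonglongrightarrow> 0"
 have "(\<lambda>n. (\<integral>x. norm (f n x) powr r \<partial>M) powr (1 / r)) \<longlonglongrightarrow> 0 powr (1 / r)"
  by (rule tendsto_powr'[OF L tendsto_const]) (use assms in auto)
 then show "(\<lambda>n. Lnorm \<Omega> r (f n)) \<longlonglongrightarrow> 0" by (simp add: Lnorm_def)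
qed

text \<open>The representative chosen by \<open>wgrad\<close> lies in \<open>L\<^sup>r\<close> because weak gradients are unique up to null sets.\<close>

lemma W01_imp_sobolev0:
 assumes r: "1 \<le> r" and u: "u \<in> W01 \<Omega> r"
 shows "sobolev0 r u (wgrad \<Omega> u)"
proof -
 have r0: "0 < r" using r by simp
 obtain g where g: "u \<in> Lspace \<Omega> r" "g \<in> Lspace \<Omega> r" "is_weak_gradient \<Omega> u g"
  using u unfolding W01_def W1_def by blast
 obtain \<phi> where \<phi>: "\<And>n. \<phi> n \<in> test_functions \<Omega>"
  "(\<lambda>n. Lnorm \<Omega> r (\<lambda>x. \<phi> n x - u x)) \<longlonglongrightarrow> 0"
  "(\<lambda>n. Lnorm \<Omega> r (\<lambda>x. grad (\<phi> n) x - wgrad \<Omega> u x)) \<longlonglongrightarrow> 0"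
  using u unfolding W01_def by blast
 have "is_weak_gradient \<Omega> u (wgrad \<Omega> u)" unfolding wgrad_def using g(3) by (rule someI[of "is_weak_gradient \<Omega> u"])
 then have ae: "AE x in M. g x = wgrad \<Omega> u x" using g(3) weak_gradient_unique by blast
 have m: "wgrad \<Omega> u \<in> borel_measurable M" using AE_eq_measurable[OF LspaceD(1)[OF g(2)] ae] .
 have W: "wgrad \<Omega> u \<in> Lspace \<Omega> r"
  by (rule Lspace_dominated[OF r0 g(2) m, of 1]) (use ae in auto)
 note c = C1_compact_support_Lspace[OF test_functions_C1[OF \<phi>(1)] r0]
 have "Lnull r (\<lambda>n x. \<phi> n x - u x)" "Lnull r (\<lambda>n x. grad (\<phi> n) x - wgrad \<Omega> u x)"
  unfolding Lnull_def
  by (intro conjI allI Lspace_diff[OF r0] g(1) W c iffD1[OF Lnorm_null_iff[OF r0]] \<phi>(2,3))+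
 then show ?thesis using g(1) W test_functions_C1[OF \<phi>(1)] by (intro sobolev0I)
qed

text \<open>Each \<open>C\<^sup>1\<close> approximation is replaced by a mollification at uniform distance \<open>1/n\<close>, which costs nothing in the limit
  because \<open>\<Omega>\<close> is bounded.\<close>

lemma sobolev0_imp_W01:
 assumes r: "1 \<le> r" and s: "sobolev0 r u D"
 shows "u \<in> W01 \<Omega> r"
proof -
 have r0: "0 < r" using r by simp
 obtain h g where hg: "\<And>n. C1_compact_support \<Omega> (h n) (g n)"
  "Lnull r (\<lambda>n x. h n x - u x)" "Lnull r (\<lambda>n x. g n x - D x)"
  using s unfolding sobolev0_def by blast
 have "\<exists>\<psi>. \<psi> \<in> test_functions \<Omega> \<and> (\<forall>x. \<bar>\<psi> x - h n x\<bar> \<le> inverse (real (Suc n))) \<and>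
   (\<forall>x. norm (grad \<psi> x - g n x) \<le> inverse (real (Suc n)))" for n
 proof -
  obtain K where K: "compact K" "K \<subseteq> \<Omega>" "\<And>x. x \<notin> K \<Longrightarrow> h n x = 0 \<and> g n x = 0"
   "\<And>x. GDERIV (h n) x :> g n x" "continuous_on UNIV (g n)"
   using hg(1)[of n] unfolding C1_compact_support_def by blast
  then have C: "C1_compact_support K (h n) (g n)" unfolding C1_compact_support_def by blast
  have "0 < inverse (real (Suc n))" by simp
  then show ?thesis
   using mollification[OF \<Omega>_open K(1,2)] C1_compact_support_continuous[OF hg(1)] K(3) C by metis
 qed
 then obtain \<psi> where \<psi>: "\<And>n. \<psi> n \<in> test_functions \<Omega>" "\<And>n x. \<bar>\<psi> n x - h n x\<bar> \<le> inverse (real (Suc n))"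
   "\<And>n x. norm (grad (\<psi> n) x - g n x) \<le> inverse (real (Suc n))"
  by metis
 note c = C1_compact_support_Lspace[OF test_functions_C1[OF \<psi>(1)] r0]
 note c' = C1_compact_support_Lspace[OF hg(1) r0]
 note W = sobolev0D[OF s]
 have ae: "AE x in M. D x = wgrad \<Omega> u x" using sobolev0_wgrad[OF r s] by eventually_elim simp
 have wm: "wgrad \<Omega> u \<in> borel_measurable M" using AE_eq_measurable[OF W(4) ae] .
 have "Lnull r (\<lambda>n x. \<psi> n x - h n x)" "Lnull r (\<lambda>n x. grad (\<psi> n) x - g n x)"
  using \<psi>(2,3) c[THEN LspaceD(1)] c'[THEN LspaceD(1)]
  by (auto intro!: Lnull_uniform[OF r0 _ _ LIMSEQ_inverse_real_of_nat] borel_measurable_diff)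
 from Lnull_add[OF r0 this(1) hg(2)] Lnull_add[OF r0 this(2) hg(3)]
 have n: "Lnull r (\<lambda>n x. \<psi> n x - u x)" "Lnull r (\<lambda>n x. grad (\<psi> n) x - D x)" by simp_all
 have "Lnull r (\<lambda>n x. grad (\<psi> n) x - wgrad \<Omega> u x)"
 proof (rule Lnull_dominated_by[OF r0 n(2), of _ 1])
  show "(\<lambda>x. grad (\<psi> n) x - wgrad \<Omega> u x) \<in> borel_measurable M" for n
   using c(2)[THEN LspaceD(1)] wm by (rule borel_measurable_diff)
 qed (use ae in auto)
 then have "(\<lambda>n. Lnorm \<Omega> r (\<lambda>x. \<psi> n x - u x)) \<longlonglongrightarrow> 0"
  "(\<lambda>n. Lnorm \<Omega> r (\<lambda>x. grad (\<psi> n) x - wgrad \<Omega> u x)) \<longlonglongrightarrow> 0"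
  using LnullD(2)[OF n(1)] LnullD(2)
  by (auto intro!: iffD2[OF Lnorm_null_iff[OF r0]])
 then show ?thesis
  using \<psi>(1) W(1,2) sobolev0_weak_gradient[OF r s] unfolding W01_def W1_def by blast
qed

lemma sobolev0_C1:
 assumes "C1_compact_support \<Omega> h g" "0 < r"
 shows "sobolev0 r h g"
proof -
 have "Lnull r (\<lambda>n x. 0 :: real)" "Lnull r (\<lambda>n x. 0 :: 'a)" using assms(2) by (auto simp: Lnull_def Lspace_def)
 then have "Lnull r (\<lambda>n x. h x - h x)" "Lnull r (\<lambda>n x. g x - g x)" by simp_all
 then show ?thesis
  using C1_compact_support_Lspace[OF assms] assms(1) by (intro sobolev0I)
qed

lemma sobolev0_add:
 assumes r: "0 < r" and s: "sobolev0 r u D" "sobolev0 r u' D'"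
 shows "sobolev0 r (\<lambda>x. u x + u' x) (\<lambda>x. D x + D' x)"
proof -
 obtain h g where hg: "\<And>n. C1_compact_support \<Omega> (h n) (g n)"
  "Lnull r (\<lambda>n x. h n x - u x)" "Lnull r (\<lambda>n x. g n x - D x)"
  using s unfolding sobolev0_def by blast
 obtain h' g' where hg': "\<And>n. C1_compact_support \<Omega> (h' n) (g' n)"
  "Lnull r (\<lambda>n x. h' n x - u' x)" "Lnull r (\<lambda>n x. g' n x - D' x)"
  using s unfolding sobolev0_def by blast
 have C: "C1_compact_support \<Omega> (\<lambda>x. h n x + h' n x) (\<lambda>x. g n x + g' n x)" for n
 proof -
  obtain K where K: "compact K" "K \<subseteq> \<Omega>" "\<And>x. x \<notin> K \<Longrightarrow> h n x = 0"
   using hg(1)[of n] unfolding C1_compact_support_def by blast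
  obtain K' where K': "compact K'" "K' \<subseteq> \<Omega>" "\<And>x. x \<notin> K' \<Longrightarrow> h' n x = 0"
   using hg'(1)[of n] unfolding C1_compact_support_def by blast
  have d: "\<And>x. GDERIV (h n) x :> g n x" "\<And>x. GDERIV (h' n) x :> g' n x"
   "continuous_on UNIV (g n)" "continuous_on UNIV (g' n)"
   using hg(1)[of n] hg'(1)[of n] unfolding C1_compact_support_def by blast+
  show ?thesis
   by (rule C1_compact_supportI[where K="K \<union> K'"])
    (use K K' d in \<open>auto intro: GDERIV_add continuous_on_add compact_Un\<close>)
 qed
 have "Lnull r (\<lambda>n x. h n x + h' n x - (u x + u' x))" "Lnull r (\<lambda>n x. g n x + g' n x - (D x + D' x))"
  using Lnull_add[OF r hg(2) hg'(2)] Lnull_add[OF r hg(3) hg'(3)] by (simp_all add: algebra_simps)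
 moreover have "(\<lambda>x. u x + u' x) \<in> Lspace \<Omega> r" "(\<lambda>x. D x + D' x) \<in> Lspace \<Omega> r"
  using sobolev0D[OF s(1)] sobolev0D[OF s(2)] Lspace_add[OF r] by blast+
 ultimately show ?thesis using C by (intro sobolev0I)
qed

lemma sobolev0_mono:
 assumes "0 < s" "s \<le> r" "sobolev0 r u D"
 shows "sobolev0 s u D"
proof -
 obtain h g where hg: "\<And>n. C1_compact_support \<Omega> (h n) (g n)"
  "Lnull r (\<lambda>n x. h n x - u x)" "Lnull r (\<lambda>n x. g n x - D x)"
  using assms(3) by (rule sobolev0E) blast
 show ?thesis
  by (rule sobolev0I[OF Lspace_mono[OF assms(1,2) sobolev0D(1)[OF assms(3)]]
     Lspace_mono[OF assms(1,2) sobolev0D(2)[OF assms(3)]] hg(1)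
     Lnull_mono[OF assms(1,2) hg(2)] Lnull_mono[OF assms(1,2) hg(3)]])
qed

end

section \<open>The chain rule and quotients of powers\<close>

lemma C1_compact_support_compose:
 assumes h: "C1_compact_support \<Omega> h g"
  and F: "\<And>t. (F has_real_derivative F' t) (at t)" "continuous_on UNIV F'" "F 0 = 0"
 shows "C1_compact_support \<Omega> (\<lambda>x. F (h x)) (\<lambda>x. F' (h x) *\<^sub>R g x)"
proof -
 obtain K where K: "compact K" "K \<subseteq> \<Omega>" "\<And>x. x \<notin> K \<Longrightarrow> h x = 0"
  and der: "\<And>x. GDERIV h x :> g x" and cg: "continuous_on UNIV g"
  using h unfolding C1_compact_support_def by blast
 show ?thesis
 proof (rule C1_compact_supportI[OF _ _ K(1,2)])
  show "GDERIV (\<lambda>x. F (h x)) x :> F' (h x) *\<^sub>R g x" for x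
   by (rule GDERIV_DERIV_compose[OF der F(1)])
  show "continuous_on UNIV (\<lambda>x. F' (h x) *\<^sub>R g x)"
   using C1_compact_support_continuous[OF h] cg
   by (intro continuous_on_scaleR continuous_on_compose2[OF F(2)]) auto
 qed (use K(3) F(3) in auto)
qed

lemma lipschitz_of_deriv_bound:
 fixes F F' :: "real \<Rightarrow> real"
 assumes "\<And>t. (F has_real_derivative F' t) (at t)" "\<And>t. \<bar>F' t\<bar> \<le> L"
 shows "\<bar>F a - F b\<bar> \<le> L * \<bar>a - b\<bar>"
proof -
 have "norm (F a - F b) \<le> L * norm (a - b)"
  by (rule field_differentiable_bound[of UNIV F F'])
   (use assms has_field_derivative_at_within in auto)
 then show ?thesis by simp
qed

text \<open>Functions such as \<open>t \<mapsto> (t + \<delta>) powr (-b)\<close> are needed for \<open>t \<ge> 0\<close> only, whereas the chain rule asks for a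
  \<open>C\<^sup>1\<close> function with bounded derivative on the whole line.\<close>

lemma linear_extension_deriv:
 fixes G G' :: "real \<Rightarrow> real"
 assumes G: "\<And>t. 0 \<le> t \<Longrightarrow> (G has_real_derivative G' t) (at t)"
 shows "((\<lambda>t. if 0 \<le> t then G t else G 0 + G' 0 * t) has_real_derivative (if 0 \<le> t then G' t else G' 0)) (at t)"
proof -
 consider "0 < t" | "t = 0" | "t < 0" by linarith
 then show ?thesis
 proof cases
  case 1
  have "((\<lambda>t. if 0 \<le> t then G t else G 0 + G' 0 * t) has_real_derivative G' t) (at t)"
   by (rule has_field_derivative_transform_within_open[OF G, where S="{0<..}"]) (use 1 in auto)
  then show ?thesis using 1 by simp
 next
  case 2
  have "((\<lambda>h. (G (0 + h) - G 0) / h) \<longlongrightarrow> G' 0) (at 0)"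
   using G[of 0] by (simp add: has_field_derivative_iff)
  then have lim: "((\<lambda>h. (G h - G 0) / h - G' 0) \<longlongrightarrow> 0) (at 0)"
   using LIM_zero by fastforce
  have "((\<lambda>h. ((if 0 \<le> h then G h else G 0 + G' 0 * h) - G 0) / h - G' 0) \<longlongrightarrow> 0) (at 0)"
  proof (rule Lim_null_comparison[OF _ tendsto_norm_zero[OF lim]])
   show "\<forall>\<^sub>F h in at 0. norm (((if 0 \<le> h then G h else G 0 + G' 0 * h) - G 0) / h - G' 0) \<le> norm ((G h - G 0) / h - G' 0)"
    by (auto simp: eventually_at intro!: exI[of _ 1])
  qed
  then have "((\<lambda>h. ((if 0 \<le> h then G h else G 0 + G' 0 * h) - G 0) / h) \<longlongrightarrow> G' 0) (at 0)"
   by (rule LIM_zero_cancel)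
  then show ?thesis using 2 by (simp add: has_field_derivative_iff)
 next
  case 3
  have "((\<lambda>t. G 0 + G' 0 * t) has_real_derivative G' 0) (at t)"
   by (auto intro!: derivative_eq_intros)
  then have "((\<lambda>t. if 0 \<le> t then G t else G 0 + G' 0 * t) has_real_derivative G' 0) (at t)"
   by (rule has_field_derivative_transform_within_open[where S="{..<0}"]) (use 3 in auto)
  then show ?thesis using 3 by simp
 qed
qed

lemma pos_part_powr_deriv:
 fixes a t :: real
 assumes "1 < a"
 shows "((\<lambda>t. max 0 t powr a) has_real_derivative a * max 0 t powr (a - 1)) (at t)"
proof -
 consider "0 < t" | "t = 0" | "t < 0" by linarith
 then show ?thesis
 proof cases
  case 1
  have "((\<lambda>t. t powr a) has_real_derivative a * t powr (a - 1)) (at t)"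
   using 1 by (auto intro!: derivative_eq_intros)
  then have "((\<lambda>t. max 0 t powr a) has_real_derivative a * t powr (a - 1)) (at t)"
   by (rule has_field_derivative_transform_within_open[where S="{0<..}"]) (use 1 in auto)
  then show ?thesis using 1 by simp
 next
  case 2
  have "((\<lambda>h. max 0 h powr a / h) \<longlongrightarrow> 0) (at 0)"
  proof (rule Lim_null_comparison)
   have "norm (max 0 h powr a / h) \<le> \<bar>h\<bar> powr (a - 1)" for h :: real
   proof (cases "0 < h")
    case True
    then show ?thesis by (simp add: powr_diff)
   next
    case False
    then have "max 0 h = 0" by simp
    then show ?thesis by simp
   qed
   then show "\<forall>\<^sub>F h in at 0. norm (max 0 h powr a / h) \<le> \<bar>h\<bar> powr (a - 1)"
    by (intro always_eventually) auto
   have "((\<lambda>h. \<bar>h\<bar> powr (a - 1)) \<longlongrightarrow> \<bar>0\<bar> powr (a - 1)) (at (0::real))"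
    using assms by (intro tendsto_powr' tendsto_intros) auto
   then show "((\<lambda>h. \<bar>h\<bar> powr (a - 1)) \<longlongrightarrow> 0) (at (0::real))" using assms by simp
  qed
  then show ?thesis using 2 assms by (simp add: has_field_derivative_iff)
 next
  case 3
  have "((\<lambda>_. 0) has_real_derivative 0) (at t)" by simp
  then have "((\<lambda>t. max 0 t powr a) has_real_derivative 0) (at t)"
   by (rule has_field_derivative_transform_within_open[where S="{..<0}"]) (use 3 in auto)
  then show ?thesis using 3 by simp
 qed
qed

context bounded_open
begin

lemma measurable_compose_continuous:
 fixes F :: "real \<Rightarrow> real"
 assumes "continuous_on UNIV F" "u \<in> borel_measurable M"
 shows "(\<lambda>x. F (u x)) \<in> borel_measurable M"
 using measurable_compose[OF assms(2) borel_measurable_continuous_onI[OF assms(1)]] .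

text \<open>The factor \<open>w\<close> has bounded gradient and no boundary condition; the boundary condition is carried by \<open>F (u x)\<close>,
  whence \<open>F 0 = 0\<close>. Convergence of \<open>F' (h n) *\<^sub>R g n\<close> is obtained along a subsequence on which \<open>h n\<close> converges almost
  everywhere.\<close>

lemma sobolev0_chain:
 assumes r: "0 < r" and s: "sobolev0 r u U"
  and F: "\<And>t. (F has_real_derivative F' t) (at t)" "continuous_on UNIV F'" "\<And>t. \<bar>F' t\<bar> \<le> L" "F 0 = 0"
  and w: "\<And>x. x \<in> \<Omega> \<Longrightarrow> GDERIV w x :> dw x" "continuous_on \<Omega> dw"
   "\<And>x. x \<in> \<Omega> \<Longrightarrow> \<bar>w x\<bar> \<le> B" "\<And>x. x \<in> \<Omega> \<Longrightarrow> norm (dw x) \<le> B"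
 shows "sobolev0 r (\<lambda>x. w x * F (u x)) (\<lambda>x. F (u x) *\<^sub>R dw x + (w x * F' (u x)) *\<^sub>R U x)"
proof -
 obtain h0 g0 where hg0: "\<And>n. C1_compact_support \<Omega> (h0 n) (g0 n)"
  "Lnull r (\<lambda>n x. h0 n x - u x)" "Lnull r (\<lambda>n x. g0 n x - U x)"
  using s by (rule sobolev0E) blast
 obtain k where k: "strict_mono k" "AE x in M. (\<lambda>n. h0 (k n) x - u x) \<longlonglongrightarrow> 0"
  using hg0(2) by (rule Lnull_AE_subseq[OF r])
 define h where "h n = h0 (k n)" for n
 define g where "g n = g0 (k n)" for n
 have hg: "\<And>n. C1_compact_support \<Omega> (h n) (g n)"
  "Lnull r (\<lambda>n x. h n x - u x)" "Lnull r (\<lambda>n x. g n x - U x)"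
  and hu: "AE x in M. (\<lambda>n. h n x - u x) \<longlonglongrightarrow> 0"
  using hg0(1) Lnull_subseq[OF k(1) hg0(2)] Lnull_subseq[OF k(1) hg0(3)] k(2) by (simp_all add: h_def g_def)
 note [measurable] = sobolev0D(3,4)[OF s]
 have [measurable]: "h n \<in> borel_measurable M" "g n \<in> borel_measurable M" for n
  using C1_compact_support_Lspace[OF hg(1) r] LspaceD(1) by auto
 have cF: "continuous_on UNIV F"
  using F(1) by (intro continuous_at_imp_continuous_on ballI DERIV_isCont)
 have [measurable]: "w \<in> borel_measurable M" "dw \<in> borel_measurable M"
  using w by (auto intro!: continuous_measurable continuous_at_imp_continuous_on GDERIV_isCont)
 have [measurable]: "(\<lambda>x. F (u x)) \<in> borel_measurable M" "(\<lambda>x. F' (u x)) \<in> borel_measurable M"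
  "(\<lambda>x. F (h n x)) \<in> borel_measurable M" "(\<lambda>x. F' (h n x)) \<in> borel_measurable M" for n
  using measurable_compose_continuous[OF cF, of u] measurable_compose_continuous[OF F(2), of u]
   measurable_compose_continuous[OF cF, of "h n" for n] measurable_compose_continuous[OF F(2), of "h n" for n]
  by simp_all
 have L0: "0 \<le> L" using F(3)[of 0] by linarith
 define B' where "B' = max B 0"
 have B': "0 \<le> B'" "\<And>x. x \<in> \<Omega> \<Longrightarrow> \<bar>w x\<bar> \<le> B'" "\<And>x. x \<in> \<Omega> \<Longrightarrow> norm (dw x) \<le> B'"
  using w(3,4) by (force simp: B'_def)+
 have lip: "\<bar>F a - F b\<bar> \<le> L * \<bar>a - b\<bar>" for a b
  using lipschitz_of_deriv_bound[OF F(1,3)] .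
 have Fb: "\<bar>F a\<bar> \<le> L * \<bar>a\<bar>" for a using lip[of a 0] F(4) by simp
 have memU: "(\<lambda>x. w x * F (u x)) \<in> Lspace \<Omega> r"
 proof (rule Lspace_dominated[OF r sobolev0D(1)[OF s]])
  show "AE x in M. norm (w x * F (u x)) \<le> (B' * L) * norm (u x)"
  proof (rule AE_I2)
   fix x assume "x \<in> space M"
   then have "\<bar>w x\<bar> * \<bar>F (u x)\<bar> \<le> B' * (L * \<bar>u x\<bar>)"
    using B' Fb by (intro mult_mono) auto
   then show "norm (w x * F (u x)) \<le> (B' * L) * norm (u x)" by (simp add: abs_mult mult.assoc)
  qed
 qed (use B' L0 in auto)
 have mem1: "(\<lambda>x. F (u x) *\<^sub>R dw x) \<in> Lspace \<Omega> r"
 proof (rule Lspace_dominated[OF r sobolev0D(1)[OF s]])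
  show "AE x in M. norm (F (u x) *\<^sub>R dw x) \<le> (B' * L) * norm (u x)"
  proof (rule AE_I2)
   fix x assume "x \<in> space M"
   then have "norm (dw x) * \<bar>F (u x)\<bar> \<le> B' * (L * \<bar>u x\<bar>)"
    using B' Fb by (intro mult_mono) auto
   then show "norm (F (u x) *\<^sub>R dw x) \<le> (B' * L) * norm (u x)" by (simp add: mult_ac)
  qed
 qed (use B' L0 in auto)
 have mem2: "(\<lambda>x. (w x * F' (u x)) *\<^sub>R U x) \<in> Lspace \<Omega> r"
 proof (rule Lspace_dominated[OF r sobolev0D(2)[OF s]])
  show "AE x in M. norm ((w x * F' (u x)) *\<^sub>R U x) \<le> (B' * L) * norm (U x)"
  proof (rule AE_I2)
   fix x assume "x \<in> space M"
   then have "\<bar>w x\<bar> * \<bar>F' (u x)\<bar> \<le> B' * L"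
    using B' F(3) by (intro mult_mono) auto
   then show "norm ((w x * F' (u x)) *\<^sub>R U x) \<le> (B' * L) * norm (U x)"
    by (simp add: abs_mult mult_right_mono)
  qed
 qed (use B' L0 in auto)
 have N1: "Lnull r (\<lambda>n x. w x * F (h n x) - w x * F (u x))"
 proof (rule Lnull_dominated_by[OF r hg(2)])
  show "AE x in M. norm (w x * F (h n x) - w x * F (u x)) \<le> (B' * L) * norm (h n x - u x)" for n
  proof (rule AE_I2)
   fix x assume "x \<in> space M"
   then have "\<bar>w x\<bar> * \<bar>F (h n x) - F (u x)\<bar> \<le> B' * (L * \<bar>h n x - u x\<bar>)"
    using B' lip by (intro mult_mono) auto
   then show "norm (w x * F (h n x) - w x * F (u x)) \<le> (B' * L) * norm (h n x - u x)"
    by (simp add: mult.assoc flip: right_diff_distrib abs_mult)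
  qed
 qed (use B' L0 in auto)
 have N2: "Lnull r (\<lambda>n x. (F (h n x) - F (u x)) *\<^sub>R dw x)"
 proof (rule Lnull_dominated_by[OF r hg(2)])
  show "AE x in M. norm ((F (h n x) - F (u x)) *\<^sub>R dw x) \<le> (B' * L) * norm (h n x - u x)" for n
  proof (rule AE_I2)
   fix x assume "x \<in> space M"
   then have "norm (dw x) * \<bar>F (h n x) - F (u x)\<bar> \<le> B' * (L * \<bar>h n x - u x\<bar>)"
    using B' lip by (intro mult_mono) auto
   then show "norm ((F (h n x) - F (u x)) *\<^sub>R dw x) \<le> (B' * L) * norm (h n x - u x)"
    by (simp add: mult_ac)
  qed
 qed (use B' L0 in auto)
 have N3: "Lnull r (\<lambda>n x. (w x * F' (h n x)) *\<^sub>R (g n x - U x))"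
 proof (rule Lnull_dominated_by[OF r hg(3)])
  show "AE x in M. norm ((w x * F' (h n x)) *\<^sub>R (g n x - U x)) \<le> (B' * L) * norm (g n x - U x)" for n
  proof (rule AE_I2)
   fix x assume "x \<in> space M"
   then have "\<bar>w x\<bar> * \<bar>F' (h n x)\<bar> \<le> B' * L"
    using B' F(3) by (intro mult_mono) auto
   then show "norm ((w x * F' (h n x)) *\<^sub>R (g n x - U x)) \<le> (B' * L) * norm (g n x - U x)"
    by (simp add: abs_mult mult_right_mono)
  qed
 qed (use B' L0 in auto)
 have N4: "Lnull r (\<lambda>n x. (w x * (F' (h n x) - F' (u x))) *\<^sub>R U x)"
 proof (rule Lnull_pointwise[OF r])
  show "(\<lambda>x. (2 * B' * L) *\<^sub>R U x) \<in> Lspace \<Omega> r"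
   by (rule Lspace_dominated[OF r sobolev0D(2)[OF s], of _ "2 * B' * L"]) (use B' L0 in auto)
  show "AE x in M. norm ((w x * (F' (h n x) - F' (u x))) *\<^sub>R U x) \<le> norm ((2 * B' * L) *\<^sub>R U x)" for n
  proof (rule AE_I2)
   fix x assume "x \<in> space M"
   then have "\<bar>w x\<bar> * \<bar>F' (h n x) - F' (u x)\<bar> \<le> B' * (2 * L)"
    using B' F(3)[of "h n x"] F(3)[of "u x"] by (intro mult_mono) auto
   then show "norm ((w x * (F' (h n x) - F' (u x))) *\<^sub>R U x) \<le> norm ((2 * B' * L) *\<^sub>R U x)"
    using mult_right_mono[of "\<bar>w x\<bar> * \<bar>F' (h n x) - F' (u x)\<bar>" "B' * (2 * L)" "norm (U x)"] B' L0
    by (simp add: abs_mult mult_ac)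
  qed
  show "AE x in M. (\<lambda>n. (w x * (F' (h n x) - F' (u x))) *\<^sub>R U x) \<longlonglongrightarrow> 0"
   using hu
  proof eventually_elim
   case (elim x)
   then have "(\<lambda>n. h n x) \<longlonglongrightarrow> u x" by (rule LIM_zero_cancel)
   then have "(\<lambda>n. F' (h n x)) \<longlonglongrightarrow> F' (u x)"
    by (rule continuous_on_tendsto_compose[OF F(2)]) auto
   then have "(\<lambda>n. (w x * (F' (h n x) - F' (u x))) *\<^sub>R U x) \<longlonglongrightarrow> (w x * (F' (u x) - F' (u x))) *\<^sub>R U x"
    by (intro tendsto_intros)
   then show ?case by simp
  qed
 qed measurable
 show ?thesis
 proof (rule sobolev0I[OF memU Lspace_add[OF r mem1 mem2]])
  show "C1_compact_support \<Omega> (\<lambda>x. if x \<in> \<Omega> then w x * F (h n x) else 0)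
   (\<lambda>x. if x \<in> \<Omega> then w x *\<^sub>R (F' (h n x) *\<^sub>R g n x) + F (h n x) *\<^sub>R dw x else 0)" for n
   by (rule C1_compact_support_mult[OF C1_compact_support_compose[OF hg(1) F(1,2,4)] w(1,2) \<Omega>_open])
  have [measurable]: "(\<lambda>x. if x \<in> \<Omega> then w x * F (h n x) else 0) \<in> borel_measurable M" for n
   by (rule AE_eq_measurable[of "\<lambda>x. w x * F (h n x)"]) auto
  show "Lnull r (\<lambda>n x. (if x \<in> \<Omega> then w x * F (h n x) else 0) - w x * F (u x))"
   by (rule Lnull_dominated_by[OF r N1, of _ 1]) (auto intro!: AE_I2)
  have [measurable]: "(\<lambda>x. if x \<in> \<Omega> then w x *\<^sub>R (F' (h n x) *\<^sub>R g n x) + F (h n x) *\<^sub>R dw x else 0) \<in> borel_measurable M" for n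
   by (rule AE_eq_measurable[of "\<lambda>x. w x *\<^sub>R (F' (h n x) *\<^sub>R g n x) + F (h n x) *\<^sub>R dw x"]) auto
  show "Lnull r (\<lambda>n x. (if x \<in> \<Omega> then w x *\<^sub>R (F' (h n x) *\<^sub>R g n x) + F (h n x) *\<^sub>R dw x else 0)
    - (F (u x) *\<^sub>R dw x + (w x * F' (u x)) *\<^sub>R U x))"
   by (rule Lnull_dominated_by[OF r Lnull_add[OF r Lnull_add[OF r N2 N3] N4], of _ 1])
    (auto intro!: AE_I2 eq_refl arg_cong[where f=norm] simp: algebra_simps)
 qed
qed

lemma sobolev0_scale:
 assumes r: "0 < r" and s: "sobolev0 r u U"
 shows "sobolev0 r (\<lambda>x. c * u x) (\<lambda>x. c *\<^sub>R U x)"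
 using sobolev0_chain[OF r s, of "\<lambda>t. t" "\<lambda>_. 1" 1 "\<lambda>_. c" "\<lambda>_. 0" "\<bar>c\<bar>"]
 by (auto simp: GDERIV_const)

end

text \<open>A positive bounded \<open>C\<^sup>1\<close> function with bounded gradient that tends to 0 at the boundary. One bound \<open>B\<close> serves for the
  function and its gradient.\<close>

locale positive_profile = bounded_open \<Omega> for \<Omega> :: "'a::euclidean_space set" +
 fixes \<phi> :: "'a \<Rightarrow> real" and g :: "'a \<Rightarrow> 'a" and B :: real
 assumes \<phi>_pos: "\<And>x. x \<in> \<Omega> \<Longrightarrow> 0 < \<phi> x" and \<phi>_le: "\<And>x. x \<in> \<Omega> \<Longrightarrow> \<phi> x \<le> B"
  and \<phi>_der: "\<And>x. x \<in> \<Omega> \<Longrightarrow> GDERIV \<phi> x :> g x" and g_cont: "continuous_on \<Omega> g"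
  and g_le: "\<And>x. x \<in> \<Omega> \<Longrightarrow> norm (g x) \<le> B"
  and \<phi>_vanish: "\<And>k. 0 < k \<Longrightarrow> \<exists>K. compact K \<and> K \<subseteq> \<Omega> \<and> (\<forall>x\<in>\<Omega> - K. \<phi> x \<le> k)"
  and B_pos: "0 < B"
begin

lemma \<phi>_cont: "continuous_on \<Omega> \<phi>"
 using \<phi>_der by (intro continuous_at_imp_continuous_on ballI GDERIV_isCont)

lemma \<phi>_meas [measurable]: "\<phi> \<in> borel_measurable M" and g_meas [measurable]: "g \<in> borel_measurable M"
 using \<phi>_cont g_cont by (auto intro: continuous_measurable)

lemma \<phi>_powr_GDERIV: "x \<in> \<Omega> \<Longrightarrow> GDERIV (\<lambda>x. \<phi> x powr a) x :> (a * \<phi> x powr (a - 1)) *\<^sub>R g x"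
 by (rule GDERIV_DERIV_compose[OF \<phi>_der]) (use \<phi>_pos in \<open>auto intro!: derivative_eq_intros\<close>)

lemma \<phi>_powr_cont: "continuous_on \<Omega> (\<lambda>x. \<phi> x powr a)"
 using \<phi>_cont by (intro continuous_on_powr continuous_on_const) (use \<phi>_pos in force)+

lemma \<phi>_powr_grad_cont: "continuous_on \<Omega> (\<lambda>x. (a * \<phi> x powr (a - 1)) *\<^sub>R g x)"
 by (intro continuous_intros \<phi>_powr_cont g_cont)

lemma \<phi>_powr_le: "0 \<le> a \<Longrightarrow> x \<in> \<Omega> \<Longrightarrow> \<phi> x powr a \<le> B powr a"
 using \<phi>_pos[of x] \<phi>_le[of x] by (intro powr_mono2) auto

lemma \<phi>_powr_grad_le: "1 \<le> a \<Longrightarrow> x \<in> \<Omega> \<Longrightarrow> norm ((a * \<phi> x powr (a - 1)) *\<^sub>R g x) \<le> a * B powr a"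
proof -
 assume a: "1 \<le> a" "x \<in> \<Omega>"
 have "\<phi> x powr (a - 1) * norm (g x) \<le> B powr (a - 1) * B"
  using a \<phi>_powr_le[of "a - 1" x] g_le[of x] by (intro mult_mono) auto
 also have "\<dots> = B powr a" using B_pos by (simp add: powr_diff)
 finally show ?thesis using a by (simp add: mult.assoc mult_left_mono)
qed

text \<open>The truncations \<open>max 0 (\<phi> - k) powr a\<close> are \<open>C\<^sup>1\<close> because \<open>a > 1\<close>, have compact support because \<open>\<phi>\<close> tends to 0 at the
  boundary, and converge as \<open>k\<close> tends to 0.\<close>

lemma sobolev0_power:
 assumes r: "0 < r" and a: "1 < a"
 shows "sobolev0 r (\<lambda>x. \<phi> x powr a) (\<lambda>x. (a * \<phi> x powr (a - 1)) *\<^sub>R g x)"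
proof -
 define c where "c n = inverse (real (Suc n))" for n
 have c: "c \<longlonglongrightarrow> 0" "0 < c n" for n
  unfolding c_def using LIMSEQ_inverse_real_of_nat by auto
 define h where "h n x = max 0 (\<phi> x - c n) powr a" for n x
 define dh where "dh n x = (a * max 0 (\<phi> x - c n) powr (a - 1)) *\<^sub>R g x" for n x
 have cont0: "continuous_on UNIV (\<lambda>t. max 0 t powr b)" if "0 < b" for b :: real
  using that by (intro continuous_on_powr' continuous_intros) auto
 have [measurable]: "(\<lambda>x. max 0 (\<phi> x - c n) powr b) \<in> borel_measurable M" for n b
  by measurable
 have hle: "0 \<le> max 0 (\<phi> x - c n) powr b \<and> max 0 (\<phi> x - c n) powr b \<le> \<phi> x powr b" if "x \<in> \<Omega>" "0 < b" for n x b
  using \<phi>_pos[OF that(1)] c(2)[of n] that(2) by (auto intro!: powr_mono2)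
 have lim: "(\<lambda>n. max 0 (\<phi> x - c n) powr b) \<longlonglongrightarrow> \<phi> x powr b" if "x \<in> \<Omega>" "0 < b" for x b
 proof -
  have "(\<lambda>n. max 0 (\<phi> x - c n) powr b) \<longlonglongrightarrow> max 0 (\<phi> x - 0) powr b"
   using that by (intro tendsto_powr' tendsto_max tendsto_diff tendsto_const c(1)) auto
  then show ?thesis using \<phi>_pos[OF that(1)] by simp
 qed
 show ?thesis
 proof (rule sobolev0I)
  show m1: "(\<lambda>x. \<phi> x powr a) \<in> Lspace \<Omega> r"
   by (rule Lspace_bounded[where B="B powr a"]) (use r a \<phi>_powr_le in auto)
  show m2: "(\<lambda>x. (a * \<phi> x powr (a - 1)) *\<^sub>R g x) \<in> Lspace \<Omega> r"
   by (rule Lspace_bounded[where B="a * B powr a"]) (use r a \<phi>_powr_grad_le in auto)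
  show "C1_compact_support \<Omega> (\<lambda>x. if x \<in> \<Omega> then h n x else 0) (\<lambda>x. if x \<in> \<Omega> then dh n x else 0)" for n
  proof -
   obtain K where K: "compact K" "K \<subseteq> \<Omega>" "\<forall>x\<in>\<Omega> - K. \<phi> x \<le> c n"
    using \<phi>_vanish[OF c(2)] by blast
   show ?thesis
   proof (rule C1_compact_support_extend[OF _ _ \<Omega>_open K(1,2)])
    show "GDERIV (h n) x :> dh n x" if "x \<in> \<Omega>" for x
     unfolding h_def dh_def
     by (rule GDERIV_DERIV_compose[of "\<lambda>x. \<phi> x - c n" x "g x", OF _ pos_part_powr_deriv[OF a]])
      (use GDERIV_diff[OF \<phi>_der[OF that] GDERIV_const] in simp)
    show "continuous_on \<Omega> (dh n)"
     unfolding dh_def using a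
     by (intro continuous_on_scaleR continuous_on_mult continuous_on_const g_cont
       continuous_on_compose2[OF cont0] continuous_on_diff \<phi>_cont) auto
   qed (use K(3) in \<open>auto simp: h_def\<close>)
  qed
  have N1: "Lnull r (\<lambda>n x. h n x - \<phi> x powr a)"
  proof (rule Lnull_pointwise[OF r m1])
   show "(\<lambda>x. h n x - \<phi> x powr a) \<in> borel_measurable M" for n unfolding h_def by measurable
   show "AE x in M. norm (h n x - \<phi> x powr a) \<le> norm (\<phi> x powr a)" for n
    using hle a by (intro AE_I2) (fastforce simp: h_def)
   show "AE x in M. (\<lambda>n. h n x - \<phi> x powr a) \<longlonglongrightarrow> 0"
    unfolding h_def using lim a by (intro AE_I2 LIM_zero) auto
  qed
  show "Lnull r (\<lambda>n x. (if x \<in> \<Omega> then h n x else 0) - \<phi> x powr a)"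
  proof (rule Lnull_dominated_by[OF r N1, of _ 1])
   show "(\<lambda>x. (if x \<in> \<Omega> then h n x else 0) - \<phi> x powr a) \<in> borel_measurable M" for n
    by (rule AE_eq_measurable[of "\<lambda>x. h n x - \<phi> x powr a"]) (auto simp: h_def)
  qed (auto intro!: AE_I2)
  have N2: "Lnull r (\<lambda>n x. dh n x - (a * \<phi> x powr (a - 1)) *\<^sub>R g x)"
  proof (rule Lnull_pointwise[OF r m2])
   show "(\<lambda>x. dh n x - (a * \<phi> x powr (a - 1)) *\<^sub>R g x) \<in> borel_measurable M" for n unfolding dh_def by measurable
   show "AE x in M. norm (dh n x - (a * \<phi> x powr (a - 1)) *\<^sub>R g x) \<le> norm ((a * \<phi> x powr (a - 1)) *\<^sub>R g x)" for n
   proof (rule AE_I2)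
    fix x assume x: "x \<in> space M"
    have "dh n x - (a * \<phi> x powr (a - 1)) *\<^sub>R g x = (a * (max 0 (\<phi> x - c n) powr (a - 1) - \<phi> x powr (a - 1))) *\<^sub>R g x"
     by (simp add: dh_def algebra_simps)
    also have "norm \<dots> \<le> norm ((a * \<phi> x powr (a - 1)) *\<^sub>R g x)"
     using hle[of x "a - 1" n] x a by (auto simp: abs_mult intro!: mult_right_mono mult_left_mono)
    finally show "norm (dh n x - (a * \<phi> x powr (a - 1)) *\<^sub>R g x) \<le> norm ((a * \<phi> x powr (a - 1)) *\<^sub>R g x)" .
   qed
   show "AE x in M. (\<lambda>n. dh n x - (a * \<phi> x powr (a - 1)) *\<^sub>R g x) \<longlonglongrightarrow> 0"
    unfolding dh_def using lim a by (intro AE_I2 LIM_zero tendsto_scaleR tendsto_mult tendsto_const) auto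
  qed
  show "Lnull r (\<lambda>n x. (if x \<in> \<Omega> then dh n x else 0) - (a * \<phi> x powr (a - 1)) *\<^sub>R g x)"
  proof (rule Lnull_dominated_by[OF r N2, of _ 1])
   show "(\<lambda>x. (if x \<in> \<Omega> then dh n x else 0) - (a * \<phi> x powr (a - 1)) *\<^sub>R g x) \<in> borel_measurable M" for n
    by (rule AE_eq_measurable[of "\<lambda>x. dh n x - (a * \<phi> x powr (a - 1)) *\<^sub>R g x"]) (auto simp: dh_def)
  qed (auto intro!: AE_I2)
 qed
qed

text \<open>The difference \<open>(u + \<delta>) powr (-b) - \<delta> powr (-b)\<close> vanishes with \<open>u\<close> and is covered by the chain rule with the factor
  \<open>\<phi> powr a\<close>; the remaining multiple of \<open>\<phi> powr a\<close> is covered by \<open>sobolev0_power\<close>.\<close>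

lemma sobolev0_power_quotient:
 assumes r: "0 < r" and s: "sobolev0 r u U" and nn: "AE x in M. 0 \<le> u x"
  and a: "1 < a" and b: "0 < b" and \<delta>: "0 < \<delta>"
 shows "sobolev0 r (\<lambda>x. \<phi> x powr a * (u x + \<delta>) powr (- b))
  (\<lambda>x. (a * \<phi> x powr (a - 1) * (u x + \<delta>) powr (- b)) *\<^sub>R g x
    - (b * \<phi> x powr a * (u x + \<delta>) powr (- b - 1)) *\<^sub>R U x)"
proof -
 define G where "G t = (t + \<delta>) powr (- b) - \<delta> powr (- b)" for t
 define G' where "G' t = - b * (t + \<delta>) powr (- b - 1)" for t
 define F where "F t = (if 0 \<le> t then G t else G 0 + G' 0 * t)" for t
 define F' where "F' t = (if 0 \<le> t then G' t else G' 0)" for t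
 have "(G has_real_derivative G' t) (at t)" if "0 \<le> t" for t
  unfolding G_def G'_def using that \<delta> by (auto intro!: derivative_eq_intros)
 then have F: "(F has_real_derivative F' t) (at t)" for t
  unfolding F_def F'_def by (rule linear_extension_deriv)
 have F'_eq: "F' = (\<lambda>t. - b * (max 0 t + \<delta>) powr (- b - 1))"
  by (auto simp: F'_def G'_def fun_eq_iff max_def)
 have F'c: "continuous_on UNIV F'"
  unfolding F'_eq using \<delta> by (intro continuous_intros) (smt (verit) max.cobounded1)
 have F'b: "\<bar>F' t\<bar> \<le> b * \<delta> powr (- b - 1)" for t
  unfolding F'_eq using b \<delta> by (auto simp: abs_mult intro!: mult_left_mono powr_mono2')
 have F0: "F 0 = 0" by (simp add: F_def G_def)
 define C where "C = max (B powr a) (a * B powr a)"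
 have 1: "sobolev0 r (\<lambda>x. \<phi> x powr a * F (u x))
  (\<lambda>x. F (u x) *\<^sub>R ((a * \<phi> x powr (a - 1)) *\<^sub>R g x) + (\<phi> x powr a * F' (u x)) *\<^sub>R U x)"
  by (rule sobolev0_chain[OF r s F F'c F'b F0 \<phi>_powr_GDERIV \<phi>_powr_grad_cont, where B=C])
   (use a \<phi>_powr_le[of a] \<phi>_powr_grad_le[of a] in \<open>auto simp: C_def intro: order_trans max.coboundedI1 max.coboundedI2\<close>)
 have 2: "sobolev0 r (\<lambda>x. \<delta> powr (- b) * \<phi> x powr a) (\<lambda>x. \<delta> powr (- b) *\<^sub>R ((a * \<phi> x powr (a - 1)) *\<^sub>R g x))"
  by (rule sobolev0_scale[OF r sobolev0_power[OF r a]])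
 show ?thesis
 proof (rule sobolev0_cong_AE[OF sobolev0_add[OF r 1 2] r])
  show "AE x in M. \<phi> x powr a * F (u x) + \<delta> powr (- b) * \<phi> x powr a = \<phi> x powr a * (u x + \<delta>) powr (- b)"
   using nn by eventually_elim (simp add: F_def G_def algebra_simps)
  show "AE x in M. F (u x) *\<^sub>R ((a * \<phi> x powr (a - 1)) *\<^sub>R g x) + (\<phi> x powr a * F' (u x)) *\<^sub>R U x
    + \<delta> powr (- b) *\<^sub>R ((a * \<phi> x powr (a - 1)) *\<^sub>R g x)
   = (a * \<phi> x powr (a - 1) * (u x + \<delta>) powr (- b)) *\<^sub>R g x - (b * \<phi> x powr a * (u x + \<delta>) powr (- b - 1)) *\<^sub>R U x"
   using nn
   by eventually_elim
    (simp add: F_def G_def F'_def G'_def algebra_simps flip: scaleR_add_left)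
 qed
qed

end

section \<open>Boundary values\<close>

lemma nn_integral_bounded_eq_integral:
 fixes f :: "'a::euclidean_space \<Rightarrow> real"
 assumes \<Omega>: "open \<Omega>" and [measurable]: "f \<in> borel_measurable borel" "A \<in> sets borel"
  and A: "A \<subseteq> \<Omega>" "bounded A" and f: "\<And>x. 0 \<le> f x" "\<And>x. x \<in> A \<Longrightarrow> f x \<le> b"
 shows "(\<integral>\<^sup>+x. ennreal (f x) * indicator A x \<partial>lborel) = ennreal (\<integral>x. indicator A x * f x \<partial>lebesgue_on \<Omega>)"
proof -
 have "integrable lborel (\<lambda>x. indicator A x * f x)"
 proof (rule Bochner_Integration.integrable_bound)
  show "integrable lborel (\<lambda>x. \<bar>b\<bar> * indicator A x)"
   using emeasure_bounded_finite[OF A(2)] by (intro integrable_mult_right integrable_real_indicator) auto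
  show "AE x in lborel. norm (indicator A x * f x) \<le> norm (\<bar>b\<bar> * indicator A x)"
   using f by (intro AE_I2) (fastforce simp: indicator_def)
 qed measurable
 then have "(\<integral>\<^sup>+x. ennreal (indicator A x * f x) \<partial>lborel) = ennreal (\<integral>x. indicator A x * f x \<partial>lborel)"
  using f(1) by (intro nn_integral_eq_integral) (auto simp: indicator_def)
 moreover have "(\<integral>x. indicator A x * f x \<partial>lborel) = (\<integral>x. indicator A x * f x \<partial>lebesgue_on \<Omega>)"
  using A(1) by (intro integral_lebesgue_on_eq_lborel[OF \<Omega>, symmetric]) (auto simp: indicator_def)
 moreover have "(\<integral>\<^sup>+x. ennreal (indicator A x * f x) \<partial>lborel) = (\<integral>\<^sup>+x. ennreal (f x) * indicator A x \<partial>lborel)"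
  by (intro nn_integral_cong) (auto simp: indicator_def)
 ultimately show ?thesis by simp
qed

lemma abs_powr_deriv:
 fixes q t :: real
 assumes "1 < q"
 shows "((\<lambda>t. \<bar>t\<bar> powr q) has_real_derivative q * max 0 t powr (q - 1) - q * max 0 (- t) powr (q - 1)) (at t)"
proof -
 have eq: "(\<lambda>t. \<bar>t\<bar> powr q) = (\<lambda>t. max 0 t powr q + max 0 (- t) powr q)"
  using assms by (auto simp: fun_eq_iff max_def abs_if)
 have "((\<lambda>t. max 0 (- t) powr q) has_real_derivative (q * max 0 (- t) powr (q - 1)) * (- 1)) (at t)"
  by (rule DERIV_chain2[OF pos_part_powr_deriv[OF assms]]) (auto intro!: derivative_eq_intros)
 from DERIV_add[OF pos_part_powr_deriv[OF assms] this] show ?thesis unfolding eq by simp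
qed

context bounded_open
begin

lemma set_M_integrable:
 fixes f :: "'a \<Rightarrow> real"
 assumes "integrable M f" "A \<in> sets lebesgue"
 shows "integrable M (\<lambda>x. indicator A x * f x)"
proof (rule Bochner_Integration.integrable_bound[OF assms(1)])
 have "indicat_real A \<in> borel_measurable M"
  using assms(2) by (intro measurable_restrict_space1) simp
 then show "(\<lambda>x. indicator A x * f x) \<in> borel_measurable M" using assms(1) by measurable
qed (auto simp: indicator_def)

lemma classical_weak_gradient:
 assumes \<phi>: "\<And>x. x \<in> \<Omega> \<Longrightarrow> GDERIV \<phi> x :> g x" "continuous_on \<Omega> g"
  and b: "\<And>x. x \<in> \<Omega> \<Longrightarrow> \<bar>\<phi> x\<bar> \<le> B" "\<And>x. x \<in> \<Omega> \<Longrightarrow> norm (g x) \<le> B"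
 shows "is_weak_gradient \<Omega> \<phi> g"
 unfolding is_weak_gradient_def
proof (intro conjI allI impI ballI)
 have c: "continuous_on \<Omega> \<phi>" using \<phi>(1) by (intro continuous_at_imp_continuous_on ballI GDERIV_isCont)
 have i: "integrable M \<phi>" "integrable M g"
  using b c \<phi>(2) by (auto intro!: bounded_integrable continuous_measurable)
 fix K assume K: "compact K \<and> K \<subseteq> \<Omega>"
 show "\<phi> absolutely_integrable_on K" "g absolutely_integrable_on K"
  using K i by (auto intro!: set_integrable_lebesgue_on[OF \<Omega>_open] simp: borel_compact)
next
 fix \<psi> assume \<psi>: "\<psi> \<in> test_functions \<Omega>"
 note \<psi>1 = test_functions_C1[OF \<psi>]
 have c: "continuous_on \<Omega> \<phi>" using \<phi>(1) by (intro continuous_at_imp_continuous_on ballI GDERIV_isCont)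
 have i: "integrable M (\<lambda>x. \<phi> x *\<^sub>R grad \<psi> x)" "integrable M (\<lambda>x. \<psi> x *\<^sub>R g x)"
 proof -
  have "integrable M (grad \<psi>)" "integrable M \<psi>"
   using Lspace_integrable[OF order_refl] C1_compact_support_Lspace[OF \<psi>1, of 1] by auto
  then show "integrable M (\<lambda>x. \<phi> x *\<^sub>R grad \<psi> x)" "integrable M (\<lambda>x. \<psi> x *\<^sub>R g x)"
   using bounded_mult_integrable[OF _ continuous_measurable[OF c] b(1)]
    bounded_scaleR_integrable[OF _ continuous_measurable[OF \<phi>(2)] b(2)] by blast+
 qed
 note prod = C1_compact_support_mult[OF \<psi>1 \<phi> \<Omega>_open]
 have m: "(\<lambda>x. if x \<in> \<Omega> then \<phi> x *\<^sub>R grad \<psi> x + \<psi> x *\<^sub>R g x else 0) \<in> borel_measurable borel"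
  using prod unfolding C1_compact_support_def by (intro borel_measurable_continuous_onI) blast
 have "(\<integral>x. \<phi> x *\<^sub>R grad \<psi> x + \<psi> x *\<^sub>R g x \<partial>M) = (\<integral>x. (if x \<in> \<Omega> then \<phi> x *\<^sub>R grad \<psi> x + \<psi> x *\<^sub>R g x else 0) \<partial>M)"
  by (intro Bochner_Integration.integral_cong) auto
 also have "\<dots> = 0"
  using integral_gradient_eq_0[OF prod] integral_lebesgue_on_eq_lborel[OF \<Omega>_open m] by simp
 finally show "(\<integral>x. \<phi> x *\<^sub>R grad \<psi> x \<partial>M) = - (\<integral>x. \<psi> x *\<^sub>R g x \<partial>M)"
  using i by (simp add: add_eq_0_iff)
qed

text \<open>Suppose \<open>\<phi> \<ge> m > 0\<close> near \<open>x0\<close>. Over a small piece of the boundary graph let \<open>D\<close> be the part of \<open>\<Omega>\<close> of height less than \<open>h\<close>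
  above the graph. A shift by \<open>h\<close> moves \<open>D\<close> out of \<open>\<Omega>\<close>, where the approximations of \<open>\<phi>\<close> vanish, so the translation
  estimate bounds the integral of \<open>\<phi>\<close> over \<open>D\<close> by \<open>h B |D|\<close>. This is less than \<open>m |D|\<close> for small \<open>h\<close>, a contradiction.\<close>

lemma trace_zero:
 assumes bdry: "C2_boundary \<Omega>" and x0: "x0 \<in> frontier \<Omega>"
  and \<phi>c: "continuous_on (closure \<Omega>) \<phi>" and s: "sobolev0 r \<phi> g" and r1: "1 \<le> r"
  and gb: "\<And>x. x \<in> \<Omega> \<Longrightarrow> norm (g x) \<le> B"
 shows "\<phi> x0 \<le> 0"
proof (rule ccontr)
 assume "\<not> \<phi> x0 \<le> 0"
 define m where "m = \<phi> x0 / 2"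
 have m: "0 < m" using \<open>\<not> \<phi> x0 \<le> 0\<close> by (simp add: m_def)
 have x0c: "x0 \<in> closure \<Omega>" "x0 \<notin> \<Omega>" using x0 \<Omega>_open by (auto simp: frontier_def interior_open)
 obtain R \<nu> \<gamma> where R: "0 < R" and \<nu>: "norm \<nu> = 1" and "Ck 2 \<gamma>"
  and graph: "\<Omega> \<inter> ball x0 R = {x \<in> ball x0 R. \<gamma> (x - (x \<bullet> \<nu>) *\<^sub>R \<nu>) < x \<bullet> \<nu>}"
  using bdry x0 unfolding C2_boundary_def by blast
 then have \<gamma>: "continuous_on UNIV \<gamma>" using Ck_continuous by blast
 define P where "P x = x - (x \<bullet> \<nu>) *\<^sub>R \<nu>" for x
 have P_shift: "P (x + s *\<^sub>R \<nu>) = P x" for x s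
  using \<nu> by (simp add: P_def inner_add_left algebra_simps flip: power2_norm_eq_inner)
 have Pc: "continuous_on UNIV P" unfolding P_def by (intro continuous_intros)
 have \<gamma>P: "continuous_on UNIV (\<lambda>x. \<gamma> (P x))" by (rule continuous_on_compose2[OF \<gamma> Pc]) auto
 have \<gamma>0: "\<gamma> (P x0) = x0 \<bullet> \<nu>"
 proof (rule antisym)
  show "x0 \<bullet> \<nu> \<le> \<gamma> (P x0)"
  proof (rule ccontr)
   assume "\<not> x0 \<bullet> \<nu> \<le> \<gamma> (P x0)"
   then have "x0 \<in> {x \<in> ball x0 R. \<gamma> (x - (x \<bullet> \<nu>) *\<^sub>R \<nu>) < x \<bullet> \<nu>}" using R by (simp add: P_def)
   with graph x0c(2) show False by blast
  qed
  show "\<gamma> (P x0) \<le> x0 \<bullet> \<nu>"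
  proof -
   have cl: "closed {x. \<gamma> (P x) \<le> x \<bullet> \<nu>}"
    using \<gamma>P by (intro closed_Collect_le continuous_intros)
   have "x0 \<in> closure (ball x0 R \<inter> \<Omega>)"
    using open_Int_closure_subset[OF open_ball, of x0 R \<Omega>] x0c(1) R by auto
   moreover have "ball x0 R \<inter> \<Omega> \<subseteq> {x. \<gamma> (P x) \<le> x \<bullet> \<nu>}"
   proof
    fix y assume "y \<in> ball x0 R \<inter> \<Omega>"
    then have "y \<in> {x \<in> ball x0 R. \<gamma> (x - (x \<bullet> \<nu>) *\<^sub>R \<nu>) < x \<bullet> \<nu>}" using graph by blast
    then show "y \<in> {x. \<gamma> (P x) \<le> x \<bullet> \<nu>}" by (simp add: P_def)
   qed
   ultimately have "x0 \<in> {x. \<gamma> (P x) \<le> x \<bullet> \<nu>}"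
    using closure_minimal[OF _ cl] by blast
   then show ?thesis by simp
  qed
 qed
 (* As m is phi x0 / 2, continuity gives phi >= m near x0. *)
 obtain t0 where t0: "0 < t0" "\<And>x. x \<in> closure \<Omega> \<Longrightarrow> dist x x0 < t0 \<Longrightarrow> dist (\<phi> x) (\<phi> x0) < m"
  using \<phi>c x0c(1) m unfolding continuous_on_iff by metis
 define t where "t = min t0 R"
 have t: "0 < t" "t \<le> R" using t0 R by (auto simp: t_def)
 have \<phi>t: "m \<le> \<phi> x" if "x \<in> \<Omega>" "dist x x0 < t" for x
  using t0(2)[of x] that closure_subset[of \<Omega>] by (auto simp: t_def dist_real_def m_def abs_if split: if_splits)
 obtain \<rho>0 where \<rho>0: "0 < \<rho>0" "\<And>y. dist y (P x0) < \<rho>0 \<Longrightarrow> dist (\<gamma> y) (\<gamma> (P x0)) < t / 4"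
  using \<gamma> t unfolding continuous_on_iff by (metis UNIV_I zero_less_divide_iff zero_less_numeral)
 define \<rho> where "\<rho> = min \<rho>0 (t / 4)"
 (* The second bound gives h B < m, the first keeps the layer in the ball where phi >= m. *)
 define h where "h = min (t / 4) (m / (2 * (\<bar>B\<bar> + 1)))"
 have \<rho>: "0 < \<rho>" using \<rho>0 t by (simp add: \<rho>_def)
 have "0 < h" unfolding h_def using t m by (auto intro!: divide_pos_pos add_nonneg_pos)
 moreover have "h \<le> t / 4" unfolding h_def by (rule min.cobounded1)
 ultimately have h: "0 < h" "h \<le> t / 4" by auto
 have hB: "h * \<bar>B\<bar> < m"
 proof -
  have "h * \<bar>B\<bar> \<le> m / (2 * (\<bar>B\<bar> + 1)) * \<bar>B\<bar>" by (intro mult_right_mono) (auto simp: h_def)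
  also have "m * \<bar>B\<bar> < m * (2 * (\<bar>B\<bar> + 1))" using m by (intro mult_strict_left_mono) auto
  then have "m / (2 * (\<bar>B\<bar> + 1)) * \<bar>B\<bar> < m" by (simp add: pos_divide_less_eq)
  finally show ?thesis .
 qed
 (* The layer of height h on both sides of the graph; D is its inner half. *)
 define S where "S = {x. dist (P x) (P x0) < \<rho> \<and> \<gamma> (P x) - h < x \<bullet> \<nu> \<and> x \<bullet> \<nu> < \<gamma> (P x) + h}"
 define D where "D = {x \<in> S. \<gamma> (P x) < x \<bullet> \<nu>}"
 have So: "open S" unfolding S_def
  using \<gamma>P Pc by (intro open_Collect_conj open_Collect_less continuous_intros)
 have "D = S \<inter> {x. \<gamma> (P x) < x \<bullet> \<nu>}" by (auto simp: D_def)
 moreover have "open {x. \<gamma> (P x) < x \<bullet> \<nu>}"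
  using \<gamma>P by (intro open_Collect_less continuous_intros)
 ultimately have Do: "open D" using So by auto
 have Sball: "dist x x0 < t" if "x \<in> S" for x
 proof -
  have "x - x0 = (P x - P x0) + (x \<bullet> \<nu> - x0 \<bullet> \<nu>) *\<^sub>R \<nu>" by (simp add: P_def algebra_simps)
  then have "norm (x - x0) \<le> norm (P x - P x0) + \<bar>x \<bullet> \<nu> - x0 \<bullet> \<nu>\<bar>"
   using norm_triangle_ineq[of "P x - P x0" "(x \<bullet> \<nu> - x0 \<bullet> \<nu>) *\<^sub>R \<nu>"] \<nu> by simp
  moreover have "\<bar>\<gamma> (P x) - x0 \<bullet> \<nu>\<bar> < t / 4"
   using that \<rho>0(2)[of "P x"] \<gamma>0 by (simp add: S_def \<rho>_def dist_real_def)
  moreover have "\<gamma> (P x) - h < x \<bullet> \<nu>" "x \<bullet> \<nu> < \<gamma> (P x) + h" using that by (auto simp: S_def)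
  moreover have "norm (P x - P x0) < t / 4" using that by (auto simp: S_def \<rho>_def dist_norm)
  ultimately have "norm (x - x0) < t" using h(2) by linarith
  then show ?thesis by (simp add: dist_norm)
 qed
 have SR: "x \<in> ball x0 R" if "x \<in> S" for x using Sball[OF that] t by (simp add: dist_commute)
 have D\<Omega>: "D \<subseteq> \<Omega>"
 proof
  fix x assume "x \<in> D"
  then have "x \<in> {x \<in> ball x0 R. \<gamma> (x - (x \<bullet> \<nu>) *\<^sub>R \<nu>) < x \<bullet> \<nu>}" using SR by (auto simp: D_def P_def)
  then show "x \<in> \<Omega>" using graph by blast
 qed
 have S\<Omega>: "x \<in> D" if "x \<in> S" "x \<in> \<Omega>" for x
 proof -
  have "x \<in> \<Omega> \<inter> ball x0 R" using SR[OF that(1)] that(2) by blast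
  then show ?thesis using that(1) graph by (simp add: D_def P_def)
 qed
 have "x0 + (h / 2) *\<^sub>R \<nu> \<in> D"
  using \<rho> h \<gamma>0 \<nu> by (simp add: D_def S_def P_shift inner_add_left flip: power2_norm_eq_inner)
 then have Dne: "D \<noteq> {}" by blast
 have Db: "bounded D" using D\<Omega> \<Omega>_bounded bounded_subset by blast
 have seg: "x + s *\<^sub>R (- h *\<^sub>R \<nu>) \<in> S" if "x \<in> D" "0 \<le> s" "s \<le> 1" for x s
 proof -
  have eq: "x + s *\<^sub>R (- h *\<^sub>R \<nu>) = x + (- (s * h)) *\<^sub>R \<nu>" by simp
  have "(x + (- (s * h)) *\<^sub>R \<nu>) \<bullet> \<nu> = x \<bullet> \<nu> - s * h"
   using \<nu> by (simp add: inner_diff_left flip: power2_norm_eq_inner)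
  moreover have "0 \<le> s * h" "s * h \<le> h" using that h mult_right_mono[of s 1 h] by auto
  moreover have "\<gamma> (P x) < x \<bullet> \<nu>" "x \<bullet> \<nu> < \<gamma> (P x) + h" "dist (P x) (P x0) < \<rho>"
   using that(1) by (auto simp: S_def D_def)
  ultimately have "dist (P x) (P x0) < \<rho> \<and> \<gamma> (P x) - h < (x + (- (s * h)) *\<^sub>R \<nu>) \<bullet> \<nu>
    \<and> (x + (- (s * h)) *\<^sub>R \<nu>) \<bullet> \<nu> < \<gamma> (P x) + h"
   by linarith
  then show ?thesis unfolding eq S_def mem_Collect_eq P_shift .
 qed
 have sh_out: "x + (- h *\<^sub>R \<nu>) \<notin> \<Omega>" if x: "x \<in> D" for x
 proof
  assume "x + (- h *\<^sub>R \<nu>) \<in> \<Omega>"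
  moreover have "x + (- h *\<^sub>R \<nu>) \<in> S" using seg[OF x, of 1] by simp
  ultimately have "x + (- h) *\<^sub>R \<nu> \<in> D" using S\<Omega> by simp
  moreover have "(x + (- h) *\<^sub>R \<nu>) \<bullet> \<nu> = x \<bullet> \<nu> - h"
   using \<nu> by (simp add: inner_diff_left flip: power2_norm_eq_inner)
  ultimately show False using x by (auto simp: D_def S_def P_shift simp del: scaleR_minus_left)
 qed
 obtain w dw where w: "\<And>n. C1_compact_support \<Omega> (w n) (dw n)"
  "Lnull r (\<lambda>n x. w n x - \<phi> x)" "Lnull r (\<lambda>n x. dw n x - g x)"
  using s by (rule sobolev0E) blast
 have r0: "0 < r" using r1 by simp
 have iw: "integrable M (w n)" "integrable M (dw n)" for n
  using Lspace_integrable[OF r1] C1_compact_support_Lspace[OF w(1) r0] by auto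
 have i\<phi>: "integrable M \<phi>" "integrable M g" using Lspace_integrable[OF r1] sobolev0D[OF s] by auto
 have Dl: "D \<in> sets lebesgue" using Do by (rule open_sets_lebesgue)
 (* The shifted point is outside Omega, so w n vanishes there. *)
 have main: "(\<integral>x. indicator D x * \<bar>w n x\<bar> \<partial>M) \<le> h * (\<integral>x. indicator D x * norm (dw n x) \<partial>M)" for n
 proof -
  have dwc: "continuous_on UNIV (dw n)" and der: "\<And>x. GDERIV (w n) x :> dw n x"
   using w(1)[of n] unfolding C1_compact_support_def by auto
  obtain K where K: "compact K" "K \<subseteq> \<Omega>" "\<And>x. x \<notin> K \<Longrightarrow> w n x = 0" "\<And>x. x \<notin> K \<Longrightarrow> dw n x = 0"
   using w(1)[of n] unfolding C1_compact_support_def by blast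
  have wc: "continuous_on UNIV (w n)" using C1_compact_support_continuous[OF w(1)] .
  obtain b1 where b1: "\<And>x. norm (w n x) \<le> b1" using compact_support_bounded[OF wc K(1,3)] by blast
  obtain b2 where b2: "\<And>x. norm (dw n x) \<le> b2" using compact_support_bounded[OF dwc K(1,4)] by blast
  have bm [measurable]: "w n \<in> borel_measurable borel" "dw n \<in> borel_measurable borel"
   using wc dwc by (auto intro: borel_measurable_continuous_onI)
  have "(\<integral>\<^sup>+x. ennreal \<bar>w n x\<bar> * indicator D x \<partial>lborel)
    = (\<integral>\<^sup>+x. ennreal \<bar>w n (x + (- h *\<^sub>R \<nu>)) - w n x\<bar> * indicator D x \<partial>lborel)"
  proof (intro nn_integral_cong)
   fix x
   show "ennreal \<bar>w n x\<bar> * indicator D x = ennreal \<bar>w n (x + (- h *\<^sub>R \<nu>)) - w n x\<bar> * indicator D x"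
   proof (cases "x \<in> D")
    case True
    then have "w n (x + (- h *\<^sub>R \<nu>)) = 0" using sh_out K(2,3) by blast
    then show ?thesis by (simp only: diff_0 abs_minus_cancel)
   qed simp
  qed
  also have "\<dots> \<le> ennreal (norm (- h *\<^sub>R \<nu>)) * (\<integral>\<^sup>+x. ennreal (norm (dw n x)) * indicator S x \<partial>lborel)"
   using Do So der continuous_on_subset[OF dwc] seg by (intro translation_estimate) auto
  also have "(\<integral>\<^sup>+x. ennreal (norm (dw n x)) * indicator S x \<partial>lborel) = (\<integral>\<^sup>+x. ennreal (norm (dw n x)) * indicator D x \<partial>lborel)"
  proof (intro nn_integral_cong)
   fix x
   show "ennreal (norm (dw n x)) * indicator S x = ennreal (norm (dw n x)) * indicator D x"
   proof (cases "x \<in> \<Omega>")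
    case True
    then have "x \<in> S \<longleftrightarrow> x \<in> D" using S\<Omega> D_def by blast
    then show ?thesis by (simp add: indicator_def)
   next
    case False
    then have "dw n x = 0" using K(2,4) by blast
    then show ?thesis by simp
   qed
  qed
  also have "\<dots> = ennreal (\<integral>x. indicator D x * norm (dw n x) \<partial>M)"
   using Do b2 by (intro nn_integral_bounded_eq_integral[OF \<Omega>_open _ _ D\<Omega> Db]) auto
  also have "(\<integral>\<^sup>+x. ennreal \<bar>w n x\<bar> * indicator D x \<partial>lborel) = ennreal (\<integral>x. indicator D x * \<bar>w n x\<bar> \<partial>M)"
   using Do b1 by (intro nn_integral_bounded_eq_integral[OF \<Omega>_open _ _ D\<Omega> Db]) auto
  finally have "ennreal (\<integral>x. indicator D x * \<bar>w n x\<bar> \<partial>M) \<le> ennreal (h * (\<integral>x. indicator D x * norm (dw n x) \<partial>M))"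
   using h \<nu> by (simp add: ennreal_mult')
  then show ?thesis using h by (subst (asm) ennreal_le_iff) auto
 qed
 have indm [measurable]: "indicat_real D \<in> borel_measurable M"
  using Dl by (intro measurable_restrict_space1) simp
 note [measurable] = sobolev0D(3,4)[OF s]
 have [measurable]: "w n \<in> borel_measurable M" "dw n \<in> borel_measurable M" for n
  using iw borel_measurable_integrable by blast+
 have L1: "(\<lambda>n. \<integral>x. indicator D x * \<bar>w n x\<bar> \<partial>M) \<longlonglongrightarrow> (\<integral>x. indicator D x * \<bar>\<phi> x\<bar> \<partial>M)"
 proof (rule Lnull_integral_tendsto[OF r1 Lnull_dominated_by[OF r0 w(2), of _ 1]])
  show "AE x in M. norm (indicator D x * \<bar>w n x\<bar> - indicator D x * \<bar>\<phi> x\<bar>) \<le> 1 * norm (w n x - \<phi> x)" for n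
   by (intro AE_I2) (auto simp: indicator_def)
 qed (use set_M_integrable[OF _ Dl] iw i\<phi> in auto)
 have L2: "(\<lambda>n. \<integral>x. indicator D x * norm (dw n x) \<partial>M) \<longlonglongrightarrow> (\<integral>x. indicator D x * norm (g x) \<partial>M)"
 proof (rule Lnull_integral_tendsto[OF r1 Lnull_dominated_by[OF r0 w(3), of _ 1]])
  show "AE x in M. norm (indicator D x * norm (dw n x) - indicator D x * norm (g x)) \<le> 1 * norm (dw n x - g x)" for n
   by (intro AE_I2) (auto simp: indicator_def norm_triangle_ineq3)
 qed (use set_M_integrable[OF _ Dl] iw i\<phi> in auto)
 have le: "(\<integral>x. indicator D x * \<bar>\<phi> x\<bar> \<partial>M) \<le> h * (\<integral>x. indicator D x * norm (g x) \<partial>M)"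
  by (rule LIMSEQ_le[OF L1 tendsto_mult_left[OF L2]]) (use main in auto)
 have iD: "integrable M (indicat_real D)"
  using set_M_integrable[of "\<lambda>_. 1", OF _ Dl] by simp
 have "m * (\<integral>x. indicat_real D x \<partial>M) \<le> (\<integral>x. indicator D x * \<bar>\<phi> x\<bar> \<partial>M)"
 proof -
  have "(\<integral>x. m * indicator D x \<partial>M) \<le> (\<integral>x. indicator D x * \<bar>\<phi> x\<bar> \<partial>M)"
  proof (rule integral_mono)
   show "m * indicator D x \<le> indicator D x * \<bar>\<phi> x\<bar>" for x
    using \<phi>t[of x] Sball[of x] D\<Omega> m by (auto simp: D_def indicator_def)
  qed (use iD set_M_integrable[OF _ Dl] i\<phi> in auto)
  then show ?thesis by simp
 qed
 moreover have "(\<integral>x. indicator D x * norm (g x) \<partial>M) \<le> \<bar>B\<bar> * (\<integral>x. indicat_real D x \<partial>M)"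
 proof -
  have "(\<integral>x. indicator D x * norm (g x) \<partial>M) \<le> (\<integral>x. \<bar>B\<bar> * indicator D x \<partial>M)"
  proof (rule integral_mono)
   show "indicator D x * norm (g x) \<le> \<bar>B\<bar> * indicator D x" for x
    using gb[of x] D\<Omega> by (cases "x \<in> D") auto
  qed (use iD set_M_integrable[OF _ Dl] i\<phi> in auto)
  then show ?thesis by simp
 qed
 ultimately have "m * (\<integral>x. indicat_real D x \<partial>M) \<le> h * \<bar>B\<bar> * (\<integral>x. indicat_real D x \<partial>M)"
  using le h by (smt (verit) mult.assoc mult_left_mono)
 moreover have "0 < (\<integral>x. indicat_real D x \<partial>M)"
 proof -
  have "(\<integral>x. indicat_real D x \<partial>M) = (\<integral>x. indicat_real D x \<partial>lborel)"
   using Do D\<Omega> by (intro integral_lebesgue_on_eq_lborel[OF \<Omega>_open, of "indicat_real D"]) (auto simp: indicator_def)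
  also have "\<dots> = measure lborel D" using Do by simp
  also have "\<dots> > 0"
  proof -
   have "emeasure lborel D \<noteq> 0"
    using open_not_negligible[OF Do Dne] Do by (auto simp: negligible_iff_emeasure0 emeasure_completion)
   then show ?thesis
    using emeasure_bounded_finite[OF Db] by (simp add: measure_def enn2real_positive_iff zero_less_iff_neq_zero)
  qed
  finally show ?thesis .
 qed
 ultimately show False using hB by (smt (verit) mult_right_mono mult_strict_right_mono)
qed

lemma vanish_from_frontier:
 assumes \<phi>c: "continuous_on (closure \<Omega>) \<phi>" and fr: "\<And>x. x \<in> frontier \<Omega> \<Longrightarrow> \<phi> x \<le> 0" and k: "0 < k"
 shows "\<exists>K. compact K \<and> K \<subseteq> \<Omega> \<and> (\<forall>x\<in>\<Omega> - K. \<phi> x \<le> (k::real))"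
proof (intro exI conjI)
 let ?K = "closure \<Omega> \<inter> {x \<in> closure \<Omega>. k \<le> \<phi> x}"
 have "closed {x \<in> closure \<Omega>. k \<le> \<phi> x}"
  using continuous_closed_preimage[OF \<phi>c closed_closure, of "{k..}"] by (simp add: vimage_def Int_def)
 then show "compact ?K"
  using compact_closure[of \<Omega>] \<Omega>_bounded by (intro compact_Int_closed) auto
 show "?K \<subseteq> \<Omega>"
 proof
  fix x assume x: "x \<in> ?K"
  show "x \<in> \<Omega>"
  proof (rule ccontr)
   assume "x \<notin> \<Omega>"
   then have "x \<in> frontier \<Omega>" using x \<Omega>_open by (auto simp: frontier_def interior_open)
   with fr x k show False by fastforce
  qed
 qed
 show "\<forall>x\<in>\<Omega> - ?K. \<phi> x \<le> k" using closure_subset[of \<Omega>] by fastforce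
qed

end

section \<open>Integral estimates by translation\<close>

text \<open>Compare \<open>H\<close> on \<open>A\<close> with its translates by vectors of length less than \<open>s\<close>: the error is at most \<open>s\<close> times the gradient
  integral, and the average of the translates at any point is at most the integral of \<open>H\<close> divided by the volume of the ball.\<close>

lemma set_average_bound:
 fixes H :: "'a::euclidean_space \<Rightarrow> real" and dH :: "'a \<Rightarrow> 'a"
 assumes H: "C1_compact_support \<Omega> H dH" and nn: "\<And>x. 0 \<le> H x" and A [measurable]: "A \<in> sets borel" and s: "0 < s"
 shows "emeasure lborel (ball (0::'a) s) * (\<integral>\<^sup>+x. ennreal (H x) * indicator A x \<partial>lborel)
  \<le> emeasure lborel (ball (0::'a) s) * (ennreal s * (\<integral>\<^sup>+x. ennreal (norm (dH x)) \<partial>lborel))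
   + emeasure lborel A * (\<integral>\<^sup>+x. ennreal (H x) \<partial>lborel)"
proof -
 have der: "\<And>x. GDERIV H x :> dH x" and cd: "continuous_on UNIV dH"
  using H unfolding C1_compact_support_def by auto
 have [measurable]: "H \<in> borel_measurable borel" "dH \<in> borel_measurable borel"
  using C1_compact_support_continuous[OF H] cd by (auto intro: borel_measurable_continuous_onI)
 have [measurable]: "ball (0::'a) s \<in> sets borel" by simp
 define I where "I = (\<integral>\<^sup>+x. ennreal (norm (dH x)) \<partial>lborel)"
 have pt: "(\<integral>\<^sup>+x. ennreal (H x) * indicator A x \<partial>lborel)
   \<le> ennreal s * I + (\<integral>\<^sup>+x. ennreal (H (x + y)) * indicator A x \<partial>lborel)" if y: "y \<in> ball 0 s" for y
 proof -
  have "(\<integral>\<^sup>+x. ennreal (H x) * indicator A x \<partial>lborel)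
    \<le> (\<integral>\<^sup>+x. ennreal \<bar>H (x + y) - H x\<bar> * indicator A x + ennreal (H (x + y)) * indicator A x \<partial>lborel)"
   by (intro nn_integral_mono) (auto simp: indicator_def nn simp flip: ennreal_plus intro!: ennreal_leI)
  also have "\<dots> = (\<integral>\<^sup>+x. ennreal \<bar>H (x + y) - H x\<bar> * indicator A x \<partial>lborel) + (\<integral>\<^sup>+x. ennreal (H (x + y)) * indicator A x \<partial>lborel)"
   by (intro nn_integral_add) measurable
  also have "(\<integral>\<^sup>+x. ennreal \<bar>H (x + y) - H x\<bar> * indicator A x \<partial>lborel) \<le> ennreal (norm y) * I"
   using translation_estimate[of A UNIV H dH y] der cd by (simp add: I_def)
  also have "ennreal (norm y) * I \<le> ennreal s * I"
   using y by (intro mult_right_mono ennreal_leI) auto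
  finally show ?thesis by (simp add: add_right_mono)
 qed
 have "emeasure lborel (ball (0::'a) s) * (\<integral>\<^sup>+x. ennreal (H x) * indicator A x \<partial>lborel)
   = (\<integral>\<^sup>+y. (\<integral>\<^sup>+x. ennreal (H x) * indicator A x \<partial>lborel) * indicator (ball (0::'a) s) y \<partial>lborel)"
  by (subst nn_integral_cmult_indicator) (auto simp: mult.commute)
 also have "\<dots> \<le> (\<integral>\<^sup>+y. ennreal s * I * indicator (ball (0::'a) s) y + (\<integral>\<^sup>+x. ennreal (H (x + y)) * indicator A x \<partial>lborel) \<partial>lborel)"
  by (intro nn_integral_mono) (use pt in \<open>auto simp: indicator_def\<close>)
 also have "\<dots> = ennreal s * I * emeasure lborel (ball (0::'a) s) + (\<integral>\<^sup>+y. (\<integral>\<^sup>+x. ennreal (H (x + y)) * indicator A x \<partial>lborel) \<partial>lborel)"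
  by (subst nn_integral_add) (auto simp: nn_integral_cmult_indicator)
 also have "(\<integral>\<^sup>+y. (\<integral>\<^sup>+x. ennreal (H (x + y)) * indicator A x \<partial>lborel) \<partial>lborel)
   = (\<integral>\<^sup>+x. (\<integral>\<^sup>+y. ennreal (H (x + y)) * indicator A x \<partial>lborel) \<partial>lborel)"
  by (rule lborel_pair.Fubini') measurable
 also have "\<dots> = (\<integral>\<^sup>+x. (\<integral>\<^sup>+y. ennreal (H y) \<partial>lborel) * indicator A x \<partial>lborel)"
 proof (intro nn_integral_cong)
  fix x
  show "(\<integral>\<^sup>+y. ennreal (H (x + y)) * indicator A x \<partial>lborel) = (\<integral>\<^sup>+y. ennreal (H y) \<partial>lborel) * indicator A x"
   using nn_integral_lborel_translate[of "\<lambda>y. ennreal (H y)" x]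
   by (subst nn_integral_multc) (auto simp: add.commute)
 qed
 also have "\<dots> = emeasure lborel A * (\<integral>\<^sup>+x. ennreal (H x) \<partial>lborel)"
  by (subst nn_integral_cmult_indicator) (auto simp: mult.commute)
 finally show ?thesis by (simp add: I_def mult_ac)
qed

text \<open>Translation by \<open>y - x\<close>, which has length less than \<open>2 * R\<close>, for each pair of points in the ball. The tripled ball
  gives the segments room.\<close>

lemma poincare_double_integral:
 fixes z :: "'a::euclidean_space \<Rightarrow> real" and dz :: "'a \<Rightarrow> 'a"
 assumes R: "0 < R" and der: "\<And>x. x \<in> ball x0 (3 * R) \<Longrightarrow> GDERIV z x :> dz x"
  and cont: "continuous_on (ball x0 (3 * R)) dz"
 shows "(\<integral>\<^sup>+x. (\<integral>\<^sup>+y. ennreal \<bar>z x - z y\<bar> * indicator (ball x0 R) y \<partial>lborel) * indicator (ball x0 R) x \<partial>lborel)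
  \<le> ennreal (2 * R) * emeasure lborel (ball (0::'a) (2 * R)) *
    (\<integral>\<^sup>+x. ennreal (norm (dz x)) * indicator (ball x0 (3 * R)) x \<partial>lborel)"
proof -
 let ?W = "ball x0 (3 * R)" and ?B = "ball x0 R" and ?V = "ball (0::'a) (2 * R)"
 define I where "I = (\<integral>\<^sup>+x. ennreal (norm (dz x)) * indicator ?W x \<partial>lborel)"
 have cz: "continuous_on ?W z"
  using der by (intro continuous_at_imp_continuous_on ballI GDERIV_isCont)
 have [measurable]: "?B \<in> sets borel" "?V \<in> sets borel" by simp_all
 define zt where "zt x = indicator ?W x *\<^sub>R z x" for x
 have [measurable]: "zt \<in> borel_measurable borel"
  unfolding zt_def by (rule borel_measurable_continuous_on_indicator[OF _ cz]) auto
 have BV: "x + v \<in> ?W" if "x \<in> ?B" "norm v < 2 * R" for x v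
  using that norm_triangle_ineq[of "x - x0" v] by (auto simp: dist_norm norm_minus_commute algebra_simps)
 have inB: "x \<in> ?W" if "x \<in> ?B" for x using that R by auto
 have "(\<integral>\<^sup>+x. (\<integral>\<^sup>+y. ennreal \<bar>z x - z y\<bar> * indicator ?B y \<partial>lborel) * indicator ?B x \<partial>lborel)
  \<le> (\<integral>\<^sup>+x. (\<integral>\<^sup>+v. ennreal \<bar>zt (x + v) - zt x\<bar> * indicator ?V v * indicator ?B x \<partial>lborel) \<partial>lborel)"
 proof (intro nn_integral_mono)
  fix x
  show "(\<integral>\<^sup>+y. ennreal \<bar>z x - z y\<bar> * indicator ?B y \<partial>lborel) * indicator ?B x
   \<le> (\<integral>\<^sup>+v. ennreal \<bar>zt (x + v) - zt x\<bar> * indicator ?V v * indicator ?B x \<partial>lborel)"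
  proof (cases "x \<in> ?B")
   case True
   have "(\<integral>\<^sup>+y. ennreal \<bar>z x - z y\<bar> * indicator ?B y \<partial>lborel)
     = (\<integral>\<^sup>+y. ennreal \<bar>zt x - zt y\<bar> * indicator ?B y \<partial>lborel)"
    using inB True by (intro nn_integral_cong) (auto simp: zt_def indicator_def)
   also have "\<dots> = (\<integral>\<^sup>+v. ennreal \<bar>zt x - zt (v + x)\<bar> * indicator ?B (v + x) \<partial>lborel)"
    by (rule nn_integral_lborel_translate[symmetric]) measurable
   also have "\<dots> \<le> (\<integral>\<^sup>+v. ennreal \<bar>zt (x + v) - zt x\<bar> * indicator ?V v * indicator ?B x \<partial>lborel)"
   proof (intro nn_integral_mono)
    fix v :: 'a
    have "norm v < 2 * R" if "v + x \<in> ?B"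
    proof -
     have "norm ((v + x - x0) - (x - x0)) \<le> norm (v + x - x0) + norm (x - x0)" by (rule norm_triangle_ineq4)
     moreover have "norm (v + x - x0) < R" "norm (x - x0) < R"
      using that True by (auto simp: dist_norm norm_minus_commute)
     ultimately show ?thesis by simp
    qed
    then show "ennreal \<bar>zt x - zt (v + x)\<bar> * indicator ?B (v + x) \<le> ennreal \<bar>zt (x + v) - zt x\<bar> * indicator ?V v * indicator ?B x"
     using True by (cases "v + x \<in> ?B") (auto simp: add.commute abs_minus_commute)
   qed
   finally show ?thesis using True by simp
  qed simp
 qed
 also have "\<dots> = (\<integral>\<^sup>+v. (\<integral>\<^sup>+x. ennreal \<bar>zt (x + v) - zt x\<bar> * indicator ?V v * indicator ?B x \<partial>lborel) \<partial>lborel)"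
  by (rule lborel_pair.Fubini') measurable
 also have "\<dots> \<le> (\<integral>\<^sup>+v. ennreal (2 * R) * I * indicator ?V v \<partial>lborel)"
 proof (intro nn_integral_mono)
  fix v :: 'a
  show "(\<integral>\<^sup>+x. ennreal \<bar>zt (x + v) - zt x\<bar> * indicator ?V v * indicator ?B x \<partial>lborel) \<le> ennreal (2 * R) * I * indicator ?V v"
  proof (cases "v \<in> ?V")
   case True
   then have v: "norm v < 2 * R" by simp
   have "(\<integral>\<^sup>+x. ennreal \<bar>zt (x + v) - zt x\<bar> * indicator ?V v * indicator ?B x \<partial>lborel)
     = (\<integral>\<^sup>+x. ennreal \<bar>z (x + v) - z x\<bar> * indicator ?B x \<partial>lborel)"
    using True BV[OF _ v] inB by (intro nn_integral_cong) (auto simp: zt_def indicator_def)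
   also have "\<dots> \<le> ennreal (norm v) * I"
    unfolding I_def
   proof (rule translation_estimate[OF _ _ der cont])
    fix x and t :: real assume x: "x \<in> ?B" and t: "0 \<le> t" "t \<le> 1"
    have "norm (t *\<^sub>R v) \<le> 1 * norm v" using t mult_right_mono[OF t(2), of "norm v"] by simp
    then show "x + t *\<^sub>R v \<in> ?W" using v x by (intro BV) auto
   qed auto
   also have "\<dots> \<le> ennreal (2 * R) * I" using v by (intro mult_right_mono ennreal_leI) auto
   finally show ?thesis using True by simp
  qed simp
 qed
 also have "\<dots> = ennreal (2 * R) * emeasure lborel ?V * I"
  by (subst nn_integral_cmult_indicator) (auto simp: mult_ac)
 finally show ?thesis by (simp add: I_def)
qed

context bounded_open
begin

lemma measure_M: "A \<in> sets lebesgue \<Longrightarrow> A \<subseteq> \<Omega> \<Longrightarrow> measure M A = measure lebesgue A"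
 by (simp add: measure_restrict_space)

lemma integral_indicator_M:
 assumes "A \<in> sets lebesgue" "A \<subseteq> \<Omega>"
 shows "(\<integral>x. indicator A x \<partial>M) = measure lebesgue A"
proof -
 have "A \<in> sets M" using assms by (auto simp: sets_restrict_space)
 then have "(\<integral>x. indicator A x \<partial>M) = measure M A"
  using assms(2) by (simp add: Int_absorb2 Int_absorb1)
 then show ?thesis using measure_M[OF assms] by simp
qed

lemma indicator_M_measurable [measurable]: "A \<in> sets lebesgue \<Longrightarrow> indicat_real A \<in> borel_measurable M"
 by (intro measurable_restrict_space1) simp

lemma ball_pos: "0 < R \<Longrightarrow> 0 < measure lborel (ball (x0::'a) R)"
 by (rule content_ball_pos)

lemma C1_set_bound:
 assumes H: "C1_compact_support \<Omega> H dH" and nn: "\<And>x. 0 \<le> H x" and A: "A \<in> sets lebesgue" "A \<subseteq> \<Omega>" and s: "0 < s"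
 shows "(\<integral>x. indicator A x * H x \<partial>M) \<le> s * (\<integral>x. norm (dH x) \<partial>M)
   + measure lebesgue A / measure lborel (ball (0::'a) s) * (\<integral>x. H x \<partial>M)"
proof -
 define b where "b = measure lborel (ball (0::'a) s)"
 have b: "0 < b" using s ball_pos by (simp add: b_def)
 have eb: "emeasure lborel (ball (0::'a) s) = ennreal b"
  unfolding b_def using emeasure_bounded_finite[OF bounded_ball, of "0::'a" s] by (simp add: emeasure_eq_ennreal_measure less_top)
 obtain A0 where A0: "A \<subseteq> A0" "A0 \<in> sets lborel" "emeasure lebesgue A = emeasure lborel A0"
  by (rule completion_upper[OF A(1)]) blast
 define A' where "A' = A0 \<inter> \<Omega>"
 have A': "A \<subseteq> A'" "A' \<in> sets borel" "A' \<subseteq> \<Omega>" using A0 A(2) \<Omega>_open by (auto simp: A'_def)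
 have A'b: "bounded A'" using A'(3) \<Omega>_bounded bounded_subset by blast
 have le1: "emeasure lborel A' \<le> emeasure lebesgue A"
  unfolding A0(3) A'_def using A0(2) by (intro emeasure_mono) auto
 have fin: "emeasure lebesgue A < \<infinity>"
  using emeasure_mono[of A \<Omega> lebesgue] A(2) lmeasurable_open[OF \<Omega>_bounded \<Omega>_open]
  by (auto simp: fmeasurable_def intro: le_less_trans)
 have eA: "emeasure lborel A' \<le> ennreal (measure lebesgue A)"
  using le1 fin by (simp add: emeasure_eq_ennreal_measure less_top)
 have der: "\<And>x. GDERIV H x :> dH x" and cd: "continuous_on UNIV dH"
  using H unfolding C1_compact_support_def by auto
 have ch: "continuous_on UNIV H" using C1_compact_support_continuous[OF H] .
 obtain K where K: "compact K" "K \<subseteq> \<Omega>" "\<And>x. x \<notin> K \<Longrightarrow> H x = 0" "\<And>x. x \<notin> K \<Longrightarrow> dH x = 0"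
  using H unfolding C1_compact_support_def by blast
 obtain b1 where b1: "\<And>x. norm (H x) \<le> b1" using compact_support_bounded[OF ch K(1,3)] by blast
 obtain b2 where b2: "\<And>x. norm (dH x) \<le> b2" using compact_support_bounded[OF cd K(1,4)] by blast
 have [measurable]: "H \<in> borel_measurable borel" "dH \<in> borel_measurable borel"
  using ch cd by (auto intro: borel_measurable_continuous_onI)
 have iH: "integrable M H" "integrable M (\<lambda>x. norm (dH x))"
  using Lspace_integrable[OF order_refl] C1_compact_support_Lspace[OF H, of 1] by auto
 have 1: "(\<integral>\<^sup>+x. ennreal (H x) * indicator A' x \<partial>lborel) = ennreal (\<integral>x. indicator A' x * H x \<partial>M)"
  using A' b1 nn by (intro nn_integral_bounded_eq_integral[OF \<Omega>_open _ _ A'(3) A'b]) (auto intro: order_trans[OF abs_ge_self])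
 have full: "(\<integral>\<^sup>+x. ennreal (f x) \<partial>lborel) = ennreal (\<integral>x. f x \<partial>M)"
  if [measurable]: "f \<in> borel_measurable borel" and f: "\<And>x. 0 \<le> f x" "\<And>x. f x \<le> c" "\<And>x. x \<notin> K \<Longrightarrow> f x = 0" for f :: "'a \<Rightarrow> real" and c
 proof -
  have "(\<integral>\<^sup>+x. ennreal (f x) \<partial>lborel) = (\<integral>\<^sup>+x. ennreal (f x) * indicator \<Omega> x \<partial>lborel)"
  proof (intro nn_integral_cong)
   fix x
   have "f x = 0" if "x \<notin> \<Omega>" using f(3) K(2) that by blast
   then show "ennreal (f x) = ennreal (f x) * indicator \<Omega> x" by (auto simp: indicator_def)
  qed
  also have "\<dots> = ennreal (\<integral>x. indicator \<Omega> x * f x \<partial>M)"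
   using f \<Omega>_open by (intro nn_integral_bounded_eq_integral[OF \<Omega>_open _ _ order_refl \<Omega>_bounded]) auto
  also have "(\<integral>x. indicator \<Omega> x * f x \<partial>M) = (\<integral>x. f x \<partial>M)"
   by (intro Bochner_Integration.integral_cong) auto
  finally show ?thesis .
 qed
 have 2: "(\<integral>\<^sup>+x. ennreal (norm (dH x)) \<partial>lborel) = ennreal (\<integral>x. norm (dH x) \<partial>M)"
  using b2 K(4) by (intro full) auto
 have 3: "(\<integral>\<^sup>+x. ennreal (H x) \<partial>lborel) = ennreal (\<integral>x. H x \<partial>M)"
  using b1 K(3) nn by (intro full[of _ b1]) (auto intro: order_trans[OF abs_ge_self])
 have J: "0 \<le> (\<integral>x. H x \<partial>M)" "0 \<le> (\<integral>x. norm (dH x) \<partial>M)" "0 \<le> (\<integral>x. indicator A' x * H x \<partial>M)"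
  using nn by (auto intro!: Bochner_Integration.integral_nonneg)
 have "ennreal b * ennreal (\<integral>x. indicator A' x * H x \<partial>M)
   \<le> ennreal b * (ennreal s * ennreal (\<integral>x. norm (dH x) \<partial>M)) + emeasure lborel A' * ennreal (\<integral>x. H x \<partial>M)"
  using set_average_bound[OF H nn A'(2) s] unfolding eb 1 2 3 .
 also have "\<dots> \<le> ennreal b * (ennreal s * ennreal (\<integral>x. norm (dH x) \<partial>M)) + ennreal (measure lebesgue A) * ennreal (\<integral>x. H x \<partial>M)"
  using eA by (intro add_left_mono mult_right_mono) auto
 also have "\<dots> = ennreal (b * (s * (\<integral>x. norm (dH x) \<partial>M)) + measure lebesgue A * (\<integral>x. H x \<partial>M))"
  using b s J by (simp add: ennreal_mult' ennreal_plus flip: ennreal_mult')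
 finally have "b * (\<integral>x. indicator A' x * H x \<partial>M) \<le> b * (s * (\<integral>x. norm (dH x) \<partial>M)) + measure lebesgue A * (\<integral>x. H x \<partial>M)"
 proof -
  assume "ennreal b * ennreal (\<integral>x. indicator A' x * H x \<partial>M)
   \<le> ennreal (b * (s * (\<integral>x. norm (dH x) \<partial>M)) + measure lebesgue A * (\<integral>x. H x \<partial>M))"
  then have "ennreal (b * (\<integral>x. indicator A' x * H x \<partial>M))
   \<le> ennreal (b * (s * (\<integral>x. norm (dH x) \<partial>M)) + measure lebesgue A * (\<integral>x. H x \<partial>M))"
   using b by (simp add: ennreal_mult')
  then show ?thesis using b s J by (subst (asm) ennreal_le_iff) auto
 qed
 then have "(\<integral>x. indicator A' x * H x \<partial>M) \<le> s * (\<integral>x. norm (dH x) \<partial>M) + measure lebesgue A / b * (\<integral>x. H x \<partial>M)"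
  using b by (simp add: field_simps)
 moreover have "(\<integral>x. indicator A x * H x \<partial>M) \<le> (\<integral>x. indicator A' x * H x \<partial>M)"
  using A A' nn iH(1) by (intro integral_mono set_M_integrable) (auto simp: indicator_def)
 ultimately show ?thesis by (simp add: b_def)
qed

lemma powr_norm_triangle:
 fixes a b :: "'b::real_normed_vector"
 assumes "0 \<le> q"
 shows "norm a powr q \<le> 2 powr q * (norm b powr q + norm (b - a) powr q)"
proof -
 have "norm a \<le> norm b + norm (b - a)" using norm_triangle_ineq4[of b "b - a"] by simp
 then have "norm a powr q \<le> (norm b + norm (b - a)) powr q" using assms by (intro powr_mono2) auto
 also have "\<dots> \<le> 2 powr q * (norm b powr q + norm (b - a) powr q)" using assms by (intro powr_add_le) auto
 finally show ?thesis .
qed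

text \<open>The average bound applied to \<open>|h|^q\<close>, whose gradient is controlled by Young's inequality. Choosing first the
  radius \<open>s\<close> and then \<open>\<nu>\<close> makes both terms small. It does the work of the compact embedding of \<open>W01 \<Omega> q\<close>
  into \<open>L\<^sup>q\<close>.\<close>

lemma uniform_integrability:
 assumes q: "1 < q" and \<eta>: "0 < \<eta>"
 obtains \<nu> where "0 < \<nu>"
  "\<And>u D A. sobolev0 q u D \<Longrightarrow> A \<in> sets lebesgue \<Longrightarrow> A \<subseteq> \<Omega> \<Longrightarrow> measure lebesgue A \<le> \<nu> \<Longrightarrow>
   (\<integral>x. indicator A x * \<bar>u x\<bar> powr q \<partial>M) \<le> \<eta> * ((\<integral>x. \<bar>u x\<bar> powr q \<partial>M) + (\<integral>x. norm (D x) powr q \<partial>M))"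
proof -
 define K where "K = 2 powr q"
 have K: "0 < K" by (simp add: K_def)
 define \<kappa> where "\<kappa> = \<eta> / (K * K)"
 have \<kappa>: "0 < \<kappa>" using \<eta> K by (simp add: \<kappa>_def)
 define s where "s = \<kappa> / (2 * q)"
 have s: "0 < s" using \<kappa> q by (simp add: s_def)
 define b where "b = measure lborel (ball (0::'a) s)"
 have b: "0 < b" using s ball_pos by (simp add: b_def)
 define \<nu> where "\<nu> = \<kappa> * b / 2"
 have \<nu>: "0 < \<nu>" using \<kappa> b by (simp add: \<nu>_def)
 have q0: "0 < q" using q by simp
 have smooth: "(\<integral>x. indicator A x * \<bar>h x\<bar> powr q \<partial>M) \<le> \<kappa> * ((\<integral>x. \<bar>h x\<bar> powr q \<partial>M) + (\<integral>x. norm (g x) powr q \<partial>M))"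
  if h: "C1_compact_support \<Omega> h g" and A: "A \<in> sets lebesgue" "A \<subseteq> \<Omega>" "measure lebesgue A \<le> \<nu>" for h g A
 proof -
  let ?F' = "\<lambda>t. q * max 0 t powr (q - 1) - q * max 0 (- t) powr (q - 1)"
  have H: "C1_compact_support \<Omega> (\<lambda>x. \<bar>h x\<bar> powr q) (\<lambda>x. ?F' (h x) *\<^sub>R g x)"
  proof (rule C1_compact_support_compose[OF h abs_powr_deriv[OF q]])
   show "continuous_on UNIV ?F'"
    using q by (intro continuous_intros continuous_on_powr') auto
  qed simp
  have F'b: "\<bar>?F' t\<bar> = q * \<bar>t\<bar> powr (q - 1)" for t
   using q by (cases "0 \<le> t") (auto simp: abs_mult)
  note hL = LspaceD[OF C1_compact_support_Lspace(1)[OF h q0]]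
  note gL = LspaceD[OF C1_compact_support_Lspace(2)[OF h q0]]
  have ih: "integrable M (\<lambda>x. \<bar>h x\<bar> powr q)" "integrable M (\<lambda>x. norm (g x) powr q)"
   using hL gL by auto
  have "(\<integral>x. norm (?F' (h x) *\<^sub>R g x) \<partial>M) \<le> (\<integral>x. q * (\<bar>h x\<bar> powr q + norm (g x) powr q) \<partial>M)"
  proof (rule integral_mono)
   show "integrable M (\<lambda>x. norm (?F' (h x) *\<^sub>R g x))"
    by (rule integrable_norm[OF Lspace_integrable[OF order_refl C1_compact_support_Lspace(2)[OF H]]]) simp
   show "norm (?F' (h x) *\<^sub>R g x) \<le> q * (\<bar>h x\<bar> powr q + norm (g x) powr q)" for x
    using young_with_constant[of "\<bar>h x\<bar>" "norm (g x)" 1 q] q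
    by (simp only: norm_scaleR real_norm_def F'b) (simp add: mult.assoc)
  qed (use ih in auto)
  also have "\<dots> = q * ((\<integral>x. \<bar>h x\<bar> powr q \<partial>M) + (\<integral>x. norm (g x) powr q \<partial>M))" using ih by simp
  finally have 1: "(\<integral>x. norm (?F' (h x) *\<^sub>R g x) \<partial>M) \<le> q * ((\<integral>x. \<bar>h x\<bar> powr q \<partial>M) + (\<integral>x. norm (g x) powr q \<partial>M))" .
  have J: "0 \<le> (\<integral>x. \<bar>h x\<bar> powr q \<partial>M)" "0 \<le> (\<integral>x. norm (g x) powr q \<partial>M)"
   by (auto intro!: Bochner_Integration.integral_nonneg)
  have "(\<integral>x. indicator A x * \<bar>h x\<bar> powr q \<partial>M)
   \<le> s * (\<integral>x. norm (?F' (h x) *\<^sub>R g x) \<partial>M) + measure lebesgue A / b * (\<integral>x. \<bar>h x\<bar> powr q \<partial>M)"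
   unfolding b_def using A s by (intro C1_set_bound[OF H]) auto
  also have "\<dots> \<le> s * (q * ((\<integral>x. \<bar>h x\<bar> powr q \<partial>M) + (\<integral>x. norm (g x) powr q \<partial>M))) + \<nu> / b * (\<integral>x. \<bar>h x\<bar> powr q \<partial>M)"
   using 1 s A b J by (intro add_mono mult_left_mono mult_right_mono divide_right_mono) auto
  also have "\<dots> = \<kappa> / 2 * ((\<integral>x. \<bar>h x\<bar> powr q \<partial>M) + (\<integral>x. norm (g x) powr q \<partial>M)) + \<kappa> / 2 * (\<integral>x. \<bar>h x\<bar> powr q \<partial>M)"
   using q b by (simp add: s_def \<nu>_def)
  also have "\<dots> \<le> \<kappa> * ((\<integral>x. \<bar>h x\<bar> powr q \<partial>M) + (\<integral>x. norm (g x) powr q \<partial>M))"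
   using J \<kappa> by (simp add: field_simps)
  finally show ?thesis .
 qed
 show ?thesis
 proof (rule that[OF \<nu>])
  fix u D A
  assume u: "sobolev0 q u D" and A: "A \<in> sets lebesgue" "A \<subseteq> \<Omega>" "measure lebesgue A \<le> \<nu>"
  obtain h g where hg: "\<And>n. C1_compact_support \<Omega> (h n) (g n)"
   "Lnull q (\<lambda>n x. h n x - u x)" "Lnull q (\<lambda>n x. g n x - D x)"
   using u by (rule sobolev0E) blast
  define e where "e = (\<lambda>n. \<integral>x. norm (h n x - u x) powr q \<partial>M)"
  define e' where "e' = (\<lambda>n. \<integral>x. norm (g n x - D x) powr q \<partial>M)"
  have e: "e \<longlonglongrightarrow> 0" "e' \<longlonglongrightarrow> 0" using LnullD(2)[OF hg(2)] LnullD(2)[OF hg(3)] by (auto simp: e_def e'_def)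
  have iu: "integrable M (\<lambda>x. \<bar>u x\<bar> powr q)" "integrable M (\<lambda>x. norm (D x) powr q)"
   using LspaceD(2)[OF sobolev0D(1)[OF u]] LspaceD(2)[OF sobolev0D(2)[OF u]] by auto
  have ih: "integrable M (\<lambda>x. \<bar>h n x\<bar> powr q)" "integrable M (\<lambda>x. norm (g n x) powr q)" for n
   using LspaceD(2)[OF C1_compact_support_Lspace(1)[OF hg(1) q0]] LspaceD(2)[OF C1_compact_support_Lspace(2)[OF hg(1) q0]] by auto
  have ie: "integrable M (\<lambda>x. \<bar>h n x - u x\<bar> powr q)" "integrable M (\<lambda>x. norm (g n x - D x) powr q)" for n
   using LspaceD(2)[OF LnullD(1)[OF hg(2)]] LspaceD(2)[OF LnullD(1)[OF hg(3)]] by auto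
  define T where "T = (\<integral>x. \<bar>u x\<bar> powr q \<partial>M) + (\<integral>x. norm (D x) powr q \<partial>M)"
  have bound: "(\<integral>x. indicator A x * \<bar>u x\<bar> powr q \<partial>M) \<le> K * (\<kappa> * (K * (T + e n + e' n)) + e n)" for n
  proof -
   have "(\<integral>x. indicator A x * \<bar>u x\<bar> powr q \<partial>M) \<le> (\<integral>x. K * (indicator A x * \<bar>h n x\<bar> powr q + \<bar>h n x - u x\<bar> powr q) \<partial>M)"
   proof (rule integral_mono)
    show "indicator A x * \<bar>u x\<bar> powr q \<le> K * (indicator A x * \<bar>h n x\<bar> powr q + \<bar>h n x - u x\<bar> powr q)" for x
     using powr_norm_triangle[of q "u x" "h n x"] q by (auto simp: indicator_def K_def)
   qed (use set_M_integrable[OF _ A(1)] iu ih ie in auto)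
   also have "\<dots> = K * ((\<integral>x. indicator A x * \<bar>h n x\<bar> powr q \<partial>M) + e n)"
    using set_M_integrable[OF ih(1) A(1)] ie by (simp add: e_def)
   also have "\<dots> \<le> K * (\<kappa> * ((\<integral>x. \<bar>h n x\<bar> powr q \<partial>M) + (\<integral>x. norm (g n x) powr q \<partial>M)) + e n)"
    using smooth[OF hg(1) A] K by (intro mult_left_mono add_right_mono) auto
   also have "\<dots> \<le> K * (\<kappa> * (K * (T + e n + e' n)) + e n)"
   proof -
    have "(\<integral>x. \<bar>h n x\<bar> powr q \<partial>M) \<le> (\<integral>x. K * (\<bar>u x\<bar> powr q + \<bar>h n x - u x\<bar> powr q) \<partial>M)"
     using powr_norm_triangle[of q "h n _" "u _"] q ih iu ie
     by (intro integral_mono) (auto simp: K_def abs_minus_commute)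
    moreover have "(\<integral>x. norm (g n x) powr q \<partial>M) \<le> (\<integral>x. K * (norm (D x) powr q + norm (g n x - D x) powr q) \<partial>M)"
     using powr_norm_triangle[of q "g n _" "D _"] q ih iu ie
     by (intro integral_mono) (auto simp: K_def norm_minus_commute)
    ultimately have "(\<integral>x. \<bar>h n x\<bar> powr q \<partial>M) + (\<integral>x. norm (g n x) powr q \<partial>M) \<le> K * (T + e n + e' n)"
     using iu ie by (simp add: T_def e_def e'_def algebra_simps)
    then show ?thesis using K \<kappa> by (intro mult_left_mono add_right_mono) auto
   qed
   finally show ?thesis .
  qed
  have "(\<lambda>n. K * (\<kappa> * (K * (T + e n + e' n)) + e n)) \<longlonglongrightarrow> K * (\<kappa> * (K * (T + 0 + 0)) + 0)"
   by (intro tendsto_intros e)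
  also have "K * (\<kappa> * (K * (T + 0 + 0)) + 0) = \<eta> * T" using K by (simp add: \<kappa>_def)
  finally have "(\<integral>x. indicator A x * \<bar>u x\<bar> powr q \<partial>M) \<le> \<eta> * T"
   using bound by (intro LIMSEQ_le_const) auto
  then show "(\<integral>x. indicator A x * \<bar>u x\<bar> powr q \<partial>M) \<le> \<eta> * ((\<integral>x. \<bar>u x\<bar> powr q \<partial>M) + (\<integral>x. norm (D x) powr q \<partial>M))"
   by (simp add: T_def)
 qed
qed

end

section \<open>Local means and connectedness\<close>

context bounded_open
begin

lemma C1_poincare:
 fixes z :: "'a \<Rightarrow> real" and dz :: "'a \<Rightarrow> 'a"
 assumes R: "0 < R" and W\<Omega>: "ball x0 (3 * R) \<subseteq> \<Omega>"
  and der: "\<And>x. x \<in> ball x0 (3 * R) \<Longrightarrow> GDERIV z x :> dz x"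
  and cont: "continuous_on (ball x0 (3 * R)) dz"
  and zb: "\<And>x. x \<in> ball x0 (3 * R) \<Longrightarrow> \<bar>z x\<bar> \<le> b1" and dzb: "\<And>x. x \<in> ball x0 (3 * R) \<Longrightarrow> norm (dz x) \<le> b2"
 shows "(\<integral>x. indicator (ball x0 R) x * \<bar>z x - (\<integral>y. indicator (ball x0 R) y * z y \<partial>M) / measure lborel (ball x0 R)\<bar> \<partial>M)
  \<le> 2 * R * measure lborel (ball (0::'a) (2 * R)) / measure lborel (ball x0 R) *
    (\<integral>x. indicator (ball x0 (3 * R)) x * norm (dz x) \<partial>M)"
proof -
 let ?W = "ball x0 (3 * R)" and ?B = "ball x0 R" and ?V = "ball (0::'a) (2 * R)"
 define m where "m = measure lborel ?B"
 have m: "0 < m" using R ball_pos by (simp add: m_def)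
 have BW: "?B \<subseteq> ?W" using R by auto
 have cz: "continuous_on ?W z"
  using der by (intro continuous_at_imp_continuous_on ballI GDERIV_isCont)
 define zt where "zt x = indicator ?W x *\<^sub>R z x" for x
 define dzt where "dzt x = indicator ?W x *\<^sub>R dz x" for x
 have [measurable]: "zt \<in> borel_measurable borel" "dzt \<in> borel_measurable borel"
  unfolding zt_def dzt_def
  by (rule borel_measurable_continuous_on_indicator[OF _ cz] borel_measurable_continuous_on_indicator[OF _ cont]; simp)+
 have ztb: "\<bar>zt x\<bar> \<le> \<bar>b1\<bar>" for x using zb[of x] by (auto simp: zt_def indicator_def)
 have B_sets [measurable]: "?B \<in> sets borel" "?W \<in> sets borel" "?B \<in> sets lebesgue" by (auto simp: borel_open)
 have iB: "integrable M (\<lambda>y. indicator ?B y * zt y)" "integrable M (indicat_real ?B)"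
 proof -
  have "zt \<in> borel_measurable M" by (intro measurable_restrict_space1 measurable_completion) simp
  then have "integrable M zt" by (rule bounded_integrable) (use ztb in auto)
  then show "integrable M (\<lambda>y. indicator ?B y * zt y)" by (rule set_M_integrable) simp
  show "integrable M (indicat_real ?B)" using set_M_integrable[of "\<lambda>_. 1" ?B] by simp
 qed
 have eqB: "(\<integral>y. indicator ?B y * z y \<partial>M) = (\<integral>y. indicator ?B y * zt y \<partial>M)"
  using BW by (intro Bochner_Integration.integral_cong) (auto simp: zt_def indicator_def)
 define a where "a = (\<integral>y. indicator ?B y * zt y \<partial>M) / m"
 have B1: "(\<integral>y. indicat_real ?B y \<partial>M) = m"
  using integral_indicator_M[of ?B] BW W\<Omega> by (simp add: m_def measure_completion)
 have pt: "ennreal (m * \<bar>zt x - a\<bar>) \<le> (\<integral>\<^sup>+y. ennreal \<bar>zt x - zt y\<bar> * indicator ?B y \<partial>lborel)" for x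
 proof -
  have "m * (zt x - a) = zt x * (\<integral>y. indicat_real ?B y \<partial>M) - (\<integral>y. indicator ?B y * zt y \<partial>M)"
   unfolding B1 a_def using m by (simp add: field_simps)
  also have "\<dots> = (\<integral>y. zt x * indicat_real ?B y - indicator ?B y * zt y \<partial>M)"
   using iB by (subst Bochner_Integration.integral_diff) auto
  also have "\<dots> = (\<integral>y. indicator ?B y * (zt x - zt y) \<partial>M)"
   by (intro Bochner_Integration.integral_cong) (auto simp: algebra_simps)
  finally have "m * \<bar>zt x - a\<bar> = \<bar>\<integral>y. indicator ?B y * (zt x - zt y) \<partial>M\<bar>"
   using m by (metis abs_mult abs_of_pos)
  also have "\<dots> \<le> (\<integral>y. \<bar>indicator ?B y * (zt x - zt y)\<bar> \<partial>M)" by (rule integral_abs_bound)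
  also have "\<dots> = (\<integral>y. indicator ?B y * \<bar>zt x - zt y\<bar> \<partial>M)"
   by (intro Bochner_Integration.integral_cong) (auto simp: abs_mult)
  finally have "ennreal (m * \<bar>zt x - a\<bar>) \<le> ennreal (\<integral>y. indicator ?B y * \<bar>zt x - zt y\<bar> \<partial>M)"
   by (rule ennreal_leI)
  also have "\<dots> = (\<integral>\<^sup>+y. ennreal \<bar>zt x - zt y\<bar> * indicator ?B y \<partial>lborel)"
  proof (rule nn_integral_bounded_eq_integral[OF \<Omega>_open, symmetric])
   show "\<bar>zt x - zt y\<bar> \<le> \<bar>b1\<bar> + \<bar>b1\<bar>" for y using ztb[of x] ztb[of y] by linarith
  qed (use BW W\<Omega> in auto)
  finally show ?thesis .
 qed
 have "ennreal (\<integral>x. indicator ?B x * (m * \<bar>zt x - a\<bar>) \<partial>M) = (\<integral>\<^sup>+x. ennreal (m * \<bar>zt x - a\<bar>) * indicator ?B x \<partial>lborel)"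
 proof (rule nn_integral_bounded_eq_integral[OF \<Omega>_open, symmetric])
  show "m * \<bar>zt x - a\<bar> \<le> m * (\<bar>b1\<bar> + \<bar>a\<bar>)" for x using ztb[of x] m by (intro mult_left_mono) auto
 qed (use BW W\<Omega> m in auto)
 also have "\<dots> \<le> (\<integral>\<^sup>+x. (\<integral>\<^sup>+y. ennreal \<bar>zt x - zt y\<bar> * indicator ?B y \<partial>lborel) * indicator ?B x \<partial>lborel)"
  by (intro nn_integral_mono mult_right_mono pt) auto
 also have "\<dots> = (\<integral>\<^sup>+x. (\<integral>\<^sup>+y. ennreal \<bar>z x - z y\<bar> * indicator ?B y \<partial>lborel) * indicator ?B x \<partial>lborel)"
 proof (intro nn_integral_cong)
  fix x
  show "(\<integral>\<^sup>+y. ennreal \<bar>zt x - zt y\<bar> * indicator ?B y \<partial>lborel) * indicator ?B x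
   = (\<integral>\<^sup>+y. ennreal \<bar>z x - z y\<bar> * indicator ?B y \<partial>lborel) * indicator ?B x"
  proof (cases "x \<in> ?B")
   case True
   have "(\<integral>\<^sup>+y. ennreal \<bar>zt x - zt y\<bar> * indicator ?B y \<partial>lborel) = (\<integral>\<^sup>+y. ennreal \<bar>z x - z y\<bar> * indicator ?B y \<partial>lborel)"
    using BW True by (intro nn_integral_cong) (auto simp: zt_def indicator_def)
   then show ?thesis by simp
  qed simp
 qed
 also have "\<dots> \<le> ennreal (2 * R) * emeasure lborel ?V * (\<integral>\<^sup>+x. ennreal (norm (dz x)) * indicator ?W x \<partial>lborel)"
  by (rule poincare_double_integral[OF R der cont])
 also have "(\<integral>\<^sup>+x. ennreal (norm (dz x)) * indicator ?W x \<partial>lborel) = (\<integral>\<^sup>+x. ennreal (norm (dzt x)) * indicator ?W x \<partial>lborel)"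
  by (intro nn_integral_cong) (auto simp: dzt_def indicator_def)
 also have "\<dots> = ennreal (\<integral>x. indicator ?W x * norm (dzt x) \<partial>M)"
 proof (rule nn_integral_bounded_eq_integral[OF \<Omega>_open])
  show "(\<lambda>x. norm (dzt x)) \<in> borel_measurable borel" by measurable
  show "norm (dzt x) \<le> b2" if "x \<in> ?W" for x using dzb[OF that] that by (simp add: dzt_def)
 qed (use W\<Omega> in auto)
 also have "(\<integral>x. indicator ?W x * norm (dzt x) \<partial>M) = (\<integral>x. indicator ?W x * norm (dz x) \<partial>M)"
  by (intro Bochner_Integration.integral_cong) (auto simp: dzt_def indicator_def)
 also have "emeasure lborel ?V = ennreal (measure lborel ?V)"
  using emeasure_bounded_finite[OF bounded_ball, of "0::'a" "2 * R"] by (simp add: emeasure_eq_ennreal_measure less_top)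
 finally have "ennreal (\<integral>x. indicator ?B x * (m * \<bar>zt x - a\<bar>) \<partial>M)
  \<le> ennreal (2 * R * measure lborel ?V * (\<integral>x. indicator ?W x * norm (dz x) \<partial>M))"
  using R by (simp add: ennreal_mult')
 moreover have "0 \<le> (\<integral>x. indicator ?W x * norm (dz x) \<partial>M)"
  by (intro Bochner_Integration.integral_nonneg) auto
 ultimately have "(\<integral>x. indicator ?B x * (m * \<bar>zt x - a\<bar>) \<partial>M) \<le> 2 * R * measure lborel ?V * (\<integral>x. indicator ?W x * norm (dz x) \<partial>M)"
  using R by (subst (asm) ennreal_le_iff) auto
 moreover have "(\<integral>x. indicator ?B x * (m * \<bar>zt x - a\<bar>) \<partial>M) = m * (\<integral>x. indicator ?B x * \<bar>z x - a\<bar> \<partial>M)"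
 proof -
  have "(\<integral>x. indicator ?B x * (m * \<bar>zt x - a\<bar>) \<partial>M) = (\<integral>x. m * (indicator ?B x * \<bar>z x - a\<bar>) \<partial>M)"
   using BW by (intro Bochner_Integration.integral_cong) (auto simp: zt_def indicator_def)
  then show ?thesis by simp
 qed
 ultimately have "m * (\<integral>x. indicator ?B x * \<bar>z x - a\<bar> \<partial>M) \<le> 2 * R * measure lborel ?V * (\<integral>x. indicator ?W x * norm (dz x) \<partial>M)"
  by (simp only:)
 then have "(\<integral>x. indicator ?B x * \<bar>z x - a\<bar> \<partial>M) \<le> 2 * R * measure lborel ?V * (\<integral>x. indicator ?W x * norm (dz x) \<partial>M) / m"
  by (subst pos_le_divide_eq[OF m]) (simp only: mult.commute)
 then show ?thesis unfolding a_def eqB m_def by simp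
qed

text \<open>The factor \<open>w\<close> has to be bounded on the compact ball alone, because it is used with \<open>w = 1/\<phi>\<close>, which is unbounded near the
  boundary.\<close>

lemma sobolev0_poincare:
 fixes u :: "'a \<Rightarrow> real" and D :: "'a \<Rightarrow> 'a"
 assumes r: "1 \<le> r" and u: "sobolev0 r u D" and R: "0 < R" and W\<Omega>: "cball x0 (3 * R) \<subseteq> \<Omega>"
  and w: "\<And>x. x \<in> \<Omega> \<Longrightarrow> GDERIV w x :> dw x" "continuous_on \<Omega> dw"
 shows "integrable M (\<lambda>x. indicator (ball x0 (3 * R)) x * (w x * u x))" (is ?P)
  and "integrable M (\<lambda>x. indicator (ball x0 (3 * R)) x *\<^sub>R (u x *\<^sub>R dw x + w x *\<^sub>R D x))" (is ?Q)
  and "(\<integral>x. indicator (ball x0 R) x * \<bar>w x * u x - (\<integral>y. indicator (ball x0 R) y * (w y * u y) \<partial>M) / measure lborel (ball x0 R)\<bar> \<partial>M)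
  \<le> 2 * R * measure lborel (ball (0::'a) (2 * R)) / measure lborel (ball x0 R) *
    (\<integral>x. indicator (ball x0 (3 * R)) x * norm (u x *\<^sub>R dw x + w x *\<^sub>R D x) \<partial>M)" (is ?T)
proof -
 let ?W = "ball x0 (3 * R)" and ?B = "ball x0 R"
 have r0: "0 < r" using r by simp
 have W': "?W \<subseteq> \<Omega>" using W\<Omega> ball_subset_cball by blast
 have BW: "?B \<subseteq> ?W" using R by auto
 have B\<Omega>: "?B \<subseteq> \<Omega>" using BW W' by blast
 define m where "m = measure lborel ?B"
 have m: "0 < m" using R ball_pos by (simp add: m_def)
 have sets: "?B \<in> sets lebesgue" "?W \<in> sets lebesgue" by (auto simp: borel_open)
 have wc: "continuous_on \<Omega> w" using w(1) by (intro continuous_at_imp_continuous_on ballI GDERIV_isCont)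
 obtain b where b: "0 \<le> b" "\<And>x. x \<in> ?W \<Longrightarrow> \<bar>w x\<bar> \<le> b" "\<And>x. x \<in> ?W \<Longrightarrow> norm (dw x) \<le> b"
 proof -
  have "compact (w ` cball x0 (3 * R))" "compact (dw ` cball x0 (3 * R))"
   using W\<Omega> wc w(2) by (auto intro!: compact_continuous_image intro: continuous_on_subset)
  then have "bounded (w ` cball x0 (3 * R))" "bounded (dw ` cball x0 (3 * R))"
   using compact_imp_bounded by blast+
  then obtain b1 b2 where "\<forall>y\<in>w ` cball x0 (3 * R). norm y \<le> b1" "\<forall>y\<in>dw ` cball x0 (3 * R). norm y \<le> b2"
   unfolding bounded_iff by blast
  then show ?thesis
   using that[of "max 0 (max b1 b2)"] ball_subset_cball[of x0 "3 * R"] by (fastforce simp: le_max_iff_disj)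
 qed
 have [measurable]: "w \<in> borel_measurable M" "dw \<in> borel_measurable M"
  using wc w(2) by (auto intro: continuous_measurable)
 have [measurable]: "indicat_real ?B \<in> borel_measurable M" "indicat_real ?W \<in> borel_measurable M"
  using sets by (auto intro: indicator_M_measurable)
 note [measurable] = sobolev0D(3,4)[OF u]
 obtain h g where hg: "\<And>n. C1_compact_support \<Omega> (h n) (g n)"
  "Lnull r (\<lambda>n x. h n x - u x)" "Lnull r (\<lambda>n x. g n x - D x)"
  using u by (rule sobolev0E) blast
 have [measurable]: "h n \<in> borel_measurable M" "g n \<in> borel_measurable M" for n
  using C1_compact_support_Lspace[OF hg(1) r0] LspaceD(1) by auto
 have int: "integrable M (\<lambda>x. indicator ?W x * (w x * f x))"
   "integrable M (\<lambda>x. indicator ?W x *\<^sub>R (f x *\<^sub>R dw x + w x *\<^sub>R d x))"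
  if f: "integrable M f" "integrable M d" for f :: "'a \<Rightarrow> real" and d :: "'a \<Rightarrow> 'a"
 proof -
  note [measurable] = borel_measurable_integrable[OF f(1)] borel_measurable_integrable[OF f(2)]
  show "integrable M (\<lambda>x. indicator ?W x * (w x * f x))"
  proof (rule Bochner_Integration.integrable_bound)
   show "integrable M (\<lambda>x. b * \<bar>f x\<bar>)" using f by auto
   show "AE x in M. norm (indicator ?W x * (w x * f x)) \<le> norm (b * \<bar>f x\<bar>)"
    using b by (intro AE_I2) (auto simp: indicator_def abs_mult intro: mult_right_mono)
  qed measurable
  show "integrable M (\<lambda>x. indicator ?W x *\<^sub>R (f x *\<^sub>R dw x + w x *\<^sub>R d x))"
  proof (rule Bochner_Integration.integrable_bound)
   show "integrable M (\<lambda>x. b * \<bar>f x\<bar> + b * norm (d x))" using f by auto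
   show "AE x in M. norm (indicator ?W x *\<^sub>R (f x *\<^sub>R dw x + w x *\<^sub>R d x)) \<le> norm (b * \<bar>f x\<bar> + b * norm (d x))"
   proof (rule AE_I2)
    fix x
    have "norm (f x *\<^sub>R dw x + w x *\<^sub>R d x) \<le> b * \<bar>f x\<bar> + b * norm (d x)" if "x \<in> ?W"
     using norm_triangle_ineq[of "f x *\<^sub>R dw x" "w x *\<^sub>R d x"]
      mult_right_mono[OF b(2)[OF that], of "norm (d x)"] mult_left_mono[OF b(3)[OF that], of "\<bar>f x\<bar>"]
     by (simp add: mult.commute)
    then show "norm (indicator ?W x *\<^sub>R (f x *\<^sub>R dw x + w x *\<^sub>R d x)) \<le> norm (b * \<bar>f x\<bar> + b * norm (d x))"
     using b(1) by (cases "x \<in> ?W") auto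
   qed
  qed measurable
 qed
 have iu: "integrable M u" "integrable M D" using Lspace_integrable[OF r] sobolev0D[OF u] by auto
 have ih: "integrable M (h n)" "integrable M (g n)" for n
  using Lspace_integrable[OF r] C1_compact_support_Lspace[OF hg(1) r0] by auto
 show P: ?P and Q: ?Q using int[OF iu] by auto
 define z where "z x = w x * u x" for x
 define dz where "dz x = u x *\<^sub>R dw x + w x *\<^sub>R D x" for x
 define zn where "zn n x = w x * h n x" for n x
 define dzn where "dzn n x = h n x *\<^sub>R dw x + w x *\<^sub>R g n x" for n x
 have [measurable]: "z \<in> borel_measurable M" "dz \<in> borel_measurable M" "zn n \<in> borel_measurable M" "dzn n \<in> borel_measurable M" for n
  unfolding z_def dz_def zn_def dzn_def by measurable
 have iz: "integrable M (\<lambda>x. indicator ?W x * z x)" "integrable M (\<lambda>x. indicator ?W x *\<^sub>R dz x)"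
  "integrable M (\<lambda>x. indicator ?W x * zn n x)" "integrable M (\<lambda>x. indicator ?W x *\<^sub>R dzn n x)" for n
  unfolding z_def dz_def zn_def dzn_def using int[OF iu] int[OF ih] by auto
 have izB: "integrable M (\<lambda>x. indicator ?B x * z x)" "integrable M (\<lambda>x. indicator ?B x * zn n x)" for n
 proof -
  have eq: "(\<lambda>x. indicator ?B x * f x) = (\<lambda>x. indicator ?B x * (indicator ?W x * f x))" for f :: "'a \<Rightarrow> real"
   using BW by (auto simp: indicator_def fun_eq_iff)
  show "integrable M (\<lambda>x. indicator ?B x * z x)" "integrable M (\<lambda>x. indicator ?B x * zn n x)" for n
   using set_M_integrable[OF iz(1) sets(1)] set_M_integrable[OF iz(3) sets(1)] eq by auto
 qed
 have N1: "Lnull r (\<lambda>n x. indicator ?B x * zn n x - indicator ?B x * z x)"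
 proof (rule Lnull_dominated_by[OF r0 hg(2) _ b(1)])
  show "AE x in M. norm (indicator ?B x * zn n x - indicator ?B x * z x) \<le> b * norm (h n x - u x)" for n
  proof (rule AE_I2)
   fix x
   have "\<bar>w x\<bar> * \<bar>h n x - u x\<bar> \<le> b * \<bar>h n x - u x\<bar>" if "x \<in> ?B"
    using b(2)[of x] that BW by (intro mult_right_mono) auto
   then show "norm (indicator ?B x * zn n x - indicator ?B x * z x) \<le> b * norm (h n x - u x)"
    using b(1) by (cases "x \<in> ?B") (auto simp: zn_def z_def abs_mult simp flip: right_diff_distrib)
  qed
 qed measurable
 have N2: "Lnull r (\<lambda>n x. indicator ?W x *\<^sub>R dzn n x - indicator ?W x *\<^sub>R dz x)"
 proof -
  have M1: "Lnull r (\<lambda>n x. (indicator ?W x * (h n x - u x)) *\<^sub>R dw x)"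
  proof (rule Lnull_dominated_by[OF r0 hg(2) _ b(1)])
   show "AE x in M. norm ((indicator ?W x * (h n x - u x)) *\<^sub>R dw x) \<le> b * norm (h n x - u x)" for n
    using b by (intro AE_I2) (auto simp: indicator_def mult.commute intro: mult_right_mono)
  qed measurable
  have M2: "Lnull r (\<lambda>n x. (indicator ?W x * w x) *\<^sub>R (g n x - D x))"
  proof (rule Lnull_dominated_by[OF r0 hg(3) _ b(1)])
   show "AE x in M. norm ((indicator ?W x * w x) *\<^sub>R (g n x - D x)) \<le> b * norm (g n x - D x)" for n
    using b by (intro AE_I2) (auto simp: indicator_def intro: mult_right_mono)
  qed measurable
  show ?thesis
  proof (rule Lnull_dominated_by[OF r0 Lnull_add[OF r0 M1 M2], of _ 1])
   show "(\<lambda>x. indicator ?W x *\<^sub>R dzn n x - indicator ?W x *\<^sub>R dz x) \<in> borel_measurable M" for n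
    by measurable
  qed (auto intro!: AE_I2 eq_refl arg_cong[where f=norm] simp: dzn_def dz_def algebra_simps)
 qed
 define an where "an n = (\<integral>y. indicator ?B y * zn n y \<partial>M) / m" for n
 define a where "a = (\<integral>y. indicator ?B y * z y \<partial>M) / m"
 have an: "an \<longlonglongrightarrow> a"
  unfolding an_def a_def using m
  by (intro tendsto_divide tendsto_const Lnull_integral_tendsto[OF r N1] izB) auto
 have iBc: "integrable M (\<lambda>x. indicator ?B x * c)" for c :: real
  using set_M_integrable[of "\<lambda>_. c", OF _ sets(1)] by simp
 have iabs: "integrable M (\<lambda>x. indicator ?B x * \<bar>f x - c\<bar>)" if "integrable M (\<lambda>x. indicator ?B x * f x)" for f :: "'a \<Rightarrow> real" and c
 proof -
  have "integrable M (\<lambda>x. \<bar>indicator ?B x * f x - indicator ?B x * c\<bar>)"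
   using that iBc by (intro integrable_abs Bochner_Integration.integrable_diff)
  also have "(\<lambda>x. \<bar>indicator ?B x * f x - indicator ?B x * c\<bar>) = (\<lambda>x. indicator ?B x * \<bar>f x - c\<bar>)"
   by (auto simp: indicator_def fun_eq_iff)
  finally show ?thesis .
 qed
 have L1: "(\<lambda>n. \<integral>x. indicator ?B x * \<bar>zn n x - an n\<bar> \<partial>M) \<longlonglongrightarrow> (\<integral>x. indicator ?B x * \<bar>z x - a\<bar> \<partial>M)"
 proof (rule Lnull_integral_tendsto[OF r])
  have N3: "Lnull r (\<lambda>n x. indicator ?B x * (a - an n))"
  proof (rule Lnull_uniform[OF r0])
   show "norm (indicator ?B x * (a - an n)) \<le> \<bar>a - an n\<bar>" for n x by (auto simp: indicator_def)
   have "(\<lambda>n. \<bar>a - an n\<bar>) \<longlonglongrightarrow> \<bar>a - a\<bar>" by (intro tendsto_intros an)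
   then show "(\<lambda>n. \<bar>a - an n\<bar>) \<longlonglongrightarrow> 0" by simp
  qed measurable
  show "Lnull r (\<lambda>n x. indicator ?B x * \<bar>zn n x - an n\<bar> - indicator ?B x * \<bar>z x - a\<bar>)"
  proof (rule Lnull_dominated_by[OF r0 Lnull_add[OF r0 N1 N3], of _ 1])
   show "(\<lambda>x. indicator ?B x * \<bar>zn n x - an n\<bar> - indicator ?B x * \<bar>z x - a\<bar>) \<in> borel_measurable M" for n
    by measurable
  qed (auto intro!: AE_I2 simp: indicator_def)
 qed (use iabs izB in auto)
 have L2: "(\<lambda>n. \<integral>x. indicator ?W x * norm (dzn n x) \<partial>M) \<longlonglongrightarrow> (\<integral>x. indicator ?W x * norm (dz x) \<partial>M)"
 proof (rule Lnull_integral_tendsto[OF r])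
  show "Lnull r (\<lambda>n x. indicator ?W x * norm (dzn n x) - indicator ?W x * norm (dz x))"
  proof (rule Lnull_dominated_by[OF r0 N2, of _ 1])
   show "(\<lambda>x. indicator ?W x * norm (dzn n x) - indicator ?W x * norm (dz x)) \<in> borel_measurable M" for n
    by measurable
  qed (auto intro!: AE_I2 norm_triangle_ineq3 simp: indicator_def)
  show "integrable M (\<lambda>x. indicator ?W x * norm (dzn n x))" "integrable M (\<lambda>x. indicator ?W x * norm (dz x))" for n
   using integrable_norm[OF iz(4)[of n]] integrable_norm[OF iz(2)] by simp_all
 qed
 define C where "C = 2 * R * measure lborel (ball (0::'a) (2 * R)) / m"
 have "(\<integral>x. indicator ?B x * \<bar>zn n x - an n\<bar> \<partial>M) \<le> C * (\<integral>x. indicator ?W x * norm (dzn n x) \<partial>M)" for n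
 proof -
  have hd: "\<And>x. GDERIV (h n) x :> g n x" "continuous_on UNIV (g n)" using hg(1)[of n] unfolding C1_compact_support_def by auto
  have hc: "continuous_on UNIV (h n)" using C1_compact_support_continuous[OF hg(1)] .
  obtain K where K: "compact K" "\<And>x. x \<notin> K \<Longrightarrow> h n x = 0" "\<And>x. x \<notin> K \<Longrightarrow> g n x = 0"
   using hg(1)[of n] unfolding C1_compact_support_def by blast
  obtain b1 where b1: "0 \<le> b1" "\<And>x. norm (h n x) \<le> b1" using compact_support_bounded[OF hc K(1,2)] by blast
  obtain b2 where b2: "0 \<le> b2" "\<And>x. norm (g n x) \<le> b2" using compact_support_bounded[OF hd(2) K(1,3)] by blast
  show ?thesis
   unfolding C_def m_def an_def
  proof (rule C1_poincare[OF R W'])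
   show "GDERIV (zn n) x :> dzn n x" if "x \<in> ?W" for x
    using GDERIV_mult[OF w(1) hd(1), of x] that W' by (auto simp: zn_def[abs_def] dzn_def add.commute)
   show "continuous_on ?W (dzn n)"
    unfolding dzn_def
    by (intro continuous_intros continuous_on_subset[OF hc] continuous_on_subset[OF hd(2)]
      continuous_on_subset[OF wc W'] continuous_on_subset[OF w(2) W']) auto
   show "\<bar>zn n x\<bar> \<le> b * b1" if "x \<in> ?W" for x
    using b(1) b(2)[OF that] b1(2)[of x] by (auto simp: zn_def abs_mult intro!: mult_mono)
   show "norm (dzn n x) \<le> b1 * b + b * b2" if "x \<in> ?W" for x
   proof -
    have "norm (dzn n x) \<le> \<bar>h n x\<bar> * norm (dw x) + \<bar>w x\<bar> * norm (g n x)"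
     using norm_triangle_ineq[of "h n x *\<^sub>R dw x" "w x *\<^sub>R g n x"] by (simp add: dzn_def)
    also have "\<dots> \<le> b1 * b + b * b2"
     using b(2,3)[OF that] b1 b2 b(1) by (intro add_mono mult_mono) auto
    finally show ?thesis .
   qed
  qed
 qed
 then have "(\<integral>x. indicator ?B x * \<bar>z x - a\<bar> \<partial>M) \<le> C * (\<integral>x. indicator ?W x * norm (dz x) \<partial>M)"
  by (intro LIMSEQ_le[OF L1 tendsto_mult_left[OF L2]]) auto
 then show ?T unfolding C_def a_def z_def dz_def m_def .
qed

text \<open>On \<open>S\<close> the functions are close to 0 and to \<open>c n\<close>; as \<open>S\<close> has positive measure, \<open>c n\<close> tends to 0.\<close>

lemma mean_to_zero:
 fixes z :: "nat \<Rightarrow> 'a \<Rightarrow> real"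
 assumes B: "B \<in> sets lebesgue" "B \<subseteq> \<Omega>" and S: "S \<in> sets lebesgue" "S \<subseteq> B" "\<not> negligible S"
  and int: "\<And>n. integrable M (\<lambda>x. indicator B x * z n x)"
  and c: "(\<lambda>n. \<integral>x. indicator B x * \<bar>z n x - c n\<bar> \<partial>M) \<longlonglongrightarrow> 0"
  and zS: "(\<lambda>n. \<integral>x. indicator S x * \<bar>z n x\<bar> \<partial>M) \<longlonglongrightarrow> 0"
 shows "(\<lambda>n. \<integral>x. indicator B x * \<bar>z n x\<bar> \<partial>M) \<longlonglongrightarrow> 0"
proof -
 define s where "s = measure lebesgue S"
 have S\<Omega>: "S \<subseteq> \<Omega>" using S B by blast
 have "S \<in> lmeasurable"
  using S(1) S\<Omega> lmeasurable_open[OF \<Omega>_bounded \<Omega>_open] fmeasurableI2 by blast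
 then have s: "0 < s" using S(3) negligible_iff_measure[of S] by (simp add: s_def zero_less_measure_iff)
 have iS: "integrable M (\<lambda>x. indicator S x * f x)" if "integrable M (\<lambda>x. indicator B x * f x)" for f :: "'a \<Rightarrow> real"
 proof -
  have "(\<lambda>x. indicator S x * f x) = (\<lambda>x. indicator S x * (indicator B x * f x))"
   using S(2) by (auto simp: indicator_def fun_eq_iff)
  then show ?thesis using set_M_integrable[OF that S(1)] by simp
 qed
 have iBc: "integrable M (\<lambda>x. indicator B x * d)" for d :: real
  using set_M_integrable[of "\<lambda>_. d", OF _ B(1)] by simp
 have iabs: "integrable M (\<lambda>x. indicator B x * \<bar>z n x - d\<bar>)" for n d
 proof -
  have "integrable M (\<lambda>x. \<bar>indicator B x * z n x - indicator B x * d\<bar>)"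
   using int iBc by (intro integrable_abs Bochner_Integration.integrable_diff)
  also have "(\<lambda>x. \<bar>indicator B x * z n x - indicator B x * d\<bar>) = (\<lambda>x. indicator B x * \<bar>z n x - d\<bar>)"
   by (auto simp: indicator_def fun_eq_iff)
  finally show ?thesis .
 qed
 have iz: "integrable M (\<lambda>x. indicator B x * \<bar>z n x\<bar>)" for n using iabs[of n 0] by simp
 have c1: "s * \<bar>c n\<bar> \<le> (\<integral>x. indicator B x * \<bar>z n x - c n\<bar> \<partial>M) + (\<integral>x. indicator S x * \<bar>z n x\<bar> \<partial>M)" for n
 proof -
  have "s * \<bar>c n\<bar> = (\<integral>x. indicator S x * \<bar>c n\<bar> \<partial>M)"
   using integral_indicator_M[OF S(1) S\<Omega>] by (simp add: s_def)
  also have "\<dots> \<le> (\<integral>x. indicator B x * \<bar>z n x - c n\<bar> + indicator S x * \<bar>z n x\<bar> \<partial>M)"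
   using S(2) iS[OF iz] iS[OF iBc] iabs by (intro integral_mono) (auto simp: indicator_def)
  also have "\<dots> = (\<integral>x. indicator B x * \<bar>z n x - c n\<bar> \<partial>M) + (\<integral>x. indicator S x * \<bar>z n x\<bar> \<partial>M)"
   using iS[OF iz] iabs by simp
  finally show ?thesis .
 qed
 have "(\<lambda>n. (\<integral>x. indicator B x * \<bar>z n x - c n\<bar> \<partial>M) + (\<integral>x. indicator S x * \<bar>z n x\<bar> \<partial>M)) \<longlonglongrightarrow> 0"
  using tendsto_add_zero[OF c zS] .
 from tendsto_zero_le[OF this c1] have "(\<lambda>n. s * \<bar>c n\<bar>) \<longlonglongrightarrow> 0" using s by simp
 from tendsto_mult_right_zero[OF this, of "1 / s"] have c0: "(\<lambda>n. \<bar>c n\<bar>) \<longlonglongrightarrow> 0" using s by simp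
 have le: "(\<integral>x. indicator B x * \<bar>z n x\<bar> \<partial>M) \<le> (\<integral>x. indicator B x * \<bar>z n x - c n\<bar> \<partial>M) + measure lebesgue B * \<bar>c n\<bar>" for n
 proof -
  have "(\<integral>x. indicator B x * \<bar>z n x\<bar> \<partial>M) \<le> (\<integral>x. indicator B x * \<bar>z n x - c n\<bar> + indicator B x * \<bar>c n\<bar> \<partial>M)"
   using iz iBc iabs by (intro integral_mono) (auto simp: indicator_def)
  also have "\<dots> = (\<integral>x. indicator B x * \<bar>z n x - c n\<bar> \<partial>M) + measure lebesgue B * \<bar>c n\<bar>"
   using iabs iBc integral_indicator_M[OF B] by simp
  finally show ?thesis .
 qed
 show ?thesis
  by (rule tendsto_zero_le[OF tendsto_add_zero[OF c tendsto_mult_right_zero[OF c0]] le])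
   (auto intro!: Bochner_Integration.integral_nonneg)
qed

text \<open>The points with a ball on which \<open>z n\<close> tends to 0 form an open set. It is relatively closed, because two balls that
  meet do so in a set of positive measure and \<open>mean_to_zero\<close> transfers smallness from one to the other, and
  nonempty, because some ball meets \<open>E\<close> in positive measure.\<close>

lemma connected_spread:
 fixes z :: "nat \<Rightarrow> 'a \<Rightarrow> real"
 assumes conn: "connected \<Omega>"
  and loc: "\<And>x. x \<in> \<Omega> \<Longrightarrow> \<exists>R>0. ball x R \<subseteq> \<Omega> \<and> (\<forall>n. integrable M (\<lambda>y. indicator (ball x R) y * z n y)) \<and>
    (\<exists>c. (\<lambda>n. \<integral>y. indicator (ball x R) y * \<bar>z n y - c n\<bar> \<partial>M) \<longlonglongrightarrow> 0)"
  and E: "E \<in> sets lebesgue" "E \<subseteq> \<Omega>" "\<not> negligible E"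
  and intE: "\<And>n. integrable M (\<lambda>x. indicator E x * z n x)"
  and zE: "(\<lambda>n. \<integral>x. indicator E x * \<bar>z n x\<bar> \<partial>M) \<longlonglongrightarrow> 0"
  and x: "x \<in> \<Omega>"
 shows "\<exists>R>0. ball x R \<subseteq> \<Omega> \<and> (\<forall>n. integrable M (\<lambda>y. indicator (ball x R) y * z n y)) \<and>
   (\<lambda>n. \<integral>y. indicator (ball x R) y * \<bar>z n y\<bar> \<partial>M) \<longlonglongrightarrow> 0"
proof -
 define good where "good x R \<longleftrightarrow> 0 < R \<and> ball x R \<subseteq> \<Omega> \<and> (\<forall>n. integrable M (\<lambda>y. indicator (ball x R) y * z n y)) \<and>
   (\<lambda>n. \<integral>y. indicator (ball x R) y * \<bar>z n y\<bar> \<partial>M) \<longlonglongrightarrow> 0" for x R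
 define G where "G = {x \<in> \<Omega>. \<exists>R. good x R}"
 have bl: "ball y R \<in> sets lebesgue" for y :: 'a and R by (simp add: borel_open)
 have sub: "(\<lambda>n. \<integral>y. indicator S y * \<bar>z n y\<bar> \<partial>M) \<longlonglongrightarrow> 0"
  if T: "\<And>n. integrable M (\<lambda>y. indicator T y * z n y)" "(\<lambda>n. \<integral>y. indicator T y * \<bar>z n y\<bar> \<partial>M) \<longlonglongrightarrow> 0"
   and S: "S \<in> sets lebesgue" "S \<subseteq> T" for S T
 proof (rule tendsto_zero_le[OF T(2)])
  fix n
  have i: "integrable M (\<lambda>y. indicator T y * \<bar>z n y\<bar>)"
   using integrable_abs[OF T(1)[of n]] by (simp add: abs_mult)
  have "(\<lambda>y. indicator S y * \<bar>z n y\<bar>) = (\<lambda>y. indicator S y * (indicator T y * \<bar>z n y\<bar>))"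
   using S(2) by (auto simp: indicator_def fun_eq_iff)
  then have "integrable M (\<lambda>y. indicator S y * \<bar>z n y\<bar>)" using set_M_integrable[OF i S(1)] by simp
  then show "(\<integral>y. indicator S y * \<bar>z n y\<bar> \<partial>M) \<le> (\<integral>y. indicator T y * \<bar>z n y\<bar> \<partial>M)"
   using i S(2) by (intro integral_mono) (auto simp: indicator_def)
 qed (auto intro!: Bochner_Integration.integral_nonneg)
 have step: "x \<in> G" if x: "x \<in> \<Omega>" and R: "0 < R" "ball x R \<subseteq> \<Omega>" "\<And>n. integrable M (\<lambda>y. indicator (ball x R) y * z n y)"
   "(\<lambda>n. \<integral>y. indicator (ball x R) y * \<bar>z n y - c n\<bar> \<partial>M) \<longlonglongrightarrow> 0"
   and T: "\<And>n. integrable M (\<lambda>y. indicator T y * z n y)" "(\<lambda>n. \<integral>y. indicator T y * \<bar>z n y\<bar> \<partial>M) \<longlonglongrightarrow> 0"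
   and S: "S \<in> sets lebesgue" "S \<subseteq> T" "S \<subseteq> ball x R" "\<not> negligible S" for x R c S T
 proof -
  have "good x R"
   unfolding good_def using R mean_to_zero[OF bl R(2) S(1,3,4) R(3,4) sub[OF T S(1,2)]] by blast
  then show ?thesis using x by (auto simp: G_def)
 qed
 have Go: "open G"
  unfolding open_contains_ball
 proof
  fix x assume "x \<in> G"
  then obtain R where R: "good x R" by (auto simp: G_def)
  show "\<exists>e>0. ball x e \<subseteq> G"
  proof (intro exI conjI)
   show "0 < R" using R by (simp add: good_def)
   show "ball x R \<subseteq> G"
   proof
    fix y assume y: "y \<in> ball x R"
    have y\<Omega>: "y \<in> \<Omega>" using y R by (auto simp: good_def)
    obtain R' c where R': "0 < R'" "ball y R' \<subseteq> \<Omega>" "\<And>n. integrable M (\<lambda>v. indicator (ball y R') v * z n v)"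
     "(\<lambda>n. \<integral>v. indicator (ball y R') v * \<bar>z n v - c n\<bar> \<partial>M) \<longlonglongrightarrow> 0"
     using loc[OF y\<Omega>] by blast
    have "open (ball y R' \<inter> ball x R)" "y \<in> ball y R' \<inter> ball x R" using R'(1) y by auto
    then have "\<not> negligible (ball y R' \<inter> ball x R)" using open_not_negligible by blast
    then show "y \<in> G"
     using step[OF y\<Omega> R', of "ball x R" "ball y R' \<inter> ball x R"] R bl unfolding good_def by blast
   qed
  qed
 qed
 have Co: "open (\<Omega> - G)"
  unfolding open_contains_ball
 proof
  fix x assume x: "x \<in> \<Omega> - G"
  obtain R c where R: "0 < R" "ball x R \<subseteq> \<Omega>" "\<And>n. integrable M (\<lambda>v. indicator (ball x R) v * z n v)"
   "(\<lambda>n. \<integral>v. indicator (ball x R) v * \<bar>z n v - c n\<bar> \<partial>M) \<longlonglongrightarrow> 0"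
   using loc[of x] x by blast
  have "y \<notin> G" if y: "y \<in> ball x R" for y
  proof
   assume "y \<in> G"
   then obtain R' where R': "good y R'" by (auto simp: G_def)
   have "open (ball x R \<inter> ball y R')" "y \<in> ball x R \<inter> ball y R'" using y R' by (auto simp: good_def)
   then have "\<not> negligible (ball x R \<inter> ball y R')" using open_not_negligible by blast
   then have "x \<in> G"
    using step[OF _ R, of "ball y R'" "ball x R \<inter> ball y R'"] x R' bl unfolding good_def by blast
   with x show False by blast
  qed
  then show "\<exists>e>0. ball x e \<subseteq> \<Omega> - G" using R by blast
 qed
 have "G \<noteq> {}"
 proof
  assume G: "G = {}"
  have "negligible E"
   unfolding locally_negligible_alt[of E]
  proof
   fix x assume xE: "x \<in> E"
   then have x: "x \<in> \<Omega>" using E by blast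
   obtain R c where R: "0 < R" "ball x R \<subseteq> \<Omega>" "\<And>n. integrable M (\<lambda>v. indicator (ball x R) v * z n v)"
    "(\<lambda>n. \<integral>v. indicator (ball x R) v * \<bar>z n v - c n\<bar> \<partial>M) \<longlonglongrightarrow> 0"
    using loc[OF x] by blast
   have "negligible (E \<inter> ball x R)"
   proof (rule ccontr)
    assume "\<not> negligible (E \<inter> ball x R)"
    then have "x \<in> G" using step[OF x R intE zE, of "E \<inter> ball x R"] E(1) bl by blast
    with G show False by blast
   qed
   then show "\<exists>U. openin (top_of_set E) U \<and> x \<in> U \<and> negligible U"
    using xE R(1) by (intro exI[of _ "E \<inter> ball x R"]) (auto intro: openin_open_Int)
  qed
  with E(3) show False by blast
 qed
 moreover have "G = {} \<or> \<Omega> - G = {}"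
  using conn Go Co unfolding connected_def G_def by blast
 ultimately have "x \<in> G" using x by blast
 then show ?thesis unfolding G_def good_def by blast
qed

end

section \<open>The eigenfunction and the Picone identity\<close>

text \<open>Here \<open>s\<close>, \<open>v\<close> are the values of \<open>\<phi>\<close> and \<open>u + \<delta>\<close> at a point, and \<open>s *\<^sub>R A\<close>, \<open>v *\<^sub>R b\<close> their gradients; \<open>\<Psi>\<close> and \<open>\<Theta>\<close> are
  then the gradients of the two test functions. Factoring out logarithmic gradients reduces everything to
  identities in \<open>A\<close> and \<open>b\<close>.\<close>

lemma picone_pointwise:
 fixes A b :: "'a::euclidean_space" and s v p q :: real
 assumes s: "0 < s" and v: "0 < v" and q: "1 < q"
 defines "\<Psi> \<equiv> (p * s powr (p - 1) * v powr (- (p - 1))) *\<^sub>R (s *\<^sub>R A) - ((p - 1) * s powr p * v powr (- (p - 1) - 1)) *\<^sub>R (v *\<^sub>R b)"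
  and "\<Theta> \<equiv> ((p - q + 1) * s powr (p - q + 1 - 1) * v powr (- (p - q))) *\<^sub>R (s *\<^sub>R A) - ((p - q) * s powr (p - q + 1) * v powr (- (p - q) - 1)) *\<^sub>R (v *\<^sub>R b)"
 shows "flux q (s *\<^sub>R A) \<bullet> \<Theta> = s powr p * v powr (- (p - q)) * (flux q A \<bullet> ((p - q + 1) *\<^sub>R A - (p - q) *\<^sub>R b))" (is ?P)
  and "flux q (v *\<^sub>R b) \<bullet> \<Psi> = flux q (s *\<^sub>R A) \<bullet> \<Theta> - s powr p * v powr (- (p - q)) * picone_remainder p q A b" (is ?Q)
  and "1 < p \<Longrightarrow> flux p (v *\<^sub>R b) \<bullet> \<Psi> \<le> norm (s *\<^sub>R A) powr p" (is "_ \<Longrightarrow> ?T")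
proof -
 have comb: "(a1 *\<^sub>R (c1 *\<^sub>R A) - a2 *\<^sub>R (c2 *\<^sub>R b)) = w *\<^sub>R (d1 *\<^sub>R A - d2 *\<^sub>R b)"
  if "a1 * c1 = w * d1" "a2 * c2 = w * d2" for a1 a2 c1 c2 w d1 d2 :: real
  unfolding scaleR_scaleR scaleR_right_diff_distrib that ..
 have \<Psi>: "\<Psi> = (s powr p * v powr (- (p - 1))) *\<^sub>R (p *\<^sub>R A - (p - 1) *\<^sub>R b)"
  unfolding \<Psi>_def
 proof (rule comb)
  have e: "s powr (p - 1) * s = s powr p" using s by (simp add: powr_diff)
  show "p * s powr (p - 1) * v powr (- (p - 1)) * s = s powr p * v powr (- (p - 1)) * p"
   unfolding e[symmetric] by (simp only: mult_ac)
  have e': "v powr (- (p - 1) - 1) * v = v powr (- (p - 1))" using v powr_add[of v "- (p - 1) - 1" 1] by simp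
  show "(p - 1) * s powr p * v powr (- (p - 1) - 1) * v = s powr p * v powr (- (p - 1)) * (p - 1)"
   unfolding e'[symmetric] by (simp only: mult_ac)
 qed
 have \<Theta>: "\<Theta> = (s powr (p - q + 1) * v powr (- (p - q))) *\<^sub>R ((p - q + 1) *\<^sub>R A - (p - q) *\<^sub>R b)"
  unfolding \<Theta>_def
 proof (rule comb)
  have e: "s powr (p - q + 1 - 1) * s = s powr (p - q + 1)" using s by (simp add: powr_add)
  show "(p - q + 1) * s powr (p - q + 1 - 1) * v powr (- (p - q)) * s = s powr (p - q + 1) * v powr (- (p - q)) * (p - q + 1)"
   unfolding e[symmetric] by (simp only: mult_ac)
  have e': "v powr (- (p - q) - 1) * v = v powr (- (p - q))" using v powr_add[of v "- (p - q) - 1" 1] by simp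
  show "(p - q) * s powr (p - q + 1) * v powr (- (p - q) - 1) * v = s powr (p - q + 1) * v powr (- (p - q)) * (p - q)"
   unfolding e'[symmetric] by (simp only: mult_ac)
 qed
 define F1 where "F1 = flux q A \<bullet> ((p - q + 1) *\<^sub>R A - (p - q) *\<^sub>R b)"
 define F2 where "F2 r = flux r b \<bullet> (p *\<^sub>R A - (p - 1) *\<^sub>R b)" for r
 have e1: "s powr (q - 1) * s powr (p - q + 1) = s powr p" by (simp flip: powr_add)
 have "s powr (p - q + 1) * v powr (- (p - q)) * (s powr (q - 1) * F1) = s powr p * v powr (- (p - q)) * F1"
  unfolding e1[symmetric] by (simp only: mult_ac)
 then show P: ?P
  unfolding \<Theta> flux_scaleR[OF s] inner_scaleR_left inner_scaleR_right F1_def .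
 have e2: "v powr (q - 1) * v powr (- (p - 1)) = v powr (- (p - q))" by (simp flip: powr_add)
 have "s powr p * v powr (- (p - 1)) * (v powr (q - 1) * F2 q) = s powr p * v powr (- (p - q)) * F2 q"
  unfolding e2[symmetric] by (simp only: mult_ac)
 then have "flux q (v *\<^sub>R b) \<bullet> \<Psi> = s powr p * v powr (- (p - q)) * F2 q"
  unfolding \<Psi> flux_scaleR[OF v] inner_scaleR_left inner_scaleR_right F2_def .
 then show ?Q
  unfolding P picone_remainder_eq[OF q] F2_def by (simp add: right_diff_distrib)
 assume p: "1 < p"
 have e3: "v powr (p - 1) * v powr (- (p - 1)) = 1" using v by (simp flip: powr_add)
 have "s powr p * v powr (- (p - 1)) * (v powr (p - 1) * F2 p) = (v powr (p - 1) * v powr (- (p - 1))) * (s powr p * F2 p)"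
  by (simp only: mult_ac)
 then have "s powr p * v powr (- (p - 1)) * (v powr (p - 1) * F2 p) = s powr p * F2 p"
  unfolding e3 mult_1 .
 then have "flux p (v *\<^sub>R b) \<bullet> \<Psi> = s powr p * F2 p"
  unfolding \<Psi> flux_scaleR[OF v] inner_scaleR_left inner_scaleR_right F2_def .
 also have "F2 p \<le> norm A powr p"
  using convexity_defect_nonneg[OF p, of A b]
  by (simp add: F2_def convexity_defect_alt inner_diff_right flux_inner_self algebra_simps)
 then have "s powr p * F2 p \<le> s powr p * norm A powr p" by (rule mult_left_mono) simp
 also have "s powr p * norm A powr p = norm (s *\<^sub>R A) powr p" using s by (simp add: powr_mult)
 finally show ?T .
qed

context bounded_open
begin

lemma flux_measurable:
 fixes X :: "'a \<Rightarrow> 'b::euclidean_space"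
 assumes [measurable]: "X \<in> borel_measurable M"
 shows "(\<lambda>x. flux r (X x)) \<in> borel_measurable M"
 unfolding flux_def by measurable

lemma flux_inner_integrable:
 fixes X Y :: "'a \<Rightarrow> 'b::euclidean_space"
 assumes r: "1 < r" and X: "X \<in> Lspace \<Omega> r" and Y: "Y \<in> Lspace \<Omega> r"
 shows "integrable M (\<lambda>x. flux r (X x) \<bullet> Y x)"
proof (rule Bochner_Integration.integrable_bound)
 show "integrable M (\<lambda>x. norm (X x) powr r + norm (Y x) powr r)"
  using LspaceD(2)[OF X] LspaceD(2)[OF Y] by auto
 show "(\<lambda>x. flux r (X x) \<bullet> Y x) \<in> borel_measurable M"
  using flux_measurable[OF LspaceD(1)[OF X]] LspaceD(1)[OF Y] by measurable
 show "AE x in M. norm (flux r (X x) \<bullet> Y x) \<le> norm (norm (X x) powr r + norm (Y x) powr r)"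
 proof (rule AE_I2)
  fix x
  have "\<bar>flux r (X x) \<bullet> Y x\<bar> \<le> norm (X x) powr (r - 1) * norm (Y x)" by (rule flux_inner_le)
  also have "\<dots> \<le> norm (X x) powr r + norm (Y x) powr r"
   using young_with_constant[of "norm (X x)" "norm (Y x)" 1 r] r by simp
  finally show "norm (flux r (X x) \<bullet> Y x) \<le> norm (norm (X x) powr r + norm (Y x) powr r)" by simp
 qed
qed

end

text \<open>Minimality of the Rayleigh quotient in the language of \<open>sobolev0\<close>; \<open>\<mu>\<close> is the eigenvalue.\<close>

locale first_eigenfunction = positive_profile \<Omega> \<phi> g B
 for \<Omega> :: "'a::euclidean_space set" and \<phi> g B +
 fixes p q \<mu> :: real
 assumes q: "1 < q" and qp: "q < p" and \<mu>: "0 \<le> \<mu>"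
  and minimal: "\<And>h H. sobolev0 q h H \<Longrightarrow> \<mu> * (\<integral>x. \<bar>h x\<bar> powr q \<partial>M) \<le> (\<integral>x. norm (H x) powr q \<partial>M)"
  and attained: "(\<integral>x. norm (g x) powr q \<partial>M) = \<mu> * (\<integral>x. \<phi> x powr q \<partial>M)"
  and \<phi>_sobolev: "sobolev0 q \<phi> g"
  and \<Omega>_connected: "connected \<Omega>"
begin

lemma p: "1 < p" "0 < p" "0 < q" "0 < p - q" "0 < p - 1" "0 < q - 1"
 using q qp by auto

text \<open>Minimality along \<open>\<phi> + t h\<close> for small \<open>t > 0\<close>. By convexity the increment of \<open>|g|^q\<close> is at most its linearisation at the new
  point \<open>g + t H\<close>, and that of \<open>\<phi>^q\<close> is at least its linearisation at \<open>\<phi>\<close>; so only the fluxes have to pass to the limit.\<close>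

lemma euler_lagrange_ge:
 assumes s: "sobolev0 q h H"
 shows "\<mu> * (\<integral>x. \<phi> x powr (q - 1) * h x \<partial>M) \<le> (\<integral>x. flux q (g x) \<bullet> H x \<partial>M)"
proof -
 note L\<phi> = sobolev0D[OF \<phi>_sobolev] and L = sobolev0D[OF s]
 note [measurable] = L(3,4)
 define t where "t n = inverse (real (Suc n))" for n
 have t0: "t \<longlonglongrightarrow> 0" unfolding t_def by (rule LIMSEQ_inverse_real_of_nat)
 have t: "0 < t n" "t n \<le> 1" for n by (auto simp: t_def divide_simps)
 have st: "sobolev0 q (\<lambda>x. \<phi> x + t n * h x) (\<lambda>x. g x + t n *\<^sub>R H x)" for n
  by (rule sobolev0_add[OF p(3) \<phi>_sobolev sobolev0_scale[OF p(3) s]])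
 note Lt = sobolev0D[OF st]
 have i\<phi>h: "integrable M (\<lambda>x. \<phi> x powr (q - 1) * h x)"
 proof (rule Bochner_Integration.integrable_bound)
  show "integrable M (\<lambda>x. B powr (q - 1) * \<bar>h x\<bar>)" using Lspace_integrable[OF _ L(1)] q by auto
  show "AE x in M. norm (\<phi> x powr (q - 1) * h x) \<le> norm (B powr (q - 1) * \<bar>h x\<bar>)"
   using \<phi>_powr_le[of "q - 1"] q by (intro AE_I2) (auto simp: abs_mult intro!: mult_right_mono)
 qed measurable
 have ineq: "\<mu> * (\<integral>x. \<phi> x powr (q - 1) * h x \<partial>M) \<le> (\<integral>x. flux q (g x + t n *\<^sub>R H x) \<bullet> H x \<partial>M)" for n
 proof -
  have iF: "integrable M (\<lambda>x. flux q (g x + t n *\<^sub>R H x) \<bullet> H x)"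
   by (rule flux_inner_integrable[OF q Lt(2) L(2)])
  have i: "integrable M (\<lambda>x. norm (g x) powr q)" "integrable M (\<lambda>x. norm (g x + t n *\<^sub>R H x) powr q)"
   "integrable M (\<lambda>x. \<phi> x powr q)" "integrable M (\<lambda>x. \<bar>\<phi> x + t n * h x\<bar> powr q)"
  proof -
   have "integrable M (\<lambda>x. \<bar>\<phi> x\<bar> powr q)" using LspaceD(2)[OF L\<phi>(1)] by simp
   then show "integrable M (\<lambda>x. \<phi> x powr q)"
    by (rule Bochner_Integration.integrable_cong[THEN iffD1, rotated -1]) (use \<phi>_pos in \<open>auto simp: less_imp_le\<close>)
  qed (use LspaceD(2)[OF L\<phi>(2)] LspaceD(2)[OF Lt(2)] LspaceD(2)[OF Lt(1)] in auto)
  have "(\<integral>x. norm (g x + t n *\<^sub>R H x) powr q \<partial>M) - (\<integral>x. norm (g x) powr q \<partial>M)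
    = (\<integral>x. norm (g x + t n *\<^sub>R H x) powr q - norm (g x) powr q \<partial>M)"
   using i by simp
  also have "\<dots> \<le> (\<integral>x. q * t n * (flux q (g x + t n *\<^sub>R H x) \<bullet> H x) \<partial>M)"
  proof (rule integral_mono)
   show "norm (g x + t n *\<^sub>R H x) powr q - norm (g x) powr q \<le> q * t n * (flux q (g x + t n *\<^sub>R H x) \<bullet> H x)" for x
    using convexity_defect_nonneg[OF q, of "g x" "g x + t n *\<^sub>R H x"]
    by (simp add: convexity_defect_def mult.assoc)
  qed (use i iF in auto)
  finally have 1: "(\<integral>x. norm (g x + t n *\<^sub>R H x) powr q \<partial>M) - (\<integral>x. norm (g x) powr q \<partial>M)
    \<le> q * t n * (\<integral>x. flux q (g x + t n *\<^sub>R H x) \<bullet> H x \<partial>M)" by simp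
  have "q * t n * (\<integral>x. \<phi> x powr (q - 1) * h x \<partial>M) = (\<integral>x. q * t n * (\<phi> x powr (q - 1) * h x) \<partial>M)" by simp
  also have "\<dots> \<le> (\<integral>x. \<bar>\<phi> x + t n * h x\<bar> powr q - \<phi> x powr q \<partial>M)"
  proof (rule integral_mono)
   show "q * t n * (\<phi> x powr (q - 1) * h x) \<le> \<bar>\<phi> x + t n * h x\<bar> powr q - \<phi> x powr q" if "x \<in> space M" for x
   proof -
    have \<phi>x: "0 < \<phi> x" using \<phi>_pos that by simp
    have "flux q (\<phi> x) = \<phi> x powr (q - 1)" using \<phi>x by (simp add: flux_def powr_diff power2_eq_square)
    then show ?thesis
     using convexity_defect_nonneg[OF q, of "\<phi> x + t n * h x" "\<phi> x"] \<phi>x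
     by (simp add: convexity_defect_def mult_ac)
   qed
  qed (use i i\<phi>h in auto)
  also have "\<dots> = (\<integral>x. \<bar>\<phi> x + t n * h x\<bar> powr q \<partial>M) - (\<integral>x. \<phi> x powr q \<partial>M)" using i by simp
  finally have "\<mu> * (q * t n * (\<integral>x. \<phi> x powr (q - 1) * h x \<partial>M))
    \<le> \<mu> * ((\<integral>x. \<bar>\<phi> x + t n * h x\<bar> powr q \<partial>M) - (\<integral>x. \<phi> x powr q \<partial>M))"
   using \<mu> by (rule mult_left_mono)
  also have "\<dots> \<le> (\<integral>x. norm (g x + t n *\<^sub>R H x) powr q \<partial>M) - (\<integral>x. norm (g x) powr q \<partial>M)"
   using minimal[OF st] attained by (simp add: right_diff_distrib)
  also note 1
  finally have "(q * t n) * (\<mu> * (\<integral>x. \<phi> x powr (q - 1) * h x \<partial>M)) \<le> (q * t n) * (\<integral>x. flux q (g x + t n *\<^sub>R H x) \<bullet> H x \<partial>M)"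
   by (simp add: mult_ac)
  then show ?thesis using t[of n] p by (simp add: mult_le_cancel_left_pos)
 qed
 have "(\<lambda>n. \<integral>x. flux q (g x + t n *\<^sub>R H x) \<bullet> H x \<partial>M) \<longlonglongrightarrow> (\<integral>x. flux q (g x) \<bullet> H x \<partial>M)"
 proof (rule integral_dominated_convergence[where w="\<lambda>x. 2 powr q * (norm (g x) powr q + norm (H x) powr q) + norm (H x) powr q"])
  show "integrable M (\<lambda>x. 2 powr q * (norm (g x) powr q + norm (H x) powr q) + norm (H x) powr q)"
   using LspaceD(2)[OF L\<phi>(2)] LspaceD(2)[OF L(2)] by auto
  show "(\<lambda>x. flux q (g x) \<bullet> H x) \<in> borel_measurable M"
   using flux_measurable[OF g_meas] by measurable
  show "(\<lambda>x. flux q (g x + t n *\<^sub>R H x) \<bullet> H x) \<in> borel_measurable M" for n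
   using flux_measurable[OF Lt(4)] by measurable
  show "AE x in M. (\<lambda>n. flux q (g x + t n *\<^sub>R H x) \<bullet> H x) \<longlonglongrightarrow> flux q (g x) \<bullet> H x"
  proof (rule AE_I2)
   fix x
   have "(\<lambda>n. g x + t n *\<^sub>R H x) \<longlonglongrightarrow> g x + 0 *\<^sub>R H x" by (intro tendsto_intros t0)
   then have "(\<lambda>n. flux q (g x + t n *\<^sub>R H x)) \<longlonglongrightarrow> flux q (g x + 0 *\<^sub>R H x)"
    by (rule continuous_on_tendsto_compose[OF continuous_flux[OF q]]) auto
   then show "(\<lambda>n. flux q (g x + t n *\<^sub>R H x) \<bullet> H x) \<longlonglongrightarrow> flux q (g x) \<bullet> H x"
    by (simp add: tendsto_inner)
  qed
  show "AE x in M. norm (flux q (g x + t n *\<^sub>R H x) \<bullet> H x) \<le> 2 powr q * (norm (g x) powr q + norm (H x) powr q) + norm (H x) powr q" for n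
  proof (rule AE_I2)
   fix x
   have "norm (flux q (g x + t n *\<^sub>R H x) \<bullet> H x) \<le> norm (g x + t n *\<^sub>R H x) powr (q - 1) * norm (H x)"
    using flux_inner_le by simp
   also have "\<dots> \<le> norm (g x + t n *\<^sub>R H x) powr q + norm (H x) powr q"
    using young_with_constant[of "norm (g x + t n *\<^sub>R H x)" "norm (H x)" 1 q] q by simp
   also have "norm (g x + t n *\<^sub>R H x) powr q \<le> (norm (g x) + norm (H x)) powr q"
   proof (rule powr_mono2)
    have "norm (t n *\<^sub>R H x) \<le> norm (H x)" using t[of n] mult_right_mono[of "t n" 1 "norm (H x)"] by simp
    then show "norm (g x + t n *\<^sub>R H x) \<le> norm (g x) + norm (H x)"
     using norm_triangle_ineq[of "g x" "t n *\<^sub>R H x"] by simp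
   qed (use q in auto)
   also have "\<dots> \<le> 2 powr q * (norm (g x) powr q + norm (H x) powr q)"
    using q by (intro powr_add_le) auto
   finally show "norm (flux q (g x + t n *\<^sub>R H x) \<bullet> H x) \<le> 2 powr q * (norm (g x) powr q + norm (H x) powr q) + norm (H x) powr q"
    by simp
  qed
 qed
 then show ?thesis using ineq by (intro LIMSEQ_le_const) auto
qed

lemma euler_lagrange:
 assumes s: "sobolev0 q h H"
 shows "(\<integral>x. flux q (g x) \<bullet> H x \<partial>M) = \<mu> * (\<integral>x. \<phi> x powr (q - 1) * h x \<partial>M)"
proof (rule antisym)
 show "\<mu> * (\<integral>x. \<phi> x powr (q - 1) * h x \<partial>M) \<le> (\<integral>x. flux q (g x) \<bullet> H x \<partial>M)"
  by (rule euler_lagrange_ge[OF s])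
 have "sobolev0 q (\<lambda>x. - h x) (\<lambda>x. - H x)" using sobolev0_scale[OF p(3) s, of "-1"] by simp
 from euler_lagrange_ge[OF this] show "(\<integral>x. flux q (g x) \<bullet> H x \<partial>M) \<le> \<mu> * (\<integral>x. \<phi> x powr (q - 1) * h x \<partial>M)"
  by simp
qed

text \<open>All that is used of a solution in the weighted estimates; \<open>U\<close> stands for the gradient of \<open>u\<close>.\<close>

definition admissible :: "('a \<Rightarrow> real) \<Rightarrow> ('a \<Rightarrow> 'a) \<Rightarrow> bool" where
 "admissible u U \<longleftrightarrow> sobolev0 p u U \<and> (AE x in M. 0 \<le> u x)"

text \<open>\<open>\<phi>^p / v^(p-q)\<close>, which is \<open>\<phi>^(q-1)\<close> times the function with which the equation of \<open>\<phi>\<close> is tested.\<close>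

definition weight :: "real \<Rightarrow> ('a \<Rightarrow> real) \<Rightarrow> 'a \<Rightarrow> real" where
 "weight \<delta> u x = \<phi> x powr p * (u x + \<delta>) powr (- (p - q))"

text \<open>The gradient of \<open>ln (u + \<delta>)\<close>.\<close>

definition logdiff :: "real \<Rightarrow> ('a \<Rightarrow> real) \<Rightarrow> ('a \<Rightarrow> 'a) \<Rightarrow> 'a \<Rightarrow> 'a" where
 "logdiff \<delta> u U x = (1 / (u x + \<delta>)) *\<^sub>R U x"

definition remainder :: "real \<Rightarrow> ('a \<Rightarrow> real) \<Rightarrow> ('a \<Rightarrow> 'a) \<Rightarrow> 'a \<Rightarrow> real" where
 "remainder \<delta> u U x = weight \<delta> u x * picone_remainder p q ((1 / \<phi> x) *\<^sub>R g x) (logdiff \<delta> u U x)"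

abbreviation mass where "mass \<delta> u \<equiv> (\<integral>x. weight \<delta> u x \<partial>M)"

abbreviation defect where "defect \<delta> u U \<equiv> (\<integral>x. remainder \<delta> u U x \<partial>M)"

abbreviation log_energy where
 "log_energy \<delta> u U x \<equiv> weight \<delta> u x * (norm ((1 / \<phi> x) *\<^sub>R g x) powr q + norm (logdiff \<delta> u U x) powr q)"

lemma admissibleD:
 assumes "admissible u U"
 shows "sobolev0 p u U" "AE x in M. x \<in> \<Omega> \<and> 0 \<le> u x" "AE x in M. 0 \<le> u x"
  "u \<in> borel_measurable M" "U \<in> borel_measurable M" "sobolev0 q u U"
 using assms sobolev0D[of p u U] sobolev0_mono[OF p(3), of p u U] qp
 unfolding admissible_def by auto

lemma weight_measurable:
 assumes "admissible u U" shows "weight \<delta> u \<in> borel_measurable M"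
 using admissibleD(4)[OF assms] unfolding weight_def[abs_def] by measurable

lemma remainder_measurable:
 assumes "admissible u U" shows "remainder \<delta> u U \<in> borel_measurable M"
proof -
 note [measurable] = admissibleD(4,5)[OF assms] weight_measurable[OF assms]
 show ?thesis
  unfolding remainder_def[abs_def] picone_remainder_def convexity_defect_alt logdiff_def flux_def by measurable
qed

lemma weight_nonneg: "0 \<le> weight \<delta> u x"
 by (simp add: weight_def)

lemma weight_bound:
 assumes "x \<in> \<Omega>" "0 \<le> u x" "0 < \<delta>"
 shows "0 < weight \<delta> u x" "weight \<delta> u x \<le> B powr p * \<delta> powr (- (p - q))"
 using assms \<phi>_pos[of x] \<phi>_powr_le[of p x] p
 by (auto simp: weight_def intro!: mult_mono powr_mono2')

lemma weight_integrable:
 assumes "admissible u U" "0 < \<delta>"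
 shows "integrable M (weight \<delta> u)"
proof (rule integrable_const_bound[where B="B powr p * \<delta> powr (- (p - q))"])
 show "AE x in M. norm (weight \<delta> u x) \<le> B powr p * \<delta> powr (- (p - q))"
  using admissibleD(2)[OF assms(1)] by eventually_elim (use weight_bound assms(2) in \<open>auto simp: abs_of_pos\<close>)
qed (rule weight_measurable[OF assms(1)])

lemma remainder_nonneg:
 assumes "admissible u U" "0 < \<delta>"
 shows "AE x in M. 0 \<le> remainder \<delta> u U x"
 using admissibleD(2)[OF assms(1)]
proof eventually_elim
 case (elim x)
 have "0 \<le> picone_remainder p q ((1 / \<phi> x) *\<^sub>R g x) (logdiff \<delta> u U x)"
  using convexity_defect_le_picone_remainder[OF q qp] convexity_defect_nonneg[OF q] by (meson order_trans)
 then show ?case using weight_bound(1)[of x u \<delta>] elim assms(2) by (simp add: remainder_def)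
qed

text \<open>The gradient of \<open>\<phi>^a / (u + \<delta>)^b\<close>, the type of function with which the equations are tested.\<close>

abbreviation test_grad where
 "test_grad a b \<delta> u U x \<equiv> (a * \<phi> x powr (a - 1) * (u x + \<delta>) powr (- b)) *\<^sub>R g x - (b * \<phi> x powr a * (u x + \<delta>) powr (- b - 1)) *\<^sub>R U x"

lemma picone_pointwise':
 assumes "x \<in> \<Omega>" "0 \<le> u x" "0 < \<delta>"
 shows "flux q (g x) \<bullet> test_grad (p - q + 1) (p - q) \<delta> u U x =
   weight \<delta> u x * (flux q ((1 / \<phi> x) *\<^sub>R g x) \<bullet> ((p - q + 1) *\<^sub>R ((1 / \<phi> x) *\<^sub>R g x) - (p - q) *\<^sub>R logdiff \<delta> u U x))"
  and "flux q (U x) \<bullet> test_grad p (p - 1) \<delta> u U x =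
   flux q (g x) \<bullet> test_grad (p - q + 1) (p - q) \<delta> u U x - remainder \<delta> u U x"
  and "flux p (U x) \<bullet> test_grad p (p - 1) \<delta> u U x \<le> norm (g x) powr p"
proof -
 have s: "0 < \<phi> x" and v: "0 < u x + \<delta>" using assms \<phi>_pos by auto
 have eq: "\<phi> x *\<^sub>R ((1 / \<phi> x) *\<^sub>R g x) = g x" "(u x + \<delta>) *\<^sub>R logdiff \<delta> u U x = U x"
  using s v by (auto simp: logdiff_def)
 note P = picone_pointwise[OF s v q, where p=p and A="(1 / \<phi> x) *\<^sub>R g x" and b="logdiff \<delta> u U x", unfolded eq]
 show "flux q (g x) \<bullet> test_grad (p - q + 1) (p - q) \<delta> u U x =
   weight \<delta> u x * (flux q ((1 / \<phi> x) *\<^sub>R g x) \<bullet> ((p - q + 1) *\<^sub>R ((1 / \<phi> x) *\<^sub>R g x) - (p - q) *\<^sub>R logdiff \<delta> u U x))"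
  unfolding weight_def by (rule P(1))
 show "flux q (U x) \<bullet> test_grad p (p - 1) \<delta> u U x =
   flux q (g x) \<bullet> test_grad (p - q + 1) (p - q) \<delta> u U x - remainder \<delta> u U x"
  unfolding remainder_def weight_def by (rule P(2))
 show "flux p (U x) \<bullet> test_grad p (p - 1) \<delta> u U x \<le> norm (g x) powr p"
  using P(3)[OF p(1)] .
qed

lemma test_sobolev:
 assumes "admissible u U" "0 < \<delta>" "1 < a" "0 < b"
 shows "sobolev0 p (\<lambda>x. \<phi> x powr a * (u x + \<delta>) powr (- b)) (\<lambda>x. test_grad a b \<delta> u U x)"
  and "sobolev0 q (\<lambda>x. \<phi> x powr a * (u x + \<delta>) powr (- b)) (\<lambda>x. test_grad a b \<delta> u U x)"
 using sobolev0_power_quotient[OF _ _ admissibleD(3)[OF assms(1)] assms(3,4,2)] admissibleD(1,6)[OF assms(1)] p by auto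

lemma eigen_test:
 assumes a: "admissible u U" "0 < \<delta>"
 shows "integrable M (\<lambda>x. flux q (g x) \<bullet> test_grad (p - q + 1) (p - q) \<delta> u U x)" (is ?P)
  and "(\<integral>x. flux q (g x) \<bullet> test_grad (p - q + 1) (p - q) \<delta> u U x \<partial>M) = \<mu> * mass \<delta> u" (is ?Q)
proof -
 have ts: "sobolev0 q (\<lambda>x. \<phi> x powr (p - q + 1) * (u x + \<delta>) powr (- (p - q))) (\<lambda>x. test_grad (p - q + 1) (p - q) \<delta> u U x)"
  by (rule test_sobolev(2)[OF a]) (use p in auto)
 show ?P by (rule flux_inner_integrable[OF q sobolev0D(2)[OF \<phi>_sobolev] sobolev0D(2)[OF ts]])
 have "(\<integral>x. \<phi> x powr (q - 1) * (\<phi> x powr (p - q + 1) * (u x + \<delta>) powr (- (p - q))) \<partial>M) = mass \<delta> u"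
  by (intro Bochner_Integration.integral_cong) (auto simp: weight_def simp flip: powr_add mult.assoc)
 then show ?Q using euler_lagrange[OF ts] by simp
qed

lemma picone_integrated:
 assumes a: "admissible u U" "0 < \<delta>"
 shows "integrable M (remainder \<delta> u U)" (is ?P)
  and "integrable M (\<lambda>x. flux q (U x) \<bullet> test_grad p (p - 1) \<delta> u U x)" (is ?Q)
  and "(\<integral>x. flux q (U x) \<bullet> test_grad p (p - 1) \<delta> u U x \<partial>M) = \<mu> * mass \<delta> u - defect \<delta> u U" (is ?R)
  and "integrable M (\<lambda>x. flux p (U x) \<bullet> test_grad p (p - 1) \<delta> u U x)" (is ?S)
  and "(\<integral>x. flux p (U x) \<bullet> test_grad p (p - 1) \<delta> u U x \<partial>M) \<le> (\<integral>x. norm (g x) powr p \<partial>M)" (is ?T)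
proof -
 note ts = test_sobolev[OF a p(1) p(5)]
 note [measurable] = remainder_measurable[OF a(1)]
 show Q: ?Q by (rule flux_inner_integrable[OF q sobolev0D(2)[OF admissibleD(6)[OF a(1)]] sobolev0D(2)[OF ts(2)]])
 show S: ?S by (rule flux_inner_integrable[OF p(1) sobolev0D(2)[OF admissibleD(1)[OF a(1)]] sobolev0D(2)[OF ts(1)]])
 note E = eigen_test[OF a]
 have ae: "AE x in M. flux q (g x) \<bullet> test_grad (p - q + 1) (p - q) \<delta> u U x - flux q (U x) \<bullet> test_grad p (p - 1) \<delta> u U x = remainder \<delta> u U x"
  using admissibleD(2)[OF a(1)] by eventually_elim (use picone_pointwise'(2) a(2) in simp)
 have iD: "integrable M (\<lambda>x. flux q (g x) \<bullet> test_grad (p - q + 1) (p - q) \<delta> u U x - flux q (U x) \<bullet> test_grad p (p - 1) \<delta> u U x)"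
  using E(1) Q by (rule Bochner_Integration.integrable_diff)
 show P: ?P
  by (rule Bochner_Integration.integrable_cong_AE_imp[OF iD remainder_measurable[OF a(1)]])
   (use ae in \<open>auto elim: eventually_mono\<close>)
 have "defect \<delta> u U = (\<integral>x. flux q (g x) \<bullet> test_grad (p - q + 1) (p - q) \<delta> u U x - flux q (U x) \<bullet> test_grad p (p - 1) \<delta> u U x \<partial>M)"
  by (rule integral_cong_AE) (use ae iD in auto)
 also have "\<dots> = \<mu> * mass \<delta> u - (\<integral>x. flux q (U x) \<bullet> test_grad p (p - 1) \<delta> u U x \<partial>M)"
  using E Q by (subst Bochner_Integration.integral_diff) auto
 finally show ?R by simp
 have "g \<in> Lspace \<Omega> p" using p g_le by (intro Lspace_bounded[where B=B]) auto
 then have "integrable M (\<lambda>x. norm (g x) powr p)" using LspaceD(2) by blast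
 with S show ?T
 proof (rule integral_mono_AE)
  show "AE x in M. flux p (U x) \<bullet> test_grad p (p - 1) \<delta> u U x \<le> norm (g x) powr p"
   using admissibleD(2)[OF a(1)] by eventually_elim (use picone_pointwise'(3) a(2) in simp)
 qed
qed

text \<open>The \<open>q\<close>-th root of the weight.\<close>

definition quot :: "real \<Rightarrow> ('a \<Rightarrow> real) \<Rightarrow> 'a \<Rightarrow> real" where
 "quot \<delta> u x = \<phi> x powr (p / q) * (u x + \<delta>) powr (- ((p - q) / q))"

lemma quot_sobolev:
 assumes "admissible u U" "0 < \<delta>"
 shows "sobolev0 q (quot \<delta> u) (\<lambda>x. test_grad (p / q) ((p - q) / q) \<delta> u U x)"
 using test_sobolev(2)[OF assms, of "p / q" "(p - q) / q"] p q qp unfolding quot_def[abs_def]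
 by (auto simp: field_simps)

lemma quot_powr:
 assumes "x \<in> \<Omega>" "0 \<le> u x" "0 < \<delta>"
 shows "0 < quot \<delta> u x" "\<bar>quot \<delta> u x\<bar> powr q = weight \<delta> u x"
 using assms \<phi>_pos[of x] p by (auto simp: quot_def weight_def powr_mult powr_powr abs_mult)

lemma quot_grad:
 assumes "x \<in> \<Omega>" "0 \<le> u x" "0 < \<delta>"
 shows "test_grad (p / q) ((p - q) / q) \<delta> u U x =
  quot \<delta> u x *\<^sub>R ((p / q) *\<^sub>R ((1 / \<phi> x) *\<^sub>R g x) - ((p - q) / q) *\<^sub>R logdiff \<delta> u U x)"
proof -
 have s: "0 < \<phi> x" and v: "0 < u x + \<delta>" using assms \<phi>_pos by auto
 have "\<phi> x powr (p / q - 1) = \<phi> x powr (p / q) * (1 / \<phi> x)"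
  "(u x + \<delta>) powr (- ((p - q) / q) - 1) = (u x + \<delta>) powr (- ((p - q) / q)) * (1 / (u x + \<delta>))"
  using s v by (simp_all add: powr_diff)
 then show ?thesis by (simp add: quot_def logdiff_def scaleR_right_diff_distrib mult_ac)
qed

text \<open>The equation of \<open>\<phi>\<close>, tested with \<open>\<phi>^(p-q+1) / v^(p-q)\<close>, expresses \<open>\<mu> * mass\<close> as the weighted integral of the inner
  product in \<open>coercive_up_to_defect\<close>; the defect occurring there is dominated by the remainder.\<close>

lemma energy_bound:
 obtains C where "0 < C"
  "\<And>u U \<delta>. admissible u U \<Longrightarrow> 0 < \<delta> \<Longrightarrow>
    integrable M (\<lambda>x. log_energy \<delta> u U x) \<and>
    (\<integral>x. log_energy \<delta> u U x \<partial>M)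
     \<le> C * (mass \<delta> u + defect \<delta> u U)"
proof -
 obtain c K where cK: "0 < c" "0 \<le> K" "\<And>a b::'a. c * (norm a powr q + norm b powr q)
    \<le> flux q a \<bullet> (((p - q) + 1) *\<^sub>R a - (p - q) *\<^sub>R b) + K * convexity_defect q a b"
  using coercive_up_to_defect[OF q, of "p - q"] p by auto
 define C where "C = (\<mu> + K + 1) / c"
 have C: "0 < C" using cK \<mu> by (simp add: C_def)
 show ?thesis
 proof (rule that[OF C])
  fix u U and \<delta> :: real assume a: "admissible u U" "0 < \<delta>"
  let ?S = "\<lambda>x. log_energy \<delta> u U x"
  let ?T = "\<lambda>x. flux q (g x) \<bullet> test_grad (p - q + 1) (p - q) \<delta> u U x + K * remainder \<delta> u U x"
  note E = eigen_test[OF a] and P = picone_integrated[OF a]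
  have iT: "integrable M ?T" using E(1) P(1) by simp
  have le: "AE x in M. c * ?S x \<le> ?T x \<and> 0 \<le> ?S x"
   using admissibleD(2)[OF a(1)]
  proof eventually_elim
   case (elim x)
   then have x: "x \<in> \<Omega>" "0 \<le> u x" by auto
   note w = weight_bound(1)[of x u \<delta>, OF x a(2)]
   let ?a = "(1 / \<phi> x) *\<^sub>R g x" and ?b = "logdiff \<delta> u U x"
   have "K * convexity_defect q ?a ?b \<le> K * picone_remainder p q ?a ?b"
    using cK(2) convexity_defect_le_picone_remainder[OF q qp] by (rule mult_left_mono[rotated])
   then have "c * (norm ?a powr q + norm ?b powr q)
     \<le> flux q ?a \<bullet> ((p - q + 1) *\<^sub>R ?a - (p - q) *\<^sub>R ?b) + K * picone_remainder p q ?a ?b"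
    using cK(3)[of ?a ?b] by linarith
   then have "weight \<delta> u x * (c * (norm ?a powr q + norm ?b powr q))
     \<le> weight \<delta> u x * (flux q ?a \<bullet> ((p - q + 1) *\<^sub>R ?a - (p - q) *\<^sub>R ?b) + K * picone_remainder p q ?a ?b)"
    using w by (intro mult_left_mono) auto
   then show ?case
    using w unfolding picone_pointwise'(1)[of x u \<delta> U, OF x a(2)] remainder_def
    by (simp add: distrib_left mult_ac)
  qed
  note [measurable] = admissibleD(4,5)[OF a(1)] weight_measurable[OF a(1)]
  have Sm: "?S \<in> borel_measurable M" unfolding logdiff_def by measurable
  have cdiv: "a \<le> 1 / c * b" if "c * a \<le> b" for a b :: real using that cK(1) by (simp add: field_simps)
  have iS: "integrable M ?S"
  proof (rule Bochner_Integration.integrable_bound[of M "\<lambda>x. 1 / c * ?T x"])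
   show "integrable M (\<lambda>x. 1 / c * ?T x)" using iT by (rule integrable_mult_right)
   show "AE x in M. norm (?S x) \<le> norm (1 / c * ?T x)"
    using le
   proof eventually_elim
    case (elim x)
    have "norm (?S x) = ?S x" using elim by (simp only: real_norm_def abs_of_nonneg)
    also have "?S x \<le> 1 / c * ?T x" using elim by (intro cdiv) blast
    also have "\<dots> \<le> norm (1 / c * ?T x)" by (simp only: real_norm_def abs_ge_self)
    finally show ?case .
   qed
  qed (rule Sm)
  have "c * (\<integral>x. ?S x \<partial>M) = (\<integral>x. c * ?S x \<partial>M)" by simp
  also have "\<dots> \<le> (\<integral>x. ?T x \<partial>M)"
   by (rule integral_mono_AE) (use iS iT le in \<open>auto elim: eventually_mono\<close>)
  also have "\<dots> = \<mu> * mass \<delta> u + K * defect \<delta> u U"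
   using E P(1) by (subst Bochner_Integration.integral_add) auto
  also have "\<dots> \<le> (\<mu> + K + 1) * (mass \<delta> u + defect \<delta> u U)"
  proof -
   have "0 \<le> mass \<delta> u"
    by (intro Bochner_Integration.integral_nonneg weight_nonneg)
   moreover have "0 \<le> defect \<delta> u U"
    by (rule integral_nonneg_AE[OF remainder_nonneg[OF a]])
   ultimately show ?thesis using \<mu> cK(2) by (simp add: algebra_simps)
  qed
  finally show "integrable M ?S \<and> (\<integral>x. ?S x \<partial>M) \<le> C * (mass \<delta> u + defect \<delta> u U)"
   using iS cdiv by (auto simp: C_def)
 qed
qed

end

section \<open>Concentration of the weight and the logarithmic gradient\<close>

context bounded_open
begin

lemma small_sublevel:
 fixes y :: "'a \<Rightarrow> real"
 assumes y: "y \<in> borel_measurable M" "AE x in M. 0 < y x" and \<nu>: "0 < \<nu>"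
 obtains k where "0 < k" "{x \<in> \<Omega>. y x < k} \<in> sets lebesgue" "measure lebesgue {x \<in> \<Omega>. y x < k} \<le> \<nu>"
proof -
 define k where "k n = inverse (real (Suc n))" for n
 define A where "A n = {x \<in> \<Omega>. y x < k n}" for n
 have AM: "A n \<in> sets M" for n
 proof -
  have "{x \<in> space M. y x < k n} \<in> sets M" using y(1) by measurable
  then show ?thesis by (simp add: A_def)
 qed
 have kd: "k n \<le> k m" if "m \<le> n" for m n using that by (simp add: k_def le_imp_inverse_le)
 have "decseq A" using kd unfolding decseq_def A_def by fastforce
 then have "(\<lambda>n. measure M (A n)) \<longlonglongrightarrow> measure M (\<Inter>n. A n)"
  using AM by (intro finite_Lim_measure_decseq) auto
 moreover have "measure M (\<Inter>n. A n) = 0"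
 proof -
  have "AE x in M. x \<notin> (\<Inter>n. A n)"
   using y(2)
  proof eventually_elim
   case (elim x)
   then obtain n where "k n < y x" unfolding k_def using reals_Archimedean by blast
   then show ?case by (auto simp: A_def intro!: exI[of _ n])
  qed
  then have "(\<Inter>n. A n) \<in> null_sets M"
   using AM by (subst AE_iff_null_sets) auto
  then show ?thesis by (simp add: null_sets_def measure_def)
 qed
 ultimately have "(\<lambda>n. measure M (A n)) \<longlonglongrightarrow> 0" by simp
 then have "\<forall>\<^sub>F n in sequentially. measure M (A n) < \<nu>" using \<nu> by (rule order_tendstoD(2))
 then obtain n where n: "measure M (A n) < \<nu>" by (meson eventually_happens trivial_limit_sequentially)
 have As: "A n \<in> sets lebesgue" using AM[of n] sets.Int[OF \<Omega>_sets] by (auto simp: sets_restrict_space)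
 show ?thesis
 proof (rule that)
  show "0 < k n" by (simp add: k_def)
  show "{x \<in> \<Omega>. y x < k n} \<in> sets lebesgue" using As by (simp add: A_def)
  have "A n \<subseteq> \<Omega>" by (auto simp: A_def)
  then show "measure lebesgue {x \<in> \<Omega>. y x < k n} \<le> \<nu>"
   using n measure_M[OF As] by (simp add: A_def)
 qed
qed

end

context first_eigenfunction
begin

lemma weight_integral_nonneg: "0 \<le> mass \<delta> u"
 by (intro Bochner_Integration.integral_nonneg weight_nonneg)

lemma remainder_integral_nonneg: "admissible u U \<Longrightarrow> 0 < \<delta> \<Longrightarrow> 0 \<le> defect \<delta> u U"
 by (rule integral_nonneg_AE[OF remainder_nonneg])

lemma quot_powr_AE:
 assumes "admissible u U" "0 < \<delta>"
 shows "AE x in M. \<bar>quot \<delta> u x\<bar> powr q = weight \<delta> u x"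
 using admissibleD(2)[OF assms(1)] by eventually_elim (use quot_powr assms(2) in blast)

text \<open>By \<open>energy_bound\<close> the \<open>q\<close>-th root of the weight is bounded in \<open>W01 \<Omega> q\<close> relative to its mass, so uniform integrability
  applies. The point is that \<open>\<nu>\<close> depends neither on \<open>u\<close> nor on \<open>\<delta>\<close>.\<close>

lemma weight_concentration:
 assumes L: "0 \<le> L"
 obtains \<nu> where "0 < \<nu>"
  "\<And>u U \<delta> A. admissible u U \<Longrightarrow> 0 < \<delta> \<Longrightarrow> defect \<delta> u U \<le> L * (1 + mass \<delta> u) \<Longrightarrow>
   A \<in> sets lebesgue \<Longrightarrow> A \<subseteq> \<Omega> \<Longrightarrow> measure lebesgue A \<le> \<nu> \<Longrightarrow>
   (\<integral>x. indicator A x * weight \<delta> u x \<partial>M) \<le> (1 + mass \<delta> u) / 2"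
proof -
 obtain C where C: "0 < C" and energy: "\<And>u U \<delta>. admissible u U \<Longrightarrow> 0 < \<delta> \<Longrightarrow>
    integrable M (\<lambda>x. log_energy \<delta> u U x) \<and>
    (\<integral>x. log_energy \<delta> u U x \<partial>M)
     \<le> C * (mass \<delta> u + defect \<delta> u U)"
  using energy_bound by blast
 define K where "K = 2 powr q * (p / q) powr q"
 have K: "0 < K" using p by (simp add: K_def)
 define T where "T = 1 + K * C * (1 + L)"
 have T: "0 < T" using K C L by (simp add: T_def add_pos_nonneg)
 define \<eta> where "\<eta> = 1 / (2 * T)"
 have \<eta>: "0 < \<eta>" using T by (simp add: \<eta>_def)
 obtain \<nu> where \<nu>: "0 < \<nu>" and UI: "\<And>u D A. sobolev0 q u D \<Longrightarrow> A \<in> sets lebesgue \<Longrightarrow> A \<subseteq> \<Omega> \<Longrightarrow> measure lebesgue A \<le> \<nu> \<Longrightarrow>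
   (\<integral>x. indicator A x * \<bar>u x\<bar> powr q \<partial>M) \<le> \<eta> * ((\<integral>x. \<bar>u x\<bar> powr q \<partial>M) + (\<integral>x. norm (D x) powr q \<partial>M))"
  using uniform_integrability[OF q \<eta>] by blast
 show ?thesis
 proof (rule that[OF \<nu>])
  fix u U and \<delta> :: real and A
  assume a: "admissible u U" "0 < \<delta>" and R: "defect \<delta> u U \<le> L * (1 + mass \<delta> u)"
   and A: "A \<in> sets lebesgue" "A \<subseteq> \<Omega>" "measure lebesgue A \<le> \<nu>"
  let ?G = "\<lambda>x. test_grad (p / q) ((p - q) / q) \<delta> u U x"
  let ?S = "\<lambda>x. log_energy \<delta> u U x"
  define W where "W = mass \<delta> u"
  have W0: "0 \<le> W" unfolding W_def by (rule weight_integral_nonneg)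
  note qs = quot_sobolev[OF a]
  note ae = quot_powr_AE[OF a]
  note [measurable] = sobolev0D(3)[OF qs] weight_measurable[OF a(1)]
  have [measurable]: "indicat_real A \<in> borel_measurable M" using A(1) by (rule indicator_M_measurable)
  have e1: "(\<integral>x. \<bar>quot \<delta> u x\<bar> powr q \<partial>M) = W"
   unfolding W_def by (rule integral_cong_AE) (use ae in auto)
  have e2: "(\<integral>x. indicator A x * \<bar>quot \<delta> u x\<bar> powr q \<partial>M) = (\<integral>x. indicator A x * weight \<delta> u x \<partial>M)"
  proof (rule integral_cong_AE)
   show "AE x in M. indicator A x * \<bar>quot \<delta> u x\<bar> powr q = indicator A x * weight \<delta> u x"
    using ae by eventually_elim simp
  qed measurable
  have "(\<integral>x. norm (?G x) powr q \<partial>M) \<le> (\<integral>x. K * ?S x \<partial>M)"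
  proof (rule integral_mono_AE)
   show "integrable M (\<lambda>x. norm (?G x) powr q)" using LspaceD(2)[OF sobolev0D(2)[OF qs]] .
   show "integrable M (\<lambda>x. K * ?S x)" using energy[OF a] by (intro integrable_mult_right) blast
   show "AE x in M. norm (?G x) powr q \<le> K * ?S x"
    using admissibleD(2)[OF a(1)]
   proof eventually_elim
    case (elim x)
    then have x: "x \<in> \<Omega>" "0 \<le> u x" by auto
    let ?a = "(1 / \<phi> x) *\<^sub>R g x" and ?b = "logdiff \<delta> u U x"
    have "norm ((p / q) *\<^sub>R ?a - ((p - q) / q) *\<^sub>R ?b) \<le> p / q * norm ?a + (p - q) / q * norm ?b"
     using norm_triangle_ineq4[of "(p / q) *\<^sub>R ?a" "((p - q) / q) *\<^sub>R ?b"] p by (simp only: norm_scaleR) simp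
    also have "\<dots> \<le> p / q * norm ?a + p / q * norm ?b"
     using p by (intro add_left_mono mult_right_mono divide_right_mono) auto
    also have "\<dots> = p / q * (norm ?a + norm ?b)" by (simp only: distrib_left)
    finally have "norm ((p / q) *\<^sub>R ?a - ((p - q) / q) *\<^sub>R ?b) powr q \<le> (p / q * (norm ?a + norm ?b)) powr q"
     using p by (intro powr_mono2) auto
    also have "\<dots> = (p / q) powr q * (norm ?a + norm ?b) powr q" using p by (intro powr_mult)
    also have "\<dots> \<le> (p / q) powr q * (2 powr q * (norm ?a powr q + norm ?b powr q))"
     using p by (intro mult_left_mono powr_add_le) auto
    also have "\<dots> = K * (norm ?a powr q + norm ?b powr q)" unfolding K_def by (simp only: mult_ac)
    finally have le: "norm ((p / q) *\<^sub>R ?a - ((p - q) / q) *\<^sub>R ?b) powr q \<le> K * (norm ?a powr q + norm ?b powr q)" .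
    have "norm (?G x) powr q = \<bar>quot \<delta> u x\<bar> powr q * norm ((p / q) *\<^sub>R ?a - ((p - q) / q) *\<^sub>R ?b) powr q"
     unfolding quot_grad[of x u \<delta> U, OF x a(2)] norm_scaleR by (intro powr_mult)
    also have "\<dots> \<le> weight \<delta> u x * (K * (norm ?a powr q + norm ?b powr q))"
     unfolding quot_powr(2)[of x u \<delta>, OF x a(2)] by (intro mult_left_mono le weight_nonneg)
    finally show ?case by (simp only: mult_ac)
   qed
  qed
  also have "\<dots> = K * (\<integral>x. ?S x \<partial>M)" by simp
  also have "\<dots> \<le> K * (C * (W + defect \<delta> u U))"
   using energy[OF a] K unfolding W_def by (intro mult_left_mono) auto
  also have "\<dots> \<le> K * (C * ((1 + L) * (1 + W)))"
   using R K C W0 unfolding W_def[symmetric] by (intro mult_left_mono) (auto simp: algebra_simps)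
  finally have G: "(\<integral>x. norm (?G x) powr q \<partial>M) \<le> K * C * (1 + L) * (1 + W)" by (simp only: mult_ac)
  have "(\<integral>x. indicator A x * weight \<delta> u x \<partial>M) \<le> \<eta> * (W + (\<integral>x. norm (?G x) powr q \<partial>M))"
   using UI[OF qs A] unfolding e1 e2 .
  also have "\<dots> \<le> \<eta> * (T * (1 + W))"
   using G \<eta> by (intro mult_left_mono) (auto simp: T_def algebra_simps)
  also have "\<dots> = (1 + W) / 2" using T by (simp add: \<eta>_def)
  finally show "(\<integral>x. indicator A x * weight \<delta> u x \<partial>M) \<le> (1 + mass \<delta> u) / 2" unfolding W_def .
 qed
qed

end

text \<open>The inequality for \<open>\<alpha>\<close> says that \<open>\<alpha>\<close> exceeds the Rayleigh quotient of exponent \<open>p\<close> at \<open>\<phi>\<close>.\<close>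

locale forced_problem = first_eigenfunction \<Omega> \<phi> g B p q \<mu>
 for \<Omega> :: "'a::euclidean_space set" and \<phi> g B p q \<mu> +
 fixes f :: "'a \<Rightarrow> real" and \<alpha> Cf :: real
 assumes f_meas [measurable]: "f \<in> borel_measurable M" and f_nonneg: "AE x in M. 0 \<le> f x"
  and f_le: "AE x in M. f x \<le> Cf" and f_nonzero: "\<not> (AE x in M. f x = 0)"
  and \<alpha>: "(\<integral>x. norm (g x) powr p \<partial>M) < \<alpha> * (\<integral>x. \<phi> x powr p \<partial>M)"
begin

lemma \<phi>_powr_integrable: "0 \<le> a \<Longrightarrow> integrable M (\<lambda>x. \<phi> x powr a)"
 by (rule bounded_integrable[where B="B powr a"]) (use \<phi>_powr_le in auto)

abbreviation forcing where
 "forcing \<delta> u x \<equiv> f x * (\<phi> x powr p * (u x + \<delta>) powr (- (p - 1)))"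

lemma \<alpha>_pos: "0 < \<alpha>"
proof (rule ccontr)
 assume "\<not> 0 < \<alpha>"
 then have "\<alpha> * (\<integral>x. \<phi> x powr p \<partial>M) \<le> 0" by (intro mult_nonpos_nonneg) auto
 moreover have "0 \<le> (\<integral>x. norm (g x) powr p \<partial>M)" by (intro Bochner_Integration.integral_nonneg) auto
 ultimately show False using \<alpha> by linarith
qed

definition solution :: "real \<Rightarrow> ('a \<Rightarrow> real) \<Rightarrow> ('a \<Rightarrow> 'a) \<Rightarrow> bool" where
 "solution \<beta> u U \<longleftrightarrow> admissible u U \<and>
  (\<forall>\<psi> \<Psi>. sobolev0 p \<psi> \<Psi> \<longrightarrow>
   (\<integral>x. flux p (U x) \<bullet> \<Psi> x + flux q (U x) \<bullet> \<Psi> x \<partial>M)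
   = (\<integral>x. (\<alpha> * u x powr (p - 1) + \<beta> * u x powr (q - 1) + f x) * \<psi> x \<partial>M))"

lemma solution_identity:
 assumes s: "solution \<beta> u U" and \<psi>: "sobolev0 p \<psi> \<Psi>" and b: "AE x in M. 0 \<le> \<psi> x \<and> \<psi> x \<le> b"
 shows "(\<integral>x. flux p (U x) \<bullet> \<Psi> x \<partial>M) + (\<integral>x. flux q (U x) \<bullet> \<Psi> x \<partial>M)
   = \<alpha> * (\<integral>x. u x powr (p - 1) * \<psi> x \<partial>M) + \<beta> * (\<integral>x. u x powr (q - 1) * \<psi> x \<partial>M) + (\<integral>x. f x * \<psi> x \<partial>M)"
  and "0 \<le> (\<integral>x. u x powr (p - 1) * \<psi> x \<partial>M)" "0 \<le> (\<integral>x. u x powr (q - 1) * \<psi> x \<partial>M)" "0 \<le> (\<integral>x. f x * \<psi> x \<partial>M)"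
  and "integrable M (\<lambda>x. f x * \<psi> x)" "integrable M (\<lambda>x. u x powr (q - 1) * \<psi> x)"
proof -
 have a: "admissible u U" using s by (simp add: solution_def)
 note u = admissibleD[OF a] and L = sobolev0D[OF \<psi>]
 note [measurable] = u(4,5) L(3,4)
 have mult: "integrable M (\<lambda>x. F x * \<psi> x)" if "integrable M F" for F :: "'a \<Rightarrow> real"
 proof (rule Bochner_Integration.integrable_bound[of M "\<lambda>x. b * \<bar>F x\<bar>"])
  show "AE x in M. norm (F x * \<psi> x) \<le> norm (b * \<bar>F x\<bar>)"
   using b
  proof eventually_elim
   case (elim x)
   then have "\<bar>F x\<bar> * \<bar>\<psi> x\<bar> \<le> \<bar>F x\<bar> * \<bar>b\<bar>" by (intro mult_left_mono) auto
   then show ?case by (simp add: abs_mult mult.commute)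
  qed
  show "integrable M (\<lambda>x. b * \<bar>F x\<bar>)" using that by auto
  show "(\<lambda>x. F x * \<psi> x) \<in> borel_measurable M" using borel_measurable_integrable[OF that] by measurable
 qed
 have pow: "integrable M (\<lambda>x. u x powr r)" if r: "0 < r" "r \<le> p" for r
 proof -
  have "integrable M (\<lambda>x. \<bar>u x\<bar> powr r)" using LspaceD(2)[OF Lspace_mono[OF r sobolev0D(1)[OF u(1)]]] by simp
  then show ?thesis
   by (rule Bochner_Integration.integrable_cong_AE_imp) (use u(3) in \<open>auto elim!: eventually_mono\<close>)
 qed
 have if': "integrable M f"
  by (rule integrable_const_bound[where B=Cf]) (use f_nonneg f_le in \<open>auto elim: eventually_elim2\<close>)
 have i: "integrable M (\<lambda>x. u x powr (p - 1) * \<psi> x)" "integrable M (\<lambda>x. u x powr (q - 1) * \<psi> x)" "integrable M (\<lambda>x. f x * \<psi> x)"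
  using p qp by (auto intro!: mult pow if')
 show "integrable M (\<lambda>x. f x * \<psi> x)" "integrable M (\<lambda>x. u x powr (q - 1) * \<psi> x)" using i by auto
 show "0 \<le> (\<integral>x. u x powr (p - 1) * \<psi> x \<partial>M)" "0 \<le> (\<integral>x. u x powr (q - 1) * \<psi> x \<partial>M)"
  using b by (auto intro!: integral_nonneg_AE elim!: eventually_mono)
 show "0 \<le> (\<integral>x. f x * \<psi> x \<partial>M)"
  using b f_nonneg by (intro integral_nonneg_AE) (auto elim: eventually_elim2)
 have j: "integrable M (\<lambda>x. flux p (U x) \<bullet> \<Psi> x)" "integrable M (\<lambda>x. flux q (U x) \<bullet> \<Psi> x)"
  using flux_inner_integrable[OF p(1) sobolev0D(2)[OF u(1)] L(2)]
   flux_inner_integrable[OF q sobolev0D(2)[OF u(6)] sobolev0D(2)[OF sobolev0_mono[OF p(3) less_imp_le[OF qp] \<psi>]]] by auto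
 have "(\<integral>x. flux p (U x) \<bullet> \<Psi> x \<partial>M) + (\<integral>x. flux q (U x) \<bullet> \<Psi> x \<partial>M) = (\<integral>x. flux p (U x) \<bullet> \<Psi> x + flux q (U x) \<bullet> \<Psi> x \<partial>M)"
  using j by simp
 also have "\<dots> = (\<integral>x. (\<alpha> * u x powr (p - 1) + \<beta> * u x powr (q - 1) + f x) * \<psi> x \<partial>M)"
  using s \<psi> unfolding solution_def by blast
 also have "\<dots> = (\<integral>x. \<alpha> * (u x powr (p - 1) * \<psi> x) + \<beta> * (u x powr (q - 1) * \<psi> x) + f x * \<psi> x \<partial>M)"
  by (simp add: algebra_simps)
 also have "\<dots> = \<alpha> * (\<integral>x. u x powr (p - 1) * \<psi> x \<partial>M) + \<beta> * (\<integral>x. u x powr (q - 1) * \<psi> x \<partial>M) + (\<integral>x. f x * \<psi> x \<partial>M)"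
  using i by simp
 finally show "(\<integral>x. flux p (U x) \<bullet> \<Psi> x \<partial>M) + (\<integral>x. flux q (U x) \<bullet> \<Psi> x \<partial>M)
   = \<alpha> * (\<integral>x. u x powr (p - 1) * \<psi> x \<partial>M) + \<beta> * (\<integral>x. u x powr (q - 1) * \<psi> x \<partial>M) + (\<integral>x. f x * \<psi> x \<partial>M)" .
qed

text \<open>Tested with \<open>\<phi> powr p\<close>, the equation of \<open>u = 0\<close> would say that \<open>f\<close> vanishes.\<close>

lemma solution_not_zero:
 assumes s: "solution \<beta> u U" shows "\<not> (AE x in M. u x = 0)"
proof
 assume u0: "AE x in M. u x = 0"
 have a: "admissible u U" using s by (simp add: solution_def)
 have z1: "sobolev0 p (\<lambda>_. 0) U"
  by (rule sobolev0_cong_AE[OF admissibleD(1)[OF a] p(2) u0]) auto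
 have "C1_compact_support \<Omega> (\<lambda>_. 0) (\<lambda>_. 0)"
  by (rule C1_compact_supportI[where K="{}"]) (auto simp: GDERIV_const)
 then have z2: "sobolev0 p (\<lambda>_. 0) (\<lambda>_. 0)" using p(2) by (rule sobolev0_C1)
 have U0: "AE x in M. U x = 0"
  using sobolev0_wgrad[OF _ z1] sobolev0_wgrad[OF _ z2] p by (auto elim: eventually_elim2)
 have \<psi>: "sobolev0 p (\<lambda>x. \<phi> x powr p) (\<lambda>x. (p * \<phi> x powr (p - 1)) *\<^sub>R g x)"
  by (rule sobolev0_power[OF p(2,1)])
 have b: "AE x in M. 0 \<le> \<phi> x powr p \<and> \<phi> x powr p \<le> B powr p"
  using \<phi>_powr_le p by (intro AE_I2) auto
 note I = solution_identity[OF s \<psi> b]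
 have z: "integral\<^sup>L M F = 0" if "AE x in M. F x = 0" for F :: "'a \<Rightarrow> real"
  using that by (rule integral_eq_zero_AE)
 have "(\<integral>x. flux p (U x) \<bullet> ((p * \<phi> x powr (p - 1)) *\<^sub>R g x) \<partial>M) = 0" "(\<integral>x. flux q (U x) \<bullet> ((p * \<phi> x powr (p - 1)) *\<^sub>R g x) \<partial>M) = 0"
  using U0 by (auto intro!: z elim!: eventually_mono)
 moreover have "(\<integral>x. u x powr (p - 1) * \<phi> x powr p \<partial>M) = 0" "(\<integral>x. u x powr (q - 1) * \<phi> x powr p \<partial>M) = 0"
  using u0 by (auto intro!: z elim!: eventually_mono)
 ultimately have "(\<integral>x. f x * \<phi> x powr p \<partial>M) = 0" using I(1) by simp
 moreover have "AE x in M. 0 \<le> f x * \<phi> x powr p" using f_nonneg by eventually_elim simp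
 ultimately have "AE x in M. f x * \<phi> x powr p = 0"
  using integral_nonneg_eq_0_iff_AE[OF I(5)] by simp
 moreover have "AE x in M. 0 < \<phi> x" using \<phi>_pos by (intro AE_I2) simp
 ultimately have "AE x in M. f x = 0" by eventually_elim simp
 with f_nonzero show False by simp
qed

text \<open>The logarithmic estimate of Moser type: test with \<open>\<phi>^p / v^(q-1)\<close>. On the left, Young's inequality leaves
  \<open>-(q-1)/2\<close> times the wanted integral and terms bounded independently of \<open>\<delta>\<close>; the term with \<open>\<beta>\<close> is bounded since
  \<open>u / v \<le> 1\<close>, and the terms with \<open>\<alpha>\<close> and \<open>f\<close> have a favourable sign.\<close>

lemma log_gradient_bound:
 assumes s: "solution \<beta> u U"
 obtains C where "\<And>\<delta>. 0 < \<delta> \<Longrightarrow> \<delta> \<le> 1 \<Longrightarrow>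
  integrable M (\<lambda>x. \<phi> x powr p * norm (logdiff \<delta> u U x) powr q) \<and>
  (\<integral>x. \<phi> x powr p * norm (logdiff \<delta> u U x) powr q \<partial>M) \<le> C"
proof -
 have a: "admissible u U" using s by (simp add: solution_def)
 note u = admissibleD[OF a]
 note [measurable] = u(4,5)
 (* The constants of the Young inequality that absorbs the mixed term completely (K1) or up to one half (K2). *)
 define K1 where "K1 = p * ((q - 1) / p) powr (1 - p)"
 define K2 where "K2 = p * ((q - 1) / (2 * p)) powr (1 - q)"
 have K: "0 \<le> K1" "0 \<le> K2" using p by (auto simp: K1_def K2_def)
 (* Since delta <= 1, the factor v^(p-q) left by the p-Laplacian is at most (u + 1)^(p-q). *)
 have iv: "integrable M (\<lambda>x. \<bar>u x + 1\<bar> powr (p - q))"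
 proof -
  have "(\<lambda>x. u x + 1) \<in> Lspace \<Omega> p"
   by (rule Lspace_add[OF p(2) sobolev0D(1)[OF u(1)] Lspace_bounded[where B=1]]) (use p in auto)
  then show ?thesis using LspaceD(2)[OF Lspace_mono[of "p - q" p]] p by fastforce
 qed
 define C where "C = (K1 * B powr p * (\<integral>x. \<bar>u x + 1\<bar> powr (p - q) \<partial>M) + K2 * B powr p * measure M \<Omega>
    + \<bar>\<beta>\<bar> * (B powr p * measure M \<Omega>)) * 2 / (q - 1)"
 show ?thesis
 proof (rule that[of C])
  fix \<delta> :: real assume \<delta>: "0 < \<delta>" "\<delta> \<le> 1"
  let ?S = "\<lambda>x. \<phi> x powr p * norm (logdiff \<delta> u U x) powr q"
  let ?\<Psi> = "\<lambda>x. test_grad p (q - 1) \<delta> u U x"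
  let ?\<psi> = "\<lambda>x. \<phi> x powr p * (u x + \<delta>) powr (- (q - 1))"
  have [measurable]: "logdiff \<delta> u U \<in> borel_measurable M" unfolding logdiff_def[abs_def] by measurable
  have iS: "integrable M ?S"
  proof (rule Bochner_Integration.integrable_bound[of M "\<lambda>x. B powr p * (1 / \<delta>) powr q * norm (U x) powr q"])
   show "integrable M (\<lambda>x. B powr p * (1 / \<delta>) powr q * norm (U x) powr q)"
    using LspaceD(2)[OF sobolev0D(2)[OF u(6)]] by simp
   show "AE x in M. norm (?S x) \<le> norm (B powr p * (1 / \<delta>) powr q * norm (U x) powr q)"
    using u(2)
   proof eventually_elim
    case (elim x)
    have "norm (logdiff \<delta> u U x) \<le> 1 / \<delta> * norm (U x)"
     using elim \<delta> by (auto simp: logdiff_def abs_of_nonneg intro!: mult_right_mono divide_left_mono mult_pos_pos)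
    then have "norm (logdiff \<delta> u U x) powr q \<le> (1 / \<delta> * norm (U x)) powr q" using p by (intro powr_mono2) auto
    also have "\<dots> = (1 / \<delta>) powr q * norm (U x) powr q" using \<delta> by (intro powr_mult)
    finally have "\<phi> x powr p * norm (logdiff \<delta> u U x) powr q \<le> B powr p * ((1 / \<delta>) powr q * norm (U x) powr q)"
     using \<phi>_powr_le[of p x] elim p by (intro mult_mono) auto
    then show ?case by (simp add: mult.assoc)
   qed
  qed measurable
  have \<psi>: "sobolev0 p ?\<psi> ?\<Psi>" by (rule test_sobolev(1)[OF a \<delta>(1) p(1) p(6)])
  have b: "AE x in M. 0 \<le> ?\<psi> x \<and> ?\<psi> x \<le> B powr p * \<delta> powr (- (q - 1))"
   using u(2)
  proof eventually_elim
   case (elim x)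
   then show ?case using \<phi>_powr_le[of p x] p \<delta> by (auto intro!: mult_mono powr_mono2')
  qed
  note I = solution_identity[OF s \<psi> b]
  have ae: "AE x in M. flux p (U x) \<bullet> ?\<Psi> x + flux q (U x) \<bullet> ?\<Psi> x
    \<le> K1 * B powr p * \<bar>u x + 1\<bar> powr (p - q) + K2 * B powr p - (q - 1) / 2 * ?S x"
   using u(2)
  proof eventually_elim
   case (elim x)
   then have x: "x \<in> \<Omega>" "0 \<le> u x" by auto
   define v where "v = u x + \<delta>"
   define A where "A = (1 / \<phi> x) *\<^sub>R g x"
   define b where "b = logdiff \<delta> u U x"
   have s: "0 < \<phi> x" and v: "0 < v" using x \<phi>_pos \<delta> by (auto simp: v_def)
   have U: "U x = v *\<^sub>R b" and gx: "g x = \<phi> x *\<^sub>R A" using s v by (auto simp: b_def logdiff_def v_def A_def)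
   have \<Psi>: "?\<Psi> x = (\<phi> x powr p * v powr (- (q - 1))) *\<^sub>R (p *\<^sub>R A - (q - 1) *\<^sub>R b)"
   proof -
    have e1: "\<phi> x powr (p - 1) * \<phi> x = \<phi> x powr p" using s by (simp add: powr_diff)
    have e2: "v powr (- (q - 1) - 1) * v = v powr (- (q - 1))" using v powr_add[of v "- (q - 1) - 1" 1] by simp
    have "p * \<phi> x powr (p - 1) * v powr (- (q - 1)) * \<phi> x = \<phi> x powr p * v powr (- (q - 1)) * p"
     unfolding e1[symmetric] by (simp only: mult_ac)
    moreover have "(q - 1) * \<phi> x powr p * v powr (- (q - 1) - 1) * v = \<phi> x powr p * v powr (- (q - 1)) * (q - 1)"
     unfolding e2[symmetric] by (simp only: mult_ac)
    ultimately show ?thesis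
     unfolding U gx v_def[symmetric] scaleR_scaleR scaleR_right_diff_distrib by (simp only:)
   qed
   have gA: "\<phi> x * norm A \<le> B" using g_le[OF x(1)] s unfolding gx by simp
   have pA: "\<phi> x powr p * norm A powr r \<le> B powr p" if r: "0 < r" "r \<le> p" for r
   proof -
    have "\<phi> x powr p * norm A powr r = \<phi> x powr (p - r) * (\<phi> x * norm A) powr r"
     using s by (simp add: powr_mult powr_diff)
    also have "\<dots> \<le> B powr (p - r) * B powr r"
    proof (rule mult_mono)
     show "\<phi> x powr (p - r) \<le> B powr (p - r)" using r x(1) by (intro \<phi>_powr_le) auto
     show "(\<phi> x * norm A) powr r \<le> B powr r" using r s gA by (intro powr_mono2) auto
    qed auto
    also have "\<dots> = B powr p" by (simp flip: powr_add)
    finally show ?thesis .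
   qed
   have split: "flux r (U x) \<bullet> ?\<Psi> x = \<phi> x powr p * v powr (r - q) * (p * (flux r b \<bullet> A) - (q - 1) * norm b powr r)" for r
   proof -
    have e: "v powr (r - 1) * v powr (- (q - 1)) = v powr (r - q)" by (simp flip: powr_add)
    have "flux r b \<bullet> (p *\<^sub>R A - (q - 1) *\<^sub>R b) = p * (flux r b \<bullet> A) - (q - 1) * norm b powr r"
     by (simp add: inner_diff_right flux_inner_self)
    then show ?thesis
     unfolding \<Psi> unfolding U flux_scaleR[OF v] inner_scaleR_left inner_scaleR_right e[symmetric]
     by (simp only: mult_ac)
   qed
   have yp: "p * (flux r b \<bullet> A) \<le> p * (\<kappa> * norm b powr r + \<kappa> powr (1 - r) * norm A powr r)" if "0 < \<kappa>" "1 < r" for r \<kappa>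
    using flux_inner_le[of r b A] young_with_constant[of "norm b" "norm A" \<kappa> r] that p
    by (intro mult_left_mono) auto
   have 1: "flux p (U x) \<bullet> ?\<Psi> x \<le> K1 * B powr p * \<bar>u x + 1\<bar> powr (p - q)"
   proof -
    have "p * (flux p b \<bullet> A) - (q - 1) * norm b powr p \<le> K1 * norm A powr p"
    proof -
     have "p * ((q - 1) / p * norm b powr p + ((q - 1) / p) powr (1 - p) * norm A powr p) = (q - 1) * norm b powr p + K1 * norm A powr p"
      unfolding K1_def using p by (simp add: distrib_left)
     then show ?thesis using yp[of "(q - 1) / p" p] p by simp
    qed
    then have "\<phi> x powr p * v powr (p - q) * (p * (flux p b \<bullet> A) - (q - 1) * norm b powr p)
      \<le> \<phi> x powr p * v powr (p - q) * (K1 * norm A powr p)"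
     by (intro mult_left_mono) auto
    also have "\<dots> = K1 * (\<phi> x powr p * norm A powr p) * v powr (p - q)" by (simp only: mult_ac)
    also have "\<dots> \<le> K1 * B powr p * \<bar>u x + 1\<bar> powr (p - q)"
     using pA[of p] K(1) p x v \<delta> by (intro mult_mono powr_mono2 mult_nonneg_nonneg) (auto simp: v_def)
    finally show ?thesis unfolding split[of p] .
   qed
   have 2: "flux q (U x) \<bullet> ?\<Psi> x \<le> K2 * B powr p - (q - 1) / 2 * ?S x"
   proof -
    have "p * (flux q b \<bullet> A) - (q - 1) * norm b powr q \<le> K2 * norm A powr q - (q - 1) / 2 * norm b powr q"
    proof -
     have "p * ((q - 1) / (2 * p) * norm b powr q + ((q - 1) / (2 * p)) powr (1 - q) * norm A powr q) = (q - 1) / 2 * norm b powr q + K2 * norm A powr q"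
      unfolding K2_def using p by (simp add: distrib_left)
     then have "p * (flux q b \<bullet> A) \<le> (q - 1) / 2 * norm b powr q + K2 * norm A powr q"
      using yp[of "(q - 1) / (2 * p)" q] p q by simp
     moreover have "(q - 1) * norm b powr q = (q - 1) / 2 * norm b powr q + (q - 1) / 2 * norm b powr q" by simp
     ultimately show ?thesis by linarith
    qed
    then have "\<phi> x powr p * (p * (flux q b \<bullet> A) - (q - 1) * norm b powr q)
      \<le> \<phi> x powr p * (K2 * norm A powr q - (q - 1) / 2 * norm b powr q)"
     by (intro mult_left_mono) auto
    also have "\<dots> = K2 * (\<phi> x powr p * norm A powr q) - (q - 1) / 2 * (\<phi> x powr p * norm b powr q)"
     by (simp add: algebra_simps)
    also have "\<dots> \<le> K2 * B powr p - (q - 1) / 2 * (\<phi> x powr p * norm b powr q)"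
     using pA[of q] K(2) p qp by (intro diff_right_mono mult_left_mono) auto
    finally show ?thesis unfolding split[of q] b_def[symmetric] using v by simp
   qed
   show ?case using add_mono[OF 1 2] by (simp only: add_diff_eq)
  qed
  have iL: "integrable M (\<lambda>x. flux p (U x) \<bullet> ?\<Psi> x)" "integrable M (\<lambda>x. flux q (U x) \<bullet> ?\<Psi> x)"
   using flux_inner_integrable[OF p(1) sobolev0D(2)[OF u(1)] sobolev0D(2)[OF \<psi>]]
    flux_inner_integrable[OF q sobolev0D(2)[OF u(6)] sobolev0D(2)[OF sobolev0_mono[OF p(3) less_imp_le[OF qp] \<psi>]]] by auto
  have "(\<integral>x. flux p (U x) \<bullet> ?\<Psi> x \<partial>M) + (\<integral>x. flux q (U x) \<bullet> ?\<Psi> x \<partial>M) = (\<integral>x. flux p (U x) \<bullet> ?\<Psi> x + flux q (U x) \<bullet> ?\<Psi> x \<partial>M)"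
   using iL by simp
  also have "\<dots> \<le> (\<integral>x. K1 * B powr p * \<bar>u x + 1\<bar> powr (p - q) + K2 * B powr p - (q - 1) / 2 * ?S x \<partial>M)"
   using iL iv iS ae by (intro integral_mono_AE) auto
  also have "\<dots> = K1 * B powr p * (\<integral>x. \<bar>u x + 1\<bar> powr (p - q) \<partial>M) + K2 * B powr p * measure M \<Omega> - (q - 1) / 2 * (\<integral>x. ?S x \<partial>M)"
   using iv iS by (simp add: mult.commute)
  finally have up: "(\<integral>x. flux p (U x) \<bullet> ?\<Psi> x \<partial>M) + (\<integral>x. flux q (U x) \<bullet> ?\<Psi> x \<partial>M)
   \<le> K1 * B powr p * (\<integral>x. \<bar>u x + 1\<bar> powr (p - q) \<partial>M) + K2 * B powr p * measure M \<Omega> - (q - 1) / 2 * (\<integral>x. ?S x \<partial>M)" .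
  have "(\<integral>x. u x powr (q - 1) * ?\<psi> x \<partial>M) \<le> (\<integral>x. B powr p \<partial>M)"
  proof (rule integral_mono_AE)
   show "AE x in M. u x powr (q - 1) * ?\<psi> x \<le> B powr p"
    using u(2)
   proof eventually_elim
    case (elim x)
    have "u x powr (q - 1) * (u x + \<delta>) powr (- (q - 1)) = (u x / (u x + \<delta>)) powr (q - 1)"
     using elim \<delta> by (simp add: powr_divide powr_minus_divide del: powr_diff minus_diff_eq)
    also have "\<dots> \<le> 1 powr (q - 1)" using elim \<delta> p by (intro powr_mono2) auto
    finally have le: "u x powr (q - 1) * (u x + \<delta>) powr (- (q - 1)) \<le> 1" by simp
    have "\<phi> x powr p * (u x powr (q - 1) * (u x + \<delta>) powr (- (q - 1))) \<le> B powr p * 1"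
     using elim p \<phi>_powr_le[of p x] le by (intro mult_mono) auto
    then show ?case by (simp only: mult_ac mult_1)
   qed
  qed (use I(6) in auto)
  then have low1: "(\<integral>x. u x powr (q - 1) * ?\<psi> x \<partial>M) \<le> B powr p * measure M \<Omega>" by (simp add: mult.commute)
  have "- (\<bar>\<beta>\<bar> * (B powr p * measure M \<Omega>)) \<le> \<beta> * (\<integral>x. u x powr (q - 1) * ?\<psi> x \<partial>M)"
  proof -
   have "- (\<beta> * (\<integral>x. u x powr (q - 1) * ?\<psi> x \<partial>M)) \<le> \<bar>\<beta>\<bar> * (\<integral>x. u x powr (q - 1) * ?\<psi> x \<partial>M)"
    using I(3) mult_right_mono[of "- \<beta>" "\<bar>\<beta>\<bar>"] by fastforce
   also have "\<dots> \<le> \<bar>\<beta>\<bar> * (B powr p * measure M \<Omega>)" using low1 by (rule mult_left_mono) simp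
   finally show ?thesis by linarith
  qed
  moreover have "0 \<le> \<alpha> * (\<integral>x. u x powr (p - 1) * ?\<psi> x \<partial>M)" using \<alpha>_pos I(2) by simp
  ultimately have "(q - 1) / 2 * (\<integral>x. ?S x \<partial>M) \<le> K1 * B powr p * (\<integral>x. \<bar>u x + 1\<bar> powr (p - q) \<partial>M) + K2 * B powr p * measure M \<Omega>
    + \<bar>\<beta>\<bar> * (B powr p * measure M \<Omega>)"
   using up I(1,4) by linarith
  then have "(\<integral>x. ?S x \<partial>M) \<le> C" using p by (simp add: C_def field_simps)
  then show "integrable M ?S \<and> (\<integral>x. ?S x \<partial>M) \<le> C" using iS by simp
 qed
qed

end

section \<open>Positivity of solutions and the limit of small shifts\<close>

context bounded_open
begin

lemma negligible_iff_AE: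
 assumes "N \<subseteq> \<Omega>"
 shows "negligible N \<longleftrightarrow> (AE x in M. x \<notin> N)"
proof -
 have "negligible N \<longleftrightarrow> N \<in> null_sets lebesgue" by (rule negligible_iff_null_sets)
 also have "\<dots> \<longleftrightarrow> (AE x in lebesgue. x \<notin> N)"
  by (simp add: completion.AE_iff_null_sets)
 also have "\<dots> \<longleftrightarrow> (AE x in M. x \<notin> N)"
  using assms by (auto simp: AE_restrict_space_iff elim!: eventually_mono)
 finally show ?thesis .
qed

lemma sublevel_sets:
 fixes y :: "'a \<Rightarrow> real"
 assumes "{x \<in> space M. P x} \<in> sets M"
 shows "{x \<in> \<Omega>. P x} \<in> sets lebesgue"
 using assms sets.Int[OF \<Omega>_sets] by (auto simp: sets_restrict_space)

end

context first_eigenfunction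
begin

lemma log_sobolev:
 assumes a: "admissible u U" and \<delta>: "0 < \<delta>"
 shows "sobolev0 p (\<lambda>x. c * ln (1 + u x / \<delta>)) (\<lambda>x. c *\<^sub>R logdiff \<delta> u U x)"
proof -
 define G where "G t = ln (1 + t / \<delta>)" for t
 define G' where "G' t = 1 / (t + \<delta>)" for t
 define F where "F t = (if 0 \<le> t then G t else G 0 + G' 0 * t)" for t
 define F' where "F' t = (if 0 \<le> t then G' t else G' 0)" for t
 have "(G has_real_derivative G' t) (at t)" if "0 \<le> t" for t
 proof -
  have pos: "0 < 1 + t / \<delta>" using that \<delta> by (simp add: add_pos_nonneg)
  have "(G has_real_derivative (1 / \<delta>) / (1 + t / \<delta>)) (at t)"
   unfolding G_def using pos \<delta> by (auto intro!: derivative_eq_intros)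
  also have "(1 / \<delta>) / (1 + t / \<delta>) = G' t" using that \<delta> by (simp add: G'_def field_simps)
  finally show ?thesis .
 qed
 then have F: "(F has_real_derivative F' t) (at t)" for t
  unfolding F_def F'_def by (rule linear_extension_deriv)
 have F'_eq: "F' = (\<lambda>t. 1 / (max 0 t + \<delta>))"
  by (auto simp: F'_def G'_def fun_eq_iff max_def)
 have F'c: "continuous_on UNIV F'"
  unfolding F'_eq using \<delta> by (intro continuous_intros) (smt (verit) max.cobounded1)
 have F'b: "\<bar>F' t\<bar> \<le> 1 / \<delta>" for t
  unfolding F'_eq using \<delta> by (auto intro!: divide_left_mono mult_pos_pos)
 have F0: "F 0 = 0" by (simp add: F_def G_def)
 have "sobolev0 p (\<lambda>x. c * F (u x)) (\<lambda>x. F (u x) *\<^sub>R 0 + (c * F' (u x)) *\<^sub>R U x)"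
  by (rule sobolev0_chain[OF p(2) admissibleD(1)[OF a] F F'c F'b F0, where w="\<lambda>_. c" and dw="\<lambda>_. 0" and B="\<bar>c\<bar>"])
   (auto simp: GDERIV_const)
 then show ?thesis
 proof (rule sobolev0_cong_AE[OF _ p(2)])
  show "AE x in M. c * F (u x) = c * ln (1 + u x / \<delta>)"
   using admissibleD(3)[OF a] by eventually_elim (simp add: F_def G_def)
  show "AE x in M. F (u x) *\<^sub>R 0 + (c * F' (u x)) *\<^sub>R U x = c *\<^sub>R logdiff \<delta> u U x"
   using admissibleD(3)[OF a] by eventually_elim (simp add: F'_def G'_def logdiff_def)
 qed
qed

lemma local_ball:
 assumes "x \<in> \<Omega>"
 obtains R c where "0 < R" "cball x (3 * R) \<subseteq> \<Omega>" "0 < c" "\<And>y. y \<in> cball x (3 * R) \<Longrightarrow> c \<le> \<phi> y"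
proof -
 obtain e where e: "0 < e" "cball x e \<subseteq> \<Omega>" using \<Omega>_open assms open_contains_cball by blast
 obtain y where y: "y \<in> cball x e" "\<And>z. z \<in> cball x e \<Longrightarrow> \<phi> y \<le> \<phi> z"
  using continuous_attains_inf[of "cball x e" \<phi>] continuous_on_subset[OF \<phi>_cont e(2)] e(1) by auto
 show ?thesis
  by (rule that[of "e / 3" "\<phi> y"]) (use e y \<phi>_pos in auto)
qed

end

context forced_problem
begin

text \<open>Strong maximum principle. The functions \<open>ln (1 + u/\<delta>) / ln (1/\<delta>)\<close> vanish where \<open>u = 0\<close> and tend to 1 where \<open>u > 0\<close>.
  By the logarithmic estimate their gradients tend to 0 locally. If \<open>{u = 0}\<close> had positive measure, they would tend to
  0 everywhere by connectedness, so \<open>u\<close> would vanish identically.\<close>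

lemma solution_positive:
 assumes s: "solution \<beta> u U"
 shows "AE x in M. 0 < u x"
proof (rule ccontr)
 assume np: "\<not> (AE x in M. 0 < u x)"
 have a: "admissible u U" using s by (simp add: solution_def)
 note u = admissibleD[OF a]
 note [measurable] = u(4,5)
 obtain C where C: "\<And>\<delta>. 0 < \<delta> \<Longrightarrow> \<delta> \<le> 1 \<Longrightarrow>
  integrable M (\<lambda>x. \<phi> x powr p * norm (logdiff \<delta> u U x) powr q) \<and>
  (\<integral>x. \<phi> x powr p * norm (logdiff \<delta> u U x) powr q \<partial>M) \<le> C"
  using log_gradient_bound[OF s] by blast
 (* The shift by 2 keeps ln (N n) positive. *)
 define N where "N n = real n + 2" for n
 define \<delta> where "\<delta> n = 1 / N n" for n
 define c where "c n = 1 / ln (N n)" for n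
 define l where "l n x = c n * ln (1 + u x / \<delta> n)" for n x
 have N: "2 \<le> N n" for n by (simp add: N_def)
 have \<delta>: "0 < \<delta> n" "\<delta> n \<le> 1" for n using N[of n] by (auto simp: \<delta>_def)
 have cpos: "0 < c n" for n using N[of n] by (simp add: c_def)
 have c0: "c \<longlonglongrightarrow> 0"
 proof -
  have "filterlim (\<lambda>n. N n) at_top sequentially"
   unfolding N_def by (rule filterlim_tendsto_add_at_top[OF tendsto_const filterlim_real_sequentially, of 2, simplified add.commute])
  then have "filterlim (\<lambda>n. ln (N n)) at_top sequentially" by (rule filterlim_compose[OF ln_at_top])
  then show ?thesis unfolding c_def by (rule tendsto_divide_0[OF tendsto_const filterlim_at_top_imp_at_infinity])
 qed
 have ls: "sobolev0 p (l n) (\<lambda>x. c n *\<^sub>R logdiff (\<delta> n) u U x)" for n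
  unfolding l_def by (rule log_sobolev[OF a \<delta>(1)])
 have loc: "\<exists>R>0. ball x R \<subseteq> \<Omega> \<and> (\<forall>n. integrable M (\<lambda>y. indicator (ball x R) y * l n y)) \<and>
    (\<exists>m. (\<lambda>n. \<integral>y. indicator (ball x R) y * \<bar>l n y - m n\<bar> \<partial>M) \<longlonglongrightarrow> 0)" if x: "x \<in> \<Omega>" for x
 proof -
  obtain R b where R: "0 < R" "cball x (3 * R) \<subseteq> \<Omega>" and b: "0 < b" "\<And>y. y \<in> cball x (3 * R) \<Longrightarrow> b \<le> \<phi> y"
   using local_ball[OF x] by blast
  let ?W = "ball x (3 * R)" and ?B = "ball x R"
  have BW: "?B \<subseteq> ?W" using R(1) by auto
  have W\<Omega>: "?W \<subseteq> \<Omega>" using R(2) ball_subset_cball by blast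
  have sets: "?B \<in> sets lebesgue" "?W \<in> sets lebesgue" by (auto simp: borel_open)
  have one: "1 \<le> p" using p by simp
  note P = sobolev0_poincare[OF one ls R(1) R(2), of "\<lambda>_. 1" "\<lambda>_. 0", simplified GDERIV_const, OF TrueI, simplified]
  have iB: "integrable M (\<lambda>y. indicator ?B y * l n y)" for n
  proof -
   have "(\<lambda>y. indicator ?B y * l n y) = (\<lambda>y. indicator ?B y * (indicator ?W y * l n y))"
    using BW by (auto simp: indicator_def fun_eq_iff)
   then show ?thesis using set_M_integrable[OF P(1)[of n] sets(1)] by simp
  qed
  define K where "K = 2 * R * measure lborel (ball (0::'a) (2 * R)) / measure lborel ?B"
  have K: "0 \<le> K" using R(1) by (simp add: K_def)
  define m where "m n = (\<integral>y. indicator ?B y * l n y \<partial>M) / measure lborel ?B" for n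
  define T where "T = measure M \<Omega> + C / b powr p"
  have grad: "(\<integral>y. indicator ?W y * norm (c n *\<^sub>R logdiff (\<delta> n) u U y) \<partial>M) \<le> c n * T" for n
  proof -
   let ?S = "\<lambda>y. \<phi> y powr p * norm (logdiff (\<delta> n) u U y) powr q"
   note Cn = C[OF \<delta>, of n]
   have "(\<integral>y. indicator ?W y * norm (c n *\<^sub>R logdiff (\<delta> n) u U y) \<partial>M) \<le> (\<integral>y. c n * (1 + ?S y / b powr p) \<partial>M)"
   proof (rule integral_mono)
    show "integrable M (\<lambda>y. indicator ?W y * norm (c n *\<^sub>R logdiff (\<delta> n) u U y))"
     using integrable_norm[OF P(2)[of n]] by (simp add: abs_mult mult.assoc)
    show "integrable M (\<lambda>y. c n * (1 + ?S y / b powr p))"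
     using Cn by auto
    fix y
    show "indicator ?W y * norm (c n *\<^sub>R logdiff (\<delta> n) u U y) \<le> c n * (1 + ?S y / b powr p)"
    proof (cases "y \<in> ?W")
     case True
     define L where "L = norm (logdiff (\<delta> n) u U y)"
     have "L \<le> 1 + L powr q" using powr_le_scaled[of 1 q 1 L] q by (simp add: L_def)
     also have "L powr q \<le> \<phi> y powr p * L powr q / b powr p"
     proof -
      have "b powr p \<le> \<phi> y powr p" using b True p by (intro powr_mono2) auto
      then have "b powr p * L powr q \<le> \<phi> y powr p * L powr q" by (rule mult_right_mono) simp
      then show ?thesis using b(1) by (simp add: field_simps)
     qed
     finally have "c n * L \<le> c n * (1 + \<phi> y powr p * L powr q / b powr p)"
      using cpos[of n] by (intro mult_left_mono) auto
     then show ?thesis using True cpos[of n] by (simp add: L_def)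
    next
     case False
     then show ?thesis using cpos[of n] by (auto intro!: mult_nonneg_nonneg add_nonneg_nonneg)
    qed
   qed
   also have "\<dots> = c n * (measure M \<Omega> + (\<integral>y. ?S y \<partial>M) / b powr p)"
    using Cn by simp
   also have "\<dots> \<le> c n * T"
    unfolding T_def using Cn cpos[of n] b(1) by (intro mult_left_mono add_left_mono divide_right_mono) auto
   finally show ?thesis .
  qed
  have le: "(\<integral>y. indicator ?B y * \<bar>l n y - m n\<bar> \<partial>M) \<le> K * (c n * T)" for n
  proof -
   have "(\<integral>y. indicator ?B y * \<bar>l n y - m n\<bar> \<partial>M) \<le> K * (\<integral>y. indicator ?W y * norm (c n *\<^sub>R logdiff (\<delta> n) u U y) \<partial>M)"
    using P(3)[of n] unfolding K_def m_def by simp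
   also have "\<dots> \<le> K * (c n * T)" using grad K by (intro mult_left_mono)
   finally show ?thesis .
  qed
  have "(\<lambda>n. K * (c n * T)) \<longlonglongrightarrow> K * (0 * T)" by (intro tendsto_intros c0)
  then have "(\<lambda>n. \<integral>y. indicator ?B y * \<bar>l n y - m n\<bar> \<partial>M) \<longlonglongrightarrow> 0"
   by (intro tendsto_zero_le[OF _ le]) (auto intro!: Bochner_Integration.integral_nonneg)
  then show ?thesis using R(1) W\<Omega> BW iB by blast
 qed
 define E where "E = {x \<in> \<Omega>. u x \<le> 0}"
 have E: "E \<in> sets lebesgue" unfolding E_def by (rule sublevel_sets) measurable
 have E\<Omega>: "E \<subseteq> \<Omega>" by (auto simp: E_def)
 have "\<not> negligible E"
 proof
  assume "negligible E"
  then have "AE x in M. x \<notin> E" using negligible_iff_AE[OF E\<Omega>] by simp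
  moreover have "AE x in M. x \<in> \<Omega>" by (intro AE_I2) simp
  ultimately have "AE x in M. 0 < u x" by eventually_elim (simp add: E_def)
  with np show False by simp
 qed
 have zE: "AE x in M. indicator E x * l n x = 0" for n
  using u(3) by eventually_elim (auto simp: E_def l_def indicator_def)
 have [measurable]: "l n \<in> borel_measurable M" for n using sobolev0D(3)[OF ls] .
 have [measurable]: "indicat_real E \<in> borel_measurable M" using E by (rule indicator_M_measurable)
 have iE: "integrable M (\<lambda>x. indicator E x * l n x)" for n
  by (rule Bochner_Integration.integrable_cong_AE_imp[of M "\<lambda>_. 0"]) (use zE in \<open>auto elim: eventually_mono\<close>)
 have "(\<integral>x. indicator E x * \<bar>l n x\<bar> \<partial>M) = 0" for n
  by (rule integral_eq_zero_AE) (use zE[of n] in \<open>auto elim!: eventually_mono\<close>)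
 then have E0: "(\<lambda>n. \<integral>x. indicator E x * \<bar>l n x\<bar> \<partial>M) \<longlonglongrightarrow> 0" by simp
 note spread = connected_spread[OF \<Omega>_connected loc E E\<Omega> \<open>\<not> negligible E\<close> iE E0]
 define P where "P = {x \<in> \<Omega>. 0 < u x}"
 (* 1 + u N >= sqrt N as soon as N u^2 >= 1, and half of the limit 1 is enough. *)
 have l_half: "\<forall>\<^sub>F n in sequentially. 1 / 2 \<le> l n x" if ux: "0 < u x" for x
 proof -
  obtain n0 :: nat where n0: "1 / (u x)\<^sup>2 \<le> real n0" using real_arch_simple by blast
  show ?thesis
   unfolding eventually_sequentially
  proof (intro exI allI impI)
   fix n assume n: "n0 \<le> n"
   have "1 / (u x)\<^sup>2 \<le> N n" using n n0 by (simp add: N_def)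
   then have "1 \<le> N n * (u x)\<^sup>2" using ux by (simp add: field_simps)
   then have "N n \<le> N n * N n * (u x)\<^sup>2" using N[of n] by (simp add: mult.assoc)
   then have "sqrt (N n) \<le> N n * u x"
    using ux N[of n] by (intro real_le_lsqrt) (auto simp: power_mult_distrib power2_eq_square mult_ac)
   then have "sqrt (N n) \<le> 1 + u x / \<delta> n" by (simp add: \<delta>_def mult.commute)
   then have "ln (sqrt (N n)) \<le> ln (1 + u x / \<delta> n)" using N[of n] by (intro ln_mono) auto
   moreover have "ln (sqrt (N n)) = ln (N n) / 2" using N[of n] by (simp add: ln_sqrt)
   ultimately show "1 / 2 \<le> l n x" using N[of n] by (simp add: l_def c_def field_simps)
  qed
 qed
 have "negligible P"
  unfolding locally_negligible_alt[of P]
 proof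
  fix x assume xP: "x \<in> P"
  then have x: "x \<in> \<Omega>" by (simp add: P_def)
  obtain R where R: "0 < R" "ball x R \<subseteq> \<Omega>" "\<And>n. integrable M (\<lambda>y. indicator (ball x R) y * l n y)"
   "(\<lambda>n. \<integral>y. indicator (ball x R) y * \<bar>l n y\<bar> \<partial>M) \<longlonglongrightarrow> 0"
   using spread[OF _ x] by blast
  let ?B = "ball x R"
  have eq: "norm (indicator ?B y * l n y) = indicator ?B y * \<bar>l n y\<bar>" for n y by (simp add: abs_mult)
  obtain k where k: "strict_mono k" "AE y in M. (\<lambda>n. indicator ?B y * l (k n) y) \<longlonglongrightarrow> 0"
   using tendsto_L1_AE_subseq[of M "\<lambda>n y. indicator ?B y * l n y"] R(3,4) unfolding eq by blast
  have "AE y in M. y \<notin> P \<inter> ?B"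
   using k(2)
  proof eventually_elim
   case (elim y)
   show ?case
   proof
    assume y: "y \<in> P \<inter> ?B"
    then have "(\<lambda>n. l (k n) y) \<longlonglongrightarrow> 0" using elim by simp
    then have "\<forall>\<^sub>F n in sequentially. l (k n) y < 1 / 2" by (rule order_tendstoD(2)) simp
    moreover have "\<forall>\<^sub>F n in sequentially. 1 / 2 \<le> l (k n) y"
     using l_half[of y] y eventually_subseq[OF k(1)] by (simp add: P_def)
    ultimately have "\<forall>\<^sub>F n::nat in sequentially. False" by eventually_elim simp
    then show False by simp
   qed
  qed
  then have "negligible (P \<inter> ?B)" using negligible_iff_AE[of "P \<inter> ?B"] by (auto simp: P_def)
  then show "\<exists>V. openin (top_of_set P) V \<and> x \<in> V \<and> negligible V"
   using xP R(1) by (intro exI[of _ "P \<inter> ?B"]) (auto intro: openin_open_Int)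
 qed
 then have "AE x in M. x \<notin> P" using negligible_iff_AE[of P] by (auto simp: P_def)
 then have "AE x in M. u x = 0" using u(2) by eventually_elim (simp add: P_def)
 with solution_not_zero[OF s] show False by simp
qed

text \<open>The equation tested with \<open>\<phi>^p / v^(p-1)\<close>. The quotients \<open>u / v\<close> account for the difference between \<open>u\<close> in the
  equation and \<open>v\<close> in the test function.\<close>

lemma solution_picone:
 assumes s: "solution \<beta> u U" and \<delta>: "0 < \<delta>"
 shows "\<alpha> * (\<integral>x. \<phi> x powr p * (u x / (u x + \<delta>)) powr (p - 1) \<partial>M)
   + \<beta> * (\<integral>x. weight \<delta> u x * (u x / (u x + \<delta>)) powr (q - 1) \<partial>M)
   + (\<integral>x. forcing \<delta> u x \<partial>M) + defect \<delta> u U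
  \<le> (\<integral>x. norm (g x) powr p \<partial>M) + \<mu> * mass \<delta> u" (is ?P)
  and "0 \<le> (\<integral>x. forcing \<delta> u x \<partial>M)" (is ?Q)
  and "integrable M (\<lambda>x. forcing \<delta> u x)" (is ?R)
  and "0 \<le> (\<integral>x. \<phi> x powr p * (u x / (u x + \<delta>)) powr (p - 1) \<partial>M)" (is ?S)
  and "0 \<le> (\<integral>x. weight \<delta> u x * (u x / (u x + \<delta>)) powr (q - 1) \<partial>M)" (is ?T)
  and "(\<integral>x. weight \<delta> u x * (u x / (u x + \<delta>)) powr (q - 1) \<partial>M) \<le> mass \<delta> u" (is ?V)
  and "integrable M (\<lambda>x. weight \<delta> u x * (u x / (u x + \<delta>)) powr (q - 1))" (is ?I)
proof -
 have a: "admissible u U" using s by (simp add: solution_def)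
 note u = admissibleD[OF a]
 note [measurable] = u(4,5) weight_measurable[OF a]
 let ?\<psi> = "\<lambda>x. \<phi> x powr p * (u x + \<delta>) powr (- (p - 1))"
 have \<psi>: "sobolev0 p ?\<psi> (\<lambda>x. test_grad p (p - 1) \<delta> u U x)" by (rule test_sobolev(1)[OF a \<delta> p(1) p(5)])
 have b: "AE x in M. 0 \<le> ?\<psi> x \<and> ?\<psi> x \<le> B powr p * \<delta> powr (- (p - 1))"
  using u(2)
 proof eventually_elim
  case (elim x)
  then show ?case using \<phi>_powr_le[of p x] p \<delta> by (auto intro!: mult_mono powr_mono2')
 qed
 note I = solution_identity[OF s \<psi> b]
 have ratio: "u x powr r * (u x + \<delta>) powr (- r) = (u x / (u x + \<delta>)) powr r" if "0 \<le> u x" for x r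
  using that \<delta> by (simp add: powr_divide powr_minus_divide)
 have ae1: "AE x in M. u x powr (p - 1) * ?\<psi> x = \<phi> x powr p * (u x / (u x + \<delta>)) powr (p - 1)"
  using u(2)
 proof eventually_elim
  case (elim x)
  then show ?case using ratio[of x "p - 1"] by (metis mult.left_commute)
 qed
 have ae2: "AE x in M. u x powr (q - 1) * ?\<psi> x = weight \<delta> u x * (u x / (u x + \<delta>)) powr (q - 1)"
  using u(2)
 proof eventually_elim
  case (elim x)
  have e: "(u x + \<delta>) powr (- (p - 1)) = (u x + \<delta>) powr (- (p - q)) * (u x + \<delta>) powr (- (q - 1))"
   by (simp flip: powr_add)
  have r: "u x powr (q - 1) * (u x + \<delta>) powr (- (q - 1)) = (u x / (u x + \<delta>)) powr (q - 1)" using elim by (intro ratio) simp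
  show ?case unfolding weight_def e r[symmetric] by (simp only: mult_ac)
 qed
 have i1: "(\<integral>x. u x powr (p - 1) * ?\<psi> x \<partial>M) = (\<integral>x. \<phi> x powr p * (u x / (u x + \<delta>)) powr (p - 1) \<partial>M)"
  by (rule integral_cong_AE[OF _ _ ae1]) measurable
 have i2: "(\<integral>x. u x powr (q - 1) * ?\<psi> x \<partial>M) = (\<integral>x. weight \<delta> u x * (u x / (u x + \<delta>)) powr (q - 1) \<partial>M)"
  by (rule integral_cong_AE[OF _ _ ae2]) measurable
 note Pi = picone_integrated[OF a \<delta>]
 show ?P using I(1) Pi(3,5) unfolding i1 i2 by linarith
 show ?Q ?R using I(4,5) by auto
 show ?S ?T using I(2,3) unfolding i1 i2 by auto
 show iI: ?I
  by (rule Bochner_Integration.integrable_cong_AE_imp[OF I(6)]) (use ae2 in \<open>auto elim: eventually_mono\<close>)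
 show ?V
 proof (rule integral_mono_AE[OF iI weight_integrable[OF a \<delta>]])
  show "AE x in M. weight \<delta> u x * (u x / (u x + \<delta>)) powr (q - 1) \<le> weight \<delta> u x"
   using u(2)
  proof eventually_elim
   case (elim x)
   have "(u x / (u x + \<delta>)) powr (q - 1) \<le> 1 powr (q - 1)" using elim \<delta> p by (intro powr_mono2) auto
   then show ?case using weight_nonneg[of \<delta> u x] by (simp add: mult_left_le)
  qed
 qed
qed

text \<open>At most half of the weight sits where \<open>u < k\<close>, by \<open>weight_concentration\<close>, once \<open>k\<close> is so small that this set has
  small measure; such \<open>k\<close> exists as \<open>u > 0\<close>. Elsewhere the weight is bounded by \<open>B^p / k^(p-q)\<close>.\<close>

lemma solution_weight_bounded:
 assumes s: "solution \<beta> u U"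
 obtains C where "\<And>\<delta>. 0 < \<delta> \<Longrightarrow> mass \<delta> u \<le> C"
proof -
 have a: "admissible u U" using s by (simp add: solution_def)
 note u = admissibleD[OF a]
 define G where "G = (\<integral>x. norm (g x) powr p \<partial>M)"
 have G: "0 \<le> G" unfolding G_def by (intro Bochner_Integration.integral_nonneg) simp
 define L where "L = G + \<mu> + \<bar>\<beta>\<bar>"
 have L: "0 \<le> L" using G \<mu> by (simp add: L_def)
 obtain \<nu> where \<nu>: "0 < \<nu>" and conc: "\<And>u U \<delta> A. admissible u U \<Longrightarrow> 0 < \<delta> \<Longrightarrow> defect \<delta> u U \<le> L * (1 + mass \<delta> u) \<Longrightarrow>
   A \<in> sets lebesgue \<Longrightarrow> A \<subseteq> \<Omega> \<Longrightarrow> measure lebesgue A \<le> \<nu> \<Longrightarrow>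
   (\<integral>x. indicator A x * weight \<delta> u x \<partial>M) \<le> (1 + mass \<delta> u) / 2"
  using weight_concentration[OF L] by blast
 obtain k where k: "0 < k" "{x \<in> \<Omega>. u x < k} \<in> sets lebesgue" "measure lebesgue {x \<in> \<Omega>. u x < k} \<le> \<nu>"
  using small_sublevel[OF u(4) solution_positive[OF s] \<nu>] by blast
 let ?A = "{x \<in> \<Omega>. u x < k}"
 define D where "D = B powr p * k powr (- (p - q))"
 show ?thesis
 proof (rule that[of "1 + 2 * (D * measure M \<Omega>)"])
  fix \<delta> :: real assume \<delta>: "0 < \<delta>"
  define W where "W = mass \<delta> u"
  have W0: "0 \<le> W" unfolding W_def by (rule weight_integral_nonneg)
  note S = solution_picone[OF s \<delta>]
  define I2 where "I2 = (\<integral>x. weight \<delta> u x * (u x / (u x + \<delta>)) powr (q - 1) \<partial>M)"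
  have "- (\<beta> * I2) \<le> \<bar>\<beta>\<bar> * W"
  proof -
   have "- (\<beta> * I2) \<le> \<bar>\<beta>\<bar> * I2" using S(5) mult_right_mono[of "- \<beta>" "\<bar>\<beta>\<bar>" I2] unfolding I2_def by fastforce
   also have "\<dots> \<le> \<bar>\<beta>\<bar> * W" using S(6) unfolding I2_def W_def by (intro mult_left_mono) auto
   finally show ?thesis .
  qed
  moreover have "0 \<le> \<alpha> * (\<integral>x. \<phi> x powr p * (u x / (u x + \<delta>)) powr (p - 1) \<partial>M)" using \<alpha>_pos S(4) by simp
  ultimately have "defect \<delta> u U \<le> G + \<mu> * W + \<bar>\<beta>\<bar> * W"
   using S(1,2) unfolding I2_def W_def G_def by linarith
  also have "\<dots> \<le> L * (1 + W)" using G \<mu> W0 by (simp add: L_def algebra_simps)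
  finally have "(\<integral>x. indicator ?A x * weight \<delta> u x \<partial>M) \<le> (1 + W) / 2"
   unfolding W_def by (intro conc[OF a \<delta>] k) auto
  moreover have "W \<le> (\<integral>x. indicator ?A x * weight \<delta> u x + D \<partial>M)"
   unfolding W_def
  proof (rule integral_mono_AE[OF weight_integrable[OF a \<delta>]])
   show "integrable M (\<lambda>x. indicator ?A x * weight \<delta> u x + D)"
    using set_M_integrable[OF weight_integrable[OF a \<delta>] k(2)] by simp
   show "AE x in M. weight \<delta> u x \<le> indicator ?A x * weight \<delta> u x + D"
    using u(2)
   proof eventually_elim
    case (elim x)
    show ?case
    proof (cases "u x < k")
     case False
     have "weight \<delta> u x \<le> D"
      unfolding weight_def D_def
     proof (rule mult_mono)
      show "\<phi> x powr p \<le> B powr p" using elim p by (intro \<phi>_powr_le) auto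
      show "(u x + \<delta>) powr (- (p - q)) \<le> k powr (- (p - q))"
       using False k(1) \<delta> p by (intro powr_mono2') auto
     qed auto
     then show ?thesis using weight_nonneg[of \<delta> u x] by (auto simp: indicator_def)
    qed (use elim in \<open>simp add: D_def\<close>)
   qed
  qed
  moreover have "(\<integral>x. indicator ?A x * weight \<delta> u x + D \<partial>M) = (\<integral>x. indicator ?A x * weight \<delta> u x \<partial>M) + D * measure M \<Omega>"
   using set_M_integrable[OF weight_integrable[OF a \<delta>] k(2)] by simp
  ultimately have "W \<le> 1 + 2 * (D * measure M \<Omega>)" by (simp add: field_simps)
  then show "mass \<delta> u \<le> 1 + 2 * (D * measure M \<Omega>)" unfolding W_def .
 qed
qed

text \<open>Half of the surplus, so that the other half can absorb the error of a positive shift.\<close>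

definition gap :: real where
 "gap = (\<alpha> * (\<integral>x. \<phi> x powr p \<partial>M) - (\<integral>x. norm (g x) powr p \<partial>M)) / 2"

lemma gap_pos: "0 < gap"
 using \<alpha> by (simp add: gap_def)

lemma weight_integral_pos:
 assumes a: "admissible u U" "0 < \<delta>"
 shows "0 < mass \<delta> u"
proof -
 have "mass \<delta> u \<noteq> 0"
 proof
  assume "mass \<delta> u = 0"
  then have "AE x in M. weight \<delta> u x = 0"
   using integral_nonneg_eq_0_iff_AE[OF weight_integrable[OF a]] weight_nonneg by auto
  then have "AE x in M. f x = 0"
   using admissibleD(2)[OF a(1)] by eventually_elim (use weight_bound(1) a(2) in force)
  with f_nonzero show False by simp
 qed
 then show ?thesis using weight_integral_nonneg[of \<delta> u] by simp
qed

text \<open>As \<open>\<delta>\<close> decreases to 0 the weight increases to \<open>\<phi>^p / u^(p-q)\<close>, which is integrable because the masses are bounded. By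
  dominated convergence the factors \<open>u / v\<close> in \<open>solution_picone\<close> may then be replaced by 1, at the cost of half the surplus
  and of a small multiple of the mass.\<close>

lemma solution_good_shift:
 assumes s: "solution \<beta> u U" and \<epsilon>: "0 < \<epsilon>" "\<mu> - \<epsilon> \<le> \<beta>"
 obtains \<delta> where "0 < \<delta>"
  "gap + (\<integral>x. forcing \<delta> u x \<partial>M) + defect \<delta> u U
   \<le> 2 * \<epsilon> * mass \<delta> u"
proof -
 have a: "admissible u U" using s by (simp add: solution_def)
 note u = admissibleD[OF a]
 note [measurable] = u(4,5) weight_measurable[OF a]
 have upos: "AE x in M. x \<in> \<Omega> \<and> 0 < u x" using u(2) solution_positive[OF s] by eventually_elim simp
 define \<delta> where "\<delta> n = inverse (real (Suc n))" for n
 have \<delta>: "0 < \<delta> n" for n by (simp add: \<delta>_def)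
 have \<delta>0: "\<delta> \<longlonglongrightarrow> 0" unfolding \<delta>_def by (rule LIMSEQ_inverse_real_of_nat)
 have \<delta>d: "\<delta> n \<le> \<delta> m" if "m \<le> n" for m n using that by (simp add: \<delta>_def le_imp_inverse_le)
 define W where "W n = mass (\<delta> n) u" for n
 have mono: "AE x in M. incseq (\<lambda>n. weight (\<delta> n) u x)"
  using upos
 proof eventually_elim
  case (elim x)
  show ?case
   unfolding incseq_def weight_def using elim \<delta>d \<delta> p
   by (auto intro!: mult_left_mono powr_mono2' add_pos_pos)
 qed
 have Wmono: "W m \<le> W n" if "m \<le> n" for m n
  unfolding W_def
  by (rule integral_mono_AE[OF weight_integrable[OF a \<delta>] weight_integrable[OF a \<delta>]])
   (use mono that in \<open>auto elim!: eventually_mono simp: incseq_def\<close>)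
 obtain C where C: "\<And>d. 0 < d \<Longrightarrow> mass d u \<le> C" using solution_weight_bounded[OF s] by blast
 have "incseq W" using Wmono by (auto simp: incseq_def)
 moreover have "W n \<le> C" for n unfolding W_def by (rule C[OF \<delta>])
 ultimately obtain w where w: "W \<longlonglongrightarrow> w" using incseq_convergent[of W C] by blast
 define W0 where "W0 x = \<phi> x powr p * u x powr (- (p - q))" for x
 have [measurable]: "W0 \<in> borel_measurable M" unfolding W0_def by measurable
 have lim: "AE x in M. (\<lambda>n. weight (\<delta> n) u x) \<longlonglongrightarrow> W0 x"
  using upos
 proof eventually_elim
  case (elim x)
  have "(\<lambda>n. \<phi> x powr p * (u x + \<delta> n) powr (- (p - q))) \<longlonglongrightarrow> \<phi> x powr p * (u x + 0) powr (- (p - q))"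
   using elim by (intro tendsto_intros \<delta>0) auto
  then show ?case by (simp add: weight_def W0_def)
 qed
 have iW0: "integrable M W0"
  by (rule integrable_monotone_convergence[OF weight_integrable[OF a \<delta>] mono lim w[unfolded W_def]]) measurable
 have leW0: "AE x in M. weight (\<delta> n) u x \<le> W0 x" for n
  using mono lim by eventually_elim (rule incseq_le)
 let ?\<tau> = "\<lambda>n x. u x / (u x + \<delta> n)"
 have \<tau>: "(\<lambda>n. ?\<tau> n x powr r) \<longlonglongrightarrow> 1" if "0 < u x" for x r
 proof -
  have "(\<lambda>n. (u x / (u x + \<delta> n)) powr r) \<longlonglongrightarrow> (u x / (u x + 0)) powr r"
   using that by (intro tendsto_intros \<delta>0) auto
  then show ?thesis using that by simp
 qed
 have \<tau>1: "0 \<le> ?\<tau> n x powr r \<and> ?\<tau> n x powr r \<le> 1" if "0 < u x" "0 < r" for n x r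
  using that \<delta>[of n] powr_mono2[of r "?\<tau> n x" 1] by auto
 define I2 where "I2 n = (\<integral>x. weight (\<delta> n) u x * ?\<tau> n x powr (q - 1) \<partial>M)" for n
 define I1 where "I1 n = (\<integral>x. \<phi> x powr p * ?\<tau> n x powr (p - 1) \<partial>M)" for n
 note S = solution_picone[OF s \<delta>]
 have "(\<lambda>n. \<integral>x. weight (\<delta> n) u x - weight (\<delta> n) u x * ?\<tau> n x powr (q - 1) \<partial>M) \<longlonglongrightarrow> (\<integral>x. 0 \<partial>M)"
 proof (rule integral_dominated_convergence[OF _ _ iW0])
  show "AE x in M. (\<lambda>n. weight (\<delta> n) u x - weight (\<delta> n) u x * ?\<tau> n x powr (q - 1)) \<longlonglongrightarrow> 0"
   using upos lim
  proof eventually_elim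
   case (elim x)
   have "(\<lambda>n. weight (\<delta> n) u x - weight (\<delta> n) u x * ?\<tau> n x powr (q - 1)) \<longlonglongrightarrow> W0 x - W0 x * 1"
    using elim by (intro tendsto_diff tendsto_mult \<tau>) auto
   then show ?case by simp
  qed
  show "AE x in M. norm (weight (\<delta> n) u x - weight (\<delta> n) u x * ?\<tau> n x powr (q - 1)) \<le> W0 x" for n
   using upos leW0[of n]
  proof eventually_elim
   case (elim x)
   have t: "0 \<le> ?\<tau> n x powr (q - 1)" "?\<tau> n x powr (q - 1) \<le> 1" using \<tau>1[of x "q - 1" n] elim p by auto
   have "0 \<le> weight (\<delta> n) u x * ?\<tau> n x powr (q - 1)" using t weight_nonneg by (intro mult_nonneg_nonneg)
   moreover have "weight (\<delta> n) u x * ?\<tau> n x powr (q - 1) \<le> weight (\<delta> n) u x" using t weight_nonneg by (intro mult_left_le)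
   ultimately show ?case using elim by (simp only: real_norm_def)
  qed
 qed measurable
 moreover have "(\<integral>x. weight (\<delta> n) u x - weight (\<delta> n) u x * ?\<tau> n x powr (q - 1) \<partial>M) = W n - I2 n" for n
  unfolding W_def I2_def using weight_integrable[OF a \<delta>[of n]] S(7)[of n] by (rule Bochner_Integration.integral_diff)
 ultimately have D: "(\<lambda>n. W n - I2 n) \<longlonglongrightarrow> 0" by simp
 have L1: "I1 \<longlonglongrightarrow> (\<integral>x. \<phi> x powr p \<partial>M)"
  unfolding I1_def
 proof (rule integral_dominated_convergence[where w="\<lambda>x. \<phi> x powr p"])
  show "integrable M (\<lambda>x. \<phi> x powr p)" using p by (intro \<phi>_powr_integrable) auto
  show "AE x in M. (\<lambda>n. \<phi> x powr p * ?\<tau> n x powr (p - 1)) \<longlonglongrightarrow> \<phi> x powr p"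
   using upos
  proof eventually_elim
   case (elim x)
   have "(\<lambda>n. \<phi> x powr p * ?\<tau> n x powr (p - 1)) \<longlonglongrightarrow> \<phi> x powr p * 1"
    using elim by (intro tendsto_mult tendsto_const \<tau>) auto
   then show ?case by simp
  qed
  show "AE x in M. norm (\<phi> x powr p * ?\<tau> n x powr (p - 1)) \<le> \<phi> x powr p" for n
   using upos
  proof eventually_elim
   case (elim x)
   have "0 \<le> ?\<tau> n x powr (p - 1)" "?\<tau> n x powr (p - 1) \<le> 1" using \<tau>1[of x "p - 1" n] elim p by auto
   then show ?case by (simp add: abs_mult mult_left_le)
  qed
 qed measurable
 have w0: "0 < W 0" unfolding W_def by (rule weight_integral_pos[OF a \<delta>])
 have "(\<lambda>n. \<alpha> * I1 n) \<longlonglongrightarrow> \<alpha> * (\<integral>x. \<phi> x powr p \<partial>M)" by (intro tendsto_intros L1)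
 then have e1: "\<forall>\<^sub>F n in sequentially. \<alpha> * (\<integral>x. \<phi> x powr p \<partial>M) - gap < \<alpha> * I1 n"
  using gap_pos by (intro order_tendstoD(1)) auto
 have "(\<lambda>n. \<mu> * (W n - I2 n)) \<longlonglongrightarrow> \<mu> * 0" by (intro tendsto_intros D)
 then have e2: "\<forall>\<^sub>F n in sequentially. \<mu> * (W n - I2 n) < \<epsilon> * W 0"
  using \<epsilon>(1) w0 by (intro order_tendstoD(2)) auto
 obtain n where n: "\<alpha> * (\<integral>x. \<phi> x powr p \<partial>M) - gap < \<alpha> * I1 n" "\<mu> * (W n - I2 n) < \<epsilon> * W 0"
  using eventually_happens[OF eventually_conj[OF e1 e2]] by auto
 define FI where "FI = (\<integral>x. forcing (\<delta> n) u x \<partial>M)"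
 define R where "R = defect (\<delta> n) u U"
 define G where "G = (\<integral>x. norm (g x) powr p \<partial>M)"
 have main: "\<alpha> * I1 n + \<beta> * I2 n + FI + R \<le> G + \<mu> * W n"
  using S(1)[of n] unfolding I1_def I2_def FI_def R_def G_def W_def .
 have "0 \<le> I2 n" "I2 n \<le> W n" using S(5,6)[of n] unfolding I2_def W_def by auto
 then have "(\<mu> - \<epsilon>) * I2 n \<le> \<beta> * I2 n" "\<epsilon> * I2 n \<le> \<epsilon> * W n" using \<epsilon> by (auto intro: mult_right_mono mult_left_mono)
 moreover have "\<epsilon> * W 0 \<le> \<epsilon> * W n" using Wmono[of 0 n] \<epsilon>(1) by simp
 moreover have "\<alpha> * (\<integral>x. \<phi> x powr p \<partial>M) = G + 2 * gap" unfolding gap_def G_def by (simp only: mult_2 field_sum_of_halves)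
 ultimately have "gap + FI + R \<le> 2 * \<epsilon> * W n"
  using main n by (simp add: left_diff_distrib right_diff_distrib)
 then show ?thesis using that[OF \<delta>[of n]] unfolding FI_def R_def W_def by simp
qed

end

section \<open>Nonexistence near the first eigenvalue\<close>

context first_eigenfunction
begin

text \<open>Pointwise, the difference of the logarithmic gradients is at most \<open>\<eta>\<close> times the energy, which is controlled by mass and
  defect, plus a multiple of the remainder. Let first \<open>n\<close> tend to infinity and then \<open>\<eta>\<close> to 0.\<close>

lemma logdiff_integral_small:
 assumes a: "\<And>n. admissible (u n) (U n)" and \<delta>: "\<And>n. 0 < \<delta> n"
  and M: "\<And>n. 0 < mass (\<delta> n) (u n)"
  and R: "(\<lambda>n. defect (\<delta> n) (u n) (U n) / mass (\<delta> n) (u n)) \<longlonglongrightarrow> 0"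
 defines "Y n x \<equiv> weight (\<delta> n) (u n) x * norm ((1 / \<phi> x) *\<^sub>R g x - logdiff (\<delta> n) (u n) (U n) x) powr q"
 shows "integrable M (Y n)"
  and "(\<lambda>n. (\<integral>x. Y n x \<partial>M) / mass (\<delta> n) (u n)) \<longlonglongrightarrow> 0"
proof -
 obtain C where C: "0 < C" and energy: "\<And>u U \<delta>. admissible u U \<Longrightarrow> 0 < \<delta> \<Longrightarrow>
    integrable M (\<lambda>x. log_energy \<delta> u U x) \<and>
    (\<integral>x. log_energy \<delta> u U x \<partial>M)
     \<le> C * (mass \<delta> u + defect \<delta> u U)"
  using energy_bound by blast
 let ?W = "\<lambda>n. \<integral>x. weight (\<delta> n) (u n) x \<partial>M"
 let ?R = "\<lambda>n. \<integral>x. remainder (\<delta> n) (u n) (U n) x \<partial>M"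
 let ?S = "\<lambda>n x. log_energy (\<delta> n) (u n) (U n) x"
 have Ym: "Y n \<in> borel_measurable M" for n
 proof -
  note [measurable] = admissibleD(4,5)[OF a] weight_measurable[OF a]
  show ?thesis unfolding Y_def logdiff_def by measurable
 qed
 have Y0: "0 \<le> Y n x" for n x unfolding Y_def using weight_nonneg by (intro mult_nonneg_nonneg) auto
 have pt: "AE x in M. Y n x \<le> \<eta> * ?S n x + K * remainder (\<delta> n) (u n) (U n) x"
  if K: "0 \<le> K" "\<And>a b::'a. norm (a - b) powr q \<le> \<eta> * (norm a powr q + norm b powr q) + K * convexity_defect q a b" for \<eta> K n
 proof (rule AE_I2)
  fix x
  let ?a = "(1 / \<phi> x) *\<^sub>R g x" and ?b = "logdiff (\<delta> n) (u n) (U n) x"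
  have "norm (?a - ?b) powr q \<le> \<eta> * (norm ?a powr q + norm ?b powr q) + K * convexity_defect q ?a ?b" by (rule K(2))
  also have "\<dots> \<le> \<eta> * (norm ?a powr q + norm ?b powr q) + K * picone_remainder p q ?a ?b"
   using K(1) convexity_defect_le_picone_remainder[OF q qp] by (intro add_left_mono mult_left_mono)
  finally have "weight (\<delta> n) (u n) x * norm (?a - ?b) powr q
   \<le> weight (\<delta> n) (u n) x * (\<eta> * (norm ?a powr q + norm ?b powr q) + K * picone_remainder p q ?a ?b)"
   by (intro mult_left_mono weight_nonneg)
  then show "Y n x \<le> \<eta> * ?S n x + K * remainder (\<delta> n) (u n) (U n) x"
   by (simp only: Y_def remainder_def distrib_left mult_ac)
 qed
 have int: "integrable M (Y n) \<and> (\<integral>x. Y n x \<partial>M) \<le> \<eta> * (C * (?W n + ?R n)) + K * ?R n"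
  if \<eta>: "0 \<le> \<eta>" and K: "0 \<le> K" "\<And>a b::'a. norm (a - b) powr q \<le> \<eta> * (norm a powr q + norm b powr q) + K * convexity_defect q a b" for \<eta> K n
 proof
  have i: "integrable M (\<lambda>x. \<eta> * ?S n x + K * remainder (\<delta> n) (u n) (U n) x)"
   using energy[OF a \<delta>] picone_integrated(1)[OF a \<delta>] by auto
  show iY: "integrable M (Y n)"
   by (rule Bochner_Integration.integrable_bound[OF i Ym])
    (use pt[OF K, of n] Y0 in \<open>auto elim!: eventually_mono simp: order_trans[OF _ abs_ge_self]\<close>)
  have "(\<integral>x. Y n x \<partial>M) \<le> (\<integral>x. \<eta> * ?S n x + K * remainder (\<delta> n) (u n) (U n) x \<partial>M)"
   by (rule integral_mono_AE[OF iY i pt[OF K]])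
  also have "\<dots> = \<eta> * (\<integral>x. ?S n x \<partial>M) + K * ?R n"
   using energy[OF a \<delta>] picone_integrated(1)[OF a \<delta>] by simp
  also have "\<dots> \<le> \<eta> * (C * (?W n + ?R n)) + K * ?R n"
   using energy[OF a \<delta>] \<eta> by (intro add_right_mono mult_left_mono) auto
  finally show "(\<integral>x. Y n x \<partial>M) \<le> \<eta> * (C * (?W n + ?R n)) + K * ?R n" .
 qed
 obtain K1 where K1: "0 \<le> K1" "\<And>a b::'a. norm (a - b) powr q \<le> 1 * (norm a powr q + norm b powr q) + K1 * convexity_defect q a b"
  using diff_le_convexity_defect[OF q zero_less_one] by metis
 show iY: "integrable M (Y n)" for n using int[OF _ K1] by simp
 show "(\<lambda>n. (\<integral>x. Y n x \<partial>M) / ?W n) \<longlonglongrightarrow> 0"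
 proof (rule tendstoI)
  fix e :: real assume e: "0 < e"
  define \<eta> where "\<eta> = e / (2 * C)"
  have \<eta>: "0 < \<eta>" using e C by (simp add: \<eta>_def)
  obtain K where K: "0 \<le> K" "\<And>a b::'a. norm (a - b) powr q \<le> \<eta> * (norm a powr q + norm b powr q) + K * convexity_defect q a b"
   using diff_le_convexity_defect[OF q \<eta>] by metis
  have le: "(\<integral>x. Y n x \<partial>M) / ?W n \<le> \<eta> * (C * (1 + ?R n / ?W n)) + K * (?R n / ?W n)" for n
  proof -
   have "(\<integral>x. Y n x \<partial>M) / ?W n \<le> (\<eta> * (C * (?W n + ?R n)) + K * ?R n) / ?W n"
    using int[OF less_imp_le[OF \<eta>] K] M[of n] by (intro divide_right_mono) auto
   also have "\<dots> = \<eta> * (C * (1 + ?R n / ?W n)) + K * (?R n / ?W n)"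
   proof -
    have "(\<eta> * (C * (W + r)) + K * r) / W = \<eta> * (C * (1 + r / W)) + K * (r / W)" if "0 < W" for W r :: real
     using that by (simp add: field_simps)
    from this[OF M[of n]] show ?thesis .
   qed
   finally show ?thesis .
  qed
  have "(\<lambda>n. \<eta> * (C * (1 + ?R n / ?W n)) + K * (?R n / ?W n)) \<longlonglongrightarrow> \<eta> * (C * (1 + 0)) + K * 0"
   by (intro tendsto_intros R)
  moreover have "\<eta> * (C * (1 + 0)) + K * 0 < e" using e C by (simp add: \<eta>_def)
  ultimately have "\<forall>\<^sub>F n in sequentially. \<eta> * (C * (1 + ?R n / ?W n)) + K * (?R n / ?W n) < e"
   by (rule order_tendstoD(2))
  then show "\<forall>\<^sub>F n in sequentially. dist ((\<integral>x. Y n x \<partial>M) / ?W n) 0 < e"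
  proof eventually_elim
   case (elim n)
   have "0 \<le> (\<integral>x. Y n x \<partial>M) / ?W n"
    using M[of n] Y0 by (intro divide_nonneg_pos Bochner_Integration.integral_nonneg) auto
   then show ?case using elim le[of n] by (simp add: dist_real_def)
  qed
 qed
qed

text \<open>\<open>(\<phi> / (u + \<delta>))^((p-q)/q)\<close>, normalised so that the integral of \<open>(\<phi> * ratio)^q\<close> is 1.\<close>

definition ratio :: "real \<Rightarrow> ('a \<Rightarrow> real) \<Rightarrow> 'a \<Rightarrow> real" where
 "ratio \<delta> u x = mass \<delta> u powr (- 1 / q) * (1 / \<phi> x) * quot \<delta> u x"

lemma ratio_measurable: "admissible u U \<Longrightarrow> 0 < \<delta> \<Longrightarrow> ratio \<delta> u \<in> borel_measurable M"
 unfolding ratio_def[abs_def] using sobolev0D(3)[OF quot_sobolev] by measurable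

lemma ratio_powr:
 assumes a: "admissible u U" and \<delta>: "0 < \<delta>" and m: "0 < mass \<delta> u"
 shows "AE x in M. x \<in> \<Omega> \<and> 0 \<le> ratio \<delta> u x \<and>
  (\<phi> x * ratio \<delta> u x) powr q = weight \<delta> u x / mass \<delta> u"
 using admissibleD(2)[OF a]
proof eventually_elim
 case (elim x)
 then have x: "x \<in> \<Omega>" "0 \<le> u x" by auto
 define d where "d = mass \<delta> u powr (- 1 / q)"
 have d: "0 < d" "d powr q = 1 / mass \<delta> u"
  unfolding d_def powr_powr using m p by (simp_all add: powr_minus_divide)
 note Q = quot_powr[of x u \<delta>, OF x \<delta>]
 have s: "0 < \<phi> x" using \<phi>_pos x by simp
 have "\<phi> x * ratio \<delta> u x = d * quot \<delta> u x" using s by (simp add: ratio_def d_def)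
 moreover have "(d * quot \<delta> u x) powr q = weight \<delta> u x / mass \<delta> u"
  using Q d by (simp add: powr_mult)
 moreover have "0 \<le> ratio \<delta> u x" using Q(1) d(1) s by (simp add: ratio_def d_def)
 ultimately show ?case using x by simp
qed

text \<open>The gradient of the ratio is \<open>(p-q)/q\<close> times the ratio times the difference of the logarithmic gradients. On a
  ball where \<open>\<phi>\<close> is bounded below it tends to 0 by \<open>logdiff_integral_small\<close>, and Poincare's inequality applies.\<close>

lemma ratio_local_oscillation:
 assumes a: "\<And>n. admissible (u n) (U n)" and \<delta>: "\<And>n. 0 < \<delta> n"
  and M: "\<And>n. 0 < mass (\<delta> n) (u n)"
  and R: "(\<lambda>n. defect (\<delta> n) (u n) (U n) / mass (\<delta> n) (u n)) \<longlonglongrightarrow> 0"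
  and x: "x \<in> \<Omega>"
 shows "\<exists>R>0. ball x R \<subseteq> \<Omega> \<and> (\<forall>n. integrable M (\<lambda>y. indicator (ball x R) y * ratio (\<delta> n) (u n) y)) \<and>
  (\<exists>c. (\<lambda>n. \<integral>y. indicator (ball x R) y * \<bar>ratio (\<delta> n) (u n) y - c n\<bar> \<partial>M) \<longlonglongrightarrow> 0)"
proof -
 define m where "m n = mass (\<delta> n) (u n)" for n
 have m: "0 < m n" for n unfolding m_def by (rule M)
 define Y where "Y n x = weight (\<delta> n) (u n) x * norm ((1 / \<phi> x) *\<^sub>R g x - logdiff (\<delta> n) (u n) (U n) x) powr q" for n x
 have iY: "integrable M (Y n)" for n
  unfolding Y_def using logdiff_integral_small(1)[OF a \<delta> M R] .
 have Ym: "(\<lambda>n. (\<integral>x. Y n x \<partial>M) / m n) \<longlonglongrightarrow> 0"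
  unfolding Y_def m_def using logdiff_integral_small(2)[OF a \<delta> M R] .
 define d where "d n = m n powr (- 1 / q)" for n
 have dq: "d n powr q = 1 / m n" for n
  unfolding d_def powr_powr using m[of n] p by (simp add: powr_minus_divide)
 have d0: "0 < d n" for n using m[of n] by (simp add: d_def)
 (* z is the q-th root of the weight times a smooth factor, so the product rule gives its gradient. *)
 define w where "w n x = d n * (1 / \<phi> x)" for n x
 define dw where "dw n x = (- d n / (\<phi> x)\<^sup>2) *\<^sub>R g x" for n x
 define z where "z n x = w n x * quot (\<delta> n) (u n) x" for n x
 have w_der: "GDERIV (w n) x :> dw n x" if "x \<in> \<Omega>" for n x
  unfolding w_def dw_def
  by (rule GDERIV_DERIV_compose[OF \<phi>_der[OF that], of "\<lambda>t. d n * (1 / t)"])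
   (use \<phi>_pos[OF that] in \<open>auto intro!: derivative_eq_intros simp: power2_eq_square\<close>)
 have w_cont: "continuous_on \<Omega> (dw n)" for n
  unfolding dw_def using \<phi>_pos by (intro continuous_intros \<phi>_cont g_cont) force
 note qs = quot_sobolev[OF a \<delta>]
 let ?G = "\<lambda>n x. test_grad (p / q) ((p - q) / q) (\<delta> n) (u n) (U n) x"
 have grad_eq: "AE x in M. norm (quot (\<delta> n) (u n) x *\<^sub>R dw n x + w n x *\<^sub>R ?G n x) powr q
   = ((p - q) / q) powr q / m n * (1 / \<phi> x) powr q * Y n x" for n
  using admissibleD(2)[OF a[of n]]
 proof eventually_elim
  case (elim x)
  then have x: "x \<in> \<Omega>" "0 \<le> u n x" by auto
  let ?a = "(1 / \<phi> x) *\<^sub>R g x" and ?b = "logdiff (\<delta> n) (u n) (U n) x"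
  have s: "0 < \<phi> x" using \<phi>_pos x by simp
  have "quot (\<delta> n) (u n) x *\<^sub>R dw n x + w n x *\<^sub>R ?G n x
   = (w n x * quot (\<delta> n) (u n) x) *\<^sub>R (- ?a + ((p / q) *\<^sub>R ?a - ((p - q) / q) *\<^sub>R ?b))"
  proof -
   have "dw n x = - (w n x *\<^sub>R ?a)" by (simp add: dw_def w_def power2_eq_square)
   moreover have "Q *\<^sub>R (- (r *\<^sub>R A)) + r *\<^sub>R (Q *\<^sub>R V) = (r * Q) *\<^sub>R (- A + V)" for Q r and A V :: 'a
    by (simp add: scaleR_diff_right mult.commute)
   ultimately show ?thesis
    unfolding quot_grad[of x "u n" "\<delta> n" "U n", OF x \<delta>] by (simp only:)
  qed
  also have "- ?a + ((p / q) *\<^sub>R ?a - ((p - q) / q) *\<^sub>R ?b) = ((p - q) / q) *\<^sub>R (?a - ?b)"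
  proof -
   have "(p - q) / q = p / q - 1" using p by (simp add: diff_divide_distrib)
   then have "((p - q) / q) *\<^sub>R ?a = (p / q) *\<^sub>R ?a - ?a" by (simp only: scaleR_left_diff_distrib scaleR_one)
   then show ?thesis by (simp only: scaleR_right_diff_distrib) simp
  qed
  also have "norm ((w n x * quot (\<delta> n) (u n) x) *\<^sub>R (((p - q) / q) *\<^sub>R (?a - ?b))) powr q
    = ((p - q) / q) powr q * (w n x) powr q * (\<bar>quot (\<delta> n) (u n) x\<bar> powr q * norm (?a - ?b) powr q)"
  proof -
   have "norm ((c * Q) *\<^sub>R (r *\<^sub>R V)) powr q = r powr q * c powr q * (\<bar>Q\<bar> powr q * norm V powr q)"
    if "0 \<le> c" "0 \<le> r" for c r Q and V :: 'a
    using that by (simp add: abs_mult powr_mult)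
   moreover have "0 \<le> w n x" "0 \<le> (p - q) / q" using p q s d0[of n] by (simp_all add: w_def)
   ultimately show ?thesis by blast
  qed
  also have "\<bar>quot (\<delta> n) (u n) x\<bar> powr q * norm (?a - ?b) powr q = Y n x"
   unfolding quot_powr(2)[of x "u n" "\<delta> n", OF x \<delta>] Y_def ..
  also have "(w n x) powr q = 1 / m n * (1 / \<phi> x) powr q"
   unfolding w_def using d0[of n] s by (subst powr_mult) (auto simp: dq)
  finally show ?case by simp
 qed
 have one: "1 \<le> q" using q by simp
 have ratio_z: "ratio (\<delta> n) (u n) y = z n y" for n y by (simp add: ratio_def z_def w_def d_def m_def)
 have "\<exists>R>0. ball x R \<subseteq> \<Omega> \<and> (\<forall>n. integrable M (\<lambda>y. indicator (ball x R) y * z n y)) \<and>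
  (\<exists>c. (\<lambda>n. \<integral>y. indicator (ball x R) y * \<bar>z n y - c n\<bar> \<partial>M) \<longlonglongrightarrow> 0)"
 proof -
  obtain r b where r: "0 < r" "cball x (3 * r) \<subseteq> \<Omega>" and b: "0 < b" "\<And>y. y \<in> cball x (3 * r) \<Longrightarrow> b \<le> \<phi> y"
   using local_ball[OF x] by blast
  let ?W = "ball x (3 * r)" and ?B = "ball x r"
  have BW: "?B \<subseteq> ?W" using r(1) by auto
  have W\<Omega>: "?W \<subseteq> \<Omega>" using r(2) ball_subset_cball by blast
  have sets: "?B \<in> sets lebesgue" "?W \<in> sets lebesgue" by (auto simp: borel_open)
  note P = sobolev0_poincare[OF one qs r w_der w_cont]
  define D where "D n y = quot (\<delta> n) (u n) y *\<^sub>R dw n y + w n y *\<^sub>R ?G n y" for n y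
  have iB: "integrable M (\<lambda>y. indicator ?B y * z n y)" for n
  proof -
   have "(\<lambda>y. indicator ?B y * z n y) = (\<lambda>y. indicator ?B y * (indicator ?W y * z n y))"
    using BW by (auto simp: indicator_def fun_eq_iff)
   then show ?thesis using set_M_integrable[OF P(1)[of n n] sets(1)] by (simp add: z_def)
  qed
  define K where "K = 2 * r * measure lborel (ball (0::'a) (2 * r)) / measure lborel ?B"
  have D_le: "AE y in M. norm (indicator ?W y *\<^sub>R D n y) powr q \<le> ((p - q) / q) powr q * (1 / b) powr q * (Y n y / m n)" for n
   using grad_eq[of n]
  proof eventually_elim
   case (elim y)
   have Y0: "0 \<le> Y n y" unfolding Y_def using weight_nonneg by (intro mult_nonneg_nonneg) auto
   show ?case
   proof (cases "y \<in> ?W")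
    case True
    have "b \<le> \<phi> y" using True b(2)[of y] ball_subset_cball by blast
    then have "(1 / \<phi> y) powr q \<le> (1 / b) powr q" using b(1) p by (intro powr_mono2 divide_left_mono) auto
    then have "((p - q) / q) powr q * (Y n y / m n) * (1 / \<phi> y) powr q \<le> ((p - q) / q) powr q * (Y n y / m n) * (1 / b) powr q"
     using Y0 m[of n] by (intro mult_left_mono) auto
    then show ?thesis using True elim by (simp add: D_def mult_ac)
   next
    case False
    then show ?thesis using Y0 m[of n] p by simp
   qed
  qed
  have DL: "(\<lambda>y. indicator ?W y *\<^sub>R D n y) \<in> Lspace \<Omega> q" for n
  proof -
   have meas: "(\<lambda>y. indicator ?W y *\<^sub>R D n y) \<in> borel_measurable M"
    using borel_measurable_integrable[OF P(2)[of n n]] by (simp add: D_def)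
   have "integrable M (\<lambda>y. norm (indicator ?W y *\<^sub>R D n y) powr q)"
   proof (rule Bochner_Integration.integrable_bound)
    show "integrable M (\<lambda>y. ((p - q) / q) powr q * (1 / b) powr q * (Y n y / m n))" using iY by auto
    show "AE y in M. norm (norm (indicator ?W y *\<^sub>R D n y) powr q) \<le> norm (((p - q) / q) powr q * (1 / b) powr q * (Y n y / m n))"
     using D_le[of n] by eventually_elim (simp only: real_norm_def order_trans[OF _ abs_ge_self] abs_of_nonneg powr_ge_zero)
   qed (use meas in measurable)
   then show ?thesis using meas by (simp add: Lspace_def)
  qed
  have "(\<lambda>n. \<integral>y. norm (indicator ?W y *\<^sub>R D n y) powr q \<partial>M) \<longlonglongrightarrow> 0"
  proof (rule tendsto_zero_le)
   show "(\<lambda>n. ((p - q) / q) powr q * (1 / b) powr q * ((\<integral>y. Y n y \<partial>M) / m n)) \<longlonglongrightarrow> 0"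
    using tendsto_mult_right_zero[OF Ym] .
   show "(\<integral>y. norm (indicator ?W y *\<^sub>R D n y) powr q \<partial>M) \<le> ((p - q) / q) powr q * (1 / b) powr q * ((\<integral>y. Y n y \<partial>M) / m n)" for n
   proof -
    have "(\<integral>y. norm (indicator ?W y *\<^sub>R D n y) powr q \<partial>M) \<le> (\<integral>y. ((p - q) / q) powr q * (1 / b) powr q * (Y n y / m n) \<partial>M)"
     using LspaceD(2)[OF DL[of n]] iY[of n] D_le[of n] by (intro integral_mono_AE) auto
    then show ?thesis by simp
   qed
  qed simp
  then have "Lnull q (\<lambda>n y. indicator ?W y *\<^sub>R D n y)" using DL by (simp add: Lnull_def)
  from Lnull_tendsto_integral[OF one this]
  have D0: "(\<lambda>n. \<integral>y. indicator ?W y * norm (D n y) \<partial>M) \<longlonglongrightarrow> 0" by simp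
  define c where "c n = (\<integral>y. indicator ?B y * z n y \<partial>M) / measure lborel ?B" for n
  have le: "(\<integral>y. indicator ?B y * \<bar>z n y - c n\<bar> \<partial>M) \<le> K * (\<integral>y. indicator ?W y * norm (D n y) \<partial>M)" for n
   using P(3)[of n n] unfolding K_def c_def z_def D_def .
  have "(\<lambda>n. \<integral>y. indicator ?B y * \<bar>z n y - c n\<bar> \<partial>M) \<longlonglongrightarrow> 0"
   by (rule tendsto_zero_le[OF tendsto_mult_right_zero[OF D0] le]) (auto intro!: Bochner_Integration.integral_nonneg)
  then show ?thesis using r(1) W\<Omega> BW iB by blast
 qed
 then show ?thesis by (simp only: ratio_z)
qed

text \<open>Take a compact set \<open>K\<close> outside which \<open>\<phi>\<close> is small. On \<open>K\<close> the ratio is at most \<open>t\<close> except on a set of small measure,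
  for some large \<open>n\<close>. Off these two small sets the weight is at most a fraction of its mass, and on them it carries
  little more than half of the mass; together that is less than everything.\<close>

lemma ratio_not_locally_null:
 assumes L: "0 \<le> L" and a: "\<And>n. admissible (u n) (U n)" and \<delta>: "\<And>n. 0 < \<delta> n"
  and M: "\<And>n. 2 \<le> mass (\<delta> n) (u n)"
  and R: "\<And>n. defect (\<delta> n) (u n) (U n) \<le> L * (1 + mass (\<delta> n) (u n))"
  and null: "\<And>x. x \<in> \<Omega> \<Longrightarrow> \<exists>r>0. ball x r \<subseteq> \<Omega> \<and> (\<forall>n. integrable M (\<lambda>y. indicator (ball x r) y * ratio (\<delta> n) (u n) y)) \<and>
   (\<lambda>n. \<integral>y. indicator (ball x r) y * \<bar>ratio (\<delta> n) (u n) y\<bar> \<partial>M) \<longlonglongrightarrow> 0"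
 shows False
proof -
 define z where "z n = ratio (\<delta> n) (u n)" for n
 define m where "m n = mass (\<delta> n) (u n)" for n
 have m: "0 < m n" "2 \<le> m n" for n using M[of n] by (auto simp: m_def)
 have z_nn: "AE x in M. x \<in> \<Omega> \<and> 0 \<le> z n x \<and> (\<phi> x * z n x) powr q = weight (\<delta> n) (u n) x / m n" for n
  unfolding z_def m_def by (rule ratio_powr[OF a \<delta> m(1)[unfolded m_def]])
 have z_meas [measurable]: "z n \<in> borel_measurable M" for n unfolding z_def by (rule ratio_measurable[OF a \<delta>])
 obtain \<nu> where \<nu>: "0 < \<nu>" and conc: "\<And>u U \<delta> A. admissible u U \<Longrightarrow> 0 < \<delta> \<Longrightarrow> defect \<delta> u U \<le> L * (1 + mass \<delta> u) \<Longrightarrow>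
   A \<in> sets lebesgue \<Longrightarrow> A \<subseteq> \<Omega> \<Longrightarrow> measure lebesgue A \<le> \<nu> \<Longrightarrow>
   (\<integral>x. indicator A x * weight \<delta> u x \<partial>M) \<le> (1 + mass \<delta> u) / 2"
  using weight_concentration[OF L] by blast
 have \<nu>2: "0 < \<nu> / 2" using \<nu> by simp
 have \<phi>_ae: "AE x in M. 0 < \<phi> x" using \<phi>_pos by (intro AE_I2) simp
 obtain k where k: "0 < k" "{x \<in> \<Omega>. \<phi> x < k} \<in> sets lebesgue" "measure lebesgue {x \<in> \<Omega>. \<phi> x < k} \<le> \<nu> / 2"
  using small_sublevel[OF \<phi>_meas \<phi>_ae \<nu>2] by blast
 obtain K where K: "compact K" "K \<subseteq> \<Omega>" "\<And>x. x \<in> \<Omega> - K \<Longrightarrow> \<phi> x \<le> k / 2"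
  using \<phi>_vanish[of "k / 2"] k(1) by auto
 have Kl: "K \<in> sets lebesgue" using K(1) by (simp add: borel_compact)
 define good where "good x r \<longleftrightarrow> 0 < r \<and> ball x r \<subseteq> \<Omega> \<and> (\<forall>n. integrable M (\<lambda>y. indicator (ball x r) y * z n y)) \<and>
   (\<lambda>n. \<integral>y. indicator (ball x r) y * \<bar>z n y\<bar> \<partial>M) \<longlonglongrightarrow> 0" for x r
 have "\<forall>x\<in>\<Omega>. \<exists>r. good x r" using null unfolding good_def z_def by blast
 from bchoice[OF this] obtain rad where "\<forall>x\<in>\<Omega>. good x (rad x)" by blast
 then have rad: "0 < rad x \<and> ball x (rad x) \<subseteq> \<Omega> \<and> (\<forall>n. integrable M (\<lambda>y. indicator (ball x (rad x)) y * z n y)) \<and>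
   (\<lambda>n. \<integral>y. indicator (ball x (rad x)) y * \<bar>z n y\<bar> \<partial>M) \<longlonglongrightarrow> 0" if "x \<in> \<Omega>" for x
  using that unfolding good_def by blast
 obtain T where T: "T \<subseteq> K" "finite T" "K \<subseteq> (\<Union>x\<in>T. ball x (rad x))"
 proof (rule compactE_image[OF K(1), of K "\<lambda>x. ball x (rad x)"])
  show "K \<subseteq> (\<Union>x\<in>K. ball x (rad x))"
  proof
   fix x assume x: "x \<in> K"
   then have "x \<in> ball x (rad x)" using rad[of x] K(2) by auto
   then show "x \<in> (\<Union>x\<in>K. ball x (rad x))" using x by blast
  qed
 qed (use that in auto)
 have izB: "integrable M (\<lambda>y. indicator (ball x (rad x)) y * \<bar>z n y\<bar>)" if "x \<in> T" for x n
 proof -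
  have "integrable M (\<lambda>y. indicator (ball x (rad x)) y * z n y)" using rad that T(1) K(2) by blast
  from integrable_abs[OF this] show ?thesis by (simp add: abs_mult)
 qed
 have iK: "integrable M (\<lambda>y. indicator K y * \<bar>z n y\<bar>) \<and>
   (\<integral>y. indicator K y * \<bar>z n y\<bar> \<partial>M) \<le> (\<Sum>x\<in>T. \<integral>y. indicator (ball x (rad x)) y * \<bar>z n y\<bar> \<partial>M)" for n
 proof
  have [measurable]: "indicat_real K \<in> borel_measurable M" using Kl by (rule indicator_M_measurable)
  have isum: "integrable M (\<lambda>y. \<Sum>x\<in>T. indicator (ball x (rad x)) y * \<bar>z n y\<bar>)"
   using izB by (intro Bochner_Integration.integrable_sum)
  have le: "indicator K y * \<bar>z n y\<bar> \<le> (\<Sum>x\<in>T. indicator (ball x (rad x)) y * \<bar>z n y\<bar>)" for y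
  proof (cases "y \<in> K")
   case True
   then obtain x where x: "x \<in> T" "y \<in> ball x (rad x)" using T(3) by blast
   have "indicator (ball x (rad x)) y * \<bar>z n y\<bar> \<le> (\<Sum>x\<in>T. indicator (ball x (rad x)) y * \<bar>z n y\<bar>)"
    using x(1) T(2) by (intro member_le_sum) auto
   then show ?thesis using True x(2) by simp
  qed (auto intro!: sum_nonneg)
  show i: "integrable M (\<lambda>y. indicator K y * \<bar>z n y\<bar>)"
   by (rule Bochner_Integration.integrable_bound[OF isum]) (use le in \<open>auto intro!: AE_I2 order_trans[OF _ abs_ge_self] simp: abs_mult\<close>)
  show "(\<integral>y. indicator K y * \<bar>z n y\<bar> \<partial>M) \<le> (\<Sum>x\<in>T. \<integral>y. indicator (ball x (rad x)) y * \<bar>z n y\<bar> \<partial>M)"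
   using integral_mono[OF i isum le] izB by (subst (asm) Bochner_Integration.integral_sum) auto
 qed
 have K0: "(\<lambda>n. \<integral>y. indicator K y * \<bar>z n y\<bar> \<partial>M) \<longlonglongrightarrow> 0"
 proof (rule tendsto_zero_le)
  have "(\<lambda>n. \<Sum>x\<in>T. \<integral>y. indicator (ball x (rad x)) y * \<bar>z n y\<bar> \<partial>M) \<longlonglongrightarrow> (\<Sum>x\<in>T. 0)"
   using rad T(1) K(2) by (intro tendsto_sum) blast
  then show "(\<lambda>n. \<Sum>x\<in>T. \<integral>y. indicator (ball x (rad x)) y * \<bar>z n y\<bar> \<partial>M) \<longlonglongrightarrow> 0" by simp
 qed (use iK in \<open>auto intro!: Bochner_Integration.integral_nonneg\<close>)
 define v where "v = measure M \<Omega>"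
 have v: "0 \<le> v" by (simp add: v_def)
 (* Then weights below m (B t)^q contribute at most m / 8 in total. *)
 define t where "t = (1 / (8 * (v + 1))) powr (1 / q) / B"
 have t: "0 < t" using v B_pos by (simp add: t_def)
 have tq: "(B * t) powr q * v \<le> 1 / 8"
 proof -
  have "(B * t) powr q = 1 / (8 * (v + 1))" using B_pos v p by (simp add: t_def powr_powr)
  also have "\<dots> * v \<le> 1 / 8" using v by (simp add: field_simps)
  finally show ?thesis .
 qed
 have "\<forall>\<^sub>F n in sequentially. (\<integral>y. indicator K y * \<bar>z n y\<bar> \<partial>M) < \<nu> / 2 * t"
  using \<nu> t by (intro order_tendstoD(2)[OF K0]) auto
 then obtain n where n: "(\<integral>y. indicator K y * \<bar>z n y\<bar> \<partial>M) < \<nu> / 2 * t"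
  by (meson eventually_happens trivial_limit_sequentially)
 define A1 where "A1 = {x \<in> \<Omega>. \<phi> x < k}"
 define A2 where "A2 = {x \<in> \<Omega>. x \<in> K \<and> t < z n x}"
 have A2: "A2 \<in> sets lebesgue"
 proof -
  have "{x \<in> \<Omega>. t < z n x} \<in> sets lebesgue" by (rule sublevel_sets) measurable
  moreover have "A2 = {x \<in> \<Omega>. t < z n x} \<inter> K" by (auto simp: A2_def)
  ultimately show ?thesis using Kl by auto
 qed
 have A: "A1 \<union> A2 \<in> sets lebesgue" "A1 \<union> A2 \<subseteq> \<Omega>" using A2 k(2) by (auto simp: A1_def A2_def)
 have "t * measure lebesgue A2 = (\<integral>x. t * indicator A2 x \<partial>M)"
  using integral_indicator_M[OF A2] by (simp add: A2_def)
 also have "\<dots> \<le> (\<integral>y. indicator K y * \<bar>z n y\<bar> \<partial>M)"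
 proof (rule integral_mono)
  show "integrable M (\<lambda>x. t * indicator A2 x)" using set_M_integrable[of "\<lambda>_. t", OF _ A2] by (simp add: mult.commute)
  show "integrable M (\<lambda>y. indicator K y * \<bar>z n y\<bar>)" using iK by blast
 qed (auto simp: A2_def indicator_def)
 also note n
 finally have "measure lebesgue A2 \<le> \<nu> / 2" using t by (simp add: mult.commute)
 have Alm: "A1 \<in> lmeasurable" "A2 \<in> lmeasurable"
 proof -
  have "A1 \<subseteq> \<Omega>" "A2 \<subseteq> \<Omega>" "A1 \<in> sets lebesgue" using k(2) by (auto simp: A1_def A2_def)
  then show "A1 \<in> lmeasurable" "A2 \<in> lmeasurable"
   using A2 by (auto intro: fmeasurableI2[OF lmeasurable_open[OF \<Omega>_bounded \<Omega>_open]])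
 qed
 have "measure lebesgue (A1 \<union> A2) \<le> measure lebesgue A1 + measure lebesgue A2"
  using Alm by (intro measure_Un_le) auto
 then have Am: "measure lebesgue (A1 \<union> A2) \<le> \<nu>" using k(3) \<open>measure lebesgue A2 \<le> \<nu> / 2\<close> by (simp add: A1_def)
 have half: "(\<integral>x. indicator (A1 \<union> A2) x * weight (\<delta> n) (u n) x \<partial>M) \<le> (1 + m n) / 2"
  unfolding m_def by (rule conc[OF a \<delta> _ A Am]) (use R in simp)
 have iA: "integrable M (\<lambda>x. indicator (A1 \<union> A2) x * weight (\<delta> n) (u n) x)"
  by (rule set_M_integrable[OF weight_integrable[OF a \<delta>] A(1)])
 have "m n \<le> (\<integral>x. indicator (A1 \<union> A2) x * weight (\<delta> n) (u n) x + m n * (B * t) powr q \<partial>M)"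
  unfolding m_def[of n]
 proof (rule integral_mono_AE[OF weight_integrable[OF a \<delta>]])
  show "integrable M (\<lambda>x. indicator (A1 \<union> A2) x * weight (\<delta> n) (u n) x + mass (\<delta> n) (u n) * (B * t) powr q)"
   using iA by simp
  show "AE x in M. weight (\<delta> n) (u n) x \<le> indicator (A1 \<union> A2) x * weight (\<delta> n) (u n) x + mass (\<delta> n) (u n) * (B * t) powr q"
   using z_nn[of n]
  proof eventually_elim
   case (elim x)
   show ?case
   proof (cases "x \<in> A1 \<union> A2")
    case True
    then show ?thesis using m(1)[of n] by (simp add: m_def)
   next
    case False
    then have nk: "\<not> \<phi> x < k" and nt: "x \<in> K \<Longrightarrow> z n x \<le> t" using elim by (auto simp: A1_def A2_def)
    have "x \<in> K" using K(3)[of x] nk elim k(1) by force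
    then have "\<phi> x * z n x \<le> B * t" using nt \<phi>_le[of x] \<phi>_pos[of x] elim B_pos by (intro mult_mono) auto
    moreover have "0 \<le> \<phi> x * z n x" using elim \<phi>_pos[of x] by (intro mult_nonneg_nonneg) auto
    ultimately have "(\<phi> x * z n x) powr q \<le> (B * t) powr q" using p by (intro powr_mono2) auto
    then have "weight (\<delta> n) (u n) x / m n \<le> (B * t) powr q" using elim by metis
    then have "weight (\<delta> n) (u n) x \<le> m n * (B * t) powr q" using m(1)[of n] by (simp add: pos_divide_le_eq mult.commute)
    then show ?thesis using False by (simp add: m_def)
   qed
  qed
 qed
 also have "\<dots> = (\<integral>x. indicator (A1 \<union> A2) x * weight (\<delta> n) (u n) x \<partial>M) + m n * ((B * t) powr q * v)"
  using iA by (simp add: v_def mult_ac)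
 also have "\<dots> \<le> (1 + m n) / 2 + m n * (1 / 8)"
  using half tq m(1)[of n] by (intro add_mono mult_left_mono) auto
 finally have "m n \<le> (1 + m n) / 2 + m n * (1 / 8)" .
 moreover have "y < 2" if "y \<le> (1 + y) / 2 + y * (1 / 8)" for y :: real
  using that by (simp add: field_simps)
 ultimately show False using m(2)[of n] by fastforce
qed

end

context forced_problem
begin

text \<open>For some \<open>e > 0\<close> the set \<open>E\<close> of points with \<open>f \<ge> e\<close> and \<open>\<phi> \<ge> e\<close> has positive measure. There the ratio to the power
  \<open>q\<close> is \<open>y^(p-q) / m \<le> (1 + y^(p-1)) / m\<close> with \<open>y = \<phi> / (u + \<delta>)\<close>, and \<open>e\<^sup>2 y^(p-1)\<close> is at most the forcing term.\<close>

lemma ratio_small_where_forced: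
 assumes a: "\<And>n. admissible (u n) (U n)" and \<delta>: "\<And>n. 0 < \<delta> n"
  and M: "\<And>n. 0 < mass (\<delta> n) (u n)"
  and minv: "(\<lambda>n. 1 / mass (\<delta> n) (u n)) \<longlonglongrightarrow> 0"
  and iF: "\<And>n. integrable M (\<lambda>x. forcing (\<delta> n) (u n) x)"
  and Fm: "(\<lambda>n. (\<integral>x. forcing (\<delta> n) (u n) x \<partial>M) / mass (\<delta> n) (u n)) \<longlonglongrightarrow> 0"
 obtains E where "E \<in> sets lebesgue" "E \<subseteq> \<Omega>" "\<not> negligible E"
  "\<And>n. integrable M (\<lambda>x. indicator E x * ratio (\<delta> n) (u n) x)"
  "(\<lambda>n. \<integral>x. indicator E x * \<bar>ratio (\<delta> n) (u n) x\<bar> \<partial>M) \<longlonglongrightarrow> 0"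
proof -
 define z where "z n = ratio (\<delta> n) (u n)" for n
 define m where "m n = mass (\<delta> n) (u n)" for n
 define F where "F n = (\<integral>x. forcing (\<delta> n) (u n) x \<partial>M)" for n
 have m: "0 < m n" for n unfolding m_def by (rule M)
 note minv = minv[folded m_def] and Fm = Fm[folded F_def m_def]
 have one: "1 \<le> q" using q by simp
 have z_nn: "AE x in M. x \<in> \<Omega> \<and> 0 \<le> z n x \<and> (\<phi> x * z n x) powr q = weight (\<delta> n) (u n) x / m n" for n
  unfolding z_def m_def by (rule ratio_powr[OF a \<delta> m[unfolded m_def]])
 have z_meas [measurable]: "z n \<in> borel_measurable M" for n unfolding z_def by (rule ratio_measurable[OF a \<delta>])
 obtain e where e: "0 < e" and Eneg: "\<not> negligible {x \<in> \<Omega>. e \<le> f x \<and> e \<le> \<phi> x}"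
 proof -
  have "\<exists>k::nat. \<not> negligible {x \<in> \<Omega>. inverse (real (Suc k)) \<le> f x \<and> inverse (real (Suc k)) \<le> \<phi> x}"
  proof (rule ccontr)
   assume "\<not> ?thesis"
   then have "\<And>k. AE x in M. x \<notin> {x \<in> \<Omega>. inverse (real (Suc k)) \<le> f x \<and> inverse (real (Suc k)) \<le> \<phi> x}"
    by (subst negligible_iff_AE[symmetric]) auto
   then have "AE x in M. \<forall>k. x \<notin> {x \<in> \<Omega>. inverse (real (Suc k)) \<le> f x \<and> inverse (real (Suc k)) \<le> \<phi> x}"
    unfolding AE_all_countable by blast
   moreover have "AE x in M. x \<in> \<Omega>" by (intro AE_I2) simp
   ultimately have "AE x in M. f x = 0"
    using f_nonneg
   proof eventually_elim
    case (elim x)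
    show ?case
    proof (rule ccontr)
     assume "f x \<noteq> 0"
     then have "0 < min (f x) (\<phi> x)" using elim \<phi>_pos by auto
     then obtain k where "inverse (real (Suc k)) < min (f x) (\<phi> x)" using reals_Archimedean by blast
     then have "inverse (real (Suc k)) \<le> f x" "inverse (real (Suc k)) \<le> \<phi> x" by auto
     with elim show False by blast
    qed
   qed
   with f_nonzero show False by simp
  qed
  then obtain k :: nat where "\<not> negligible {x \<in> \<Omega>. inverse (real (Suc k)) \<le> f x \<and> inverse (real (Suc k)) \<le> \<phi> x}" by blast
  then show ?thesis by (intro that[of "inverse (real (Suc k))"]) auto
 qed
 define E where "E = {x \<in> \<Omega>. e \<le> f x \<and> e \<le> \<phi> x}"
 have E: "E \<in> sets lebesgue" unfolding E_def by (rule sublevel_sets) measurable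
 have E\<Omega>: "E \<subseteq> \<Omega>" by (auto simp: E_def)
 have [measurable]: "indicat_real E \<in> borel_measurable M" using E by (rule indicator_M_measurable)
 have zE_le: "AE x in M. \<bar>indicator E x * z n x\<bar> powr q
   \<le> 1 / m n + 1 / (e * e) * (forcing (\<delta> n) (u n) x / m n)" for n
  using z_nn[of n] admissibleD(2)[OF a[of n]] f_nonneg
 proof eventually_elim
  case (elim x)
  let ?F = "forcing (\<delta> n) (u n) x"
  have F0: "0 \<le> ?F" using elim by (intro mult_nonneg_nonneg) auto
  show ?case
  proof (cases "x \<in> E")
   case True
   then have ef: "e \<le> f x" "e \<le> \<phi> x" by (auto simp: E_def)
   have s: "0 < \<phi> x" and v: "0 < u n x + \<delta> n" using elim \<phi>_pos \<delta>[of n] by auto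
   define y where "y = \<phi> x / (u n x + \<delta> n)"
   have y: "0 < y" using s v by (simp add: y_def)
   have wy: "weight (\<delta> n) (u n) x = \<phi> x powr q * y powr (p - q)"
    using s v by (simp add: weight_def y_def powr_divide powr_minus_divide powr_diff)
   have "(\<phi> x * z n x) powr q = \<phi> x powr q * z n x powr q" using elim s by (intro powr_mult)
   moreover have "(\<phi> x * z n x) powr q = \<phi> x powr q * (y powr (p - q) / m n)"
    using elim unfolding wy[symmetric] times_divide_eq_right by blast
   ultimately have "\<phi> x powr q * z n x powr q = \<phi> x powr q * (y powr (p - q) / m n)" by (rule trans[OF sym])
   moreover have "\<phi> x powr q \<noteq> 0" using s by simp
   ultimately have "z n x powr q = y powr (p - q) / m n" by (rule mult_left_cancel[THEN iffD1, rotated])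
   also have "y powr (p - q) \<le> 1 + y powr (p - 1)"
    using powr_le_scaled[of "p - q" "p - 1" 1 y] p q y by simp
   then have "y powr (p - q) / m n \<le> (1 + y powr (p - 1)) / m n" using m[of n] by (intro divide_right_mono) auto
   also have "y powr (p - 1) \<le> 1 / (e * e) * ?F"
   proof -
    have "\<phi> x powr p * (u n x + \<delta> n) powr (- (p - 1)) = \<phi> x * y powr (p - 1)"
     using s v by (simp add: y_def powr_divide powr_minus_divide powr_diff)
    moreover have "e * (e * y powr (p - 1)) \<le> f x * (\<phi> x * y powr (p - 1))"
     using ef e by (intro mult_mono mult_right_mono) auto
    ultimately have "e * e * y powr (p - 1) \<le> ?F" by simp
    then show ?thesis using e by (simp add: field_simps)
   qed
   then have "(1 + y powr (p - 1)) / m n \<le> (1 + 1 / (e * e) * ?F) / m n" using m[of n] by (intro divide_right_mono) auto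
   also have "\<dots> = 1 / m n + 1 / (e * e) * (?F / m n)" by (simp add: add_divide_distrib)
   finally show ?thesis using True elim by simp
  next
   case False
   then show ?thesis using F0 m[of n] p by (auto intro!: add_nonneg_nonneg)
  qed
 qed
 have zEL: "(\<lambda>x. indicator E x * z n x) \<in> Lspace \<Omega> q" for n
 proof -
  have "integrable M (\<lambda>x. \<bar>indicator E x * z n x\<bar> powr q)"
  proof (rule Bochner_Integration.integrable_bound)
   show "integrable M (\<lambda>x. 1 / m n + 1 / (e * e) * (forcing (\<delta> n) (u n) x / m n))"
    using iF[of n] by (intro Bochner_Integration.integrable_add integrable_mult_right integrable_divide) auto
   show "AE x in M. norm (\<bar>indicator E x * z n x\<bar> powr q) \<le> norm (1 / m n + 1 / (e * e) * (forcing (\<delta> n) (u n) x / m n))"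
    using zE_le[of n] by eventually_elim (simp only: real_norm_def order_trans[OF _ abs_ge_self] abs_of_nonneg powr_ge_zero)
  qed measurable
  then show ?thesis by (simp add: Lspace_def)
 qed
 have "(\<lambda>n. \<integral>x. \<bar>indicator E x * z n x\<bar> powr q \<partial>M) \<longlonglongrightarrow> 0"
 proof (rule tendsto_zero_le)
  show "(\<lambda>n. measure M \<Omega> * (1 / m n) + 1 / (e * e) * (F n / m n)) \<longlonglongrightarrow> 0"
   using tendsto_add_zero[OF tendsto_mult_right_zero[OF minv] tendsto_mult_right_zero[OF Fm]] .
  show "(\<integral>x. \<bar>indicator E x * z n x\<bar> powr q \<partial>M) \<le> measure M \<Omega> * (1 / m n) + 1 / (e * e) * (F n / m n)" for n
  proof -
   have i: "integrable M (\<lambda>x. 1 / (e * e) * (forcing (\<delta> n) (u n) x / m n))"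
    using iF[of n] by (intro integrable_mult_right integrable_divide) auto
   have "(\<integral>x. \<bar>indicator E x * z n x\<bar> powr q \<partial>M)
    \<le> (\<integral>x. 1 / m n + 1 / (e * e) * (forcing (\<delta> n) (u n) x / m n) \<partial>M)"
    using LspaceD(2)[OF zEL[of n]] i zE_le[of n] by (intro integral_mono_AE) auto
   also have "\<dots> = measure M \<Omega> * (1 / m n) + 1 / (e * e) * (F n / m n)"
    using i by (subst Bochner_Integration.integral_add) (auto simp: F_def)
   finally show ?thesis .
  qed
 qed simp
 then have "Lnull q (\<lambda>n x. indicator E x * z n x)" using zEL by (simp add: Lnull_def)
 from Lnull_tendsto_integral[OF one this]
 have zE0: "(\<lambda>n. \<integral>x. indicator E x * \<bar>z n x\<bar> \<partial>M) \<longlonglongrightarrow> 0" by (simp add: abs_mult)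
 have iE: "integrable M (\<lambda>x. indicator E x * z n x)" for n using Lspace_integrable[OF one zEL] .
 show ?thesis
  using that[OF E E\<Omega> Eneg[folded E_def]] iE zE0 unfolding z_def by blast
qed

text \<open>For \<open>\<epsilon>\<close> of order \<open>1/n\<close>, \<open>solution_good_shift\<close> makes the mass at least \<open>n\<close> and the defect and forcing terms
  negligible against it, so the preceding lemmas are contradictory.\<close>

lemma no_solution_near_eigenvalue: "\<exists>\<epsilon>>0. \<forall>\<beta>\<ge>\<mu> - \<epsilon>. \<not> (\<exists>u U. solution \<beta> u U)"
proof (rule ccontr)
 assume "\<not> ?thesis"
 then have ex: "\<exists>\<beta> u U. \<mu> - \<epsilon> \<le> \<beta> \<and> solution \<beta> u U" if "0 < \<epsilon>" for \<epsilon> using that by blast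
 (* Chosen so that gap <= 2 eps m forces m >= n + 2. *)
 define \<epsilon> where "\<epsilon> n = gap / (2 * (real n + 2))" for n
 have \<epsilon>: "0 < \<epsilon> n" for n using gap_pos by (simp add: \<epsilon>_def)
 have \<epsilon>0: "\<epsilon> \<longlonglongrightarrow> 0"
 proof -
  have "filterlim (\<lambda>n. 2 * (real n + 2)) at_top sequentially"
   by (intro filterlim_tendsto_pos_mult_at_top[OF tendsto_const] filterlim_at_top_add_at_top
     filterlim_tendsto_add_at_top[OF tendsto_const filterlim_real_sequentially, of 2, simplified add.commute]) auto
  then show ?thesis unfolding \<epsilon>_def by (rule tendsto_divide_0[OF tendsto_const filterlim_at_top_imp_at_infinity])
 qed
 define P where "P n \<delta> u U \<longleftrightarrow> 0 < \<delta> \<and> admissible u U \<and>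
  gap + (\<integral>x. forcing \<delta> u x \<partial>M) + defect \<delta> u U
   \<le> 2 * \<epsilon> n * mass \<delta> u \<and>
  integrable M (\<lambda>x. forcing \<delta> u x) \<and>
  0 \<le> (\<integral>x. forcing \<delta> u x \<partial>M)" for n \<delta> u U
 have "\<exists>\<delta> u U. P n \<delta> u U" for n
 proof -
  obtain \<beta> u U where s: "\<mu> - \<epsilon> n \<le> \<beta>" "solution \<beta> u U" using ex[OF \<epsilon>] by blast
  obtain \<delta> where d: "0 < \<delta>" "gap + (\<integral>x. forcing \<delta> u x \<partial>M) + defect \<delta> u U
   \<le> 2 * \<epsilon> n * mass \<delta> u"
   using solution_good_shift[OF s(2) \<epsilon> s(1)] by blast
  have "admissible u U" using s(2) by (simp add: solution_def)
  then have "P n \<delta> u U" using d solution_picone(2,3)[OF s(2) d(1)] by (simp only: P_def)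
  then show ?thesis by blast
 qed
 then obtain \<delta> u U where P: "\<And>n. P n (\<delta> n) (u n) (U n)" by metis
 have \<delta>: "0 < \<delta> n" and a: "admissible (u n) (U n)"
  and main: "gap + (\<integral>x. forcing (\<delta> n) (u n) x \<partial>M) + defect (\<delta> n) (u n) (U n)
   \<le> 2 * \<epsilon> n * mass (\<delta> n) (u n)"
  and iF: "integrable M (\<lambda>x. forcing (\<delta> n) (u n) x)"
  and F0: "0 \<le> (\<integral>x. forcing (\<delta> n) (u n) x \<partial>M)" for n
  using P[of n] unfolding P_def by blast+
 define m where "m n = mass (\<delta> n) (u n)" for n
 define F where "F n = (\<integral>x. forcing (\<delta> n) (u n) x \<partial>M)" for n
 define R where "R n = defect (\<delta> n) (u n) (U n)" for n
 have R0: "0 \<le> R n" for n unfolding R_def by (rule remainder_integral_nonneg[OF a \<delta>])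
 have F0: "0 \<le> F n" for n unfolding F_def by (rule F0)
 have main: "gap + F n + R n \<le> 2 * \<epsilon> n * m n" for n using main[of n] unfolding F_def R_def m_def .
 have m_large: "real n + 2 \<le> m n" for n
 proof -
  have "gap \<le> 2 * \<epsilon> n * m n" using main[of n] R0[of n] F0[of n] by linarith
  also have "2 * \<epsilon> n * m n = gap * (m n / (real n + 2))" by (simp add: \<epsilon>_def divide_simps)
  finally have "gap * 1 \<le> gap * (m n / (real n + 2))" by (simp only: mult_1_right)
  then have "1 \<le> m n / (real n + 2)" using mult_le_cancel_left_pos[OF gap_pos] by blast
  then show ?thesis by (simp add: pos_le_divide_eq)
 qed
 have m: "0 < m n" "2 \<le> m n" for n using m_large[of n] by linarith+
 have Fm: "F n / m n \<le> 2 * \<epsilon> n" and Rm: "R n / m n \<le> 2 * \<epsilon> n" for n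
  using main[of n] R0[of n] F0[of n] gap_pos m(1)[of n] by (auto simp: pos_divide_le_eq)
 have minv: "(\<lambda>n. 1 / m n) \<longlonglongrightarrow> 0"
 proof (rule tendsto_zero_le[OF LIMSEQ_inverse_real_of_nat])
  show "1 / m n \<le> inverse (real (Suc n))" for n using m_large[of n] by (simp add: inverse_eq_divide frac_le)
 qed (use m in \<open>auto intro: less_imp_le\<close>)
 have \<epsilon>2: "(\<lambda>n. 2 * \<epsilon> n) \<longlonglongrightarrow> 0" using tendsto_mult_right_zero[OF \<epsilon>0] .
 have Rm0: "(\<lambda>n. R n / m n) \<longlonglongrightarrow> 0"
  by (rule tendsto_zero_le[OF \<epsilon>2 Rm]) (use R0 m in \<open>auto intro: divide_nonneg_pos\<close>)
 have Fm0: "(\<lambda>n. F n / m n) \<longlonglongrightarrow> 0"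
  by (rule tendsto_zero_le[OF \<epsilon>2 Fm]) (use F0 m in \<open>auto intro: divide_nonneg_pos\<close>)
 note osc = ratio_local_oscillation[OF a \<delta> m(1)[unfolded m_def] Rm0[unfolded R_def m_def]]
 obtain E where E: "E \<in> sets lebesgue" "E \<subseteq> \<Omega>" "\<not> negligible E"
  "\<And>n. integrable M (\<lambda>x. indicator E x * ratio (\<delta> n) (u n) x)"
  "(\<lambda>n. \<integral>x. indicator E x * \<bar>ratio (\<delta> n) (u n) x\<bar> \<partial>M) \<longlonglongrightarrow> 0"
  by (rule ratio_small_where_forced[OF a \<delta> m(1)[unfolded m_def] minv[unfolded m_def] iF Fm0[unfolded F_def m_def]]) blast
 have "R n \<le> gap * (1 + m n)" for n
 proof -
  have "R n \<le> 2 * \<epsilon> n * m n" using main[of n] F0[of n] gap_pos by linarith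
  also have "\<dots> \<le> gap * (1 + m n)"
  proof (rule mult_mono)
   show "2 * \<epsilon> n \<le> gap" using gap_pos by (simp add: \<epsilon>_def field_simps)
  qed (use m(1)[of n] gap_pos in auto)
  finally show ?thesis .
 qed
 then show False
  using ratio_not_locally_null[OF less_imp_le[OF gap_pos] a \<delta> m(2)[unfolded m_def] _ connected_spread[OF \<Omega>_connected osc E]]
  unfolding R_def m_def by blast
qed

end

theorem proposition2p9:
 fixes \<Omega> :: "'a::euclidean_space set"
  and p q :: real
  and f \<phi>q :: "'a \<Rightarrow> real"
 assumes "bounded_C2_domain \<Omega>"
  and "1 < q" and "q < p"
  and "positive_first_eigenfunction \<Omega> q \<phi>q"
  and "f \<in> Linfty \<Omega>"
  and "\<not> (AE x in lebesgue_on \<Omega>. f x = 0)"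
  and "AE x in lebesgue_on \<Omega>. f x \<ge> 0"
 shows "\<forall>\<alpha> > alpha_star \<Omega> p \<phi>q. \<exists>\<epsilon>>0. \<forall>\<beta> \<ge> lambda1 \<Omega> q - \<epsilon>.
  \<not> (\<exists>u. weak_solution \<Omega> p q \<alpha> \<beta> f u \<and> (AE x in lebesgue_on \<Omega>. u x \<ge> 0))"
proof (intro allI impI)
 fix \<alpha> assume \<alpha>: "alpha_star \<Omega> p \<phi>q < \<alpha>"
 have dom: "open \<Omega>" "connected \<Omega>" "\<Omega> \<noteq> {}" "bounded \<Omega>" "C2_boundary \<Omega>"
  using assms(1) by (auto simp: bounded_C2_domain_def)
 interpret bounded_open \<Omega> by standard (use dom in auto)
 have q1: "1 \<le> q" and p1: "1 \<le> p" and p0: "0 < p" and q0: "0 < q" using assms(2,3) by auto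
 have \<phi>: "\<phi>q \<in> W01 \<Omega> q" "\<not> (AE x in M. \<phi>q x = 0)" "rayleigh \<Omega> q \<phi>q = lambda1 \<Omega> q"
  "C1_closure \<Omega> \<phi>q" "\<And>x. x \<in> \<Omega> \<Longrightarrow> 0 < \<phi>q x"
  using assms(4) by (auto simp: positive_first_eigenfunction_def)
 obtain g where g: "continuous_on (closure \<Omega>) \<phi>q" "continuous_on (closure \<Omega>) g" "\<And>x. x \<in> \<Omega> \<Longrightarrow> GDERIV \<phi>q x :> g x"
  using \<phi>(4) unfolding C1_closure_def by blast
 have ccl: "compact (closure \<Omega>)" using dom(4) by (simp add: compact_closure)
 obtain B1 where B1: "\<And>x. x \<in> closure \<Omega> \<Longrightarrow> norm (\<phi>q x) \<le> B1"
  using compact_imp_bounded[OF compact_continuous_image[OF g(1) ccl]] unfolding bounded_iff by blast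
 obtain B2 where B2: "\<And>x. x \<in> closure \<Omega> \<Longrightarrow> norm (g x) \<le> B2"
  using compact_imp_bounded[OF compact_continuous_image[OF g(2) ccl]] unfolding bounded_iff by blast
 define B where "B = max 1 (max B1 B2)"
 have cl: "x \<in> closure \<Omega>" if "x \<in> \<Omega>" for x using that closure_subset by blast
 have B: "0 < B" "\<And>x. x \<in> \<Omega> \<Longrightarrow> \<bar>\<phi>q x\<bar> \<le> B" "\<And>x. x \<in> \<Omega> \<Longrightarrow> norm (g x) \<le> B"
  using B1[OF cl] B2[OF cl] by (auto simp: B_def le_max_iff_disj)
 have g\<Omega>: "continuous_on \<Omega> g" using g(2) continuous_on_subset closure_subset by blast
 have wg: "is_weak_gradient \<Omega> \<phi>q g" by (rule classical_weak_gradient[OF g(3) g\<Omega> B(2,3)])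
 then have "is_weak_gradient \<Omega> \<phi>q (wgrad \<Omega> \<phi>q)" unfolding wgrad_def by (rule someI[of "is_weak_gradient \<Omega> \<phi>q"])
 then have ae_g: "AE x in M. wgrad \<Omega> \<phi>q x = g x" using wg by (rule weak_gradient_unique)
 have \<phi>s: "sobolev0 q \<phi>q g"
  by (rule sobolev0_cong_AE[OF W01_imp_sobolev0[OF q1 \<phi>(1)] q0 _ ae_g]) simp
 have gm: "g \<in> borel_measurable M" using g\<Omega> by (rule continuous_measurable)
 have wm: "wgrad \<Omega> \<phi>q \<in> borel_measurable M"
  using sobolev0D(4)[OF W01_imp_sobolev0[OF q1 \<phi>(1)]] .
 have \<phi>m: "\<phi>q \<in> borel_measurable M" using sobolev0D(3)[OF \<phi>s] .
 have Lnorm_powr: "Lnorm \<Omega> r h powr r = (\<integral>x. norm (h x) powr r \<partial>M)" if "0 < r" for r and h :: "'a \<Rightarrow> 'b::euclidean_space"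
  using that by (simp add: Lnorm_def powr_powr)
 have vanish: "\<phi>q x \<le> 0" if "x \<in> frontier \<Omega>" for x
  by (rule trace_zero[OF dom(5) that g(1) \<phi>s q1 B(3)])
 interpret positive_profile \<Omega> \<phi>q g B
 proof
  show "\<exists>K. compact K \<and> K \<subseteq> \<Omega> \<and> (\<forall>x\<in>\<Omega> - K. \<phi>q x \<le> k)" if "0 < k" for k
   by (rule vanish_from_frontier[OF g(1) vanish that])
  show "\<phi>q x \<le> B" if "x \<in> \<Omega>" for x using B(2)[OF that] by simp
 qed (use \<phi>(5) g(3) g\<Omega> B in auto)
 have abs\<phi>: "(\<integral>x. \<bar>\<phi>q x\<bar> powr r \<partial>M) = (\<integral>x. \<phi>q x powr r \<partial>M)" for r
  using \<phi>(5) by (intro Bochner_Integration.integral_cong) (auto simp: less_imp_le)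
 have wgr: "(\<integral>x. norm (wgrad \<Omega> \<phi>q x) powr r \<partial>M) = (\<integral>x. norm (g x) powr r \<partial>M)" for r
  using ae_g gm wm by (intro integral_cong_AE) (auto elim!: eventually_mono)
 have pos_int: "0 < (\<integral>x. \<phi>q x powr r \<partial>M)" if r: "0 < r" for r
 proof -
  have i: "integrable M (\<lambda>x. \<phi>q x powr r)"
   by (rule bounded_integrable[where B="B powr r"]) (use \<phi>_powr_le[of r] r in auto)
  have "(\<integral>x. \<phi>q x powr r \<partial>M) \<noteq> 0"
  proof
   assume "(\<integral>x. \<phi>q x powr r \<partial>M) = 0"
   then have "AE x in M. \<phi>q x powr r = 0" using integral_nonneg_eq_0_iff_AE[OF i] by simp
   then have "AE x in M. \<phi>q x = 0" by eventually_elim simp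
   with \<phi>(2) show False by simp
  qed
  then show ?thesis by (simp add: less_le Bochner_Integration.integral_nonneg)
 qed
 have ray0: "0 \<le> rayleigh \<Omega> q v" for v by (simp add: rayleigh_def)
 have \<mu>0: "0 \<le> lambda1 \<Omega> q" using ray0[of \<phi>q] \<phi>(3) by simp
 interpret first_eigenfunction \<Omega> \<phi>q g B p q "lambda1 \<Omega> q"
 proof
  show "(\<integral>x. norm (g x) powr q \<partial>M) = lambda1 \<Omega> q * (\<integral>x. \<phi>q x powr q \<partial>M)"
   using \<phi>(3) pos_int[OF q0] unfolding rayleigh_def Lnorm_powr[OF q0] wgr real_norm_def abs\<phi>
   by (simp add: field_simps)
  fix h H assume hH: "sobolev0 q h H"
  show "lambda1 \<Omega> q * (\<integral>x. \<bar>h x\<bar> powr q \<partial>M) \<le> (\<integral>x. norm (H x) powr q \<partial>M)"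
  proof (cases "AE x in M. h x = 0")
   case True
   then have "(\<integral>x. \<bar>h x\<bar> powr q \<partial>M) = 0" by (intro integral_eq_zero_AE) (auto elim!: eventually_mono)
   then show ?thesis by simp
  next
   case False
   have ih: "integrable M (\<lambda>x. \<bar>h x\<bar> powr q)" using LspaceD(2)[OF sobolev0D(1)[OF hH]] by simp
   have "(\<integral>x. \<bar>h x\<bar> powr q \<partial>M) \<noteq> 0"
   proof
    assume "(\<integral>x. \<bar>h x\<bar> powr q \<partial>M) = 0"
    then have "AE x in M. \<bar>h x\<bar> powr q = 0" using integral_nonneg_eq_0_iff_AE[OF ih] by simp
    then have "AE x in M. h x = 0" by eventually_elim simp
    with False show False by simp
   qed
   then have hp: "0 < (\<integral>x. \<bar>h x\<bar> powr q \<partial>M)" by (simp add: less_le Bochner_Integration.integral_nonneg)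
   have hw: "(\<integral>x. norm (wgrad \<Omega> h x) powr q \<partial>M) = (\<integral>x. norm (H x) powr q \<partial>M)"
   proof (rule integral_cong_AE)
    have ae: "AE x in M. wgrad \<Omega> h x = H x" by (rule sobolev0_wgrad[OF q1 hH])
    then show "AE x in M. norm (wgrad \<Omega> h x) powr q = norm (H x) powr q" by eventually_elim simp
    have "wgrad \<Omega> h \<in> borel_measurable M"
     by (rule AE_eq_measurable[OF sobolev0D(4)[OF hH]]) (use ae in \<open>auto elim: eventually_mono\<close>)
    then show "(\<lambda>x. norm (wgrad \<Omega> h x) powr q) \<in> borel_measurable M" by measurable
    show "(\<lambda>x. norm (H x) powr q) \<in> borel_measurable M" using sobolev0D(4)[OF hH] by measurable
   qed
   have "lambda1 \<Omega> q \<le> rayleigh \<Omega> q h"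
    unfolding lambda1_def
   proof (rule cInf_lower)
    show "rayleigh \<Omega> q h \<in> {rayleigh \<Omega> q u |u. u \<in> W01 \<Omega> q \<and> \<not> (AE x in M. u x = 0)}"
     using False sobolev0_imp_W01[OF q1 hH] by blast
    show "bdd_below {rayleigh \<Omega> q u |u. u \<in> W01 \<Omega> q \<and> \<not> (AE x in M. u x = 0)}"
     using ray0 by (auto intro!: bdd_belowI[of _ 0])
   qed
   then show ?thesis
    using hp unfolding rayleigh_def Lnorm_powr[OF q0] hw real_norm_def by (simp add: pos_le_divide_eq)
  qed
 qed (use assms(2,3) \<mu>0 \<phi>s dom(2) in auto)
 obtain Cf where Cf: "AE x in M. \<bar>f x\<bar> \<le> Cf" and fm: "f \<in> borel_measurable M"
  using assms(5) by (auto simp: Linfty_def)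
 interpret forced_problem \<Omega> \<phi>q g B p q "lambda1 \<Omega> q" f \<alpha> Cf
 proof
  show "(\<integral>x. norm (g x) powr p \<partial>M) < \<alpha> * (\<integral>x. \<phi>q x powr p \<partial>M)"
   using \<alpha> pos_int[OF p0] unfolding alpha_star_def Lnorm_powr[OF p0] wgr real_norm_def abs\<phi>
   by (simp add: pos_divide_less_eq)
  show "AE x in M. f x \<le> Cf" using Cf by eventually_elim simp
 qed (use fm assms(6,7) in auto)
 have sol: "solution \<beta> u (wgrad \<Omega> u)" if ws: "weak_solution \<Omega> p q \<alpha> \<beta> f u" and nn: "AE x in M. u x \<ge> 0" for \<beta> u
 proof -
  have uW: "u \<in> W01 \<Omega> p" using ws by (simp add: weak_solution_def)
  have us: "sobolev0 p u (wgrad \<Omega> u)" by (rule W01_imp_sobolev0[OF p1 uW])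
  note [measurable] = sobolev0D(3,4)[OF us] fm
  show ?thesis
   unfolding solution_def admissible_def
  proof (intro conjI allI impI us nn)
   fix \<psi> \<Psi> assume \<psi>: "sobolev0 p \<psi> \<Psi>"
   note [measurable] = sobolev0D(3,4)[OF \<psi>]
   have ae: "AE x in M. wgrad \<Omega> \<psi> x = \<Psi> x" by (rule sobolev0_wgrad[OF p1 \<psi>])
   have [measurable]: "wgrad \<Omega> \<psi> \<in> borel_measurable M"
    by (rule AE_eq_measurable[OF sobolev0D(4)[OF \<psi>]]) (use ae in \<open>auto elim: eventually_mono\<close>)
   have "(\<integral>x. flux p (wgrad \<Omega> u x) \<bullet> \<Psi> x + flux q (wgrad \<Omega> u x) \<bullet> \<Psi> x \<partial>M)
    = (\<integral>x. (norm (wgrad \<Omega> u x) powr (p - 2) + norm (wgrad \<Omega> u x) powr (q - 2)) * (wgrad \<Omega> u x \<bullet> wgrad \<Omega> \<psi> x) \<partial>M)"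
   proof (rule integral_cong_AE)
    show "AE x in M. flux p (wgrad \<Omega> u x) \<bullet> \<Psi> x + flux q (wgrad \<Omega> u x) \<bullet> \<Psi> x
     = (norm (wgrad \<Omega> u x) powr (p - 2) + norm (wgrad \<Omega> u x) powr (q - 2)) * (wgrad \<Omega> u x \<bullet> wgrad \<Omega> \<psi> x)"
     using ae by eventually_elim (simp add: flux_def distrib_right)
   qed (unfold flux_def, measurable)
   also have "\<dots> = (\<integral>x. (\<alpha> * \<bar>u x\<bar> powr (p - 2) * u x + \<beta> * \<bar>u x\<bar> powr (q - 2) * u x + f x) * \<psi> x \<partial>M)"
    using ws sobolev0_imp_W01[OF p1 \<psi>] by (simp add: weak_solution_def)
   also have "\<dots> = (\<integral>x. (\<alpha> * u x powr (p - 1) + \<beta> * u x powr (q - 1) + f x) * \<psi> x \<partial>M)"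
   proof (rule integral_cong_AE)
    have pw: "\<bar>t\<bar> powr (r - 2) * t = t powr (r - 1)" if "0 \<le> t" for t r :: real
     using that powr_add[of t "r - 2" 1] by (cases "t = 0") auto
    show "AE x in M. (\<alpha> * \<bar>u x\<bar> powr (p - 2) * u x + \<beta> * \<bar>u x\<bar> powr (q - 2) * u x + f x) * \<psi> x
     = (\<alpha> * u x powr (p - 1) + \<beta> * u x powr (q - 1) + f x) * \<psi> x"
     using nn by eventually_elim (simp only: mult.assoc pw)
   qed measurable
   finally show "(\<integral>x. flux p (wgrad \<Omega> u x) \<bullet> \<Psi> x + flux q (wgrad \<Omega> u x) \<bullet> \<Psi> x \<partial>M)
    = (\<integral>x. (\<alpha> * u x powr (p - 1) + \<beta> * u x powr (q - 1) + f x) * \<psi> x \<partial>M)" .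
  qed
 qed
 obtain \<epsilon> where "0 < \<epsilon>" "\<And>\<beta>. lambda1 \<Omega> q - \<epsilon> \<le> \<beta> \<Longrightarrow> \<not> (\<exists>u U. solution \<beta> u U)"
  using no_solution_near_eigenvalue by blast
 then show "\<exists>\<epsilon>>0. \<forall>\<beta> \<ge> lambda1 \<Omega> q - \<epsilon>.
  \<not> (\<exists>u. weak_solution \<Omega> p q \<alpha> \<beta> f u \<and> (AE x in lebesgue_on \<Omega>. u x \<ge> 0))"
  using sol by blast
qed

end
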